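(* Let $G$ be a finitely presented pro-$p$ group with $d(G)>1$, and suppose it is not the case that $d(G)=2$ and $r(G)=1$. If $G$ is an open subgroup of a $p$-adic analytic group, or an open subgroup of an $\mathcal{O}_F$-perfect group for some non-Archimedean local field $F$ of characteristic $p$, then $r(G)>d(G)^2/4$.
   Context: $d(G)$ is the generator rank and $r(G)$ the relation rank of the pro-$p$ group $G$. A $p$-adic analytic group is a closed subgroup of $\mathrm{GL}_n(\mathbb{Z}_p)$ for some $n$. Let $F$ be a non-Archimedean local field with ring of integers $\mathcal{O}_F$ and maximal ideal $\mathfrak m$. An $\mathcal{O}_F$-standard group (of level 1) of dimension $d$ is an $\mathcal{O}_F$-analytic group $G$ whose analytic structure is given by a single global chart $\psi:G\to\mathfrak m^{(d)}$ (a homeomorphism onto $\mathfrak m^{(d)}=\mathfrak m\times\dots\times\mathfrak m$, with $\psi(1)=0$) such that there are power series $F_1,\dots,F_d\in\mathcal{O}_F[[X_1,\dots,X_d,Y_1,\dots,Y_d]]$ without constant term with $\psi(xy)=(F_1,\dots,F_d)(\psi(x),\psi(y))$ for all $x,y\in G$. Such a $G$ of positive dimension $d$, identified with $\mathfrak m^{(d)}$ via $\psi$, is $\mathcal{O}_F$-perfect if $[G,G]=(\mathfrak m^2)^{(d)}$. *)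

theory Defs
  imports "HOL-Analysis.Analysis" "HOL-Algebra.Algebra"
begin

section \<open>Pro-p groups\<close>

locale topological_group = group G for G (structure) +
  fixes T :: "'a topology"
  assumes topspace_eq: "topspace T = carrier G"
    and continuous_mult: "continuous_map (prod_topology T T) T (\<lambda>(x, y). x \<otimes> y)"
    and continuous_inv: "continuous_map T T (\<lambda>x. inv x)"

locale pro_p_group = topological_group G T for p :: nat and G (structure) and T +
  assumes prime: "Factorial_Ring.prime p"
    and compact: "compact_space T"
    and Hausdorff: "Hausdorff_space T"
    and open_subgroups_base:
      "\<And>U. openin T U \<Longrightarrow> \<one> \<in> U \<Longrightarrow> \<exists>N. subgroup N G \<and> openin T N \<and> N \<subseteq> U"
    and p_power_index: "\<And>N. N \<lhd> G \<Longrightarrow> openin T N \<Longrightarrow> \<exists>k. card (rcosets N) = p ^ k"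

definition topological_iso ::
    "('a, 'm) monoid_scheme \<Rightarrow> 'a topology \<Rightarrow> ('b, 'n) monoid_scheme \<Rightarrow> 'b topology \<Rightarrow> ('a \<Rightarrow> 'b) \<Rightarrow> bool" where
  "topological_iso G T H S \<phi> \<longleftrightarrow> \<phi> \<in> iso G H \<and> homeomorphic_map T S \<phi>"

definition isomorphic_to_open_subgroup ::
    "('a, 'm) monoid_scheme \<Rightarrow> 'a topology \<Rightarrow> ('b, 'n) monoid_scheme \<Rightarrow> 'b topology \<Rightarrow> bool" where
  "isomorphic_to_open_subgroup G T H S \<longleftrightarrow>
     (\<exists>U \<phi>. subgroup U H \<and> openin S U \<and>
            topological_iso G T (H\<lparr>carrier := U\<rparr>) (subtopology S U) \<phi>)"

definition isomorphic_to_closed_subgroup ::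
    "('a, 'm) monoid_scheme \<Rightarrow> 'a topology \<Rightarrow> ('b, 'n) monoid_scheme \<Rightarrow> 'b topology \<Rightarrow> bool" where
  "isomorphic_to_closed_subgroup G T H S \<longleftrightarrow>
     (\<exists>K \<phi>. subgroup K H \<and> closedin S K \<and>
            topological_iso G T (H\<lparr>carrier := K\<rparr>) (subtopology S K) \<phi>)"

subsection \<open>Generator rank, presentations and relation rank\<close>

definition generator_rank :: "('a, 'm) monoid_scheme \<Rightarrow> 'a topology \<Rightarrow> nat" where
  "generator_rank G T =
     (LEAST n. \<exists>S \<subseteq> carrier G. finite S \<and> card S = n \<and> T closure_of (generate G S) = carrier G)"

text \<open>
  Free pro-p groups on a finite basis, by their universal property. The test groups \<open>H\<close> have
  underlying sets in the same type as \<open>F\<close>. The definition is only used over a type of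
  continuum cardinality, which is large enough for every topologically finitely generated pro-p group.
\<close>
definition free_pro_p_group :: "nat \<Rightarrow> 'f monoid \<Rightarrow> 'f topology \<Rightarrow> 'f set \<Rightarrow> bool" where
  "free_pro_p_group p F S B \<longleftrightarrow>
     pro_p_group p F S \<and> finite B \<and> B \<subseteq> carrier F \<and>
     (\<forall>(H :: 'f monoid) T_H f. pro_p_group p H T_H \<and> f \<in> B \<rightarrow> carrier H \<longrightarrow>
        (\<exists>!h. h \<in> hom F H \<inter> extensional (carrier F) \<and> continuous_map S T_H h \<and>
              (\<forall>x\<in>B. h x = f x)))"

definition closed_normal_closure :: "('a, 'm) monoid_scheme \<Rightarrow> 'a topology \<Rightarrow> 'a set \<Rightarrow> 'a set" where
  "closed_normal_closure G T R = (\<lambda>N. N \<lhd> G \<and> closedin T N) hull R"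

text \<open>\<open>G\<close> has a pro-p presentation with \<open>n\<close> generators and \<open>m\<close> relators.\<close>
definition has_pro_p_presentation ::
    "nat \<Rightarrow> ('a, 'm) monoid_scheme \<Rightarrow> 'a topology \<Rightarrow> nat \<Rightarrow> nat \<Rightarrow> bool" where
  "has_pro_p_presentation p G T n m \<longleftrightarrow>
     (\<exists>(F :: (nat set) monoid) S B R \<pi>.
        free_pro_p_group p F S B \<and> card B = n \<and>
        R \<subseteq> carrier F \<and> finite R \<and> card R = m \<and>
        \<pi> \<in> hom F G \<and> continuous_map S T \<pi> \<and> \<pi> ` carrier F = carrier G \<and>
        kernel F G \<pi> = closed_normal_closure F S R)"

definition finitely_presented_pro_p_group ::
    "nat \<Rightarrow> ('a, 'm) monoid_scheme \<Rightarrow> 'a topology \<Rightarrow> bool" where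
  "finitely_presented_pro_p_group p G T \<longleftrightarrow>
     pro_p_group p G T \<and> (\<exists>n m. has_pro_p_presentation p G T n m)"

text \<open>The number of relators is minimised over presentations on a minimal number of generators.\<close>
definition relation_rank :: "nat \<Rightarrow> ('a, 'm) monoid_scheme \<Rightarrow> 'a topology \<Rightarrow> nat" where
  "relation_rank p G T = (LEAST m. has_pro_p_presentation p G T (generator_rank G T) m)"


section \<open>p-adic analytic groups\<close>

text \<open>The p-adic integers, as coherent sequences of residues modulo \<open>p ^ k\<close>.\<close>
definition padic_ints :: "nat \<Rightarrow> (nat \<Rightarrow> int) ring" where
  "padic_ints p =
     \<lparr>carrier = {x. \<forall>k. x k \<in> {0..<int p ^ k} \<and> x (Suc k) mod int p ^ k = x k},
      monoid.mult = (\<lambda>x y k. (x k * y k) mod int p ^ k),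
      one = (\<lambda>k. 1 mod int p ^ k),
      ring.zero = (\<lambda>k. 0),
      add = (\<lambda>x y k. (x k + y k) mod int p ^ k)\<rparr>"

definition padic_ints_topology :: "nat \<Rightarrow> (nat \<Rightarrow> int) topology" where
  "padic_ints_topology p =
     subtopology (product_topology (\<lambda>_. discrete_topology UNIV) UNIV) (carrier (padic_ints p))"

definition matrix_monoid :: "nat \<Rightarrow> ('a, 'm) ring_scheme \<Rightarrow> (nat \<times> nat \<Rightarrow> 'a) monoid" where
  "matrix_monoid n R =
     \<lparr>carrier = ({..<n} \<times> {..<n}) \<rightarrow>\<^sub>E carrier R,
      monoid.mult = (\<lambda>A B. \<lambda>(i, j)\<in>{..<n} \<times> {..<n}. \<Oplus>\<^bsub>R\<^esub>k\<in>{..<n}. A (i, k) \<otimes>\<^bsub>R\<^esub> B (k, j)),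
      one = (\<lambda>(i, j)\<in>{..<n} \<times> {..<n}. if i = j then \<one>\<^bsub>R\<^esub> else \<zero>\<^bsub>R\<^esub>)\<rparr>"

definition general_linear_group :: "nat \<Rightarrow> ('a, 'm) ring_scheme \<Rightarrow> (nat \<times> nat \<Rightarrow> 'a) monoid" where
  "general_linear_group n R = units_of (matrix_monoid n R)"

definition GL_padic_topology :: "nat \<Rightarrow> nat \<Rightarrow> (nat \<times> nat \<Rightarrow> nat \<Rightarrow> int) topology" where
  "GL_padic_topology n p =
     subtopology (product_topology (\<lambda>_. padic_ints_topology p) ({..<n} \<times> {..<n}))
       (carrier (general_linear_group n (padic_ints p)))"

definition p_adic_analytic_group :: "nat \<Rightarrow> ('a, 'm) monoid_scheme \<Rightarrow> 'a topology \<Rightarrow> bool" where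
  "p_adic_analytic_group p G T \<longleftrightarrow>
     (\<exists>n. isomorphic_to_closed_subgroup G T
            (general_linear_group n (padic_ints p)) (GL_padic_topology n p))"


section \<open>Non-Archimedean local fields\<close>

definition has_characteristic :: "('a, 'm) ring_scheme \<Rightarrow> nat \<Rightarrow> bool" where
  "has_characteristic R p \<longleftrightarrow> (\<forall>n::nat. add_pow R n \<one>\<^bsub>R\<^esub> = \<zero>\<^bsub>R\<^esub> \<longleftrightarrow> p dvd n)"

locale nonarch_valued_field = field F for F (structure) +
  fixes absval :: "'a \<Rightarrow> real"
  assumes absval_nonneg: "x \<in> carrier F \<Longrightarrow> 0 \<le> absval x"
    and absval_eq_0_iff: "x \<in> carrier F \<Longrightarrow> absval x = 0 \<longleftrightarrow> x = \<zero>"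
    and absval_mult: "x \<in> carrier F \<Longrightarrow> y \<in> carrier F \<Longrightarrow> absval (x \<otimes> y) = absval x * absval y"
    and absval_add: "x \<in> carrier F \<Longrightarrow> y \<in> carrier F \<Longrightarrow> absval (x \<oplus> y) \<le> max (absval x) (absval y)"
    and absval_nontrivial: "\<exists>x\<in>carrier F. x \<noteq> \<zero> \<and> absval x \<noteq> 1"
begin

text \<open>The value 0 outside the carrier is needed because the locale \<open>Metric_space\<close> requires a
  metric to be nonnegative and symmetric on the whole type.\<close>
definition absval_dist :: "'a \<Rightarrow> 'a \<Rightarrow> real" where
  "absval_dist x y = (if x \<in> carrier F \<and> y \<in> carrier F then absval (x \<ominus> y) else 0)"

lemma absval_one: "absval \<one> = 1"
  using absval_mult[of \<one> \<one>] absval_eq_0_iff[of \<one>] by simp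

lemma absval_uminus:
  assumes "x \<in> carrier F"
  shows "absval (\<ominus> x) = absval x"
proof -
  have "absval (\<ominus> \<one>) * absval (\<ominus> \<one>) = absval (\<ominus> \<one> \<otimes> \<ominus> \<one>)"
    by (simp add: absval_mult)
  also have "\<dots> = 1"
    by (simp add: absval_one l_minus r_minus)
  finally have "absval (\<ominus> \<one>) = 1"
    using absval_nonneg[of "\<ominus> \<one>"] square_eq_1_iff[of "absval (\<ominus> \<one>)"] by auto
  moreover have "\<ominus> x = \<ominus> \<one> \<otimes> x"
    using assms by (simp add: l_minus)
  ultimately show ?thesis
    using assms by (simp add: absval_mult)
qed

sublocale Metric_space "carrier F" absval_dist
proof
  show "0 \<le> absval_dist x y" for x y
    by (simp add: absval_dist_def absval_nonneg)
  show "absval_dist x y = absval_dist y x" for x y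
  proof (cases "x \<in> carrier F \<and> y \<in> carrier F")
    case True
    then have "y \<ominus> x = \<ominus> (x \<ominus> y)"
      by (simp add: a_minus_def minus_add a_comm)
    with True show ?thesis
      by (simp add: absval_dist_def absval_uminus)
  qed (auto simp: absval_dist_def)
  show "absval_dist x y = 0 \<longleftrightarrow> x = y" if "x \<in> carrier F" "y \<in> carrier F" for x y
    using that by (simp add: absval_dist_def absval_eq_0_iff)
  show "absval_dist x z \<le> absval_dist x y + absval_dist y z"
    if "x \<in> carrier F" "y \<in> carrier F" "z \<in> carrier F" for x y z
  proof -
    have "x \<ominus> z = (x \<ominus> y) \<oplus> (y \<ominus> z)"
      using that by (simp add: a_minus_def a_assoc r_neg2 r_neg1)
    then have "absval (x \<ominus> z) \<le> max (absval (x \<ominus> y)) (absval (y \<ominus> z))"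
      using that absval_add[of "x \<ominus> y" "y \<ominus> z"] by simp
    also have "\<dots> \<le> absval (x \<ominus> y) + absval (y \<ominus> z)"
      using that by (simp add: absval_nonneg)
    finally show ?thesis
      using that by (simp add: absval_dist_def)
  qed
qed

end

locale nonarch_local_field = nonarch_valued_field +
  assumes locally_compact: "locally_compact_space mtopology"
begin

definition valuation_ring where
  "valuation_ring = F\<lparr>carrier := {x \<in> carrier F. absval x \<le> 1}\<rparr>"

definition maximal_ideal_set :: "'a set" where
  "maximal_ideal_set = {x \<in> carrier F. absval x < 1}"


section \<open>Analytic maps and standard groups\<close>

text \<open>
  A formal power series in variables indexed by a set \<open>I\<close> is given by its coefficients
  \<open>c \<alpha>\<close>, where the monomial \<open>\<alpha>\<close> is a multiset over \<open>I\<close>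
  (as in \<open>HOL-Algebra.Indexed_Polynomials\<close>). Values are unconditional sums over all monomials.
\<close>
definition monomial_value :: "('i \<Rightarrow> 'a) \<Rightarrow> 'i multiset \<Rightarrow> 'a" where
  "monomial_value x \<alpha> = (\<Otimes>i\<in>set_mset \<alpha>. x i [^] count \<alpha> i)"

definition power_series_sums :: "'i set \<Rightarrow> ('i multiset \<Rightarrow> 'a) \<Rightarrow> ('i \<Rightarrow> 'a) \<Rightarrow> 'a \<Rightarrow> bool" where
  "power_series_sums I c x s \<longleftrightarrow>
     limitin mtopology (\<lambda>A. \<Oplus>\<alpha>\<in>A. c \<alpha> \<otimes> monomial_value x \<alpha>) s
       (finite_subsets_at_top {\<alpha>. set_mset \<alpha> \<subseteq> I})"

definition analytic_map_on :: "'i set \<Rightarrow> ('i \<Rightarrow> 'a) set \<Rightarrow> (('i \<Rightarrow> 'a) \<Rightarrow> 'a) \<Rightarrow> bool" where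
  "analytic_map_on I U f \<longleftrightarrow>
     (\<forall>a\<in>U. \<exists>e>0. \<exists>c. (\<forall>\<alpha>. c \<alpha> \<in> carrier F) \<and>
        (\<forall>x\<in>U. (\<forall>i\<in>I. absval (x i \<ominus> a i) < e) \<longrightarrow>
           power_series_sums I c (\<lambda>i. x i \<ominus> a i) (f x)))"

text \<open>
  The group operations, read in the global chart \<open>\<psi>\<close>, are analytic.
  Pairs of \<open>d\<close>-vectors are vectors indexed by the disjoint sum \<open>{..<d} <+> {..<d}\<close>.
\<close>
definition analytic_group_in_chart ::
    "nat \<Rightarrow> ('g, 'm) monoid_scheme \<Rightarrow> 'g topology \<Rightarrow> ('g \<Rightarrow> nat \<Rightarrow> 'a) \<Rightarrow> bool" where
  "analytic_group_in_chart d G T \<psi> \<longleftrightarrow>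
     topological_group G T \<and>
     homeomorphic_map T
       (product_topology (\<lambda>_. subtopology mtopology maximal_ideal_set) {..<d}) \<psi> \<and>
     (\<forall>k<d. analytic_map_on ({..<d} <+> {..<d}) (({..<d} <+> {..<d}) \<rightarrow>\<^sub>E maximal_ideal_set)
        (\<lambda>z. \<psi> (inv_into (carrier G) \<psi> (\<lambda>i\<in>{..<d}. z (Inl i)) \<otimes>\<^bsub>G\<^esub>
                 inv_into (carrier G) \<psi> (\<lambda>i\<in>{..<d}. z (Inr i))) k)) \<and>
     (\<forall>k<d. analytic_map_on {..<d} ({..<d} \<rightarrow>\<^sub>E maximal_ideal_set)
        (\<lambda>x. \<psi> (inv\<^bsub>G\<^esub> (inv_into (carrier G) \<psi> x)) k))"

definition standard_group ::
    "nat \<Rightarrow> ('g, 'm) monoid_scheme \<Rightarrow> 'g topology \<Rightarrow> ('g \<Rightarrow> nat \<Rightarrow> 'a) \<Rightarrow> bool" where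
  "standard_group d G T \<psi> \<longleftrightarrow>
     analytic_group_in_chart d G T \<psi> \<and>
     \<psi> \<one>\<^bsub>G\<^esub> = (\<lambda>i\<in>{..<d}. \<zero>) \<and>
     (\<forall>k<d. \<exists>c. (\<forall>\<alpha>. c \<alpha> \<in> carrier valuation_ring) \<and> c {#} = \<zero> \<and>
        (\<forall>x\<in>carrier G. \<forall>y\<in>carrier G.
           power_series_sums ({..<d} <+> {..<d}) c (case_sum (\<psi> x) (\<psi> y)) (\<psi> (x \<otimes>\<^bsub>G\<^esub> y) k)))"

definition perfect_group :: "('g, 'm) monoid_scheme \<Rightarrow> 'g topology \<Rightarrow> bool" where
  "perfect_group G T \<longleftrightarrow>
     (\<exists>d>0. \<exists>\<psi>. standard_group d G T \<psi> \<and>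
        \<psi> ` derived G (carrier G) =
          {..<d} \<rightarrow>\<^sub>E ideal_prod valuation_ring maximal_ideal_set maximal_ideal_set)"

end

end

theory Submission
  imports Defs
begin

text \<open>
  Suppose \<open>r(G) \<le> d(G)\<^sup>2 / 4\<close> and take a minimal presentation of \<open>G\<close>. The Magnus map sends the basis elements of
  the free pro-\<open>p\<close> group to \<open>1 + X\<^sub>x\<close> in noncommutative power series over the field with \<open>p\<close> elements. By
  minimality each relator is \<open>1\<close> plus a series of order at least two, since otherwise a generator would be
  redundant. Let \<open>I n\<close> be the ideal generated by these series and by the series of order at least \<open>n\<close>. The
  dimensions \<open>b n\<close> of the quotients by \<open>I n\<close> satisfy the Golod--Shafarevich inequality \<open>1 + d * b n \<le> b (n + 1)
  + r * b (n - 1)\<close>, and a root \<open>t < 1\<close> of \<open>1 - d t + r t\<^sup>2 \<le> 0\<close> forces \<open>b n\<close> to grow at least like \<open>t\<^sup>-\<^sup>n\<close>.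

  On the other hand \<open>G\<close> acts on these quotients, and the elements congruent to \<open>1\<close> modulo \<open>I n\<close> form a series \<open>D
  n\<close> of open subgroups closed under commutators and \<open>p\<close>-th powers in the graded sense. An analytic group has a
  chain \<open>E j\<close> with boundedly many cosets in each step that lies inside every such series: for \<open>p\<close>-adic matrices
  the \<open>p\<close>-th power map, and for perfect groups the commutator with a fixed congruence subgroup, fills up the
  congruence subgroups. Spanning the quotients by products along this chain gives subexponential growth, a
  contradiction.
\<close>

section \<open>Filtered rings and indices\<close>

text \<open>\<open>relation_rank\<close> is a minimum over presentations on exactly
  \<open>generator_rank\<close> generators, so the existence of such a presentation has to be proved
  before relators can be counted: redundant generators are detected by a relator with a nonzero
  linear Magnus coefficient and eliminated one at a time. No completed group algebra is formed. The
  free group is known only through its universal property for test groups of one type, so for every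
  \<open>N\<close> it is mapped to a finite \<open>p\<close>-group of series truncated at length
  \<open>N\<close>, all congruences are taken at that level, and dimensions become
  base-\<open>p\<close> logarithms of finite indices. The two growth bounds can be compared because
  their constants do not depend on \<open>N\<close>: for \<open>t < s < 1\<close> the upper bound is
  \<open>C / s ^ N\<close>, the lower bound is \<open>t / t ^ N\<close>, and
  \<open>(t / s) ^ N\<close> tends to 0.\<close>

definition add_subgroup :: "'a::ab_group_add set \<Rightarrow> bool" where
  "add_subgroup J \<longleftrightarrow> 0 \<in> J \<and> (\<forall>a\<in>J. \<forall>b\<in>J. a - b \<in> J)"

lemma add_subgroup_zero: "add_subgroup J \<Longrightarrow> 0 \<in> J"
  and add_subgroup_diff: "add_subgroup J \<Longrightarrow> a \<in> J \<Longrightarrow> b \<in> J \<Longrightarrow> a - b \<in> J"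
  by (auto simp: add_subgroup_def)

lemma add_subgroup_uminus: "add_subgroup J \<Longrightarrow> a \<in> J \<Longrightarrow> - a \<in> J"
  using add_subgroup_diff[of J 0 a] by (simp add: add_subgroup_zero)

lemma add_subgroup_add: "add_subgroup J \<Longrightarrow> a \<in> J \<Longrightarrow> b \<in> J \<Longrightarrow> a + b \<in> J"
  using add_subgroup_diff[of J a "- b"] by (simp add: add_subgroup_uminus)

lemma add_subgroup_sum: "add_subgroup J \<Longrightarrow> (\<And>i. i \<in> I \<Longrightarrow> f i \<in> J) \<Longrightarrow> sum f I \<in> J"
  by (induction I rule: infinite_finite_induct) (auto simp: add_subgroup_zero add_subgroup_add)

lemma add_subgroup_diff_commute: "add_subgroup J \<Longrightarrow> a - b \<in> J \<Longrightarrow> b - a \<in> J"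
  using add_subgroup_uminus[of J "a - b"] by simp

lemma add_subgroup_diff_trans: "add_subgroup J \<Longrightarrow> a - b \<in> J \<Longrightarrow> b - c \<in> J \<Longrightarrow> a - c \<in> J"
  using add_subgroup_add[of J "a - b" "b - c"] by simp

lemma add_subgroup_of_int:
  fixes J :: "'a::ring_1 set"
  assumes "add_subgroup J" "a \<in> J"
  shows "of_int k * a \<in> J"
proof -
  have nat: "of_nat n * a \<in> J" for n
    by (induction n) (auto simp: algebra_simps assms add_subgroup_zero add_subgroup_add)
  show ?thesis
    using nat[of "nat k"] add_subgroup_uminus[OF assms(1) nat[of "nat (- k)"]]
    by (cases "k \<ge> 0") (auto simp: of_nat_nat)
qed

text \<open>The selecting predicate depends only on the coset of \<open>a\<close>, so two elements
  get the same representative exactly when they are congruent modulo \<open>J\<close>; cosets are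
  counted without forming a quotient.\<close>

definition coset_rep :: "'a::ab_group_add set \<Rightarrow> 'a \<Rightarrow> 'a" where
  "coset_rep J a = (SOME b. a - b \<in> J)"

text \<open>An infinite range has \<open>card\<close> 0, so lower bounds on the index come with a
  finiteness hypothesis.\<close>

definition add_index :: "'a::ab_group_add set \<Rightarrow> nat" where
  "add_index J = card (range (coset_rep J))"

lemma coset_rep: "add_subgroup J \<Longrightarrow> a - coset_rep J a \<in> J"
  unfolding coset_rep_def by (rule someI[of _ a]) (simp add: add_subgroup_zero)

lemma coset_rep_eq_iff:
  assumes "add_subgroup J"
  shows "coset_rep J a = coset_rep J b \<longleftrightarrow> a - b \<in> J"
proof
  assume "coset_rep J a = coset_rep J b"
  then show "a - b \<in> J"
    using coset_rep[OF assms, of a] coset_rep[OF assms, of b]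
    by (metis add_subgroup_diff_commute add_subgroup_diff_trans assms)
next
  assume "a - b \<in> J"
  then have "a - c \<in> J \<longleftrightarrow> b - c \<in> J" for c
    by (meson add_subgroup_diff_commute add_subgroup_diff_trans assms)
  then show "coset_rep J a = coset_rep J b"
    by (simp add: coset_rep_def)
qed

lemma coset_rep_idem: "add_subgroup J \<Longrightarrow> coset_rep J (coset_rep J a) = coset_rep J a"
  by (simp add: coset_rep_eq_iff add_subgroup_diff_commute coset_rep)

lemma add_index_le:
  assumes J: "add_subgroup J" and "finite Y" and cover: "\<And>a. \<exists>x\<in>Y. a - f x \<in> J"
  shows "finite (range (coset_rep J))" "add_index J \<le> card Y"
proof -
  have sub: "range (coset_rep J) \<subseteq> (\<lambda>x. coset_rep J (f x)) ` Y"
  proof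
    fix y assume "y \<in> range (coset_rep J)"
    then obtain a where "y = coset_rep J a" by auto
    then show "y \<in> (\<lambda>x. coset_rep J (f x)) ` Y"
      using cover[of a] coset_rep_eq_iff[OF J] by blast
  qed
  then show "finite (range (coset_rep J))"
    using \<open>finite Y\<close> finite_surj by blast
  show "add_index J \<le> card Y"
    unfolding add_index_def using surj_card_le[OF \<open>finite Y\<close> sub] .
qed

lemma add_index_ge:
  assumes J: "add_subgroup J" and fin: "finite (range (coset_rep J))"
    and inj: "\<And>x y. x \<in> Y \<Longrightarrow> y \<in> Y \<Longrightarrow> f x - f y \<in> J \<Longrightarrow> x = y"
  shows "card Y \<le> add_index J"
  unfolding add_index_def
proof (rule card_inj_on_le[OF _ _ fin])
  show "inj_on (\<lambda>x. coset_rep J (f x)) Y"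
    by (rule inj_onI) (use inj coset_rep_eq_iff[OF J] in blast)
qed auto

lemma add_index_pos: "finite (range (coset_rep J)) \<Longrightarrow> add_index J > 0"
  by (auto simp: add_index_def card_gt_0_iff)

lemma add_index_UNIV: "add_index (UNIV :: 'a::ab_group_add set) = 1"
proof -
  have "range (coset_rep (UNIV :: 'a set)) = {coset_rep UNIV 0}"
    by (auto simp: coset_rep_def)
  then show ?thesis
    by (simp add: add_index_def)
qed

text \<open>\<open>J 0 = UNIV\<close> together with \<open>filt_mult\<close> makes every
  \<open>J n\<close> a two-sided ideal. The instances are the order filtration \<open>low\<close>,
  the ideals \<open>rel_ideal\<close> and their truncations at a level \<open>N\<close>.\<close>

locale ring_filtration =
  fixes J :: "nat \<Rightarrow> 'a::ring_1 set"
  assumes subgroup: "add_subgroup (J n)"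
    and filt_0: "J 0 = UNIV"
    and filt_mult: "a \<in> J i \<Longrightarrow> b \<in> J j \<Longrightarrow> a * b \<in> J (i + j)"
    and filt_antimono: "i \<le> j \<Longrightarrow> J j \<subseteq> J i"
begin

lemmas zero = add_subgroup_zero[OF subgroup]
  and diff = add_subgroup_diff[OF subgroup]
  and add = add_subgroup_add[OF subgroup]
  and uminus = add_subgroup_uminus[OF subgroup]
  and diff_commute = add_subgroup_diff_commute[OF subgroup]
  and diff_trans = add_subgroup_diff_trans[OF subgroup]

lemma mult_left: "a \<in> J n \<Longrightarrow> b * a \<in> J n"
  using filt_mult[of b 0 a n] by (simp add: filt_0)

lemma mult_right: "a \<in> J n \<Longrightarrow> a * b \<in> J n"
  using filt_mult[of a n b 0] by (simp add: filt_0)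

lemma mult_mono: "a \<in> J i \<Longrightarrow> b \<in> J j \<Longrightarrow> n \<le> i + j \<Longrightarrow> a * b \<in> J n"
  using filt_mult filt_antimono by blast

lemma mult_cong: "a - a' \<in> J n \<Longrightarrow> b - b' \<in> J n \<Longrightarrow> a * b - a' * b' \<in> J n"
  using add[OF mult_right[of "a - a'" n b] mult_left[of "b - b'" n a']]
  by (simp add: algebra_simps)

lemma power: "a \<in> J i \<Longrightarrow> a ^ n \<in> J (i * n)"
  by (induction n) (auto simp: filt_0 intro: filt_mult)

end

section \<open>Noncommutative power series with integer coefficients\<close>

typedef 'x ncs = "UNIV :: ('x list \<Rightarrow> int) set"
  morphisms ncs_nth Abs_ncs ..

setup_lifting type_definition_ncs

lemma ncs_eqI: "(\<And>w. ncs_nth a w = ncs_nth b w) \<Longrightarrow> a = b"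
  by (simp add: ncs_nth_inject[symmetric] ext)

lemma ncs_nth_Abs [simp]: "ncs_nth (Abs_ncs f) = f"
  by (simp add: Abs_ncs_inverse)

instantiation ncs :: (type) ring_1
begin

lift_definition zero_ncs :: "'a ncs" is "\<lambda>_. 0" .
lift_definition one_ncs :: "'a ncs" is "\<lambda>w. if w = [] then 1 else 0" .
lift_definition plus_ncs :: "'a ncs \<Rightarrow> 'a ncs \<Rightarrow> 'a ncs" is "\<lambda>a b w. a w + b w" .
lift_definition minus_ncs :: "'a ncs \<Rightarrow> 'a ncs \<Rightarrow> 'a ncs" is "\<lambda>a b w. a w - b w" .
lift_definition uminus_ncs :: "'a ncs \<Rightarrow> 'a ncs" is "\<lambda>a w. - a w" .
lift_definition times_ncs :: "'a ncs \<Rightarrow> 'a ncs \<Rightarrow> 'a ncs" is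
  "\<lambda>a b w. \<Sum>k=0..length w. a (take k w) * b (drop k w)" .

instance
proof
  fix a b c :: "'a ncs"
  show "a * b * c = a * (b * c)"
  proof (rule ncs_eqI, transfer)
    fix a b c :: "'a list \<Rightarrow> int" and w :: "'a list"
    let ?n = "length w"
    \<comment> \<open>\<open>?f i j _\<close> belongs to the factorisation of \<open>w\<close> into
      pieces of lengths \<open>i\<close> and \<open>j\<close> and a rest; the third argument gives
      it the shape expected by \<open>fps_mult_assoc_lemma\<close>.\<close>
    let ?f = "\<lambda>i j (_::nat). a (take i w) * b (take j (drop i w)) * c (drop (i + j) w)"
    have "(\<Sum>k=0..?n. (\<Sum>j=0..length (take k w). a (take j (take k w)) * b (drop j (take k w))) * c (drop k w))
      = (\<Sum>k=0..?n. \<Sum>j=0..k. ?f j (k - j) (?n - k))"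
      by (intro sum.cong refl)
         (auto simp: sum_distrib_right min_def drop_take intro!: sum.cong)
    also have "\<dots> = (\<Sum>j=0..?n. \<Sum>i=0..?n - j. ?f j i (?n - j - i))"
      by (rule fps_mult_assoc_lemma)
    also have "\<dots> = (\<Sum>j=0..?n. a (take j w) *
        (\<Sum>i=0..length (drop j w). b (take i (drop j w)) * c (drop i (drop j w))))"
      by (intro sum.cong refl) (auto simp: sum_distrib_left mult.assoc add.commute intro!: sum.cong)
    finally show "(\<Sum>k=0..?n. (\<Sum>j=0..length (take k w). a (take j (take k w)) * b (drop j (take k w))) * c (drop k w))
      = (\<Sum>j=0..?n. a (take j w) *
        (\<Sum>i=0..length (drop j w). b (take i (drop j w)) * c (drop i (drop j w))))" .
  qed
  show "1 * a = a"
  proof (rule ncs_eqI, transfer)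
    fix a :: "'a list \<Rightarrow> int" and w :: "'a list"
    have "(\<Sum>k=0..length w. (if take k w = [] then 1 else 0) * a (drop k w))
      = (\<Sum>k=0..length w. if k = 0 then a (drop k w) else 0)"
      by (rule sum.cong) auto
    then show "(\<Sum>k=0..length w. (if take k w = [] then 1 else 0) * a (drop k w)) = a w"
      by simp
  qed
  show "a * 1 = a"
  proof (rule ncs_eqI, transfer)
    fix a :: "'a list \<Rightarrow> int" and w :: "'a list"
    have "(\<Sum>k=0..length w. a (take k w) * (if drop k w = [] then 1 else 0))
      = (\<Sum>k=0..length w. if k = length w then a (take k w) else 0)"
      by (rule sum.cong) auto
    then show "(\<Sum>k=0..length w. a (take k w) * (if drop k w = [] then 1 else 0)) = a w"
      by simp
  qed
  show "(a + b) * c = a * c + b * c"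
    by (rule ncs_eqI, transfer) (simp add: algebra_simps sum.distrib)
  show "a * (b + c) = a * b + a * c"
    by (rule ncs_eqI, transfer) (simp add: algebra_simps sum.distrib)
  show "(0 :: 'a ncs) \<noteq> 1"
    by transfer (auto simp: fun_eq_iff)
qed (transfer; auto simp: fun_eq_iff)+

end

lemma ncs_nth_simps [simp]:
  "ncs_nth 0 w = 0"
  "ncs_nth (a + b) w = ncs_nth a w + ncs_nth b w"
  "ncs_nth (a - b) w = ncs_nth a w - ncs_nth b w"
  "ncs_nth (- a) w = - ncs_nth a w"
  "ncs_nth 1 w = (if w = [] then 1 else 0)"
  by (transfer, simp)+

lemma ncs_nth_mult:
  "ncs_nth (a * b) w = (\<Sum>k=0..length w. ncs_nth a (take k w) * ncs_nth b (drop k w))"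
  by transfer simp

lemma ncs_nth_mult_Nil [simp]: "ncs_nth (a * b) [] = ncs_nth a [] * ncs_nth b []"
  by (simp add: ncs_nth_mult)

lemma ncs_nth_sum: "ncs_nth (sum f A) w = (\<Sum>x\<in>A. ncs_nth (f x) w)"
  by (induction A rule: infinite_finite_induct) auto

lemma ncs_nth_of_int: "ncs_nth (of_int k) w = (if w = [] then k else 0)"
proof -
  have "ncs_nth (of_nat n) w = (if w = [] then int n else 0)" for n
    by (induction n) auto
  then show ?thesis
    by (cases k rule: int_cases2) auto
qed

lemma ncs_nth_of_int_mult: "ncs_nth (of_int k * a) w = k * ncs_nth a w"
proof -
  have "ncs_nth (of_int k * a) w = (\<Sum>i=0..length w. if i = 0 then k * ncs_nth a (drop i w) else 0)"
    unfolding ncs_nth_mult by (rule sum.cong) (auto simp: ncs_nth_of_int)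
  then show ?thesis
    by simp
qed

section \<open>Variables, right division and the order filtration modulo \<open>p\<close>\<close>

definition ncs_X :: "'x \<Rightarrow> 'x ncs" where
  "ncs_X x = Abs_ncs (\<lambda>w. if w = [x] then 1 else 0)"

text \<open>The coefficient of the right factor \<open>X\<^sub>x\<close>.\<close>
definition ncs_div :: "'x \<Rightarrow> 'x ncs \<Rightarrow> 'x ncs" where
  "ncs_div x a = Abs_ncs (\<lambda>w. ncs_nth a (w @ [x]))"

lemma ncs_nth_X: "ncs_nth (ncs_X x) w = (if w = [x] then 1 else 0)"
  by (simp add: ncs_X_def)

lemma ncs_nth_div [simp]: "ncs_nth (ncs_div x a) w = ncs_nth a (w @ [x])"
  by (simp add: ncs_div_def)

lemma ncs_div_linear:
  "ncs_div x (a + b) = ncs_div x a + ncs_div x b"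
  "ncs_div x (a - b) = ncs_div x a - ncs_div x b"
  "ncs_div x 0 = 0"
  by (auto intro: ncs_eqI)

text \<open>The product rule of Fox calculus: \<open>ncs_div x\<close> acts as a Fox derivative and
  the constant term as augmentation. In the coefficient of \<open>w @ [x]\<close> the splitting
  whose right factor is empty contributes the last summand.\<close>

lemma ncs_div_mult: "ncs_div x (a * b) = a * ncs_div x b + of_int (ncs_nth b []) * ncs_div x a"
proof (rule ncs_eqI)
  fix w
  have "ncs_nth (a * b) (w @ [x]) = (\<Sum>k=0..length w. ncs_nth a (take k w) * ncs_nth b (drop k w @ [x]))
    + ncs_nth a (w @ [x]) * ncs_nth b []"
    by (simp add: ncs_nth_mult)
  then show "ncs_nth (ncs_div x (a * b)) w = ncs_nth (a * ncs_div x b + of_int (ncs_nth b []) * ncs_div x a) w"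
    by (simp add: ncs_nth_of_int_mult) (simp add: ncs_nth_mult)
qed

lemma ncs_nth_mult_X_snoc: "ncs_nth (a * ncs_X x) (w @ [y]) = (if y = x then ncs_nth a w else 0)"
proof -
  have "ncs_div y (a * ncs_X x) = a * ncs_div y (ncs_X x)"
    by (simp add: ncs_div_mult ncs_nth_X)
  moreover have "ncs_div y (ncs_X x) = (if y = x then 1 else 0)"
    by (rule ncs_eqI) (auto simp: ncs_nth_X)
  ultimately show ?thesis
    by (simp flip: ncs_nth_div)
qed

text \<open>Series over the field with \<open>p\<close> elements are encoded by integer series modulo \<open>p\<close>, so \<open>low p B n\<close> is the
  ideal of series of order at least \<open>n\<close> in the variables from \<open>B\<close>.\<close>
definition low :: "nat \<Rightarrow> 'x set \<Rightarrow> nat \<Rightarrow> 'x ncs set" where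
  "low p B n = {a. \<forall>w. set w \<subseteq> B \<longrightarrow> length w < n \<longrightarrow> int p dvd ncs_nth a w}"

interpretation low: ring_filtration "low p B"
proof
  show "add_subgroup (low p B n)" for n
    by (auto simp: add_subgroup_def low_def)
  show "low p B 0 = UNIV"
    by (auto simp: low_def)
  show "low p B j \<subseteq> low p B i" if "i \<le> j" for i j
    using that by (auto simp: low_def)
  show "a * b \<in> low p B (i + j)" if "a \<in> low p B i" "b \<in> low p B j" for a b i j
    unfolding low_def
  proof (safe)
    fix w assume w: "set w \<subseteq> B" "length w < i + j"
    show "int p dvd ncs_nth (a * b) w"
      unfolding ncs_nth_mult
    proof (rule dvd_sum)
      fix k assume k: "k \<in> {0..length w}"
      have l: "set (take k w) \<subseteq> B" "set (drop k w) \<subseteq> B"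
        using w(1) by (auto dest: in_set_takeD in_set_dropD)
      show "int p dvd ncs_nth a (take k w) * ncs_nth b (drop k w)"
      proof (cases "k < i")
        case True
        then have "int p dvd ncs_nth a (take k w)"
          using that(1) l k by (auto simp: low_def)
        then show ?thesis by simp
      next
        case False
        then have "int p dvd ncs_nth b (drop k w)"
          using that(2) l w(2) k by (auto simp: low_def)
        then show ?thesis by simp
      qed
    qed
  qed
qed

lemma of_nat_in_low: "of_nat p \<in> low p B n"
proof -
  have "ncs_nth (of_nat p) w = (if w = [] then int p else 0)" for w :: "'a list"
    using ncs_nth_of_int[of "int p" w] by simp
  then show ?thesis
    by (simp add: low_def)
qed

lemma ncs_div_low: "a \<in> low p B (Suc n) \<Longrightarrow> x \<in> B \<Longrightarrow> ncs_div x a \<in> low p B n"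
  by (auto simp: low_def)

text \<open>Every nonempty word over \<open>B\<close> has a last letter in \<open>B\<close>, so the
  condition on words splits by last letter. \<open>K n\<close> below has the same shape, with
  \<open>I n\<close> in place of \<open>low p B n\<close>.\<close>

lemma low_Suc_iff:
  "a \<in> low p B (Suc n) \<longleftrightarrow> int p dvd ncs_nth a [] \<and> (\<forall>x\<in>B. ncs_div x a \<in> low p B n)"
proof (safe)
  assume r: "int p dvd ncs_nth a []" "\<forall>x\<in>B. ncs_div x a \<in> low p B n"
  show "a \<in> low p B (Suc n)"
    unfolding low_def
  proof (safe)
    fix w assume "set w \<subseteq> B" "length w < Suc n"
    then show "int p dvd ncs_nth a w"
    proof (cases w rule: rev_cases)
      case (snoc v x)
      then have "set v \<subseteq> B" "x \<in> B" "length v < n"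
        using \<open>set w \<subseteq> B\<close> \<open>length w < Suc n\<close> by auto
      then show ?thesis
        using r(2) snoc by (auto simp: low_def)
    qed (use r in simp)
  qed
qed (auto simp: low_def)

lemma finite_words: "finite B \<Longrightarrow> finite {w. set w \<subseteq> B \<and> length w < n}"
  by (rule finite_subset[OF _ finite_lists_length_le[of B n]]) auto

text \<open>Canonical representatives modulo \<open>low p B n\<close>. Their finite set makes the
  indices below finite and later carries the groups \<open>unip\<close>.\<close>

definition ncs_trunc :: "nat \<Rightarrow> 'x set \<Rightarrow> nat \<Rightarrow> 'x ncs \<Rightarrow> 'x ncs" where
  "ncs_trunc p B n a = Abs_ncs (\<lambda>w. if set w \<subseteq> B \<and> length w < n then ncs_nth a w mod int p else 0)"

lemma ncs_nth_trunc:
  "ncs_nth (ncs_trunc p B n a) w = (if set w \<subseteq> B \<and> length w < n then ncs_nth a w mod int p else 0)"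
  by (simp add: ncs_trunc_def)

lemma trunc_diff: "a - ncs_trunc p B n a \<in> low p B n"
  by (auto simp: low_def ncs_nth_trunc)

lemma trunc_eq_iff: "ncs_trunc p B n a = ncs_trunc p B n b \<longleftrightarrow> a - b \<in> low p B n"
proof
  assume "ncs_trunc p B n a = ncs_trunc p B n b"
  then show "a - b \<in> low p B n"
    using trunc_diff[of a p B n] trunc_diff[of b p B n]
    by (metis low.diff_commute low.diff_trans)
next
  assume "a - b \<in> low p B n"
  then show "ncs_trunc p B n a = ncs_trunc p B n b"
    by (intro ncs_eqI) (auto simp: low_def ncs_nth_trunc mod_eq_dvd_iff)
qed

definition trunc_set :: "nat \<Rightarrow> 'x set \<Rightarrow> nat \<Rightarrow> 'x ncs set" where
  "trunc_set p B n = range (ncs_trunc p B n)"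

lemma bij_betw_trunc_set:
  fixes B :: "'x set" and n p :: nat
  assumes "p > 0"
  defines "W \<equiv> {w. set w \<subseteq> B \<and> length w < n}"
  shows "bij_betw (\<lambda>a. restrict (ncs_nth a) W) (trunc_set p B n) (W \<rightarrow>\<^sub>E {0..<int p})"
proof -
  have nth: "ncs_nth (ncs_trunc p B n a) w = (if w \<in> W then ncs_nth a w mod int p else 0)" for a w
    by (simp add: W_def ncs_nth_trunc)
  show ?thesis
  proof (rule bij_betwI[where g = "\<lambda>f. Abs_ncs (\<lambda>w. if w \<in> W then f w else 0)"])
    show "(\<lambda>a. restrict (ncs_nth a) W) \<in> trunc_set p B n \<rightarrow> W \<rightarrow>\<^sub>E {0..<int p}"
      using assms(1) by (auto simp: trunc_set_def nth)
    show "(\<lambda>f. Abs_ncs (\<lambda>w. if w \<in> W then f w else 0)) \<in> (W \<rightarrow>\<^sub>E {0..<int p}) \<rightarrow> trunc_set p B n"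
    proof
      fix f assume f: "f \<in> W \<rightarrow>\<^sub>E {0..<int p}"
      have f': "f w mod int p = f w" if "w \<in> W" for w
        using PiE_mem[OF f that] by simp
      have "Abs_ncs (\<lambda>w. if w \<in> W then f w else 0)
        = ncs_trunc p B n (Abs_ncs (\<lambda>w. if w \<in> W then f w else 0))"
        by (rule ncs_eqI) (simp add: nth f')
      then show "Abs_ncs (\<lambda>w. if w \<in> W then f w else 0) \<in> trunc_set p B n"
        unfolding trunc_set_def by (rule range_eqI)
    qed
    show "Abs_ncs (\<lambda>w. if w \<in> W then restrict (ncs_nth a) W w else 0) = a" if "a \<in> trunc_set p B n" for a
    proof -
      obtain b where "a = ncs_trunc p B n b"
        using \<open>a \<in> trunc_set p B n\<close> by (auto simp: trunc_set_def)
      then show ?thesis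
        by (intro ncs_eqI) (simp add: nth)
    qed
    show "restrict (ncs_nth (Abs_ncs (\<lambda>w. if w \<in> W then f w else 0))) W = f"
      if f: "f \<in> W \<rightarrow>\<^sub>E {0..<int p}" for f
      by (rule PiE_ext[OF _ f]) (use f in \<open>auto simp: PiE_mem[OF f]\<close>)
  qed
qed

lemma finite_trunc_set:
  assumes "p > 0" "finite B"
  shows "finite (trunc_set p B n)"
  using bij_betw_finite[OF bij_betw_trunc_set[OF assms(1), of B n]] assms
  by (simp add: finite_PiE finite_words)

section \<open>The Golod--Shafarevich recursion\<close>

text \<open>Two-sided multiples enter through \<open>gen\<close>, and \<open>low p B n\<close> is an
  ideal already, so closing under differences is enough to obtain a two-sided ideal.\<close>

inductive_set rel_ideal :: "nat \<Rightarrow> 'x set \<Rightarrow> 'x ncs set \<Rightarrow> nat \<Rightarrow> 'x ncs set"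
  for p B R n where
  low: "a \<in> low p B n \<Longrightarrow> a \<in> rel_ideal p B R n"
| gen: "f \<in> R \<Longrightarrow> a * f * b \<in> rel_ideal p B R n"
| diff: "a \<in> rel_ideal p B R n \<Longrightarrow> b \<in> rel_ideal p B R n \<Longrightarrow> a - b \<in> rel_ideal p B R n"

lemma rel_ideal_subgroup: "add_subgroup (rel_ideal p B R n)"
  by (auto simp: add_subgroup_def low.zero intro: rel_ideal.intros)

interpretation rel: ring_filtration "rel_ideal p B R"
proof
  show "add_subgroup (rel_ideal p B R n)" for n
    by (rule rel_ideal_subgroup)
  show "rel_ideal p B R 0 = UNIV"
    using low.filt_0[of p B] by (auto intro: rel_ideal.low)
  show "rel_ideal p B R j \<subseteq> rel_ideal p B R i" if "i \<le> j" for i j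
  proof
    fix a assume "a \<in> rel_ideal p B R j"
    then show "a \<in> rel_ideal p B R i"
      by induction (use low.filt_antimono[OF that, of p B] in \<open>auto intro: rel_ideal.intros\<close>)
  qed
  fix a b i j assume a: "a \<in> rel_ideal p B R i" and b: "b \<in> rel_ideal p B R j"
  note sub = rel_ideal_subgroup[of p B R "i + j"]
  from a show "a * b \<in> rel_ideal p B R (i + j)"
  proof induction
    case (low x)
    from b show ?case
    proof induction
      case (low y)
      then show ?case
        using \<open>x \<in> low p B i\<close> by (intro rel_ideal.low low.filt_mult)
    next
      case (gen f a b)
      then show ?case
        using rel_ideal.gen[of f R "x * a" b p B "i + j"] by (simp add: mult.assoc)
    next
      case (diff a b)
      then show ?case
        by (simp add: right_diff_distrib rel_ideal.diff)
    qed
  next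
    case (gen f x y)
    then show ?case
      using rel_ideal.gen[of f R x "y * b" p B "i + j"] by (simp add: mult.assoc)
  next
    case (diff x y)
    then show ?case
      by (simp add: left_diff_distrib rel_ideal.diff)
  qed
qed

lemma of_nat_in_rel_ideal: "of_nat p \<in> rel_ideal p B R n"
  by (rule rel_ideal.low[OF of_nat_in_low])

lemma rel_ideal_finite_index:
  assumes "p > 0" "finite B"
  shows "finite (range (coset_rep (rel_ideal p B R n)))"
proof (rule add_index_le(1)[OF rel_ideal_subgroup finite_trunc_set[OF assms, of n]])
  show "\<exists>x\<in>trunc_set p B n. a - x \<in> rel_ideal p B R n" for a
    using trunc_diff[of a p B n] by (auto simp: trunc_set_def intro: rel_ideal.low)
qed

locale relators =
  fixes p :: nat and B :: "'x set" and R :: "'x ncs set"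
  assumes p_pos: "p > 0" and finite_B: "finite B" and finite_R: "finite R"
    and R_low: "R \<subseteq> low p B 2"
begin

abbreviation "I \<equiv> rel_ideal p B R"

text \<open>\<open>I (Suc n)\<close> is obtained from \<open>K n\<close> by adding the products \<open>a * f\<close> with \<open>f \<in> R\<close>. Since \<open>f\<close> has order at
  least two, \<open>a\<close> matters only modulo \<open>I (n - 1)\<close>.\<close>
definition K :: "nat \<Rightarrow> 'x ncs set" where
  "K n = {a. int p dvd ncs_nth a [] \<and> (\<forall>x\<in>B. ncs_div x a \<in> I n)}"

lemma K_subgroup: "add_subgroup (K n)"
  by (auto simp: add_subgroup_def K_def ncs_div_linear rel.zero rel.diff)

lemma low_sub_K: "a \<in> low p B (Suc n) \<Longrightarrow> a \<in> K n"
  by (auto simp: low_Suc_iff K_def intro: rel_ideal.low)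

lemma p_mult_in_I: "int p dvd k \<Longrightarrow> of_int k * a \<in> I n"
proof (elim dvdE)
  fix j assume k: "k = int p * j"
  have "of_nat p * (of_int j * a) \<in> I n"
    by (rule rel.mult_right[OF of_nat_in_rel_ideal])
  then show ?thesis
    by (simp add: k mult.assoc)
qed

lemma R_Nil: "f \<in> R \<Longrightarrow> int p dvd ncs_nth f []"
  using R_low by (auto simp: low_def)

text \<open>In \<open>a * f * b\<close> split \<open>b\<close> into its constant term and a series
  \<open>?b'\<close> without constant term. By the product rule the right quotients of
  \<open>a * f * ?b'\<close> are \<open>a * f * ncs_div x ?b'\<close>, so this part lies in
  \<open>K n\<close>. The constant is central, and what remains is a left multiple of
  \<open>f\<close>.\<close>

lemma I_sub_K_plus:
  assumes "a \<in> I (Suc n)"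
  shows "\<exists>v. a - (\<Sum>f\<in>R. v f * f) \<in> K n"
  using assms
proof induction
  case (low a)
  then show ?case
    by (intro exI[of _ "\<lambda>_. 0"]) (simp add: low_sub_K)
next
  case (gen f a b)
  let ?k = "of_int (ncs_nth b []) :: 'x ncs" and ?b' = "b - of_int (ncs_nth b [])"
  have comm: "a * f * ?k = ?k * (a * f)"
    by (rule mult_of_int_commute[symmetric])
  have "a * f * ?b' \<in> K n"
  proof -
    have b': "ncs_nth ?b' [] = 0"
      by (simp add: ncs_nth_of_int)
    have "ncs_div x (a * f * ?b') \<in> I n" for x
      using rel_ideal.gen[OF gen, of a "ncs_div x ?b'" p B n] unfolding ncs_div_mult b' by simp
    moreover have "ncs_nth (a * f * ?b') [] = 0"
      by (simp only: ncs_nth_mult_Nil b' mult_zero_right)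
    ultimately show ?thesis
      unfolding K_def mem_Collect_eq by (metis dvd_0_right)
  qed
  moreover have "(\<Sum>g\<in>R. (if g = f then ?k * a else 0) * g) = ?k * a * f"
  proof -
    have "(\<Sum>g\<in>R. (if g = f then ?k * a else 0) * g) = (\<Sum>g\<in>R. if g = f then ?k * a * f else 0)"
      by (rule sum.cong) auto
    then show ?thesis
      using finite_R gen by simp
  qed
  moreover have "a * f * b = a * f * ?b' + ?k * a * f"
    unfolding right_diff_distrib comm by (simp only: mult.assoc diff_add_cancel)
  ultimately have "a * f * b - (\<Sum>g\<in>R. (if g = f then ?k * a else 0) * g) \<in> K n"
    by (simp only: add_diff_cancel_right')
  then show ?case
    by (rule exI[of _ "\<lambda>g. if g = f then ?k * a else 0"])
next
  case (diff a b)
  then obtain v w where "a - (\<Sum>f\<in>R. v f * f) \<in> K n" "b - (\<Sum>f\<in>R. w f * f) \<in> K n"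
    by blast
  then show ?case
    using add_subgroup_diff[OF K_subgroup, of "a - (\<Sum>f\<in>R. v f * f)" n "b - (\<Sum>f\<in>R. w f * f)"]
    by (intro exI[of _ "\<lambda>f. v f - w f"]) (simp add: left_diff_distrib sum_subtractf algebra_simps)
qed

text \<open>The product rule leaves \<open>u * ncs_div x f\<close> and a multiple of
  \<open>p\<close>; \<open>ncs_div x f\<close> has order at least one and lifts
  \<open>I (n - 1)\<close> to \<open>I n\<close>. For \<open>n = 0\<close> the truncated subtraction
  does no harm, as \<open>I 0\<close> is the whole ring.\<close>

lemma mult_R_in_K:
  assumes "u \<in> I (n - 1)" "f \<in> R"
  shows "u * f \<in> K n"
proof -
  have "ncs_div x (u * f) \<in> I n" if "x \<in> B" for x
  proof -
    have "ncs_div x f \<in> I 1"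
      using ncs_div_low[of f p B 1 x] R_low assms(2) that
      by (auto simp: numeral_2_eq_2 intro: rel_ideal.low)
    then have "u * ncs_div x f \<in> I n"
      by (rule rel.mult_mono[OF assms(1)]) simp
    moreover have "of_int (ncs_nth f []) * ncs_div x u \<in> I n"
      using p_mult_in_I R_Nil assms(2) by blast
    ultimately show ?thesis
      by (simp add: ncs_div_mult rel.add)
  qed
  then show ?thesis
    using R_Nil[OF assms(2)] by (simp add: K_def)
qed

lemma K_finite_index:
  shows "finite (range (coset_rep (K n)))"
proof (rule add_index_le(1)[OF K_subgroup finite_trunc_set[OF p_pos finite_B, of "Suc n"]])
  show "\<exists>x\<in>trunc_set p B (Suc n). a - x \<in> K n" for a
    using trunc_diff[of a p B "Suc n"] by (auto simp: trunc_set_def intro: low_sub_K)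
qed

text \<open>A coset of \<open>K n\<close> is reached from a representative modulo
  \<open>I (Suc n)\<close> by adding one multiple per relator, whose coefficient matters only modulo
  \<open>I (n - 1)\<close>.\<close>

lemma K_index_le: "add_index (K n) \<le> add_index (I (Suc n)) * add_index (I (n - 1)) ^ card R"
proof -
  let ?S = "range (coset_rep (I (Suc n)))" and ?U = "range (coset_rep (I (n - 1)))"
  let ?Y = "?S \<times> (R \<rightarrow>\<^sub>E ?U)"
  have fin: "finite ?S" "finite ?U"
    using rel_ideal_finite_index[OF p_pos finite_B] by auto
  have "add_index (K n) \<le> card ?Y"
  proof (rule add_index_le(2)[OF K_subgroup, where f = "\<lambda>(c, u). c + (\<Sum>f\<in>R. u f * f)"])
    show "finite ?Y"
      using fin finite_R by (auto intro: finite_PiE)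
    fix a
    obtain v where v: "a - coset_rep (I (Suc n)) a - (\<Sum>f\<in>R. v f * f) \<in> K n"
      using I_sub_K_plus coset_rep[OF rel_ideal_subgroup] by blast
    let ?u = "\<lambda>f\<in>R. coset_rep (I (n - 1)) (v f)"
    have "(\<Sum>f\<in>R. (v f - ?u f) * f) \<in> K n"
      by (intro add_subgroup_sum[OF K_subgroup] mult_R_in_K) (auto simp: coset_rep rel_ideal_subgroup)
    then have "(\<Sum>f\<in>R. v f * f) - (\<Sum>f\<in>R. ?u f * f) \<in> K n"
      by (simp only: left_diff_distrib sum_subtractf)
    from add_subgroup_add[OF K_subgroup v this]
    have "a - (coset_rep (I (Suc n)) a + (\<Sum>f\<in>R. ?u f * f)) \<in> K n"
      by (simp add: diff_diff_eq)
    moreover have "(coset_rep (I (Suc n)) a, ?u) \<in> ?Y"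
      by auto
    ultimately show "\<exists>x\<in>?Y. a - (case x of (c, u) \<Rightarrow> c + (\<Sum>f\<in>R. u f * f)) \<in> K n"
      by (intro bexI[of _ "(coset_rep (I (Suc n)) a, ?u)"]) auto
  qed
  also have "card ?Y = add_index (I (Suc n)) * add_index (I (n - 1)) ^ card R"
    using finite_R by (simp add: card_cartesian_product card_PiE add_index_def)
  finally show ?thesis .
qed

text \<open>Constant term and right quotients of a series can be prescribed independently;
  \<open>s\<close> does so. Distinct residues of the constant modulo \<open>p\<close>, or distinct
  representatives modulo \<open>I n\<close>, land in distinct cosets of \<open>K n\<close>.\<close>

lemma K_index_ge: "p * add_index (I n) ^ card B \<le> add_index (K n)"
proof -
  let ?U = "range (coset_rep (I n))"
  let ?Y = "{0..<int p} \<times> (B \<rightarrow>\<^sub>E ?U)"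
  define s where "s x = Abs_ncs (\<lambda>w. if w = [] then fst x
    else if last w \<in> B then ncs_nth (snd x (last w)) (butlast w) else 0)"
    for x :: "int \<times> ('x \<Rightarrow> 'x ncs)"
  have s_Nil: "ncs_nth (s x) [] = fst x" for x
    by (simp add: s_def)
  have s_div: "ncs_div z (s x) = snd x z" if "z \<in> B" for x z
    using that by (intro ncs_eqI) (simp add: s_def)
  have "card ?Y \<le> add_index (K n)"
  proof (rule add_index_ge[OF K_subgroup K_finite_index, where f = s])
    fix x y assume x: "x \<in> ?Y" and y: "y \<in> ?Y" and d: "s x - s y \<in> K n"
    from d have d1: "int p dvd fst x - fst y" and d2: "\<forall>z\<in>B. ncs_div z (s x - s y) \<in> I n"
      unfolding K_def mem_Collect_eq ncs_nth_simps s_Nil by blast+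
    from d1 have "fst x mod int p = fst y mod int p"
      by (simp add: mod_eq_dvd_iff)
    moreover have "fst x \<in> {0..<int p}" "fst y \<in> {0..<int p}"
      using x y by (metis mem_Times_iff)+
    ultimately have "fst x = fst y"
      by simp
    moreover have u: "snd x \<in> B \<rightarrow>\<^sub>E ?U" and u': "snd y \<in> B \<rightarrow>\<^sub>E ?U"
      using x y by (metis mem_Times_iff)+
    have "snd x = snd y"
    proof (rule PiE_ext[OF u u'])
      fix z assume "z \<in> B"
      have "snd x z - snd y z \<in> I n"
        using d2 \<open>z \<in> B\<close> by (simp add: ncs_div_linear s_div)
      then have "coset_rep (I n) (snd x z) = coset_rep (I n) (snd y z)"
        by (simp add: coset_rep_eq_iff[OF rel_ideal_subgroup])
      moreover obtain a b where "snd x z = coset_rep (I n) a" "snd y z = coset_rep (I n) b"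
        using PiE_mem[OF u \<open>z \<in> B\<close>] PiE_mem[OF u' \<open>z \<in> B\<close>] by blast
      ultimately show "snd x z = snd y z"
        by (simp only: coset_rep_idem[OF rel_ideal_subgroup])
    qed
    ultimately show "x = y"
      by (simp add: prod_eq_iff)
  qed
  also have "card ?Y = p * add_index (I n) ^ card B"
    using finite_B by (simp add: card_cartesian_product card_PiE add_index_def)
  finally show ?thesis .
qed

text \<open>The multiplicative form of the recursion for \<open>b n\<close>, with indices in place
  of powers of \<open>p\<close>; the factor \<open>p\<close> on the left stems from the constant
  term.\<close>

theorem golod_shafarevich:
  "p * add_index (I n) ^ card B \<le> add_index (I (Suc n)) * add_index (I (n - 1)) ^ card R"
  using K_index_ge K_index_le order_trans by blast

end

section \<open>The upper bound from a chain of subgroups\<close>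

text \<open>Spans are formed over the integers. Multiples of \<open>p\<close> lie in the ideals
  concerned, so modulo them these are spans over the field with \<open>p\<close> elements.\<close>

interpretation zmod: Modules.module "\<lambda>(k::int) (x::'a::ring_1). of_int k * x"
  by unfold_locales (simp_all add: algebra_simps)

lemma zspan_mult_left:
  assumes "y \<in> zmod.span Y"
  shows "c * y \<in> zmod.span ((*) c ` Y)"
  using assms
proof (induction rule: zmod.span_induct_alt)
  case base
  then show ?case
    by (simp add: zmod.span_zero)
next
  case (step k x y)
  have "c * (of_int k * x + y) = of_int k * (c * x) + c * y"
    by (metis distrib_left mult.assoc mult_of_int_commute)
  then show ?case
    using step by (simp add: zmod.span_add zmod.span_scale zmod.span_base)
qed

lemma add_index_le_power:
  fixes J :: "'a::ring_1 set"
  assumes J: "add_subgroup J" and p: "p > 0" and pJ: "\<And>a. of_nat p * a \<in> J"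
    and Y: "finite Y" and span: "\<And>a. \<exists>y\<in>zmod.span Y. a - y \<in> J"
  shows "add_index J \<le> p ^ card Y"
proof -
  have "add_index J \<le> card (Y \<rightarrow>\<^sub>E {0..<int p})"
  proof (rule add_index_le(2)[OF J, where f = "\<lambda>c. \<Sum>y\<in>Y. of_int (c y) * y"])
    show "finite (Y \<rightarrow>\<^sub>E {0..<int p})"
      using Y by (simp add: finite_PiE)
    fix a
    obtain c where c: "a - (\<Sum>y\<in>Y. of_int (c y) * y) \<in> J"
      using span[of a] by (auto simp: zmod.span_finite[OF Y])
    let ?c = "\<lambda>y\<in>Y. c y mod int p"
    have "(\<Sum>y\<in>Y. of_int (c y) * y - of_int (?c y) * y) \<in> J"
    proof (rule add_subgroup_sum[OF J])
      fix y assume "y \<in> Y"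
      have "c y - ?c y = int p * (c y div int p)"
        using \<open>y \<in> Y\<close> by (simp add: minus_mod_eq_mult_div)
      then have "of_int (c y) * y - of_int (?c y) * y = of_nat p * (of_int (c y div int p) * y)"
        by (metis left_diff_distrib mult.assoc of_int_diff of_int_mult of_int_of_nat_eq)
      then show "of_int (c y) * y - of_int (?c y) * y \<in> J"
        using pJ by simp
    qed
    from add_subgroup_add[OF J c this] have "a - (\<Sum>y\<in>Y. of_int (?c y) * y) \<in> J"
      by (simp only: sum_subtractf add_diff_eq diff_add_cancel)
    moreover have "?c \<in> Y \<rightarrow>\<^sub>E {0..<int p}"
      using p by auto
    ultimately show "\<exists>c\<in>Y \<rightarrow>\<^sub>E {0..<int p}. a - (\<Sum>y\<in>Y. of_int (c y) * y) \<in> J"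
      by blast
  qed
  also have "\<dots> = p ^ card Y"
    using Y by (simp add: card_PiE)
  finally show ?thesis .
qed

context ring_filtration
begin

text \<open>For \<open>g = m t g'\<close> with \<open>t, g \<in> E j\<close> one has \<open>a * h g = a * h g' + a * (h t - 1) * h g'\<close> modulo \<open>J N\<close>, where
  \<open>a * (h t - 1)\<close> lies \<open>j\<close> steps deeper than \<open>a\<close>. Hence level \<open>j\<close> contributes the factor \<open>1 + K * s ^ j\<close>, and
  these factors have a convergent product for every \<open>s < 1\<close>.\<close>
lemma chain_spanning_set:
  fixes h :: "'f \<Rightarrow> 'a" and m :: "'f \<Rightarrow> 'f \<Rightarrow> 'f" and E :: "nat \<Rightarrow> 'f set" and K N :: nat and s :: real
  assumes hm: "\<And>f g. f \<in> E 1 \<Longrightarrow> g \<in> E 1 \<Longrightarrow> h (m f g) - h f * h g \<in> J N"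
    and hE: "\<And>j f. 1 \<le> j \<Longrightarrow> f \<in> E j \<Longrightarrow> h f - 1 \<in> J j"
    and dec: "\<And>j. 1 \<le> j \<Longrightarrow> \<exists>T. finite T \<and> card T \<le> K \<and> T \<subseteq> E j \<and>
      (\<forall>g\<in>E j. \<exists>t\<in>T. \<exists>g'\<in>E (Suc j). g = m t g')"
    and sub: "\<And>j. 1 \<le> j \<Longrightarrow> E j \<subseteq> E 1"
    and s: "0 < s" "s < 1"
    and "1 \<le> j" "k \<le> N"
  shows "\<exists>Y. finite Y \<and> real (card Y) \<le> (\<Prod>i=j..<N. 1 + K * s ^ i) / s ^ k \<and>
    (\<forall>a\<in>J (N - k). \<forall>f\<in>E j. \<exists>y\<in>zmod.span Y. a * h f - a * y \<in> J N)"
  using \<open>1 \<le> j\<close> \<open>k \<le> N\<close>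
proof (induction "k - j" arbitrary: j k rule: less_induct)
  case less
  have prod_ge: "1 \<le> (\<Prod>i=j..<N. 1 + K * s ^ i)" for j
    using s by (intro prod_ge_1) auto
  show ?case
  proof (cases "k \<le> j")
    \<comment> \<open>The base case: \<open>a * (h f - 1)\<close> already lies in
      \<open>J N\<close>, so \<open>h f\<close> may be replaced by \<open>1\<close>.\<close>
    case True
    have "s ^ k \<le> 1"
      using s by (intro power_le_one) auto
    then have "1 \<le> (\<Prod>i=j..<N. 1 + K * s ^ i) / s ^ k"
      using prod_ge[of j] s by (simp add: field_simps)
    moreover have "a * h f - a * 1 \<in> J N" if "a \<in> J (N - k)" "f \<in> E j" for a f
    proof -
      have "a * (h f - 1) \<in> J N"
        using hE[OF \<open>1 \<le> j\<close> that(2)] that(1) True \<open>k \<le> N\<close> by (intro mult_mono[of _ "N - k" _ j]) auto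
      then show ?thesis
        by (simp add: right_diff_distrib)
    qed
    moreover have "1 \<in> zmod.span {1}"
      by (rule zmod.span_base) simp
    ultimately show ?thesis
      by (intro exI[of _ "{1}"] conjI ballI bexI[of _ 1]) auto
  next
    case False
    obtain T where T: "finite T" "card T \<le> K" "T \<subseteq> E j"
      and dec': "\<And>g. g \<in> E j \<Longrightarrow> \<exists>t\<in>T. \<exists>g'\<in>E (Suc j). g = m t g'"
      using dec[OF less.prems(1)] by blast
    let ?P = "\<Prod>i=Suc j..<N. 1 + K * s ^ i"
    \<comment> \<open>\<open>k\<close> is the distance of \<open>a\<close> from level
      \<open>N\<close>. The summand with \<open>a\<close> keeps it, the one with
      \<open>a * (h t - 1)\<close> reduces it to \<open>k - j\<close>; both continue with
      \<open>Suc j\<close>.\<close>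
    have "k - Suc j < k - j" "k - j - Suc j < k - j"
      using False less.prems(1) by auto
    obtain Y1 where Y1: "finite Y1" "real (card Y1) \<le> ?P / s ^ k"
      and sp1: "\<And>a f. a \<in> J (N - k) \<Longrightarrow> f \<in> E (Suc j) \<Longrightarrow> \<exists>y\<in>zmod.span Y1. a * h f - a * y \<in> J N"
      using less.hyps[OF \<open>k - Suc j < k - j\<close>] less.prems by (auto simp: Ball_def)
    obtain Y2 where Y2: "finite Y2" "real (card Y2) \<le> ?P / s ^ (k - j)"
      and sp2: "\<And>a f. a \<in> J (N - (k - j)) \<Longrightarrow> f \<in> E (Suc j) \<Longrightarrow> \<exists>y\<in>zmod.span Y2. a * h f - a * y \<in> J N"
      using less.hyps[OF \<open>k - j - Suc j < k - j\<close> le_SucI[OF less.prems(1)] order_trans[OF diff_le_self less.prems(2)]]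
      by (auto simp: Ball_def)
    let ?g = "\<lambda>(t, y). (h t - 1) * y"
    let ?Y = "Y1 \<union> ?g ` (T \<times> Y2)"
    have fin: "finite ?Y"
      using Y1 Y2 T by simp
    have "card ?Y \<le> card Y1 + card (?g ` (T \<times> Y2))"
      by (rule card_Un_le)
    also have "card (?g ` (T \<times> Y2)) \<le> card (T \<times> Y2)"
      using T Y2 by (intro card_image_le) simp
    also have "card (T \<times> Y2) \<le> K * card Y2"
      using T(2) by (simp add: card_cartesian_product)
    finally have "real (card ?Y) \<le> real (card Y1) + K * real (card Y2)"
      by (simp flip: of_nat_mult of_nat_add)
    also have "\<dots> \<le> ?P / s ^ k + K * (?P / s ^ (k - j))"
      using Y1 Y2 by (intro add_mono mult_left_mono) auto
    \<comment> \<open>Being \<open>j\<close> steps deeper is worth a factor \<open>s ^ j\<close>;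
      this produces \<open>1 + K * s ^ j\<close>.\<close>
    also have "?P / s ^ (k - j) = ?P * s ^ j / s ^ k"
      using False s by (simp add: power_diff)
    also have "?P / s ^ k + K * (?P * s ^ j / s ^ k) = (1 + K * s ^ j) * ?P / s ^ k"
      using s by (simp add: field_simps)
    also have "(1 + K * s ^ j) * ?P = (\<Prod>i=j..<N. 1 + K * s ^ i)"
      using False less.prems by (subst (2) prod.atLeast_Suc_lessThan) auto
    finally have card: "real (card ?Y) \<le> (\<Prod>i=j..<N. 1 + K * s ^ i) / s ^ k" .
    have "\<exists>y\<in>zmod.span ?Y. a * h f - a * y \<in> J N" if a: "a \<in> J (N - k)" and f: "f \<in> E j" for a f
    proof -
      obtain t g where t: "t \<in> T" and g: "g \<in> E (Suc j)" and f: "f = m t g"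
        using dec'[OF f] by blast
      have tE: "t \<in> E j" and tE1: "t \<in> E 1" and gE1: "g \<in> E 1"
        using t T(3) sub[of j] sub[of "Suc j"] g less.prems(1) by auto
      obtain y1 where y1: "y1 \<in> zmod.span Y1" "a * h g - a * y1 \<in> J N"
        using sp1[OF a g] by blast
      have "a * (h t - 1) \<in> J (N - (k - j))"
        using a hE[OF less.prems(1) tE] False less.prems(2) by (intro mult_mono[of _ "N - k" _ j]) auto
      then obtain y2 where y2: "y2 \<in> zmod.span Y2" "a * (h t - 1) * h g - a * (h t - 1) * y2 \<in> J N"
        using sp2[OF _ g] by blast
      have "a * (h f - h t * h g) \<in> J N"
        unfolding f by (rule mult_left[OF hm[OF tE1 gE1]])
      from add[OF this add[OF y1(2) y2(2)]]
      have "a * h f - a * (y1 + (h t - 1) * y2) \<in> J N"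
        by (simp add: algebra_simps)
      moreover have "y1 + (h t - 1) * y2 \<in> zmod.span ?Y"
      proof (rule zmod.span_add)
        show "y1 \<in> zmod.span ?Y"
          using y1(1) zmod.span_mono[of Y1 ?Y] by blast
        have "(*) (h t - 1) ` Y2 \<subseteq> ?Y"
          using t by force
        then show "(h t - 1) * y2 \<in> zmod.span ?Y"
          using zspan_mult_left[OF y2(1)] zmod.span_mono by blast
      qed
      ultimately show ?thesis
        by blast
    qed
    then show ?thesis
      using fin card by blast
  qed
qed

end

text \<open>By \<open>1 + x \<le> exp x\<close> and the geometric series. The bound is uniform in
  \<open>N\<close>.\<close>

lemma prod_one_plus_le_exp:
  fixes s :: real and K :: nat
  assumes s: "0 < s" "s < 1"
  shows "(\<Prod>i=1..<N. 1 + K * s ^ i) \<le> exp (K / (1 - s))"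
proof -
  have "(\<Prod>i=1..<N. 1 + K * s ^ i) \<le> (\<Prod>i=1..<N. exp (K * s ^ i))"
    using s by (intro prod_mono) auto
  also have "\<dots> = exp (K * (\<Sum>i=1..<N. s ^ i))"
    by (simp add: exp_sum sum_distrib_left)
  also have "(\<Sum>i=1..<N. s ^ i) \<le> suminf (\<lambda>i. s ^ i)"
    using s by (intro sum_le_suminf summable_geometric) auto
  also have "suminf (\<lambda>i. s ^ i) = 1 / (1 - s)"
    using s by (simp add: suminf_geometric)
  finally show ?thesis
    by (simp add: mult_left_mono)
qed

section \<open>Words, group elements and spanning sets\<close>

definition ncs_word :: "'x list \<Rightarrow> 'x ncs" where
  "ncs_word w = prod_list (map ncs_X w)"

lemma ncs_nth_word: "ncs_nth (ncs_word w) v = (if v = w then 1 else 0)"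
proof (induction w arbitrary: v rule: rev_induct)
  case (snoc x w)
  show ?case
  proof (cases v rule: rev_cases)
    case Nil
    then show ?thesis
      by (simp add: ncs_word_def ncs_nth_X)
  next
    case (snoc u y)
    then show ?thesis
      using snoc.IH[of u] by (auto simp: ncs_word_def ncs_nth_mult_X_snoc)
  qed
qed (simp add: ncs_word_def)

lemma low_words_span:
  assumes "finite B"
  shows "a - (\<Sum>w | set w \<subseteq> B \<and> length w < n. of_int (ncs_nth a w) * ncs_word w) \<in> low p B n"
proof -
  have "ncs_nth (\<Sum>w | set w \<subseteq> B \<and> length w < n. of_int (ncs_nth a w) * ncs_word w) v = ncs_nth a v"
    if "set v \<subseteq> B" "length v < n" for v
  proof -
    have "(\<Sum>w | set w \<subseteq> B \<and> length w < n. ncs_nth (of_int (ncs_nth a w) * ncs_word w) v)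
      = (\<Sum>w | set w \<subseteq> B \<and> length w < n. if w = v then ncs_nth a v else 0)"
      by (rule sum.cong) (auto simp: ncs_nth_of_int_mult ncs_nth_word)
    then show ?thesis
      using that finite_words[OF assms, of n] by (simp add: ncs_nth_sum)
  qed
  then show ?thesis
    by (simp add: low_def)
qed

text \<open>Modulo \<open>J N\<close>, the set \<open>W\<close> of integer combinations of values of
  \<open>h\<close> contains \<open>1\<close> and is stable under right multiplication by
  \<open>h f\<close>, hence by \<open>ncs_X x\<close>, which is congruent to some
  \<open>h f - 1\<close>. So it contains all words, and these span the series up to order
  \<open>N\<close>; finally each \<open>h f\<close> is replaced by an element of the span of
  \<open>Y\<close>.\<close>

lemma generators_span:
  fixes h :: "'f \<Rightarrow> 'x ncs"
  assumes B: "finite B" and J: "ring_filtration J" and low: "low p B N \<subseteq> J N"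
    and one: "e \<in> E" "h e - 1 \<in> J N"
    and closed: "\<And>f g. f \<in> E \<Longrightarrow> g \<in> E \<Longrightarrow> m f g \<in> E"
    and hm: "\<And>f g. f \<in> E \<Longrightarrow> g \<in> E \<Longrightarrow> h (m f g) - h f * h g \<in> J N"
    and gen: "\<And>x. x \<in> B \<Longrightarrow> \<exists>f\<in>E. h f - (1 + ncs_X x) \<in> J N"
    and Y: "\<And>f. f \<in> E \<Longrightarrow> \<exists>y\<in>zmod.span Y. h f - y \<in> J N"
  shows "\<exists>y\<in>zmod.span Y. a - y \<in> J N"
proof -
  interpret ring_filtration J by fact
  define W where "W = {a. \<exists>y\<in>zmod.span (h ` E). a - y \<in> J N}"
  have W: "add_subgroup W"
  proof -
    have "a - b \<in> W" if ab: "a \<in> W" "b \<in> W" for a b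
    proof -
      obtain y z where "y \<in> zmod.span (h ` E)" "a - y \<in> J N" "z \<in> zmod.span (h ` E)" "b - z \<in> J N"
        using ab unfolding W_def by blast
      then have "y - z \<in> zmod.span (h ` E)" "(a - b) - (y - z) \<in> J N"
        using diff[of "a - y" N "b - z"] by (auto simp: zmod.span_diff algebra_simps)
      then show ?thesis
        by (auto simp: W_def)
    qed
    moreover have "0 \<in> W"
      using zmod.span_zero zero by (force simp: W_def)
    ultimately show ?thesis
      by (simp add: add_subgroup_def)
  qed
  have W_cong: "b \<in> W" if "a \<in> W" "b - a \<in> J N" for a b
    using that diff_trans[of b a N] by (auto simp: W_def)
  have span_mult: "y * h f \<in> W" if "y \<in> zmod.span (h ` E)" "f \<in> E" for y f
    using that(1)
  proof (induction rule: zmod.span_induct_alt)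
    case base
    then show ?case
      using add_subgroup_zero[OF W] by simp
  next
    case (step k z y)
    then obtain g where g: "g \<in> E" "z = h g"
      by auto
    have "h g * h f \<in> W"
    proof (rule W_cong)
      show "h (m g f) \<in> W"
        using closed[OF g(1) that(2)] zero by (auto simp: W_def intro!: bexI[of _ "h (m g f)"] zmod.span_base)
      show "h g * h f - h (m g f) \<in> J N"
        using hm[OF g(1) that(2)] by (rule diff_commute)
    qed
    then have "of_int k * (h g * h f) \<in> W"
      by (rule add_subgroup_of_int[OF W])
    then show ?case
      using add_subgroup_add[OF W _ step.IH] by (simp add: g distrib_right mult.assoc)
  qed
  have W_mult: "a * ncs_X x \<in> W" if a: "a \<in> W" and x: "x \<in> B" for a x
  proof -
    obtain f where f: "f \<in> E" "h f - (1 + ncs_X x) \<in> J N"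
      using gen[OF x] by blast
    obtain y where y: "y \<in> zmod.span (h ` E)" "a - y \<in> J N"
      using a by (auto simp: W_def)
    have "a * ncs_X x - (y * h f - a) = (a - y) * h f - a * (h f - (1 + ncs_X x))"
      by (simp add: algebra_simps)
    also have "\<dots> \<in> J N"
      using mult_right[OF y(2)] mult_left[OF f(2)] by (rule diff)
    finally show ?thesis
      using add_subgroup_diff[OF W span_mult[OF y(1) f(1)] a] by (rule W_cong[rotated])
  qed
  have word: "ncs_word w \<in> W" if "set w \<subseteq> B" for w
    using that
  proof (induction w rule: rev_induct)
    case Nil
    have "h e \<in> W"
      using one(1) zero by (auto simp: W_def intro!: bexI[of _ "h e"] zmod.span_base)
    then show ?case
      using W_cong[OF _ diff_commute[OF one(2)]] by (simp add: ncs_word_def)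
  next
    case (snoc x w)
    then show ?case
      using W_mult by (simp add: ncs_word_def)
  qed
  have "(\<Sum>w | set w \<subseteq> B \<and> length w < N. of_int (ncs_nth a w) * ncs_word w) \<in> W"
    by (intro add_subgroup_sum[OF W] add_subgroup_of_int[OF W] word) auto
  then have "a \<in> W"
    using low_words_span[OF B, of a N p] low by (auto intro: W_cong)
  then obtain z where z: "z \<in> zmod.span (h ` E)" "a - z \<in> J N"
    by (auto simp: W_def)
  from z(1) have "\<exists>y\<in>zmod.span Y. z - y \<in> J N"
  proof (induction rule: zmod.span_induct_alt)
    case base
    then show ?case
      using zmod.span_zero zero by force
  next
    case (step k x z)
    then obtain y u where y: "y \<in> zmod.span Y" "x - y \<in> J N" and u: "u \<in> zmod.span Y" "z - u \<in> J N"
      using Y by blast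
    have "of_int k * x + z - (of_int k * y + u) = of_int k * (x - y) + (z - u)"
      by (simp add: algebra_simps)
    also have "\<dots> \<in> J N"
      by (intro add add_subgroup_of_int[OF subgroup] y u)
    finally show ?case
      using zmod.span_add[OF zmod.span_scale[OF y(1)] u(1)] by blast
  qed
  then show ?thesis
    using z(2) diff_trans by blast
qed

section \<open>Growth\<close>

text \<open>The generating function argument with finite sums: the recursion is weighted by
  \<open>t ^ Suc n\<close> and summed over \<open>n < N\<close>. The sum \<open>?U\<close> then has
  the coefficient \<open>1 - d * t + r * t\<^sup>2\<close>, and only the boundary term
  \<open>b N * t ^ N\<close> is left to absorb the constants; of these just the first,
  \<open>t\<close>, is kept.\<close>

lemma gs_growth:
  fixes b :: "nat \<Rightarrow> real"
  assumes nonneg: "\<And>n. 0 \<le> b n" and b0: "b 0 = 0"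
    and rec: "\<And>n. n < N \<Longrightarrow> 1 + d * b n \<le> b (Suc n) + r * b (n - 1)"
    and t: "0 < t" and quad: "1 - d * t + r * t\<^sup>2 \<le> 0" and r: "0 \<le> r" and N: "N > 0"
  shows "t \<le> b N * t ^ N"
proof -
  let ?U = "\<Sum>n<N. b n * t ^ n"
  have U: "0 \<le> ?U"
    using nonneg t by (intro sum_nonneg) auto
  have "t = (\<Sum>n<1. t ^ Suc n)"
    by simp
  also have "\<dots> \<le> (\<Sum>n<N. t ^ Suc n)"
    using t N by (intro sum_mono2) auto
  finally have 1: "t \<le> (\<Sum>n<N. t ^ Suc n)" .
  have "(\<Sum>n<N. t ^ Suc n * (1 + d * b n)) \<le> (\<Sum>n<N. t ^ Suc n * (b (Suc n) + r * b (n - 1)))"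
    using rec t by (intro sum_mono mult_left_mono) auto
  moreover have "(\<Sum>n<N. t ^ Suc n * (1 + d * b n)) = (\<Sum>n<N. t ^ Suc n) + d * t * ?U"
    by (simp add: sum.distrib sum_distrib_left algebra_simps)
  moreover have "(\<Sum>n<N. t ^ Suc n * (b (Suc n) + r * b (n - 1)))
      = (\<Sum>n<N. b (Suc n) * t ^ Suc n) + r * t * (\<Sum>n<N. b (n - 1) * t ^ n)"
    by (simp add: sum.distrib sum_distrib_left algebra_simps)
  moreover have "(\<Sum>n<N. b (Suc n) * t ^ Suc n) = ?U + b N * t ^ N"
    using sum.lessThan_Suc_shift[of "\<lambda>n. b n * t ^ n" N] b0 by simp
  \<comment> \<open>The shift costs a factor \<open>t\<close>; the term for \<open>n = 0\<close> is
    \<open>b 0 = 0\<close>.\<close>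
  moreover have "(\<Sum>n<N. b (n - 1) * t ^ n) \<le> t * ?U"
  proof -
    obtain M where M: "N = Suc M"
      using N by (cases N) auto
    have "(\<Sum>n<N. b (n - 1) * t ^ n) = t * (\<Sum>n<M. b n * t ^ n)"
      by (simp add: M sum.lessThan_Suc_shift b0 sum_distrib_left algebra_simps del: sum.lessThan_Suc)
    also have "\<dots> \<le> t * ?U"
      using t nonneg by (intro mult_left_mono) (auto simp: M)
    finally show ?thesis .
  qed
  then have "r * t * (\<Sum>n<N. b (n - 1) * t ^ n) \<le> r * t * (t * ?U)"
    using r t by (intro mult_left_mono) auto
  ultimately have "t + d * t * ?U \<le> ?U + b N * t ^ N + r * t * (t * ?U)"
    using 1 by linarith
  then have "t \<le> b N * t ^ N + (1 - d * t + r * t\<^sup>2) * ?U"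
    by (simp add: algebra_simps power2_eq_square)
  moreover have "(1 - d * t + r * t\<^sup>2) * ?U \<le> 0"
    using quad U by (rule mult_nonpos_nonneg)
  ultimately show ?thesis
    by linarith
qed

text \<open>At \<open>t = 2 / d\<close> the part \<open>1 - d * t\<close> equals \<open>-1\<close>
  and the quadratic term is at most \<open>1\<close>, and \<open>2 / d < 1\<close> once
  \<open>d > 2\<close>. For \<open>d = 2\<close> and \<open>r = 1\<close> the polynomial is the
  square of \<open>1 - t\<close>, which has no root below 1: the case excluded in the
  theorem.\<close>

lemma gs_quadratic_root:
  fixes d r :: nat
  assumes d: "d > 1" and r: "real r \<le> (real d)\<^sup>2 / 4" and ne: "\<not> (d = 2 \<and> r = 1)"
  obtains t :: real where "0 < t" "t < 1" "1 - d * t + r * t\<^sup>2 \<le> 0"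
proof (cases "d = 2")
  case True
  then have "r = 0"
    using r ne by (cases r) auto
  then show ?thesis
    using that[of "1/2"] True by simp
next
  case False
  show ?thesis
  proof (rule that[of "2 / d"])
    show "2 / real d < 1" "0 < 2 / real d"
      using False d by auto
    have "r * (2 / d)\<^sup>2 \<le> (real d)\<^sup>2 / 4 * (2 / d)\<^sup>2"
      using r by (intro mult_right_mono) auto
    also have "\<dots> = 1"
      using d by (simp add: power_divide)
    finally show "1 - real d * (2 / d) + r * (2 / d)\<^sup>2 \<le> 0"
      using d by simp
  qed
qed

section \<open>Finite \<open>p\<close>-groups\<close>

text \<open>The inverse turns right translation of cosets into a left action, and the restriction to
  \<open>rcosets L\<close> is what \<open>BijGroup\<close> demands of its elements.\<close>

lemma (in group) coset_action:
  assumes L: "subgroup L G"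
  shows "group_action (G\<lparr>carrier := L\<rparr>) (rcosets L) (\<lambda>g. \<lambda>c\<in>rcosets L. c #> inv g)"
proof -
  have Lc: "L \<subseteq> carrier G"
    using L by (rule subgroup.subset)
  have mem: "c #> g \<in> rcosets L" if c: "c \<in> rcosets L" and g: "g \<in> carrier G" for c g
  proof -
    obtain a where "a \<in> carrier G" "c = L #> a"
      using c by (auto simp: RCOSETS_def)
    then show ?thesis
      using g Lc by (auto simp: coset_mult_assoc intro: rcosetsI)
  qed
  have sub: "c \<subseteq> carrier G" if "c \<in> rcosets L" for c
    using that Lc rcosets_part_G[OF L] by auto
  have comp: "c #> g #> h = c #> (g \<otimes> h)" if "c \<in> rcosets L" "g \<in> carrier G" "h \<in> carrier G" for c g h
    using coset_mult_assoc[OF sub] that by auto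
  have one: "c #> \<one> = c" if "c \<in> rcosets L" for c
    using coset_mult_one[OF sub[OF that]] .
  let ?\<phi> = "\<lambda>g. \<lambda>c\<in>rcosets L. c #> inv g"
  have bij: "?\<phi> g \<in> Bij (rcosets L)" if "g \<in> carrier G" for g
    unfolding Bij_def
  proof (intro IntI CollectI)
    show "bij_betw (?\<phi> g) (rcosets L) (rcosets L)"
    proof (rule bij_betwI[where g = "\<lambda>c. c #> g"])
      show "?\<phi> g \<in> rcosets L \<rightarrow> rcosets L" "(\<lambda>c. c #> g) \<in> rcosets L \<rightarrow> rcosets L"
        using mem that by auto
      show "?\<phi> g c #> g = c" if "c \<in> rcosets L" for c
        using comp[OF that, of "inv g" g] one[OF that] that \<open>g \<in> carrier G\<close> by simp
      show "?\<phi> g (c #> g) = c" if "c \<in> rcosets L" for c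
        using comp[OF that, of g "inv g"] one[OF that] that mem \<open>g \<in> carrier G\<close> by simp
    qed
  qed simp
  have "?\<phi> \<in> hom (G\<lparr>carrier := L\<rparr>) (BijGroup (rcosets L))"
  proof (rule homI)
    fix g h assume "g \<in> carrier (G\<lparr>carrier := L\<rparr>)" "h \<in> carrier (G\<lparr>carrier := L\<rparr>)"
    then have gh: "g \<in> carrier G" "h \<in> carrier G"
      using Lc by auto
    show "?\<phi> (g \<otimes>\<^bsub>G\<lparr>carrier := L\<rparr>\<^esub> h) = ?\<phi> g \<otimes>\<^bsub>BijGroup (rcosets L)\<^esub> ?\<phi> h"
      using gh bij comp mem by (auto simp: BijGroup_def compose_def inv_mult_group fun_eq_iff restrict_def)
  qed (use bij Lc in \<open>auto simp: BijGroup_def\<close>)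
  then show ?thesis
    using subgroup_imp_group[OF L] group_BijGroup
    by (simp add: group_action_def group_hom_def group_hom_axioms_def)
qed

lemma orbit_update_carrier: "orbit (G\<lparr>carrier := L\<rparr>) \<phi> x = (\<lambda>g. \<phi> g x) ` L"
  by (auto simp: orbit_def)

text \<open>Count the fixed points of \<open>L\<close> on its cosets. Orbits have
  \<open>p\<close>-power size, the number of cosets is divisible by \<open>p\<close>, and
  \<open>L\<close> is a fixed point; hence there is another one, \<open>L #> x\<close>, and being
  fixed means that \<open>x\<close> conjugates \<open>L\<close> into itself.\<close>

lemma (in group) normalizer_grows:
  assumes p: "Factorial_Ring.prime p" and ord: "order G = p ^ k" and L: "subgroup L G" and proper: "L \<noteq> carrier G"
  obtains x where "x \<in> carrier G" "x \<notin> L" "\<And>g. g \<in> L \<Longrightarrow> x \<otimes> g \<otimes> inv x \<in> L"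
proof -
  let ?E = "rcosets L" and ?L = "G\<lparr>carrier := L\<rparr>"
  define \<phi> where "\<phi> = (\<lambda>g. \<lambda>c\<in>rcosets L. c #> inv g)"
  have phi: "\<phi> g c = c #> inv g" if "c \<in> ?E" for g c
    using that by (simp add: \<phi>_def)
  have fin: "finite (carrier G)"
    using ord p by (metis card.infinite not_prime_0 order_def power_eq_0_iff)
  have Lc: "L \<subseteq> carrier G"
    using L by (rule subgroup.subset)
  interpret A: group_action ?L ?E \<phi>
    unfolding \<phi>_def by (rule coset_action[OF L])
  have lag: "card ?E * card L = p ^ k"
    using lagrange[OF L] ord by simp
  have "card ?E \<noteq> 1"
  proof
    assume "card ?E = 1"
    then have "card L = card (carrier G)"
      using lag ord by (simp add: order_def)
    then show False
      using proper Lc fin card_subset_eq by blast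
  qed
  moreover obtain i where i: "card ?E = p ^ i"
    using lag p by (metis divides_primepow_nat dvd_triv_left)
  ultimately have pE: "p dvd card ?E"
    by (cases i) auto
  obtain j where j: "card L = p ^ j"
    using lag p by (metis divides_primepow_nat dvd_triv_right)
  have finE: "finite ?E"
    using fin by (simp add: RCOSETS_def)
  have "\<exists>c\<in>?E. c \<noteq> L \<and> orbit ?L \<phi> c = {c}"
  proof (rule ccontr)
    assume *: "\<not> ?thesis"
    let ?O = "orbits ?L ?E \<phi>"
    have LE: "L \<in> ?E"
      using L coset_join2[OF one_closed L subgroup.one_closed[OF L]] rcosetsI[OF Lc one_closed] by simp
    have "\<phi> g L = L" if "g \<in> L" for g
      using phi[OF LE] coset_join2[OF _ L, of "inv g"] subgroup.m_inv_closed[OF L that] Lc by auto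
    then have "(\<lambda>g. \<phi> g L) ` L = {L}"
      using subgroup.one_closed[OF L] by blast
    moreover have "orbit ?L \<phi> L = (\<lambda>g. \<phi> g L) ` L"
      by (rule orbit_update_carrier)
    ultimately have L_orbit: "orbit ?L \<phi> L = {L}"
      by (simp only:)
    have "p dvd card c" if c: "c \<in> ?O" "c \<noteq> {L}" for c
    proof -
      obtain b where b: "b \<in> ?E" "c = orbit ?L \<phi> b"
        using c by (auto simp: orbits_def)
      then have "b \<noteq> L"
        using L_orbit c(2) by metis
      then have "c \<noteq> {b}"
        using * b by blast
      moreover have "b \<in> c"
        using b A.orbit_refl by simp
      ultimately have "card c \<noteq> 1"
        by (auto simp: card_1_singleton_iff)
      moreover have "card c * card (stabilizer ?L \<phi> b) = p ^ j"
        using A.orbit_stabilizer_theorem[OF b(1)] b(2) j by (simp add: order_def)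
      then obtain l where "card c = p ^ l"
        using p by (metis divides_primepow_nat dvd_triv_left)
      ultimately show ?thesis
        by (cases l) auto
    qed
    moreover have part: "partition ?E ?O"
      by (rule A.orbit_partition)
    have finO: "finite ?O"
      using finE by (simp add: orbits_def)
    have LO: "{L} \<in> ?O"
      using LE L_orbit unfolding orbits_def by blast
    have "\<Union> ?O = ?E"
      by (rule partition.partition_coverture[OF part])
    moreover have "card (\<Union> ?O) = (\<Sum>c\<in>?O. card c)"
    proof (rule card_Union_disjoint)
      show "pairwise disjnt ?O"
        using partition.disjoint_union[OF part] by (auto simp: pairwise_def disjnt_def)
      show "finite c" if "c \<in> ?O" for c
        using partition.incl[OF part that] finE by (rule finite_subset)
    qed
    moreover have "(\<Sum>c\<in>?O. card c) = 1 + (\<Sum>c\<in>?O - {{L}}. card c)"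
      using sum.remove[OF finO LO, of card] by simp
    ultimately have "card ?E = 1 + (\<Sum>c\<in>?O - {{L}}. card c)" "p dvd (\<Sum>c\<in>?O - {{L}}. card c)"
      by (auto intro: dvd_sum)
    then have "p dvd 1"
      using pE by (metis dvd_add_left_iff)
    then show False
      using p by simp
  qed
  then obtain c where c: "c \<in> ?E" "c \<noteq> L" "orbit ?L \<phi> c = {c}"
    by blast
  then obtain x where x: "x \<in> carrier G" "c = L #> x"
    by (auto simp: RCOSETS_def)
  show ?thesis
  proof
    show "x \<in> carrier G" by fact
    show "x \<notin> L"
      using c(2) x coset_join2[OF x(1) L] by auto
    fix g assume g: "g \<in> L"
    have "\<phi> (inv g) c \<in> orbit ?L \<phi> c"
      using subgroup.m_inv_closed[OF L g] unfolding orbit_update_carrier by (rule imageI)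
    then have "c #> g = c"
      using c(3) phi[OF c(1), of "inv g"] g Lc by (simp add: subsetD)
    then have "L #> (x \<otimes> g) = L #> x"
      using x g Lc by (simp add: coset_mult_assoc subsetD)
    then have "x \<otimes> g \<in> L #> x"
      using x g Lc rcos_self[OF _ L, of "x \<otimes> g"] by (simp add: subsetD)
    then obtain l where "l \<in> L" "x \<otimes> g = l \<otimes> x"
      by (auto simp: r_coset_def)
    then have "x \<otimes> g \<otimes> inv x = l"
      using x(1) Lc by (simp add: m_assoc subsetD)
    with \<open>l \<in> L\<close> show "x \<otimes> g \<otimes> inv x \<in> L"
      by simp
  qed
qed

text \<open>A maximal proper subgroup is normal because normalizers grow; the quotient has no proper nontrivial
  subgroup, so it is cyclic of order \<open>p\<close>.\<close>
lemma (in group) frattini_overgroup: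
  assumes p: "Factorial_Ring.prime p" and ord: "order G = p ^ k" and L: "subgroup L G" and proper: "L \<noteq> carrier G"
  obtains M where "subgroup M G" "L \<subseteq> M" "M \<noteq> carrier G"
    "\<forall>x\<in>carrier G. \<forall>y\<in>carrier G. x \<otimes> y \<otimes> inv x \<otimes> inv y \<in> M"
    "\<forall>x\<in>carrier G. x [^] p \<in> M"
proof -
  have fin: "finite (carrier G)"
    using ord p by (metis card.infinite not_prime_0 order_def power_eq_0_iff)
  define C where "C = {M. subgroup M G \<and> L \<subseteq> M \<and> M \<noteq> carrier G}"
  have "C \<subseteq> Pow (carrier G)"
    using subgroup.subset by (auto simp: C_def)
  then have finC: "finite C"
    using fin by (simp add: finite_subset)
  have "L \<in> C"
    using L proper by (simp add: C_def)
  from finite_has_maximal2[OF finC this]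
  obtain M where "M \<in> C" and max': "L \<subseteq> M \<and> (\<forall>N\<in>C. M \<subseteq> N \<longrightarrow> M = N)"
    by (rule bexE)
  have max: "M = N" if "N \<in> C" "M \<subseteq> N" for N
    using max' that by simp
  from \<open>M \<in> C\<close>
  have M: "subgroup M G" "L \<subseteq> M" "M \<noteq> carrier G"
    by (auto simp: C_def)
  have maxi: "N = carrier G" if "subgroup N G" "M \<subseteq> N" "x \<in> N" "x \<notin> M" for N x
    using max[of N] that M(2) unfolding C_def by auto
  have Mc: "M \<subseteq> carrier G"
    using M(1) by (rule subgroup.subset)
  obtain x where x: "x \<in> carrier G" "x \<notin> M" and conj: "\<And>g. g \<in> M \<Longrightarrow> x \<otimes> g \<otimes> inv x \<in> M"
    using normalizer_grows[OF p ord M(1) M(3)] by blast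
  \<comment> \<open>The normalizer of \<open>M\<close>. The equivalence builds in both inclusions,
    which makes closure under inverses direct.\<close>
  let ?N = "{y \<in> carrier G. \<forall>g\<in>carrier G. y \<otimes> g \<otimes> inv y \<in> M \<longleftrightarrow> g \<in> M}"
  have conj_inj: "g = h" if "y \<otimes> g \<otimes> inv y = y \<otimes> h \<otimes> inv y" "y \<in> carrier G" "g \<in> carrier G" "h \<in> carrier G" for y g h
    using that by simp
  have sgN: "subgroup ?N G"
    proof (rule subgroupI)
      show "?N \<noteq> {}"
        by (auto intro!: exI[of _ \<one>])
      fix a assume a: "a \<in> ?N"
      have "inv a \<otimes> g \<otimes> inv (inv a) \<in> M \<longleftrightarrow> g \<in> M" if "g \<in> carrier G" for g
      proof -
        have "a \<otimes> (inv a \<otimes> g \<otimes> a) \<otimes> inv a = g"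
          using a that by (simp add: m_assoc[symmetric]) (simp add: m_assoc)
        moreover have "a \<otimes> (inv a \<otimes> g \<otimes> a) \<otimes> inv a \<in> M \<longleftrightarrow> inv a \<otimes> g \<otimes> a \<in> M"
          using a that by blast
        ultimately show ?thesis
          using a by simp
      qed
      then show "inv a \<in> ?N"
        using a by simp
      fix b assume b: "b \<in> ?N"
      have "a \<otimes> b \<otimes> g \<otimes> inv (a \<otimes> b) = a \<otimes> (b \<otimes> g \<otimes> inv b) \<otimes> inv a" if "g \<in> carrier G" for g
        using a b that by (simp add: m_assoc inv_mult_group)
      then show "a \<otimes> b \<in> ?N"
        using a b by simp
    qed auto
  have MN: "M \<subseteq> ?N"
    proof
      fix y assume y: "y \<in> M"
      have "g \<in> M" if "y \<otimes> g \<otimes> inv y \<in> M" "g \<in> carrier G" for g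
      proof -
        have "inv y \<otimes> (y \<otimes> g \<otimes> inv y) \<otimes> y = g"
          using y that Mc by (simp add: m_assoc subsetD) (simp add: m_assoc[symmetric] subsetD)
        then show ?thesis
          using subgroup.m_closed[OF M(1) subgroup.m_closed[OF M(1) subgroup.m_inv_closed[OF M(1) y] that(1)] y] by simp
      qed
      moreover have "y \<otimes> g \<otimes> inv y \<in> M" if "g \<in> M" for g
        by (intro subgroup.m_closed[OF M(1)] subgroup.m_inv_closed[OF M(1)] y that)
      ultimately show "y \<in> ?N"
        using y Mc by blast
    qed
    \<comment> \<open>Conjugation by \<open>x\<close> maps the finite set \<open>M\<close>
      injectively into itself, hence onto it; this gives the other direction of the
      equivalence.\<close>
    have "(\<lambda>g. x \<otimes> g \<otimes> inv x) ` M = M"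
    proof (rule endo_inj_surj)
      show "finite M"
        using Mc fin by (rule finite_subset)
      show "(\<lambda>g. x \<otimes> g \<otimes> inv x) ` M \<subseteq> M"
        by (rule image_subsetI) (rule conj)
      show "inj_on (\<lambda>g. x \<otimes> g \<otimes> inv x) M"
      proof (rule inj_onI)
        fix g h assume "g \<in> M" "h \<in> M" "x \<otimes> g \<otimes> inv x = x \<otimes> h \<otimes> inv x"
        then show "g = h"
          using conj_inj[of x g h] x(1) Mc by blast
      qed
    qed
    then have "g \<in> M" if "x \<otimes> g \<otimes> inv x \<in> M" "g \<in> carrier G" for g
    proof -
      obtain h where "h \<in> M" "x \<otimes> g \<otimes> inv x = x \<otimes> h \<otimes> inv x"
        using \<open>(\<lambda>g. x \<otimes> g \<otimes> inv x) ` M = M\<close> \<open>x \<otimes> g \<otimes> inv x \<in> M\<close> by blast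
      then show ?thesis
        using conj_inj[of x g h] x(1) \<open>g \<in> carrier G\<close> Mc by auto
    qed
  then have xN: "x \<in> ?N"
    using x(1) conj by blast
  have "?N = carrier G"
    by (rule maxi[OF sgN MN xN x(2)])
  then have "M \<lhd> G"
    using M(1) Mc by (intro normal_invI) auto
  then interpret M: normal M G .
  interpret Q: group "G Mod M"
    by (rule M.factorgroup_is_group)
  have hom: "(#>) M \<in> hom G (G Mod M)"
    by (rule M.r_coset_hom_Mod)
  interpret h: group_hom G "G Mod M" "(#>) M"
    by unfold_locales (rule hom)
  have in_M: "y \<in> M \<longleftrightarrow> M #> y = \<one>\<^bsub>G Mod M\<^esub>" if "y \<in> carrier G" for y
    using coset_join1[OF _ that M(1)] coset_join2[OF that M(1)] by auto
  \<comment> \<open>By maximality \<open>M\<close> and any \<open>z\<close> outside it generate the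
    group, so \<open>z\<close> generates the quotient.\<close>
  have cyclic: "\<exists>i::int. M #> y = (M #> z) [^]\<^bsub>G Mod M\<^esub> i" if "z \<in> carrier G" "z \<notin> M" "y \<in> carrier G" for y z
  proof -
    let ?D = "{y \<in> carrier G. \<exists>i::int. M #> y = (M #> z) [^]\<^bsub>G Mod M\<^esub> i}"
    have zQ: "M #> z \<in> carrier (G Mod M)"
      using that h.hom_closed by blast
      have sgD: "subgroup ?D G"
      proof (rule subgroupI)
        have "M #> \<one> = (M #> z) [^]\<^bsub>G Mod M\<^esub> (0::int)"
          using h.hom_one by simp
        then show "?D \<noteq> {}"
          by blast
        fix a assume "a \<in> ?D"
        then obtain i :: int where a: "a \<in> carrier G" "M #> a = (M #> z) [^]\<^bsub>G Mod M\<^esub> i"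
          by blast
        have "M #> inv a = (M #> z) [^]\<^bsub>G Mod M\<^esub> (- i)"
          using a zQ by (simp only: h.hom_inv Q.int_pow_neg)
        then show "inv a \<in> ?D"
          using a by blast
        fix b assume "b \<in> ?D"
        then obtain j :: int where b: "b \<in> carrier G" "M #> b = (M #> z) [^]\<^bsub>G Mod M\<^esub> j"
          by blast
        have "M #> (a \<otimes> b) = (M #> z) [^]\<^bsub>G Mod M\<^esub> (i + j)"
          using a b zQ by (simp only: h.hom_mult Q.int_pow_mult)
        then show "a \<otimes> b \<in> ?D"
          using a b by blast
      qed auto
      have MD: "M \<subseteq> ?D"
      proof
        fix y assume y: "y \<in> M"
        have yc: "y \<in> carrier G"
          using y Mc by (rule rev_subsetD)
        have "M #> y = (M #> z) [^]\<^bsub>G Mod M\<^esub> (0::int)"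
          using in_M[OF yc] y by simp
        with yc show "y \<in> ?D"
          by blast
      qed
      have "M #> z = (M #> z) [^]\<^bsub>G Mod M\<^esub> (1::int)"
        by (rule Q.int_pow_1[OF zQ, symmetric])
      then have zD: "z \<in> ?D"
        using that by blast
    have "?D = carrier G"
      by (rule maxi[OF sgD MD zD that(2)])
    then show ?thesis
      using that by blast
  qed
  \<comment> \<open>Both arguments are powers of \<open>x\<close> modulo \<open>M\<close>, and the
    exponents in the commutator cancel.\<close>
  have comm: "a \<otimes> b \<otimes> inv a \<otimes> inv b \<in> M" if ab: "a \<in> carrier G" "b \<in> carrier G" for a b
  proof -
    have zQ: "M #> x \<in> carrier (G Mod M)"
      using x h.hom_closed by blast
    obtain i j :: int where ij: "M #> a = (M #> x) [^]\<^bsub>G Mod M\<^esub> i" "M #> b = (M #> x) [^]\<^bsub>G Mod M\<^esub> j"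
      using cyclic[OF x ab(1)] cyclic[OF x ab(2)] by blast
    have "M #> (a \<otimes> b \<otimes> inv a \<otimes> inv b) = (M #> x) [^]\<^bsub>G Mod M\<^esub> (i + j + - i + - j)"
      using ab ij zQ by (simp only: h.hom_mult h.hom_inv Q.int_pow_mult Q.int_pow_neg m_closed inv_closed)
    also have "\<dots> = \<one>\<^bsub>G Mod M\<^esub>"
      by simp
    finally show ?thesis
      using in_M ab by simp
  qed
  have ordQ: "order (G Mod M) * card M = p ^ k"
    using lagrange[OF M(1)] ord by (simp add: order_def FactGroup_def)
  \<comment> \<open>Otherwise the \<open>p\<close>-th power of \<open>y\<close> generates the
    quotient too, so the order of \<open>y\<close> modulo \<open>M\<close> divides
    \<open>p * i - 1\<close>. It is also a power of \<open>p\<close>, hence 1.\<close>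
  have pow: "y [^] p \<in> M" if y: "y \<in> carrier G" for y
  proof (rule ccontr)
    assume np: "y [^] p \<notin> M"
    have yQ: "M #> y \<in> carrier (G Mod M)"
      using y h.hom_closed by blast
    obtain i :: int where i: "M #> y = (M #> (y [^] p)) [^]\<^bsub>G Mod M\<^esub> i"
      using cyclic[OF _ np y] y by auto
    also have "M #> (y [^] p) = (M #> y) [^]\<^bsub>G Mod M\<^esub> int p"
      using y h.hom_nat_pow by (simp add: int_pow_int)
    finally have "(M #> y) [^]\<^bsub>G Mod M\<^esub> (1::int) = (M #> y) [^]\<^bsub>G Mod M\<^esub> (int p * i)"
      using yQ by (simp add: Q.int_pow_pow)
    then have d: "int (Q.ord (M #> y)) dvd int p * i - 1"
      using Q.int_pow_eq[OF yQ] by blast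
    have "Q.ord (M #> y) dvd p ^ k"
      using Q.ord_dvd_group_order[OF yQ] unfolding ordQ[symmetric] by (rule dvd_mult2)
    then obtain l where l: "Q.ord (M #> y) = p ^ l"
      using divides_primepow_nat[OF p] by blast
    have "l = 0"
    proof (rule ccontr)
      assume "l \<noteq> 0"
      then have "int p dvd int (Q.ord (M #> y))"
        by (simp add: l)
      then have "int p dvd int p * i - 1"
        using d by (rule dvd_trans)
      then have "int p dvd int p * i - (int p * i - 1)"
        by (rule dvd_diff[OF dvd_triv_left])
      then show False
        using p by simp
    qed
    then have "M #> y = \<one>\<^bsub>G Mod M\<^esub>"
      using l yQ Q.ord_eq_1 by simp
    then have "M #> (y [^] p) = \<one>\<^bsub>G Mod M\<^esub>"
      using y by (simp only: h.hom_nat_pow Q.nat_pow_one)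
    then show False
      using np in_M y by simp
  qed
  show ?thesis
    by (rule that[OF M]) (use comm pow in blast)+
qed

section \<open>Topological groups\<close>

context topological_group
begin

lemma continuous_mult_const:
  assumes "a \<in> carrier G"
  shows "continuous_map T T (\<lambda>x. a \<otimes> x)" "continuous_map T T (\<lambda>x. x \<otimes> a)"
proof -
  have "continuous_map T (prod_topology T T) (\<lambda>x. (a, x))" "continuous_map T (prod_topology T T) (\<lambda>x. (x, a))"
    using assms by (auto intro!: continuous_map_pairedI simp: topspace_eq)
  from this[THEN continuous_map_compose, OF continuous_mult]
  show "continuous_map T T (\<lambda>x. a \<otimes> x)" "continuous_map T T (\<lambda>x. x \<otimes> a)"
    by (simp_all add: o_def)
qed

lemma openin_translate:
  assumes "openin T U" "a \<in> carrier G"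
  shows "openin T {x \<in> carrier G. a \<otimes> x \<in> U}" "openin T {x \<in> carrier G. x \<otimes> a \<in> U}"
  using openin_continuous_map_preimage[OF continuous_mult_const(1)[OF assms(2)] assms(1)]
    openin_continuous_map_preimage[OF continuous_mult_const(2)[OF assms(2)] assms(1)]
  by (simp_all add: topspace_eq)

lemma r_coset_eq_translate:
  assumes "subgroup N G" "a \<in> carrier G"
  shows "N #> a = {x \<in> carrier G. x \<otimes> inv a \<in> N}"
proof (intro Set.set_eqI iffI)
  fix x assume "x \<in> N #> a"
  then obtain n where "n \<in> N" "x = n \<otimes> a"
    by (auto simp: r_coset_def)
  then show "x \<in> {x \<in> carrier G. x \<otimes> inv a \<in> N}"
    using assms subgroup.mem_carrier[OF assms(1)] by (simp add: m_assoc)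
next
  fix x assume x: "x \<in> {x \<in> carrier G. x \<otimes> inv a \<in> N}"
  then have "x = (x \<otimes> inv a) \<otimes> a"
    using assms(2) by (simp add: m_assoc)
  then show "x \<in> N #> a"
    using x unfolding r_coset_def by blast
qed

lemma openin_r_coset: "subgroup N G \<Longrightarrow> openin T N \<Longrightarrow> a \<in> carrier G \<Longrightarrow> openin T (N #> a)"
  by (simp add: r_coset_eq_translate openin_translate)

lemma openin_subgroup_superset:
  assumes N: "subgroup N G" "openin T N" and M: "subgroup M G" "N \<subseteq> M"
  shows "openin T M"
proof -
  have "M = (\<Union>a\<in>M. N #> a)"
  proof (intro Set.set_eqI iffI)
    fix x assume "x \<in> M"
    then show "x \<in> (\<Union>a\<in>M. N #> a)"
      using rcos_self[OF _ N(1)] subgroup.mem_carrier[OF M(1)] by blast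
  next
    fix x assume "x \<in> (\<Union>a\<in>M. N #> a)"
    then show "x \<in> M"
      using M subgroup.m_closed[OF M(1)] unfolding r_coset_def by blast
  qed
  moreover have "openin T (\<Union>a\<in>M. N #> a)"
    using openin_r_coset[OF N] subgroup.mem_carrier[OF M(1)] by (intro openin_Union) blast
  ultimately show ?thesis
    by simp
qed

lemma closedin_open_subgroup:
  assumes N: "subgroup N G" "openin T N"
  shows "closedin T N"
proof -
  have "carrier G - N = (\<Union>a\<in>carrier G - N. N #> a)"
  proof (intro Set.set_eqI iffI)
    fix x assume "x \<in> carrier G - N"
    then show "x \<in> (\<Union>a\<in>carrier G - N. N #> a)"
      using rcos_self[OF _ N(1)] by blast
  next
    fix x assume "x \<in> (\<Union>a\<in>carrier G - N. N #> a)"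
    then obtain a n where a: "a \<in> carrier G" "a \<notin> N" and n: "n \<in> N" "x = n \<otimes> a"
      by (auto simp: r_coset_def)
    have nc: "n \<in> carrier G"
      using n(1) subgroup.mem_carrier[OF N(1)] by blast
    have "x \<notin> N"
    proof
      assume "x \<in> N"
      then have "inv n \<otimes> x \<in> N"
        by (intro subgroup.m_closed[OF N(1)] subgroup.m_inv_closed[OF N(1)] n(1))
      then show False
        using a nc n(2) by (simp add: m_assoc[symmetric])
    qed
    then show "x \<in> carrier G - N"
      using a nc n(2) by simp
  qed
  moreover have "openin T (\<Union>a\<in>carrier G - N. N #> a)"
    using openin_r_coset[OF N] by (intro openin_Union) blast
  ultimately show ?thesis
    unfolding closedin_def topspace_eq using subgroup.subset[OF N(1)] by simp
qed

lemma finite_rcosets_open: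
  assumes compact: "compact_space T" and N: "subgroup N G" "openin T N"
  shows "finite (rcosets N)"
proof -
  have op: "openin T U" if "U \<in> rcosets N" for U
    using that openin_r_coset[OF N] unfolding RCOSETS_def by blast
  have cover: "topspace T \<subseteq> \<Union> (rcosets N)"
    using rcosets_part_G[OF N(1)] topspace_eq by simp
  obtain \<F> where \<F>: "finite \<F>" "\<F> \<subseteq> rcosets N" "topspace T \<subseteq> \<Union>\<F>"
    using compactinD[OF compact[unfolded compact_space_def] op cover] by auto
  have "rcosets N \<subseteq> \<F>"
  proof
    fix c assume c: "c \<in> rcosets N"
    then obtain a where a: "a \<in> carrier G" "c = N #> a"
      unfolding RCOSETS_def by blast
    then have "a \<in> c"
      using rcos_self[OF _ N(1)] by simp
    have "a \<in> \<Union>\<F>"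
      using \<F>(3) a(1) by (auto simp: topspace_eq)
    then obtain c' where c': "c' \<in> \<F>" "a \<in> c'"
      by (rule UnionE)
    have "\<not> disjnt c c'"
      using \<open>a \<in> c\<close> c'(2) by (auto simp: disjnt_iff)
    then have "c = c'"
      using pairwiseD[OF rcos_disjoint[OF N(1)] c, of c'] c'(1) \<F>(2) by blast
    then show "c \<in> \<F>"
      using c' by simp
  qed
  then show ?thesis
    using \<F>(1) finite_subset by blast
qed

text \<open>Conjugation by any element of the coset \<open>N #> g\<close> gives the same condition,
  and compactness leaves finitely many cosets. The core is thus a finite intersection of open
  sets.\<close>

lemma open_normal_core:
  assumes compact: "compact_space T" and N: "subgroup N G" "openin T N"
  obtains K where "K \<lhd> G" "openin T K" "K \<subseteq> N"
proof -
  define K where "K = {x \<in> carrier G. \<forall>g\<in>carrier G. g \<otimes> x \<otimes> inv g \<in> N}"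
  have conj_mult: "g \<otimes> (x \<otimes> y) \<otimes> inv g = (g \<otimes> x \<otimes> inv g) \<otimes> (g \<otimes> y \<otimes> inv g)"
    if "g \<in> carrier G" "x \<in> carrier G" "y \<in> carrier G" for g x y
  proof -
    have "(g \<otimes> x \<otimes> inv g) \<otimes> (g \<otimes> y \<otimes> inv g) = g \<otimes> x \<otimes> (inv g \<otimes> g) \<otimes> y \<otimes> inv g"
      using that by (simp only: m_assoc m_closed inv_closed)
    then show ?thesis
      using that by (simp add: m_assoc)
  qed
  have sub: "subgroup K G"
  proof (rule subgroupI)
    show "K \<subseteq> carrier G"
      by (auto simp: K_def)
    have "\<one> \<in> K"
      using subgroup.one_closed[OF N(1)] by (simp add: K_def)
    then show "K \<noteq> {}"
      by blast
    fix a assume a: "a \<in> K"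
    have "g \<otimes> inv a \<otimes> inv g = inv (g \<otimes> a \<otimes> inv g)" if "g \<in> carrier G" for g
      using that a by (simp add: K_def inv_mult_group m_assoc)
    then show "inv a \<in> K"
      using a subgroup.m_inv_closed[OF N(1)] by (simp add: K_def)
    fix b assume b: "b \<in> K"
    show "a \<otimes> b \<in> K"
      using a b conj_mult subgroup.m_closed[OF N(1)] by (simp add: K_def)
  qed
  have "K \<lhd> G"
  proof (rule normal_invI[OF sub])
    fix x h assume x: "x \<in> carrier G" and h: "h \<in> K"
    have "g \<otimes> (x \<otimes> h \<otimes> inv x) \<otimes> inv g = (g \<otimes> x) \<otimes> h \<otimes> inv (g \<otimes> x)" if "g \<in> carrier G" for g
      using that x h by (simp add: K_def inv_mult_group m_assoc)
    then show "x \<otimes> h \<otimes> inv x \<in> K"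
      using x h by (simp add: K_def)
  qed
  moreover have "K \<subseteq> N"
  proof
    fix x assume "x \<in> K"
    then have "x \<in> carrier G" "\<one> \<otimes> x \<otimes> inv \<one> \<in> N"
      unfolding K_def by blast+
    then show "x \<in> N"
      by simp
  qed
  moreover have "openin T K"
  proof -
    let ?D = "\<lambda>a. {x \<in> carrier G. a \<otimes> x \<otimes> inv a \<in> N}"
    have "\<forall>c\<in>rcosets N. \<exists>a. a \<in> carrier G \<and> c = N #> a"
      unfolding RCOSETS_def by blast
    then obtain r where r: "\<forall>c\<in>rcosets N. r c \<in> carrier G \<and> c = N #> r c"
      by (rule bchoice[THEN exE])
    have opD: "openin T (?D a)" if a: "a \<in> carrier G" for a
    proof -
      have "openin T {x \<in> carrier G. a \<otimes> x \<in> {x \<in> carrier G. x \<otimes> inv a \<in> N}}"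
        by (rule openin_translate(1)[OF openin_translate(2)[OF N(2)]]) (use a in simp_all)
      moreover have "{x \<in> carrier G. a \<otimes> x \<in> {x \<in> carrier G. x \<otimes> inv a \<in> N}} = ?D a"
        using a by auto
      ultimately show ?thesis
        by simp
    qed
    have "K = \<Inter> ((\<lambda>c. ?D (r c)) ` (rcosets N))"
    proof (intro Set.set_eqI iffI)
      fix x assume x: "x \<in> K"
      have "x \<in> ?D (r c)" if "c \<in> rcosets N" for c
        using r that x unfolding K_def by blast
      then show "x \<in> \<Inter> ((\<lambda>c. ?D (r c)) ` (rcosets N))"
        by blast
    next
      fix x assume x: "x \<in> \<Inter> ((\<lambda>c. ?D (r c)) ` (rcosets N))"
      have mem: "x \<in> carrier G \<and> g \<otimes> x \<otimes> inv g \<in> N" if g: "g \<in> carrier G" for g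
      proof -
        have c: "N #> g \<in> rcosets N"
          using g unfolding RCOSETS_def by blast
        define a where "a = r (N #> g)"
        have a: "a \<in> carrier G" "N #> g = N #> a"
          using bspec[OF r c] unfolding a_def by auto
        have "x \<in> ?D (r (N #> g))"
          using x c by blast
        then have xD: "x \<in> carrier G" "a \<otimes> x \<otimes> inv a \<in> N"
          unfolding a_def by auto
        have "g \<in> N #> a"
          using rcos_self[OF g N(1)] a(2) by simp
        then obtain n where n: "n \<in> N" "g = n \<otimes> a"
          unfolding r_coset_def by blast
        have nc: "n \<in> carrier G"
          using n(1) subgroup.mem_carrier[OF N(1)] by blast
        have "g \<otimes> x \<otimes> inv g = n \<otimes> (a \<otimes> x \<otimes> inv a) \<otimes> inv n"
          using nc a(1) xD(1) by (simp add: n(2) inv_mult_group m_assoc)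
        moreover have "n \<otimes> (a \<otimes> x \<otimes> inv a) \<otimes> inv n \<in> N"
          by (intro subgroup.m_closed[OF N(1)] subgroup.m_inv_closed[OF N(1)] n(1) xD(2))
        ultimately show ?thesis
          using xD(1) by simp
      qed
      then show "x \<in> K"
        unfolding K_def using one_closed by blast
    qed
    moreover have "openin T (\<Inter> ((\<lambda>c. ?D (r c)) ` (rcosets N)))"
    proof (rule openin_Inter)
      show "finite ((\<lambda>c. ?D (r c)) ` (rcosets N))"
        using finite_rcosets_open[OF compact N] by blast
      show "(\<lambda>c. ?D (r c)) ` (rcosets N) \<noteq> {}"
        unfolding RCOSETS_def using one_closed by blast
      show "openin T U" if "U \<in> (\<lambda>c. ?D (r c)) ` (rcosets N)" for U
        using that opD r by blast
    qed
    ultimately show ?thesis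
      by simp
  qed
  ultimately show ?thesis
    using that by blast
qed

lemma topological_group_subgroup:
  assumes L: "subgroup L G"
  shows "topological_group (G\<lparr>carrier := L\<rparr>) (subtopology T L)"
proof -
  have Lc: "L \<subseteq> carrier G"
    using L by (rule subgroup.subset)
  interpret L: group "G\<lparr>carrier := L\<rparr>"
    by (rule subgroup_imp_group[OF L])
  show ?thesis
  proof unfold_locales
    show "topspace (subtopology T L) = carrier (G\<lparr>carrier := L\<rparr>)"
      using Lc by (simp add: topspace_eq Int_absorb1)
    have "continuous_map (subtopology (prod_topology T T) (L \<times> L)) (subtopology T L) (\<lambda>(x, y). x \<otimes> y)"
      by (intro continuous_map_into_subtopology continuous_map_from_subtopology continuous_mult)
        (auto intro: subgroup.m_closed[OF L])
    then show "continuous_map (prod_topology (subtopology T L) (subtopology T L)) (subtopology T L)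
        (\<lambda>(x, y). x \<otimes>\<^bsub>G\<lparr>carrier := L\<rparr>\<^esub> y)"
      by (simp add: subtopology_Times)
    have "continuous_map (subtopology T L) (subtopology T L) (\<lambda>x. inv x)"
      by (intro continuous_map_into_subtopology continuous_map_from_subtopology continuous_inv)
        (auto intro: subgroup.m_inv_closed[OF L])
    then show "continuous_map (subtopology T L) (subtopology T L) (\<lambda>x. inv\<^bsub>G\<lparr>carrier := L\<rparr>\<^esub> x)"
      by (rule continuous_map_eq) (simp add: L)
  qed
qed

text \<open>\<open>S\<close> and the complements of the \<open>D i\<close> form an open cover; among
  the complements in a finite subcover there is one of largest index.\<close>

lemma compact_decreasing_eventually:
  assumes compact: "compact_space T" and closed: "\<And>i. closedin T (D i)"
    and dec: "\<And>i. D (Suc i) \<subseteq> D i" and Int: "(\<Inter>i. D i) \<subseteq> {\<one>}"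
    and S: "openin T S" "\<one> \<in> S"
  obtains i :: nat where "D i \<subseteq> S"
proof -
  let ?\<U> = "insert S (range (\<lambda>i. topspace T - D i))"
  have op: "openin T U" if "U \<in> ?\<U>" for U
    using that S closed by auto
  have cover: "topspace T \<subseteq> \<Union>?\<U>"
    using Int S by blast
  obtain \<F> where \<F>: "finite \<F>" "\<F> \<subseteq> ?\<U>" "topspace T \<subseteq> \<Union>\<F>"
    using compactinD[OF compact[unfolded compact_space_def] op cover] by blast
  have "finite (\<F> - {S})" "\<F> - {S} \<subseteq> range (\<lambda>i. topspace T - D i)"
    using \<F> by auto
  then obtain I where I: "finite I" "\<F> - {S} = (\<lambda>i. topspace T - D i) ` I"
    by (metis finite_subset_image subset_image_iff)
  obtain n where n: "\<forall>i\<in>I. i \<le> n"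
    using I(1) finite_nat_set_iff_bounded_le by blast
  have anti: "D n \<subseteq> D i" if "i \<le> n" for i
    using lift_Suc_antimono_le[of D, OF dec that] .
  show ?thesis
  proof (rule that)
    show "D n \<subseteq> S"
    proof
      fix x assume x: "x \<in> D n"
      then have "x \<in> topspace T"
        using closedin_subset[OF closed] by blast
      then obtain U where U: "U \<in> \<F>" "x \<in> U"
        using \<F>(3) by blast
      show "x \<in> S"
      proof (rule ccontr)
        assume "x \<notin> S"
        then have "U \<in> \<F> - {S}"
          using U by blast
        then obtain i where "i \<in> I" "U = topspace T - D i"
          using I(2) by blast
        then show False
          using U(2) x anti n by blast
      qed
    qed
  qed
qed

end

lemma closed_subgroup_equalizer:
  assumes "group G" "group H" "topspace T = carrier G" and f: "f \<in> hom G H" "continuous_map T S f"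
    and g: "g \<in> hom G H" "continuous_map T S g" and "Hausdorff_space S"
  shows "subgroup {x \<in> carrier G. f x = g x} G" "closedin T {x \<in> carrier G. f x = g x}"
proof -
  interpret f: group_hom G H f
    using assms by (simp add: group_hom_def group_hom_axioms_def)
  interpret g: group_hom G H g
    using assms by (simp add: group_hom_def group_hom_axioms_def)
  show "subgroup {x \<in> carrier G. f x = g x} G"
    by (rule f.G.subgroupI) (auto intro!: exI[of _ "\<one>\<^bsub>G\<^esub>"])
  show "closedin T {x \<in> carrier G. f x = g x}"
    using closedin_continuous_maps_eq[OF assms(8) f(2) g(2)] assms(3) by simp
qed

section \<open>Pro-\<open>p\<close> groups\<close>

text \<open>If a prime \<open>q \<noteq> p\<close> divided the index, a Sylow \<open>q\<close>-subgroup of the quotient would contain a nontrivial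
  element.\<close>
lemma (in group) index_prime_power:
  assumes p: "Factorial_Ring.prime p" and N: "N \<lhd> G" and fin: "finite (rcosets N)"
    and pow: "\<And>x. x \<in> carrier G \<Longrightarrow> \<exists>k. x [^] (p ^ k) \<in> N"
  shows "\<exists>k. card (rcosets N) = p ^ k"
proof -
  interpret N: normal N G
    by (rule N)
  interpret Q: group "G Mod N"
    by (rule N.factorgroup_is_group)
  have carQ: "carrier (G Mod N) = rcosets N"
    by (simp add: FactGroup_def)
  have finQ: "finite (carrier (G Mod N))"
    using fin carQ by simp
  let ?n = "card (rcosets N)"
  have n0: "?n \<noteq> 0"
    using finQ Q.one_closed carQ by auto
  obtain m where m: "?n = p ^ multiplicity p ?n * m" "\<not> p dvd m"
    using multiplicity_decompose'[of ?n p] n0 p by (metis not_prime_unit)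
  have "m = 1"
  proof (rule ccontr)
    assume "m \<noteq> 1"
    then obtain q where q: "Factorial_Ring.prime q" "q dvd m"
      using prime_factor_nat by blast
    then have "q \<noteq> p"
      using m(2) by blast
    have "q dvd ?n"
      using q(2) m(1) by (metis dvd_mult)
    define a where "a = multiplicity q ?n"
    have "a > 0"
      using \<open>q dvd ?n\<close> n0 q(1) unfolding a_def by (simp add: prime_multiplicity_gt_zero_iff)
    obtain l where l: "?n = q ^ a * l"
      using multiplicity_dvd[of q ?n] unfolding a_def by (auto elim: dvdE)
    have "order (G Mod N) = q ^ a * l"
      using l carQ by (simp add: order_def)
    then obtain H where H: "subgroup H (G Mod N)" "card H = q ^ a"
      using sylow_thm[OF q(1) Q.group_axioms _ finQ] by blast
    have "finite H"
      using H(1) finQ by (meson finite_subset subgroup.subset)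
    have "H \<noteq> {\<one>\<^bsub>G Mod N\<^esub>}"
    proof
      assume "H = {\<one>\<^bsub>G Mod N\<^esub>}"
      then have "q ^ a = 1"
        using H(2) by simp
      then show False
        using q(1) \<open>a > 0\<close> by (metis nat_neq_iff one_less_power prime_gt_1_nat)
    qed
    then obtain z where z: "z \<in> H" "z \<noteq> \<one>\<^bsub>G Mod N\<^esub>"
      using subgroup.one_closed[OF H(1)] by blast
    interpret H: group "(G Mod N)\<lparr>carrier := H\<rparr>"
      by (rule Q.subgroup_imp_group[OF H(1)])
    have zc: "z \<in> carrier (G Mod N)"
      by (rule subgroup.mem_carrier[OF H(1) z(1)])
    have "z [^]\<^bsub>(G Mod N)\<lparr>carrier := H\<rparr>\<^esub> order ((G Mod N)\<lparr>carrier := H\<rparr>) = \<one>\<^bsub>(G Mod N)\<lparr>carrier := H\<rparr>\<^esub>"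
      by (rule H.pow_order_eq_1) (simp add: z)
    then have "z [^]\<^bsub>G Mod N\<^esub> (q ^ a) = \<one>\<^bsub>G Mod N\<^esub>"
      unfolding Q.nat_pow_consistent[symmetric] by (simp add: order_def H(2))
    then have qa: "Q.ord z dvd q ^ a"
      using Q.pow_eq_id[OF zc] by blast
    obtain x where x: "x \<in> carrier G" "z = N #> x"
      using zc unfolding carrier_FactGroup by blast
    obtain k where k: "x [^] (p ^ k) \<in> N"
      using pow[OF x(1)] by blast
    have "N #> (x [^] (p ^ k)) = \<one>\<^bsub>G Mod N\<^esub>"
      using coset_join2[OF _ N.subgroup_axioms k] x(1) by simp
    then have "z [^]\<^bsub>G Mod N\<^esub> (p ^ k) = \<one>\<^bsub>G Mod N\<^esub>"
      unfolding x(2) by (simp only: N.FactGroup_pow[OF x(1)])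
    then have "Q.ord z dvd p ^ k"
      using Q.pow_eq_id[OF zc] by blast
    moreover have "coprime (q ^ a) (p ^ k)"
      using primes_coprime[OF q(1) p \<open>q \<noteq> p\<close>] by simp
    ultimately have "Q.ord z dvd 1"
      using qa by (meson coprime_common_divisor)
    then show False
      using Q.ord_eq_1[OF zc] z(2) by simp
  qed
  then show ?thesis
    using m(1) by (metis mult.right_neutral)
qed

context pro_p_group
begin

lemma pow_in_open_normal:
  assumes N: "N \<lhd> G" "openin T N" and x: "x \<in> carrier G"
  shows "\<exists>k. x [^] (p ^ k) \<in> N"
proof -
  interpret N: normal N G
    by (rule N)
  interpret Q: group "G Mod N"
    by (rule N.factorgroup_is_group)
  obtain k where k: "card (rcosets N) = p ^ k"
    using p_power_index[OF N] by blast
  have xc: "N #> x \<in> carrier (G Mod N)"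
    using x unfolding carrier_FactGroup by blast
  have "(N #> x) [^]\<^bsub>G Mod N\<^esub> order (G Mod N) = \<one>\<^bsub>G Mod N\<^esub>"
    by (rule Q.pow_order_eq_1[OF xc])
  moreover have "order (G Mod N) = p ^ k"
    using k by (simp add: order_def FactGroup_def)
  ultimately have "N #> (x [^] (p ^ k)) = N"
    using N.FactGroup_pow[OF x] by simp
  then have "x [^] (p ^ k) \<in> N"
    using coset_join1[OF _ _ N.subgroup_axioms] x by simp
  then show ?thesis ..
qed

lemma open_normal_base:
  assumes "openin T U" "\<one> \<in> U"
  obtains N where "N \<lhd> G" "openin T N" "N \<subseteq> U"
proof -
  obtain V where V: "subgroup V G" "openin T V" "V \<subseteq> U"
    using open_subgroups_base[OF assms] by blast
  obtain N where N: "N \<lhd> G" "openin T N" "N \<subseteq> V"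
    by (rule open_normal_core[OF compact V(1,2)])
  show ?thesis
    by (rule that[OF N(1,2) subset_trans[OF N(3) V(3)]])
qed

text \<open>An open normal subgroup of \<open>L\<close> need not be the trace of a normal subgroup
  of \<open>G\<close>, so its index is not read off from \<open>G\<close>. Instead some open normal
  \<open>K\<close> of \<open>G\<close> meets \<open>L\<close> inside it, every element has a
  \<open>p\<close>-power power in \<open>K\<close>, and \<open>index_prime_power\<close>
  applies.\<close>

lemma closed_subgroup_pro_p:
  assumes L: "subgroup L G" "closedin T L"
  shows "pro_p_group p (G\<lparr>carrier := L\<rparr>) (subtopology T L)"
proof -
  interpret L: topological_group "G\<lparr>carrier := L\<rparr>" "subtopology T L"
    by (rule topological_group_subgroup[OF L(1)])
  have comp: "compact_space (subtopology T L)"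
    using closedin_compact_space[OF compact L(2)] by (rule compact_space_subtopology)
  show ?thesis
  proof unfold_locales
    show "Factorial_Ring.prime p"
      by (rule prime)
    show "compact_space (subtopology T L)"
      by (rule comp)
    show "Hausdorff_space (subtopology T L)"
      using Hausdorff by (rule Hausdorff_space_subtopology)
    show "\<exists>N. subgroup N (G\<lparr>carrier := L\<rparr>) \<and> openin (subtopology T L) N \<and> N \<subseteq> U"
      if U: "openin (subtopology T L) U" "\<one>\<^bsub>G\<lparr>carrier := L\<rparr>\<^esub> \<in> U" for U
    proof -
      obtain V where V: "openin T V" "U = V \<inter> L"
        using U(1) unfolding openin_subtopology by blast
      then obtain N where N: "subgroup N G" "openin T N" "N \<subseteq> V"
        using open_subgroups_base[of V] U(2) by auto
      have "subgroup (N \<inter> L) G"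
        by (rule subgroups_Inter_pair[OF N(1) L(1)])
      then have "subgroup (N \<inter> L) (G\<lparr>carrier := L\<rparr>)"
        by (rule subgroup_incl[OF _ L(1)]) simp
      then show ?thesis
        using N V unfolding openin_subtopology by blast
    qed
    fix N assume N: "N \<lhd> G\<lparr>carrier := L\<rparr>" "openin (subtopology T L) N"
    obtain V where V: "openin T V" "N = V \<inter> L"
      using N(2) unfolding openin_subtopology by blast
    have Nsub: "subgroup N (G\<lparr>carrier := L\<rparr>)"
      using N(1) by (rule normal_imp_subgroup)
    have "\<one> \<in> V"
      using subgroup.one_closed[OF Nsub] V(2) by simp
    obtain K where K: "K \<lhd> G" "openin T K" "K \<subseteq> V"
      by (rule open_normal_base[OF V(1) \<open>\<one> \<in> V\<close>])
    show "\<exists>k. card (rcosets\<^bsub>G\<lparr>carrier := L\<rparr>\<^esub> N) = p ^ k"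
    proof (rule L.index_prime_power[OF prime N(1)])
      show "finite (rcosets\<^bsub>G\<lparr>carrier := L\<rparr>\<^esub> N)"
        by (rule L.finite_rcosets_open[OF comp Nsub N(2)])
      fix x assume "x \<in> carrier (G\<lparr>carrier := L\<rparr>)"
      then have x: "x \<in> L" "x \<in> carrier G"
        using subgroup.mem_carrier[OF L(1)] by auto
      obtain k where k: "x [^] (p ^ k) \<in> K"
        using pow_in_open_normal[OF K(1,2) x(2)] by blast
      have "x [^]\<^bsub>G\<lparr>carrier := L\<rparr>\<^esub> (p ^ k) \<in> L"
        using L.nat_pow_closed[of x "p ^ k"] x(1) by simp
      then show "\<exists>k. x [^]\<^bsub>G\<lparr>carrier := L\<rparr>\<^esub> (p ^ k) \<in> N"
        using k K(3) V(2) unfolding nat_pow_consistent[symmetric] by blast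
    qed
  qed
qed

text \<open>A point \<open>g\<close> outside the closure has a coset \<open>N #> g\<close> disjoint
  from \<open>L\<close> for some open normal \<open>N\<close>. In the finite \<open>p\<close>-group
  \<open>G Mod N\<close> the image of \<open>L\<close> is still proper, and \<open>M\<close> is the
  preimage of a Frattini overgroup there. Density questions thus reduce to an open subgroup with
  elementary abelian quotient.\<close>

lemma nondense_frattini:
  assumes L: "subgroup L G" and nd: "T closure_of L \<noteq> carrier G"
  obtains M where "subgroup M G" "openin T M" "L \<subseteq> M" "M \<noteq> carrier G"
    "\<forall>x\<in>carrier G. \<forall>y\<in>carrier G. x \<otimes> y \<otimes> inv x \<otimes> inv y \<in> M"
    "\<forall>x\<in>carrier G. x [^] p \<in> M"
proof -
  obtain g where g: "g \<in> carrier G" "g \<notin> T closure_of L"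
    using nd closure_of_subset_topspace[of T L] topspace_eq by blast
  then obtain U where U: "g \<in> U" "openin T U" "U \<inter> L = {}"
    unfolding in_closure_of topspace_eq by blast
  obtain N where N: "N \<lhd> G" "openin T N" "N \<subseteq> {x \<in> carrier G. x \<otimes> g \<in> U}"
  proof (rule open_normal_base)
    show "openin T {x \<in> carrier G. x \<otimes> g \<in> U}"
      by (rule openin_translate(2)[OF U(2) g(1)])
    show "\<one> \<in> {x \<in> carrier G. x \<otimes> g \<in> U}"
      using g(1) U(1) by simp
  qed
  interpret N: normal N G
    by (rule N)
  interpret Q: group "G Mod N"
    by (rule N.factorgroup_is_group)
  have hom: "(#>) N \<in> hom G (G Mod N)"
    by (rule N.r_coset_hom_Mod)
  interpret h: group_hom G "G Mod N" "(#>) N"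
    by unfold_locales (rule hom)
  obtain k where "card (rcosets N) = p ^ k"
    using p_power_index[OF N(1,2)] by blast
  then have ord: "order (G Mod N) = p ^ k"
    by (simp add: order_def FactGroup_def)
  let ?L = "(#>) N ` L"
  have L': "subgroup ?L (G Mod N)"
    by (rule h.subgroup_img_is_subgroup[OF L])
  have gQ: "N #> g \<in> carrier (G Mod N)"
    using g(1) by (rule h.hom_closed)
  have "N #> g \<notin> ?L"
  proof
    assume "N #> g \<in> ?L"
    then obtain l where l: "l \<in> L" "N #> g = N #> l"
      by blast
    then have "l \<in> N #> g"
      using rcos_self[OF _ N.subgroup_axioms, of l] subgroup.mem_carrier[OF L] by simp
    then obtain n where "n \<in> N" "l = n \<otimes> g"
      unfolding r_coset_def by blast
    then show False
      using N(3) U(3) l(1) by blast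
  qed
  then have nL: "?L \<noteq> carrier (G Mod N)"
    using gQ by blast
  obtain M where M: "subgroup M (G Mod N)" "?L \<subseteq> M" "M \<noteq> carrier (G Mod N)"
    and comm: "\<forall>x\<in>carrier (G Mod N). \<forall>y\<in>carrier (G Mod N).
      x \<otimes>\<^bsub>G Mod N\<^esub> y \<otimes>\<^bsub>G Mod N\<^esub> inv\<^bsub>G Mod N\<^esub> x \<otimes>\<^bsub>G Mod N\<^esub> inv\<^bsub>G Mod N\<^esub> y \<in> M"
    and pow: "\<forall>x\<in>carrier (G Mod N). x [^]\<^bsub>G Mod N\<^esub> p \<in> M"
    by (rule Q.frattini_overgroup[OF prime ord L' nL])
  let ?M = "{x \<in> carrier G. N #> x \<in> M}"
  have subM: "subgroup ?M G"
  proof (rule subgroupI)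
    show "?M \<noteq> {}"
      using subgroup.one_closed[OF M(1)] h.hom_one one_closed by force
    fix a assume a: "a \<in> ?M"
    then show "inv a \<in> ?M"
      using subgroup.m_inv_closed[OF M(1)] by (simp only: mem_Collect_eq h.hom_inv inv_closed)
    fix b assume "b \<in> ?M"
    then show "a \<otimes> b \<in> ?M"
      using a subgroup.m_closed[OF M(1)] by (simp only: mem_Collect_eq h.hom_mult m_closed)
  qed blast
  have "N \<subseteq> ?M"
  proof
    fix x assume x: "x \<in> N"
    have xc: "x \<in> carrier G"
      using x by (rule N.mem_carrier)
    have "N #> x = \<one>\<^bsub>G Mod N\<^esub>"
      using coset_join2[OF xc N.subgroup_axioms x] by simp
    then show "x \<in> ?M"
      using xc subgroup.one_closed[OF M(1)] by (simp only: mem_Collect_eq)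
  qed
  then have "openin T ?M"
    by (rule openin_subgroup_superset[OF N.subgroup_axioms N(2) subM])
  moreover have "L \<subseteq> ?M"
    using M(2) subgroup.subset[OF L] by blast
  moreover have "?M \<noteq> carrier G"
  proof
    assume "?M = carrier G"
    then have "carrier (G Mod N) \<subseteq> M"
      unfolding carrier_FactGroup by blast
    then show False
      using M(3) subgroup.subset[OF M(1)] by blast
  qed
  moreover have "x \<otimes> y \<otimes> inv x \<otimes> inv y \<in> ?M" if "x \<in> carrier G" "y \<in> carrier G" for x y
    using bspec[OF bspec[OF comm h.hom_closed[OF that(1)]] h.hom_closed[OF that(2)]] that
    by (simp only: mem_Collect_eq h.hom_mult h.hom_inv m_closed inv_closed)
  moreover have "x [^] p \<in> ?M" if "x \<in> carrier G" for x
    using bspec[OF pow h.hom_closed[OF that]] that by (simp only: mem_Collect_eq h.hom_nat_pow nat_pow_closed)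
  ultimately show ?thesis
    using subM by (intro that[of ?M]) blast+
qed

end

section \<open>Free pro-\<open>p\<close> groups\<close>

lemma discrete_finite_pro_p:
  assumes p: "Factorial_Ring.prime p" and P: "group P" and ord: "order P = p ^ k"
  shows "pro_p_group p P (discrete_topology (carrier P))"
proof -
  interpret P: group P
    by (rule P)
  have fin: "finite (carrier P)"
    using ord p by (metis card.infinite not_prime_0 order_def power_eq_0_iff)
  show ?thesis
  proof unfold_locales
    show "continuous_map (prod_topology (discrete_topology (carrier P)) (discrete_topology (carrier P)))
        (discrete_topology (carrier P)) (\<lambda>(x, y). x \<otimes>\<^bsub>P\<^esub> y)"
      by (auto simp flip: prod_topology_discrete_topology)
    show "\<exists>N. subgroup N P \<and> openin (discrete_topology (carrier P)) N \<and> N \<subseteq> U"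
      if "openin (discrete_topology (carrier P)) U" "\<one>\<^bsub>P\<^esub> \<in> U" for U
      using that P.triv_subgroup by (intro exI[of _ "{\<one>\<^bsub>P\<^esub>}"]) auto
    show "\<exists>k. card (rcosets\<^bsub>P\<^esub> N) = p ^ k" if "N \<lhd> P" for N
    proof -
      have "card (rcosets\<^bsub>P\<^esub> N) * card N = p ^ k"
        using P.lagrange[OF normal_imp_subgroup[OF that]] ord by simp
      then have "card (rcosets\<^bsub>P\<^esub> N) dvd p ^ k"
        by (metis dvd_triv_left)
      then show ?thesis
        using divides_primepow_nat[OF p] by blast
    qed
  qed (use p fin in \<open>simp_all add: compact_space_discrete_topology\<close>)
qed

text \<open>A finite \<open>p\<close>-group of any type is transported into the type of the test groups by an injection into
  singletons of natural numbers.\<close>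
lemma free_hom_to_finite:
  fixes F :: "nat set monoid" and P :: "'c monoid"
  assumes free: "free_pro_p_group p F S B" and P: "group P" and ord: "order P = p ^ k"
    and f: "f \<in> B \<rightarrow> carrier P"
  obtains h where "h \<in> hom F P" "\<forall>x\<in>B. h x = f x" "\<forall>A. openin S {u \<in> carrier F. h u \<in> A}"
proof -
  interpret P: group P
    by (rule P)
  interpret F: pro_p_group p F S
    using free by (simp add: free_pro_p_group_def)
  have fin: "finite (carrier P)"
    using ord F.prime by (metis card.infinite not_prime_0 order_def power_eq_0_iff)
  obtain e0 :: "'c \<Rightarrow> nat" where e0: "inj_on e0 (carrier P)"
    using finite_imp_inj_to_nat_seg[OF fin] by blast
  define e where "e c = {e0 c}" for c
  have e: "inj_on e (carrier P)"
    using e0 by (auto simp: e_def inj_on_def)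
  define d where "d = inv_into (carrier P) e"
  have de: "d (e c) = c" if "c \<in> carrier P" for c
    using that e by (simp add: d_def)
  define P1 :: "nat set monoid" where
    "P1 = \<lparr>carrier = e ` carrier P, monoid.mult = (\<lambda>a b. e (d a \<otimes>\<^bsub>P\<^esub> d b)), one = e \<one>\<^bsub>P\<^esub>\<rparr>"
  have iso: "e \<in> iso P P1"
    using e by (auto simp: iso_def hom_def P1_def de bij_betw_def)
  have "group (P1\<lparr>one := e \<one>\<^bsub>P\<^esub>\<rparr>)"
    by (rule P.iso_imp_img_group[OF iso])
  then have grp1: "group P1"
    by (simp add: P1_def)
  have "order P1 = p ^ k"
    using ord e by (simp add: order_def P1_def card_image)
  then have "pro_p_group p P1 (discrete_topology (carrier P1))"
    by (rule discrete_finite_pro_p[OF F.prime grp1])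
  moreover have "(\<lambda>x. e (f x)) \<in> B \<rightarrow> carrier P1"
    using f by (auto simp: P1_def)
  ultimately obtain h where h: "h \<in> hom F P1" "continuous_map S (discrete_topology (carrier P1)) h"
    "\<forall>x\<in>B. h x = e (f x)"
    using free unfolding free_pro_p_group_def by blast
  have hc: "h u \<in> e ` carrier P" if "u \<in> carrier F" for u
    using h(1) that by (auto simp: hom_def P1_def)
  show ?thesis
  proof (rule that)
    show "(\<lambda>u. d (h u)) \<in> hom F P"
    proof (rule homI)
      fix u v assume uv: "u \<in> carrier F" "v \<in> carrier F"
      show "d (h u) \<in> carrier P"
        using hc[OF uv(1)] de by auto
      have "h (u \<otimes>\<^bsub>F\<^esub> v) = e (d (h u) \<otimes>\<^bsub>P\<^esub> d (h v))"
        using h(1) uv by (simp add: hom_def P1_def)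
      moreover have "d (h u) \<in> carrier P" "d (h v) \<in> carrier P"
        using hc[OF uv(1)] hc[OF uv(2)] de by auto
      ultimately show "d (h (u \<otimes>\<^bsub>F\<^esub> v)) = d (h u) \<otimes>\<^bsub>P\<^esub> d (h v)"
        by (simp add: de)
    qed
    show "\<forall>x\<in>B. d (h x) = f x"
      using h(3) f de by (auto simp: Pi_iff)
    show "\<forall>A. openin S {u \<in> carrier F. d (h u) \<in> A}"
    proof
      fix A
      have "openin S {u \<in> topspace S. h u \<in> {c \<in> carrier P1. d c \<in> A}}"
        by (rule openin_continuous_map_preimage[OF h(2)]) auto
      moreover have "{u \<in> topspace S. h u \<in> {c \<in> carrier P1. d c \<in> A}} = {u \<in> carrier F. d (h u) \<in> A}"
        using h(1) by (auto simp: F.topspace_eq hom_def)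
      ultimately show "openin S {u \<in> carrier F. d (h u) \<in> A}"
        by simp
    qed
  qed
qed

subsection \<open>The Magnus representation modulo words of length \<open>N\<close>\<close>

text \<open>The series with constant term 1 over the field with \<open>p\<close> elements modulo
  order \<open>N\<close>, on canonical representatives. For finite \<open>B\<close> this is a finite
  \<open>p\<close>-group, so it can serve as a target for the free group.\<close>

definition unip :: "nat \<Rightarrow> 'x set \<Rightarrow> nat \<Rightarrow> 'x ncs monoid" where
  "unip p B N = \<lparr>carrier = {a \<in> trunc_set p B N. ncs_nth a [] = 1},
     monoid.mult = (\<lambda>a b. ncs_trunc p B N (a * b)), one = 1\<rparr>"

lemma trunc_trunc_set: "a \<in> trunc_set p B N \<Longrightarrow> ncs_trunc p B N a = a"
  by (auto simp: trunc_set_def intro!: ncs_eqI) (simp add: ncs_nth_trunc)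

lemma in_low_one: "a \<in> low p B 1 \<longleftrightarrow> int p dvd ncs_nth a []"
  by (auto simp: low_def)

lemma geometric_left: "a * (\<Sum>k<n. (1 - a) ^ k) = 1 - (1 - a :: 'a::ring_1) ^ n"
  by (induction n) (simp_all add: algebra_simps)

lemma power_sum_right: "(\<Sum>k<n. b ^ k) * b = b * (\<Sum>k<n. (b::'a::ring_1) ^ k)"
  by (simp add: sum_distrib_left sum_distrib_right power_commutes)

lemma geometric_right: "(\<Sum>k<n. (1 - a) ^ k) * a = 1 - (1 - a :: 'a::ring_1) ^ n"
  using power_sum_right[of "1 - a" n] geometric_left[of a n] by (simp add: algebra_simps)

lemma trunc_unip_closed:
  assumes "p > 1" "N > 0" "int p dvd ncs_nth a [] - 1"
  shows "ncs_trunc p B N a \<in> carrier (unip p B N)"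
proof -
  have "ncs_nth a [] mod int p = 1 mod int p"
    using assms(3) by (simp add: mod_eq_dvd_iff)
  then show ?thesis
    using assms(1,2) by (simp add: unip_def trunc_set_def ncs_nth_trunc)
qed

lemma group_unip:
  fixes p N :: nat and B :: "'x set"
  assumes p: "p > 1" and N: "N > 0"
  shows "group (unip p B N)"
proof -
  let ?t = "ncs_trunc p B N"
  have t: "?t a - a \<in> low p B N" for a
    using trunc_diff by (rule low.diff_commute)
  have mult: "?t (?t a * ?t b) = ?t (a * b)" for a b
    by (simp add: trunc_eq_iff low.mult_cong t)
  have carD: "?t a = a" "ncs_nth a [] = 1" if "a \<in> carrier (unip p B N)" for a
    using that by (simp_all add: unip_def trunc_trunc_set)
  show ?thesis
  proof (rule groupI)
    fix a b c assume a: "a \<in> carrier (unip p B N)" and b: "b \<in> carrier (unip p B N)" and c: "c \<in> carrier (unip p B N)"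
    have "?t (a * b) \<in> carrier (unip p B N)"
      by (rule trunc_unip_closed[OF p N]) (simp add: carD[OF a] carD[OF b])
    then show "a \<otimes>\<^bsub>unip p B N\<^esub> b \<in> carrier (unip p B N)"
      by (simp add: unip_def)
    have "?t (?t (a * b) * c) = ?t (a * ?t (b * c))"
      using mult[of "a * b" c] mult[of a "b * c"] carD[OF a] carD[OF c] by (simp add: mult.assoc)
    then show "a \<otimes>\<^bsub>unip p B N\<^esub> b \<otimes>\<^bsub>unip p B N\<^esub> c = a \<otimes>\<^bsub>unip p B N\<^esub> (b \<otimes>\<^bsub>unip p B N\<^esub> c)"
      by (simp add: unip_def)
  next
    have "?t 1 = 1"
      using p N by (intro ncs_eqI) (simp add: ncs_nth_trunc)
    then show "\<one>\<^bsub>unip p B N\<^esub> \<in> carrier (unip p B N)"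
      using trunc_unip_closed[OF p N, of 1 B] by (simp add: unip_def)
    fix a assume a: "a \<in> carrier (unip p B N)"
    then show "\<one>\<^bsub>unip p B N\<^esub> \<otimes>\<^bsub>unip p B N\<^esub> a = a"
      using carD[OF a] by (simp add: unip_def)
    \<comment> \<open>The geometric series in \<open>1 - a\<close> stops at \<open>N\<close>,
      because \<open>1 - a\<close> has order at least one.\<close>
    let ?s = "\<Sum>k<N. (1 - a) ^ k"
    have a1: "1 - a \<in> low p B 1"
      unfolding in_low_one using carD(2)[OF a] by simp
    have "(1 - a) ^ N \<in> low p B N"
      using low.power[OF a1, of N] by simp
    then have inv: "?t (?s * a) = 1"
      using \<open>?t 1 = 1\<close> trunc_eq_iff[of p B N "?s * a" 1] low.uminus by (simp add: geometric_right)
    have "ncs_nth ?s [] * 1 = ncs_nth (?s * a) []"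
      using carD(2)[OF a] by simp
    also have "?s * a = 1 - (1 - a) ^ N"
      by (rule geometric_right)
    also have "ncs_nth (1 - (1 - a) ^ N) [] = 1"
    proof -
      have "ncs_nth ((1 - a) ^ N) [] = 0"
        using N carD(2)[OF a] by (cases N) auto
      then show ?thesis by simp
    qed
    finally have "?t ?s \<in> carrier (unip p B N)"
      by (intro trunc_unip_closed[OF p N]) simp
    moreover have "?t (?t ?s * a) = 1"
      using mult[of ?s a] carD(1)[OF a] inv by simp
    ultimately show "\<exists>y\<in>carrier (unip p B N). y \<otimes>\<^bsub>unip p B N\<^esub> a = \<one>\<^bsub>unip p B N\<^esub>"
      by (intro bexI[of _ "?t ?s"]) (simp_all add: unip_def)
  qed
qed

text \<open>The constant coefficient is fixed, and every other one takes \<open>p\<close> values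
  independently.\<close>

lemma order_unip:
  fixes p N :: nat and B :: "'x set"
  assumes p: "p > 1" and N: "N > 0" and B: "finite B"
  shows "\<exists>k. order (unip p B N) = p ^ k"
proof -
  define W where "W = {w. set w \<subseteq> B \<and> length w < N}"
  have finW: "finite W"
    unfolding W_def by (rule finite_words[OF B])
  let ?r = "\<lambda>a. restrict (ncs_nth a) W"
  let ?A = "\<lambda>w. if w = [] then {1} else {0..<int p}"
  have bij: "bij_betw ?r (trunc_set p B N) (W \<rightarrow>\<^sub>E {0..<int p})"
    using bij_betw_trunc_set[of p B N] p unfolding W_def by simp
  have Nil: "[] \<in> W"
    using N by (simp add: W_def)
  have "?r ` carrier (unip p B N) = PiE W ?A"
  proof (intro equalityI subsetI)
    fix f assume "f \<in> ?r ` carrier (unip p B N)"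
    then obtain a where a: "a \<in> trunc_set p B N" "ncs_nth a [] = 1" "f = ?r a"
      by (auto simp: unip_def)
    then have "f \<in> W \<rightarrow>\<^sub>E {0..<int p}"
      using bij_betw_apply[OF bij] by blast
    then show "f \<in> PiE W ?A"
      using a(2,3) by (auto simp: PiE_iff)
  next
    fix f assume f: "f \<in> PiE W ?A"
    have "f w \<in> {0..<int p}" if "w \<in> W" for w
      using PiE_mem[OF f that] p by (cases "w = []") auto
    then have "f \<in> W \<rightarrow>\<^sub>E {0..<int p}"
      using f by (auto simp: PiE_iff)
    then obtain a where a: "a \<in> trunc_set p B N" "f = ?r a"
      using bij unfolding bij_betw_def by blast
    have "ncs_nth a [] = 1"
      using PiE_mem[OF f Nil] a(2) Nil by simp
    then show "f \<in> ?r ` carrier (unip p B N)"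
      using a by (auto simp: unip_def)
  qed
  moreover have "inj_on ?r (carrier (unip p B N))"
    by (rule inj_on_subset[OF bij_betw_imp_inj_on[OF bij]]) (auto simp: unip_def)
  ultimately have "order (unip p B N) = card (PiE W ?A)"
    unfolding order_def by (metis card_image)
  also have "\<dots> = (\<Prod>w\<in>W. card (?A w))"
    by (rule card_PiE[OF finW])
  also have "\<dots> = (\<Prod>w\<in>W - {[]}. p)"
    using finW Nil by (simp add: prod.remove[of W "[]"])
  also have "\<dots> = p ^ card (W - {[]})"
    by simp
  finally show ?thesis ..
qed

text \<open>The group law of \<open>unip\<close> truncates, so \<open>h\<close> is multiplicative
  only modulo \<open>low p B N\<close>, and each \<open>N\<close> has its own \<open>h\<close>.
  Openness of all preimages expresses continuity for the discrete topology.\<close>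

lemma magnus_rep:
  fixes F :: "nat set monoid"
  assumes free: "free_pro_p_group p F S B" and N: "N > 0"
  obtains h where "\<forall>u\<in>carrier F. h u - 1 \<in> low p B 1" "h \<one>\<^bsub>F\<^esub> = 1"
    "\<forall>u\<in>carrier F. \<forall>v\<in>carrier F. h (u \<otimes>\<^bsub>F\<^esub> v) - h u * h v \<in> low p B N"
    "\<forall>x\<in>B. h x - (1 + ncs_X x) \<in> low p B N"
    "\<forall>A. openin S {u \<in> carrier F. h u \<in> A}"
proof -
  interpret F: pro_p_group p F S
    using free by (simp add: free_pro_p_group_def)
  have p: "p > 1"
    using F.prime by (rule prime_gt_1_nat)
  have B: "finite B"
    using free by (simp add: free_pro_p_group_def)
  obtain k where k: "order (unip p B N) = p ^ k"
    using order_unip[OF p N B] by blast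
  have "(\<lambda>x. ncs_trunc p B N (1 + ncs_X x)) \<in> B \<rightarrow> carrier (unip p B N)"
    by (intro Pi_I trunc_unip_closed[OF p N]) (simp add: ncs_nth_X)
  then obtain h where h: "h \<in> hom F (unip p B N)" "\<forall>x\<in>B. h x = ncs_trunc p B N (1 + ncs_X x)"
    "\<forall>A. openin S {u \<in> carrier F. h u \<in> A}"
    by (rule free_hom_to_finite[OF free group_unip[OF p N] k])
  show ?thesis
  proof (rule that[OF _ _ _ _ h(3)])
    show "h \<one>\<^bsub>F\<^esub> = 1"
      using hom_one[OF h(1) F.group_axioms group_unip[OF p N]] by (simp add: unip_def)
    show "\<forall>u\<in>carrier F. h u - 1 \<in> low p B 1"
    proof
      fix u assume "u \<in> carrier F"
      then have "ncs_nth (h u) [] = 1"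
        using hom_in_carrier[OF h(1)] by (simp add: unip_def)
      then show "h u - 1 \<in> low p B 1"
        unfolding in_low_one by simp
    qed
    show "\<forall>u\<in>carrier F. \<forall>v\<in>carrier F. h (u \<otimes>\<^bsub>F\<^esub> v) - h u * h v \<in> low p B N"
      using h(1) trunc_diff low.diff_commute by (fastforce simp: hom_def unip_def)
    show "\<forall>x\<in>B. h x - (1 + ncs_X x) \<in> low p B N"
      using h(2) trunc_diff low.diff_commute by fastforce
  qed
qed

subsection \<open>Closed subgroups of free pro-\<open>p\<close> groups\<close>

text \<open>The inclusion of \<open>B\<close> into \<open>K\<close> extends to a map from
  \<open>F\<close> to \<open>K\<close>. Viewed as an endomorphism of \<open>F\<close> it agrees with
  the identity on \<open>B\<close>, so it is the identity by uniqueness, and its values lie in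
  \<open>K\<close>.\<close>

lemma free_generates:
  fixes F :: "'f monoid"
  assumes free: "free_pro_p_group p F S B" and K: "subgroup K F" "closedin S K" and BK: "B \<subseteq> K"
  shows "K = carrier F"
proof -
  interpret F: pro_p_group p F S
    using free by (simp add: free_pro_p_group_def)
  have univ: "\<exists>!h. h \<in> hom F H \<inter> extensional (carrier F) \<and> continuous_map S T_H h \<and> (\<forall>x\<in>B. h x = f x)"
    if "pro_p_group p H T_H" "f \<in> B \<rightarrow> carrier H" for H :: "'f monoid" and T_H f
    using free that unfolding free_pro_p_group_def by blast
  have Kc: "K \<subseteq> carrier F"
    using K(1) by (rule subgroup.subset)
  have "pro_p_group p (F\<lparr>carrier := K\<rparr>) (subtopology S K)"
    by (rule F.closed_subgroup_pro_p[OF K])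
  moreover have "(\<lambda>x. x) \<in> B \<rightarrow> carrier (F\<lparr>carrier := K\<rparr>)"
    using BK by auto
  ultimately obtain h where h: "h \<in> hom F (F\<lparr>carrier := K\<rparr>)" "h \<in> extensional (carrier F)"
    "continuous_map S (subtopology S K) h" "\<forall>x\<in>B. h x = x"
    using ex1_implies_ex[OF univ[of "F\<lparr>carrier := K\<rparr>" "subtopology S K" "\<lambda>x. x"]] by blast
  have hK: "h u \<in> K" if "u \<in> carrier F" for u
    using h(1) that by (auto simp: hom_def)
  have "h = restrict (\<lambda>x. x) (carrier F)"
  proof (rule ex1E[OF univ[OF F.pro_p_group_axioms, of "\<lambda>x. x"]])
    show "(\<lambda>x. x) \<in> B \<rightarrow> carrier F"
      using BK Kc by blast
    fix h0 assume uniq: "\<forall>h'. h' \<in> hom F F \<inter> extensional (carrier F) \<and> continuous_map S S h' \<and> (\<forall>x\<in>B. h' x = x)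
      \<longrightarrow> h' = h0"
    have "h \<in> hom F F"
      using h(1) Kc by (auto simp: hom_def)
    moreover have "continuous_map S S h"
      using h(3) by (rule continuous_map_into_fulltopology)
    ultimately have "h = h0"
      using uniq h(2,4) by blast
    moreover have "restrict (\<lambda>x. x) (carrier F) = h0"
    proof -
      have "restrict (\<lambda>x. x) (carrier F) \<in> hom F F"
        by (auto simp: hom_def)
      moreover have "continuous_map S S (restrict (\<lambda>x. x) (carrier F))"
        by (rule continuous_map_eq[OF continuous_map_id]) (simp add: F.topspace_eq)
      moreover have "\<forall>x\<in>B. restrict (\<lambda>x. x) (carrier F) x = x"
        using BK Kc by auto
      ultimately show ?thesis
        using uniq by auto
    qed
    ultimately show "h = restrict (\<lambda>x. x) (carrier F)"
      by simp
  qed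
  then have "u \<in> K" if "u \<in> carrier F" for u
    using hK[OF that] that by simp
  then show ?thesis
    using Kc by blast
qed

text \<open>The uniqueness clause of \<open>free_pro_p_group\<close> speaks only of test groups in
  the type of \<open>F\<close>. Through the equalizer it carries over to Hausdorff targets of any
  type, as needed for maps into \<open>G\<close>.\<close>

lemma free_hom_eqI:
  fixes F :: "'f monoid"
  assumes free: "free_pro_p_group p F S B" and H: "group H" and "Hausdorff_space T"
    and f: "f \<in> hom F H" "continuous_map S T f" and g: "g \<in> hom F H" "continuous_map S T g"
    and eq: "\<And>x. x \<in> B \<Longrightarrow> f x = g x" and u: "u \<in> carrier F"
  shows "f u = g u"
proof -
  interpret F: pro_p_group p F S
    using free by (simp add: free_pro_p_group_def)
  note E = closed_subgroup_equalizer[OF F.group_axioms H F.topspace_eq f g \<open>Hausdorff_space T\<close>]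
  have "B \<subseteq> carrier F"
    using free by (simp add: free_pro_p_group_def)
  then have "{x \<in> carrier F. f x = g x} = carrier F"
    using eq by (intro free_generates[OF free E]) auto
  then show ?thesis
    using u by blast
qed

definition closed_hull :: "('a, 'm) monoid_scheme \<Rightarrow> 'a topology \<Rightarrow> 'a set \<Rightarrow> 'a set" where
  "closed_hull G T A = \<Inter> {K. subgroup K G \<and> closedin T K \<and> A \<subseteq> K}"

lemma closed_hull_minimal: "subgroup K G \<Longrightarrow> closedin T K \<Longrightarrow> A \<subseteq> K \<Longrightarrow> closed_hull G T A \<subseteq> K"
  by (auto simp: closed_hull_def)

lemma (in topological_group) closed_hull:
  assumes "A \<subseteq> carrier G"
  shows "subgroup (closed_hull G T A) G" "closedin T (closed_hull G T A)" "A \<subseteq> closed_hull G T A"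
proof -
  have top: "carrier G \<in> {K. subgroup K G \<and> closedin T K \<and> A \<subseteq> K}"
    using assms subgroup_self closedin_topspace[of T] by (simp add: topspace_eq)
  show "subgroup (closed_hull G T A) G"
    unfolding closed_hull_def using top by (intro subgroups_Inter) blast+
  show "closedin T (closed_hull G T A)"
    unfolding closed_hull_def using top by (intro closedin_Inter) blast+
  show "A \<subseteq> closed_hull G T A"
    by (auto simp: closed_hull_def)
qed

text \<open>A map on \<open>C\<close> is extended by the unit to the rest of \<open>B\<close>, and
  the resulting homomorphism is restricted to \<open>L\<close>. For uniqueness, the equalizer inside
  \<open>L\<close> is also closed in \<open>F\<close>, hence contains the closed hull of
  \<open>C\<close>.\<close>

lemma free_subbasis:
  fixes F :: "'f monoid"
  assumes free: "free_pro_p_group p F S B" and C: "C \<subseteq> B"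
  defines "L \<equiv> closed_hull F S C"
  shows "free_pro_p_group p (F\<lparr>carrier := L\<rparr>) (subtopology S L) C"
proof -
  interpret F: pro_p_group p F S
    using free by (simp add: free_pro_p_group_def)
  have B: "finite B" "B \<subseteq> carrier F"
    using free by (simp_all add: free_pro_p_group_def)
  have Cc: "C \<subseteq> carrier F"
    using B(2) C by blast
  have L: "subgroup L F" "closedin S L" "C \<subseteq> L"
    unfolding L_def by (rule F.closed_hull[OF Cc])+
  have Lc: "L \<subseteq> carrier F"
    using L(1) by (rule subgroup.subset)
  interpret L: pro_p_group p "F\<lparr>carrier := L\<rparr>" "subtopology S L"
    by (rule F.closed_subgroup_pro_p[OF L(1,2)])
  have "\<exists>!h. h \<in> hom (F\<lparr>carrier := L\<rparr>) H \<inter> extensional (carrier (F\<lparr>carrier := L\<rparr>)) \<and>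
      continuous_map (subtopology S L) T_H h \<and> (\<forall>x\<in>C. h x = f x)"
    if H: "pro_p_group p H T_H" and f: "f \<in> C \<rightarrow> carrier H" for H :: "'f monoid" and T_H f
  proof -
    interpret H: pro_p_group p H T_H
      by (rule H)
    let ?f = "\<lambda>x. if x \<in> C then f x else \<one>\<^bsub>H\<^esub>"
    have "?f \<in> B \<rightarrow> carrier H"
      using f by auto
    then obtain h where h: "h \<in> hom F H" "continuous_map S T_H h" "\<forall>x\<in>B. h x = ?f x"
      using free H unfolding free_pro_p_group_def by blast
    show ?thesis
    proof (rule ex1I[of _ "restrict h L"], safe)
      show "restrict h L \<in> hom (F\<lparr>carrier := L\<rparr>) H"
      proof (rule homI)
        fix x y assume xy: "x \<in> carrier (F\<lparr>carrier := L\<rparr>)" "y \<in> carrier (F\<lparr>carrier := L\<rparr>)"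
        then have "x \<in> carrier F" "y \<in> carrier F" "x \<otimes>\<^bsub>F\<^esub> y \<in> L"
          using Lc subgroup.m_closed[OF L(1)] by auto
        then show "restrict h L x \<in> carrier H"
          "restrict h L (x \<otimes>\<^bsub>F\<lparr>carrier := L\<rparr>\<^esub> y) = restrict h L x \<otimes>\<^bsub>H\<^esub> restrict h L y"
          using h(1) xy by (auto simp: hom_def)
      qed
      have "continuous_map (subtopology S L) T_H h"
        using h(2) by (rule continuous_map_from_subtopology)
      then show "continuous_map (subtopology S L) T_H (restrict h L)"
        by (rule continuous_map_eq) (simp add: F.topspace_eq)
      show "restrict h L x = f x" if "x \<in> C" for x
        using h(3) that C L(3) by auto
    next
      fix g assume g: "g \<in> hom (F\<lparr>carrier := L\<rparr>) H" "g \<in> extensional (carrier (F\<lparr>carrier := L\<rparr>))"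
        "continuous_map (subtopology S L) T_H g" "\<forall>x\<in>C. g x = f x"
      have hL: "h \<in> hom (F\<lparr>carrier := L\<rparr>) H"
        using h(1) Lc by (auto simp: hom_def)
      have hcont: "continuous_map (subtopology S L) T_H h"
        using h(2) by (rule continuous_map_from_subtopology)
      note E = closed_subgroup_equalizer[OF L.group_axioms H.group_axioms L.topspace_eq g(1,3) hL hcont H.Hausdorff]
      let ?E = "{x \<in> carrier (F\<lparr>carrier := L\<rparr>). g x = h x}"
      have "subgroup ?E F"
        using F.incl_subgroup[OF L(1)] E(1) by blast
      moreover have "closedin S ?E"
        using E(2) L(2) closedin_trans_full by blast
      moreover have "C \<subseteq> ?E"
        using g(4) h(3) C L(3) by auto
      ultimately have "L \<subseteq> ?E"
        unfolding L_def by (rule closed_hull_minimal)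
      then show "g = restrict h L"
        using g(2) by (auto simp: fun_eq_iff extensional_def)
    qed simp
  qed
  then show ?thesis
    using L.pro_p_group_axioms finite_subset[OF C B(1)] L(3) unfolding free_pro_p_group_def by auto
qed

section \<open>Presentations\<close>

locale presentation = pro_p_group p G T
  for p and G (structure) and T +
  fixes F :: "nat set monoid" and S B R \<pi>
  assumes free: "free_pro_p_group p F S B"
    and rels: "R \<subseteq> carrier F" "finite R"
    and pi_hom: "\<pi> \<in> hom F G" and pi_cont: "continuous_map S T \<pi>" and pi_surj: "\<pi> ` carrier F = carrier G"
    and pi_ker: "kernel F G \<pi> = closed_normal_closure F S R"
begin

sublocale F: pro_p_group p F S
  using free by (simp add: free_pro_p_group_def)

sublocale pi: group_hom F G \<pi>
  by unfold_locales (rule pi_hom)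

lemma basis: "finite B" "B \<subseteq> carrier F"
  using free by (simp_all add: free_pro_p_group_def)

lemma kernel_minimal:
  assumes "N \<lhd> F" "closedin S N" "R \<subseteq> N"
  shows "kernel F G \<pi> \<subseteq> N"
  unfolding pi_ker closed_normal_closure_def by (rule hull_minimal) (use assms in auto)

lemma rels_in_kernel:
  assumes "r \<in> R"
  shows "r \<in> carrier F" "\<pi> r = \<one>"
proof -
  have "r \<in> kernel F G \<pi>"
    unfolding pi_ker closed_normal_closure_def using assms by (rule hull_inc)
  then show "r \<in> carrier F" "\<pi> r = \<one>"
    by (auto simp: kernel_def)
qed

lemma closedin_image:
  assumes "closedin S C"
  shows "closedin T (\<pi> ` C)"
proof -
  have "compactin S C"
    by (rule closedin_compact_space[OF F.compact assms])
  then have "compactin T (\<pi> ` C)"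
    by (rule image_compactin[OF _ pi_cont])
  then show ?thesis
    by (rule compactin_imp_closedin[OF Hausdorff])
qed

text \<open>\<open>D\<close> is saturated for \<open>\<pi>\<close>, so complements go to
  complements, and images of closed sets are closed by compactness.\<close>

lemma openin_image:
  assumes D: "subgroup D F" "openin S D" and ker: "kernel F G \<pi> \<subseteq> D"
  shows "openin T (\<pi> ` D)"
proof -
  have "\<pi> ` (carrier F - D) = carrier G - \<pi> ` D"
  proof (intro equalityI subsetI)
    fix g assume "g \<in> \<pi> ` (carrier F - D)"
    then obtain u where u: "u \<in> carrier F" "u \<notin> D" "g = \<pi> u"
      by blast
    have "g \<notin> \<pi> ` D"
    proof
      assume "g \<in> \<pi> ` D"
      then obtain v where v: "v \<in> D" "g = \<pi> v"
        by blast
      have vc: "v \<in> carrier F"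
        by (rule subgroup.mem_carrier[OF D(1) v(1)])
      have "inv\<^bsub>F\<^esub> v \<otimes>\<^bsub>F\<^esub> u \<in> kernel F G \<pi>"
        using u vc v(2) by (simp add: kernel_def)
      then have "inv\<^bsub>F\<^esub> v \<otimes>\<^bsub>F\<^esub> u \<in> D"
        using ker by blast
      then have "v \<otimes>\<^bsub>F\<^esub> (inv\<^bsub>F\<^esub> v \<otimes>\<^bsub>F\<^esub> u) \<in> D"
        by (rule subgroup.m_closed[OF D(1) v(1)])
      then show False
        using u vc by (simp add: F.m_assoc[symmetric])
    qed
    then show "g \<in> carrier G - \<pi> ` D"
      using u by simp
  next
    fix g assume g: "g \<in> carrier G - \<pi> ` D"
    then obtain u where "u \<in> carrier F" "g = \<pi> u"
      using pi_surj by (metis DiffD1 imageE)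
    then show "g \<in> \<pi> ` (carrier F - D)"
      using g by blast
  qed
  moreover have "closedin T (\<pi> ` (carrier F - D))"
    by (rule closedin_image) (use D(2) F.topspace_eq in \<open>metis closedin_diff closedin_topspace openin_closedin_eq
      openin_subset\<close>)
  ultimately have "closedin T (carrier G - \<pi> ` D)"
    by simp
  moreover have "\<pi> ` D \<subseteq> carrier G"
    using subgroup.subset[OF D(1)] by auto
  ultimately show ?thesis
    using openin_closedin[of "\<pi> ` D" T] by (simp add: topspace_eq)
qed

lemma preimage_subgroup:
  assumes M: "subgroup M G"
  shows "subgroup {u \<in> carrier F. \<pi> u \<in> M} F"
proof (rule F.subgroupI)
  show "{u \<in> carrier F. \<pi> u \<in> M} \<noteq> {}"
    using subgroup.one_closed[OF M] F.one_closed pi.hom_one by force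
qed (use subgroup.m_closed[OF M] subgroup.m_inv_closed[OF M] in auto)

lemma preimage_open:
  assumes "openin T M"
  shows "openin S {u \<in> carrier F. \<pi> u \<in> M}"
  using openin_continuous_map_preimage[OF pi_cont assms] by (simp add: F.topspace_eq)

text \<open>Otherwise the images of the basis lie in a proper open subgroup, whose preimage is
  closed and contains \<open>B\<close>, hence is all of \<open>F\<close>.\<close>

lemma basis_generates: "T closure_of (generate G (\<pi> ` B)) = carrier G"
proof (rule ccontr)
  assume nd: "\<not> ?thesis"
  have sub: "\<pi> ` B \<subseteq> carrier G"
    using basis(2) by auto
  obtain M where M: "subgroup M G" "openin T M" "generate G (\<pi> ` B) \<subseteq> M" "M \<noteq> carrier G"
    by (rule nondense_frattini[OF generate_is_subgroup[OF sub] nd])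
  have "{u \<in> carrier F. \<pi> u \<in> M} = carrier F"
  proof (rule free_generates[OF free preimage_subgroup[OF M(1)]])
    show "closedin S {u \<in> carrier F. \<pi> u \<in> M}"
      by (rule F.closedin_open_subgroup[OF preimage_subgroup[OF M(1)] preimage_open[OF M(2)]])
    show "B \<subseteq> {u \<in> carrier F. \<pi> u \<in> M}"
      using M(3) basis(2) generate.incl[of _ "\<pi> ` B" G] by blast
  qed
  then have "\<pi> u \<in> M" if "u \<in> carrier F" for u
    using that by blast
  then have "\<pi> ` carrier F \<subseteq> M"
    by (rule image_subsetI)
  then show False
    using M(4) subgroup.subset[OF M(1)] by (simp add: pi_surj)
qed

lemma has_presentation: "has_pro_p_presentation p G T (card B) (card R)"
  unfolding has_pro_p_presentation_def using free rels pi_hom pi_cont pi_surj pi_ker by blast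

end

lemma presentationE:
  assumes "has_pro_p_presentation p G T n m" "pro_p_group p G T"
  obtains F S B R \<pi> where "presentation p G T F S B R \<pi>" "card B = n" "card R = m"
  using assms unfolding has_pro_p_presentation_def presentation_def presentation_axioms_def by blast

lemma generator_rank_le:
  assumes "A \<subseteq> carrier G" "finite A" "T closure_of (generate G A) = carrier G"
  shows "generator_rank G T \<le> card A"
  unfolding generator_rank_def by (rule Least_le) (use assms in blast)

lemma generator_rank_attained:
  assumes "A \<subseteq> carrier G" "finite A" "T closure_of (generate G A) = carrier G"
  obtains A' where "A' \<subseteq> carrier G" "finite A'" "T closure_of (generate G A') = carrier G"
    "card A' = generator_rank G T"
proof -
  have "\<exists>n. \<exists>A\<subseteq>carrier G. finite A \<and> card A = n \<and> T closure_of (generate G A) = carrier G"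
    using assms by blast
  from LeastI_ex[OF this, folded generator_rank_def] show ?thesis
    using that by blast
qed

section \<open>Linear coefficients of the Magnus map\<close>

locale magnus = presentation +
  fixes N and h :: "nat set \<Rightarrow> nat set ncs"
  assumes N2: "N \<ge> 2"
    and h_aug: "u \<in> carrier F \<Longrightarrow> h u - 1 \<in> low p B 1"
    and h_one: "h \<one>\<^bsub>F\<^esub> = 1"
    and h_mult: "u \<in> carrier F \<Longrightarrow> v \<in> carrier F \<Longrightarrow> h (u \<otimes>\<^bsub>F\<^esub> v) - h u * h v \<in> low p B N"
    and h_gen: "x \<in> B \<Longrightarrow> h x - (1 + ncs_X x) \<in> low p B N"
    and h_open: "openin S {u \<in> carrier F. h u \<in> A}"
begin

text \<open>Modulo \<open>p\<close> a homomorphism for \<open>x \<in> B\<close>, the exponent sum of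
  \<open>x\<close>. Coefficients at words of length one survive truncation because
  \<open>N \<ge> 2\<close>.\<close>

definition lin :: "nat set \<Rightarrow> nat set \<Rightarrow> int" where
  "lin x u = ncs_nth (h u) [x]"

lemma h_Nil: "u \<in> carrier F \<Longrightarrow> int p dvd ncs_nth (h u) [] - 1"
  using h_aug by (simp add: low_def)

lemma lin_cong:
  assumes "a - b \<in> low p B N" "x \<in> B"
  shows "int p dvd ncs_nth a [x] - ncs_nth b [x]"
  using assms N2 by (auto simp: low_def dest!: spec[of _ "[x]"])

lemma lin_mult:
  assumes "u \<in> carrier F" "v \<in> carrier F" "x \<in> B"
  shows "int p dvd lin x (u \<otimes>\<^bsub>F\<^esub> v) - (lin x u + lin x v)"
proof -
  have "int p dvd lin x (u \<otimes>\<^bsub>F\<^esub> v) - (ncs_nth (h u) [] * lin x v + lin x u * ncs_nth (h v) [])"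
    using lin_cong[OF h_mult[OF assms(1,2)] assms(3)] by (simp add: lin_def ncs_nth_mult)
  moreover have "int p dvd (ncs_nth (h u) [] - 1) * lin x v + lin x u * (ncs_nth (h v) [] - 1)"
    using h_Nil assms by simp
  ultimately have "int p dvd lin x (u \<otimes>\<^bsub>F\<^esub> v) - (ncs_nth (h u) [] * lin x v + lin x u * ncs_nth (h v) [])
      + ((ncs_nth (h u) [] - 1) * lin x v + lin x u * (ncs_nth (h v) [] - 1))"
    by (rule dvd_add)
  then show ?thesis
    by (simp add: algebra_simps)
qed

lemma lin_one: "lin x \<one>\<^bsub>F\<^esub> = 0"
  by (simp add: lin_def h_one)

lemma lin_inv:
  assumes "u \<in> carrier F" "x \<in> B"
  shows "int p dvd lin x (inv\<^bsub>F\<^esub> u) + lin x u"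
proof -
  have "int p dvd lin x \<one>\<^bsub>F\<^esub> - (lin x u + lin x (inv\<^bsub>F\<^esub> u))"
    using lin_mult[of u "inv\<^bsub>F\<^esub> u" x] assms by simp
  then have "int p dvd - (lin x (inv\<^bsub>F\<^esub> u) + lin x u)"
    by (simp add: lin_one algebra_simps)
  then show ?thesis
    unfolding dvd_minus_iff .
qed

lemma lin_gen: "y \<in> B \<Longrightarrow> x \<in> B \<Longrightarrow> int p dvd lin x y - (if x = y then 1 else 0)"
  using lin_cong[OF h_gen, of y x] by (auto simp: lin_def ncs_nth_X split: if_splits)

lemma lin_pow:
  assumes "u \<in> carrier F" "x \<in> B"
  shows "int p dvd lin x (u [^]\<^bsub>F\<^esub> (n::nat)) - int n * lin x u"
proof (induction n)
  case (Suc n)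
  have "int p dvd lin x (u [^]\<^bsub>F\<^esub> n \<otimes>\<^bsub>F\<^esub> u) - (lin x (u [^]\<^bsub>F\<^esub> n) + lin x u)"
    using assms by (intro lin_mult) auto
  from dvd_add[OF this Suc] show ?case
    by (simp add: algebra_simps)
qed (simp add: lin_one)

lemma lin_open: "openin S {u \<in> carrier F. Q (h u)}"
  using h_open[of "{a. Q a}"] by simp

text \<open>Modulo an open normal subgroup \<open>M\<close> with elementary abelian quotient containing all generators but \<open>\<pi> x\<close>,
  the map \<open>\<pi>\<close> is \<open>u \<mapsto> (\<pi> x)\<close> raised to \<open>lin x u\<close>.\<close>
lemma redundant_generator:
  assumes r: "r \<in> carrier F" "\<pi> r = \<one>" and x: "x \<in> B" and nd: "\<not> int p dvd lin x r"
  shows "T closure_of (generate G (\<pi> ` (B - {x}))) = carrier G"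
proof (rule ccontr)
  assume nd': "\<not> ?thesis"
  have sub: "\<pi> ` (B - {x}) \<subseteq> carrier G"
    using basis(2) by auto
  obtain M where M: "subgroup M G" "openin T M" "generate G (\<pi> ` (B - {x})) \<subseteq> M" "M \<noteq> carrier G"
    and comm: "\<forall>x\<in>carrier G. \<forall>y\<in>carrier G. x \<otimes> y \<otimes> inv x \<otimes> inv y \<in> M"
    and pow: "\<forall>x\<in>carrier G. x [^] p \<in> M"
    by (rule nondense_frattini[OF generate_is_subgroup[OF sub] nd'])
  have "M \<lhd> G"
  proof (rule normal_invI[OF M(1)])
    fix a m assume a: "a \<in> carrier G" and m: "m \<in> M"
    have mc: "m \<in> carrier G"
      by (rule subgroup.mem_carrier[OF M(1) m])
    have "a \<otimes> m \<otimes> inv a \<otimes> inv m \<in> M"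
      using comm a mc by blast
    from subgroup.m_closed[OF M(1) this m] show "a \<otimes> m \<otimes> inv a \<in> M"
      using a mc by (simp add: m_assoc)
  qed
  then interpret M: normal M G .
  interpret Q: group "G Mod M"
    by (rule M.factorgroup_is_group)
  interpret q: group_hom G "G Mod M" "(#>) M"
    by unfold_locales (rule M.r_coset_hom_Mod)
  have in_M: "y \<in> M \<longleftrightarrow> M #> y = \<one>\<^bsub>G Mod M\<^esub>" if "y \<in> carrier G" for y
    using coset_join1[OF _ that M(1)] coset_join2[OF that M(1)] by auto
  have xc: "x \<in> carrier F"
    using x basis(2) by blast
  define \<theta> where "\<theta> u = M #> \<pi> u" for u
  have theta_c: "\<theta> u \<in> carrier (G Mod M)" if "u \<in> carrier F" for u
    unfolding \<theta>_def using that by (intro q.hom_closed pi.hom_closed)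
  have theta_mult: "\<theta> (u \<otimes>\<^bsub>F\<^esub> v) = \<theta> u \<otimes>\<^bsub>G Mod M\<^esub> \<theta> v" if "u \<in> carrier F" "v \<in> carrier F" for u v
    unfolding \<theta>_def using that by (simp only: pi.hom_mult q.hom_mult pi.hom_closed)
  have theta_inv: "\<theta> (inv\<^bsub>F\<^esub> u) = inv\<^bsub>G Mod M\<^esub> \<theta> u" if "u \<in> carrier F" for u
    unfolding \<theta>_def using that by (simp only: pi.hom_inv q.hom_inv pi.hom_closed)
  have theta_one: "\<theta> u = \<one>\<^bsub>G Mod M\<^esub> \<longleftrightarrow> \<pi> u \<in> M" if "u \<in> carrier F" for u
    unfolding \<theta>_def using in_M that by simp
  define z where "z = \<theta> x"
  have zc: "z \<in> carrier (G Mod M)"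
    unfolding z_def by (rule theta_c[OF xc])
  have "\<pi> x [^] p \<in> M"
    using pow pi.hom_closed[OF xc] by blast
  then have "M #> (\<pi> x [^] p) = \<one>\<^bsub>G Mod M\<^esub>"
    using in_M[of "\<pi> x [^] p"] pi.hom_closed[OF xc] by blast
  then have "z [^]\<^bsub>G Mod M\<^esub> p = \<one>\<^bsub>G Mod M\<^esub>"
    unfolding z_def \<theta>_def using M.FactGroup_pow[OF pi.hom_closed[OF xc]] by simp
  then have ordz: "Q.ord z dvd p"
    using Q.pow_eq_id[OF zc] by blast
  have zpow: "z [^]\<^bsub>G Mod M\<^esub> a = z [^]\<^bsub>G Mod M\<^esub> b" if "int p dvd a - b" for a b :: int
  proof -
    have "int (Q.ord z) dvd b - a"
      using ordz that by (metis dvd_diff_commute dvd_trans of_nat_dvd_iff)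
    then show ?thesis
      using Q.int_pow_eq[OF zc] by blast
  qed
  \<comment> \<open>The subgroup on which the formula for \<open>\<theta>\<close> holds. It is open
    and contains \<open>B\<close>, hence is all of \<open>F\<close>.\<close>
  define D where "D = {u \<in> carrier F. \<theta> u = z [^]\<^bsub>G Mod M\<^esub> lin x u}"
  have D: "subgroup D F"
  proof (rule F.subgroupI)
    have "\<theta> \<one>\<^bsub>F\<^esub> = \<one>\<^bsub>G Mod M\<^esub>"
      using theta_one[OF F.one_closed] subgroup.one_closed[OF M(1)] by simp
    then have "\<one>\<^bsub>F\<^esub> \<in> D"
      by (simp add: D_def lin_one)
    then show "D \<noteq> {}"
      by blast
    fix u assume u: "u \<in> D"
    then have uc: "u \<in> carrier F"
      by (simp add: D_def)
    have "\<theta> (inv\<^bsub>F\<^esub> u) = z [^]\<^bsub>G Mod M\<^esub> (- lin x u)"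
      using u uc zc by (simp add: D_def theta_inv Q.int_pow_neg)
    also have "\<dots> = z [^]\<^bsub>G Mod M\<^esub> lin x (inv\<^bsub>F\<^esub> u)"
    proof (rule zpow)
      have "- lin x u - lin x (inv\<^bsub>F\<^esub> u) = - (lin x (inv\<^bsub>F\<^esub> u) + lin x u)"
        by simp
      then show "int p dvd - lin x u - lin x (inv\<^bsub>F\<^esub> u)"
        using lin_inv[OF uc x] by (simp only: dvd_minus_iff)
    qed
    finally show "inv\<^bsub>F\<^esub> u \<in> D"
      using uc by (simp add: D_def)
    fix v assume v: "v \<in> D"
    then have vc: "v \<in> carrier F"
      by (simp add: D_def)
    have "\<theta> (u \<otimes>\<^bsub>F\<^esub> v) = z [^]\<^bsub>G Mod M\<^esub> (lin x u + lin x v)"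
      using u v uc vc zc by (simp add: D_def theta_mult Q.int_pow_mult)
    also have "\<dots> = z [^]\<^bsub>G Mod M\<^esub> lin x (u \<otimes>\<^bsub>F\<^esub> v)"
      by (rule zpow) (use lin_mult[OF uc vc x] in \<open>simp only: dvd_diff_commute\<close>)
    finally show "u \<otimes>\<^bsub>F\<^esub> v \<in> D"
      using uc vc by (simp add: D_def)
  qed (auto simp: D_def)
  have "openin S D"
  proof (rule F.openin_subgroup_superset[OF _ _ D])
    \<comment> \<open>Where \<open>\<pi> u\<close> lies in \<open>M\<close> and
      \<open>lin x u\<close> vanishes modulo \<open>p\<close>, both sides of the formula are
      trivial; this open subgroup makes \<open>D\<close> open.\<close>
    let ?D1 = "{u \<in> carrier F. \<pi> u \<in> M} \<inter> {u \<in> carrier F. int p dvd lin x u}"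
    show "subgroup ?D1 F"
    proof (rule F.subgroups_Inter_pair[OF preimage_subgroup[OF M(1)]], rule F.subgroupI)
      show "{u \<in> carrier F. int p dvd lin x u} \<noteq> {}"
        using F.one_closed lin_one by force
      fix u assume u: "u \<in> {u \<in> carrier F. int p dvd lin x u}"
      then show "inv\<^bsub>F\<^esub> u \<in> {u \<in> carrier F. int p dvd lin x u}"
        using lin_inv[of u x] x by (auto simp: dvd_add_left_iff)
      fix v assume "v \<in> {u \<in> carrier F. int p dvd lin x u}"
      then show "u \<otimes>\<^bsub>F\<^esub> v \<in> {u \<in> carrier F. int p dvd lin x u}"
        using lin_mult[of u v x] u x by (auto simp: dvd_diff_left_iff)
    qed auto
    show "openin S ?D1"
      unfolding lin_def by (intro openin_Int preimage_open M(2) lin_open)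
    show "?D1 \<subseteq> D"
    proof
      fix u assume "u \<in> ?D1"
      then have u: "u \<in> carrier F" "\<pi> u \<in> M" "int p dvd lin x u"
        by auto
      have "z [^]\<^bsub>G Mod M\<^esub> lin x u = z [^]\<^bsub>G Mod M\<^esub> (0::int)"
        by (rule zpow) (use u in simp)
      then show "u \<in> D"
        using u theta_one[OF u(1)] by (simp add: D_def)
    qed
  qed
  moreover have "B \<subseteq> D"
  proof
    fix y assume y: "y \<in> B"
    then have yc: "y \<in> carrier F"
      using basis(2) by blast
    show "y \<in> D"
    proof (cases "y = x")
      case True
      have "z [^]\<^bsub>G Mod M\<^esub> lin x x = z [^]\<^bsub>G Mod M\<^esub> (1::int)"
        by (rule zpow) (use lin_gen[OF x x] in simp)
      then show ?thesis
        using True yc Q.int_pow_1[OF zc] by (simp add: D_def z_def)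
    next
      case False
      have "z [^]\<^bsub>G Mod M\<^esub> lin x y = z [^]\<^bsub>G Mod M\<^esub> (0::int)"
        by (rule zpow) (use lin_gen[OF y x] False in simp)
      moreover have "\<pi> y \<in> M"
        using M(3) False y generate.incl[of _ "\<pi> ` (B - {x})" G] by blast
      ultimately show ?thesis
        using yc theta_one[OF yc] by (simp add: D_def)
    qed
  qed
  ultimately have DF: "D = carrier F"
    using free_generates[OF free D F.closedin_open_subgroup[OF D]] by blast
  \<comment> \<open>At the relator the formula gives a trivial power of \<open>z\<close> with
    exponent prime to \<open>p\<close>. As the order of \<open>z\<close> is 1 or \<open>p\<close>,
    \<open>z\<close> is trivial and \<open>M\<close> is everything.\<close>
  have "z [^]\<^bsub>G Mod M\<^esub> lin x r = \<one>\<^bsub>G Mod M\<^esub>"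
    using r DF theta_one[OF r(1)] subgroup.one_closed[OF M(1)] unfolding D_def by auto
  then have "int (Q.ord z) dvd lin x r"
    using Q.int_pow_eq_id[OF zc] by blast
  moreover have "Q.ord z = 1 \<or> Q.ord z = p"
    using ordz prime prime_nat_iff by blast
  ultimately have "z = \<one>\<^bsub>G Mod M\<^esub>"
    using nd Q.ord_eq_1[OF zc] by auto
  then have "\<theta> u = \<one>\<^bsub>G Mod M\<^esub>" if "u \<in> carrier F" for u
    using DF that unfolding D_def by (metis (mono_tags, lifting) Q.int_pow_one mem_Collect_eq)
  then have "\<pi> u \<in> M" if "u \<in> carrier F" for u
    using theta_one that by blast
  then have "\<pi> ` carrier F \<subseteq> M"
    by (rule image_subsetI)
  then show False
    using M(4) subgroup.subset[OF M(1)] by (simp add: pi_surj)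
qed

end

lemma (in presentation) obtain_magnus:
  assumes "N \<ge> 2"
  obtains h where "magnus p G T F S B R \<pi> N h"
proof -
  have "N > 0"
    using assms by simp
  obtain h where "\<forall>u\<in>carrier F. h u - 1 \<in> low p B 1" "h \<one>\<^bsub>F\<^esub> = 1"
    "\<forall>u\<in>carrier F. \<forall>v\<in>carrier F. h (u \<otimes>\<^bsub>F\<^esub> v) - h u * h v \<in> low p B N"
    "\<forall>x\<in>B. h x - (1 + ncs_X x) \<in> low p B N"
    "\<forall>A. openin S {u \<in> carrier F. h u \<in> A}"
    by (rule magnus_rep[OF free \<open>N > 0\<close>])
  then have "magnus p G T F S B R \<pi> N h"
    using assms by unfold_locales blast+
  then show ?thesis
    by (rule that)
qed

context magnus
begin

text \<open>The Frattini subgroup of \<open>F\<close>, as the common kernel of the linear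
  coefficients modulo \<open>p\<close>.\<close>

definition lin_kernel :: "nat set set" where
  "lin_kernel = {u \<in> carrier F. \<forall>x\<in>B. int p dvd lin x u}"

lemma lin_kernel:
  shows "lin_kernel \<lhd> F" "openin S lin_kernel" "closedin S lin_kernel"
proof -
  have sub: "subgroup lin_kernel F"
  proof (rule F.subgroupI)
    have "\<one>\<^bsub>F\<^esub> \<in> lin_kernel"
      by (simp add: lin_kernel_def lin_one)
    then show "lin_kernel \<noteq> {}"
      by blast
    fix u assume u: "u \<in> lin_kernel"
    have "int p dvd lin x (inv\<^bsub>F\<^esub> u)" if "x \<in> B" for x
      using lin_inv[of u x] u that by (auto simp: lin_kernel_def dvd_add_left_iff)
    then show "inv\<^bsub>F\<^esub> u \<in> lin_kernel"
      using u by (auto simp: lin_kernel_def)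
    fix v assume v: "v \<in> lin_kernel"
    have "int p dvd lin x (u \<otimes>\<^bsub>F\<^esub> v)" if "x \<in> B" for x
      using lin_mult[of u v x] u v that by (auto simp: lin_kernel_def dvd_diff_left_iff)
    then show "u \<otimes>\<^bsub>F\<^esub> v \<in> lin_kernel"
      using u v by (auto simp: lin_kernel_def)
  qed (auto simp: lin_kernel_def)
  show "lin_kernel \<lhd> F"
  proof (rule F.normal_invI[OF sub])
    fix u v assume u: "u \<in> carrier F" and v: "v \<in> lin_kernel"
    then have vc: "v \<in> carrier F"
      by (simp add: lin_kernel_def)
    have "int p dvd lin x (u \<otimes>\<^bsub>F\<^esub> v \<otimes>\<^bsub>F\<^esub> inv\<^bsub>F\<^esub> u)" if x: "x \<in> B" for x
    proof -
      have "int p dvd (lin x (u \<otimes>\<^bsub>F\<^esub> v \<otimes>\<^bsub>F\<^esub> inv\<^bsub>F\<^esub> u) - (lin x (u \<otimes>\<^bsub>F\<^esub> v) + lin x (inv\<^bsub>F\<^esub> u)))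
        + (lin x (u \<otimes>\<^bsub>F\<^esub> v) - (lin x u + lin x v)) + (lin x (inv\<^bsub>F\<^esub> u) + lin x u) + lin x v"
        using v x by (intro dvd_add lin_mult lin_inv u vc x) (auto simp: lin_kernel_def u vc)
      then show ?thesis
        by (simp add: algebra_simps)
    qed
    then show "u \<otimes>\<^bsub>F\<^esub> v \<otimes>\<^bsub>F\<^esub> inv\<^bsub>F\<^esub> u \<in> lin_kernel"
      using u vc by (simp add: lin_kernel_def)
  qed
  show op: "openin S lin_kernel"
    unfolding lin_kernel_def lin_def by (rule lin_open)
  show "closedin S lin_kernel"
    by (rule F.closedin_open_subgroup[OF sub op])
qed

definition linvec :: "nat set \<Rightarrow> nat set \<Rightarrow> int" where
  "linvec u = (\<lambda>x\<in>B. lin x u mod int p)"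

lemma linvec_surj:
  assumes v: "v \<in> B \<rightarrow>\<^sub>E {0..<int p}"
  obtains u where "u \<in> carrier F" "linvec u = v"
proof -
  have "\<exists>u\<in>carrier F. \<forall>x\<in>B. int p dvd lin x u - (if x \<in> A then v x else 0)" if "A \<subseteq> B" for A
    using finite_subset[OF that basis(1)] that
  proof (induction A rule: finite_induct)
    case empty
    then show ?case
      by (intro bexI[of _ "\<one>\<^bsub>F\<^esub>"]) (auto simp: lin_one)
  next
    case (insert y A)
    then obtain u where u: "u \<in> carrier F" "\<forall>x\<in>B. int p dvd lin x u - (if x \<in> A then v x else 0)"
      by blast
    have y: "y \<in> B" "y \<in> carrier F"
      using insert.prems basis(2) by auto
    have vy: "int (nat (v y)) = v y"
      using PiE_mem[OF v y(1)] by simp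
    let ?u = "u \<otimes>\<^bsub>F\<^esub> y [^]\<^bsub>F\<^esub> nat (v y)"
    have "int p dvd lin x ?u - (if x \<in> insert y A then v x else 0)" if x: "x \<in> B" for x
    proof -
      have "int p dvd v y * (lin x y - (if x = y then 1 else 0))"
        using lin_gen[OF y(1) x] by (rule dvd_mult)
      moreover have "int p dvd lin x (y [^]\<^bsub>F\<^esub> nat (v y)) - v y * lin x y"
        using lin_pow[OF y(2) x, of "nat (v y)"] by (simp only: vy)
      moreover have "int p dvd lin x ?u - (lin x u + lin x (y [^]\<^bsub>F\<^esub> nat (v y)))"
        by (rule lin_mult[OF u(1) _ x]) (simp add: y)
      moreover have "int p dvd lin x u - (if x \<in> A then v x else 0)"
        using u(2) x by blast
      ultimately have "int p dvd v y * (lin x y - (if x = y then 1 else 0)) + (lin x (y [^]\<^bsub>F\<^esub> nat (v y)) - v y * lin x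
        y)
         + (lin x ?u - (lin x u + lin x (y [^]\<^bsub>F\<^esub> nat (v y)))) + (lin x u - (if x \<in> A then v x else 0))"
        by (intro dvd_add)
      also have "\<dots> = lin x ?u - (if x \<in> insert y A then v x else 0)"
        using insert.hyps(2) by (auto simp: algebra_simps)
      finally show ?thesis .
    qed
    then show ?case
      using u(1) y(2) by (intro bexI[of _ ?u]) auto
  qed
  from this[of B] obtain u where u: "u \<in> carrier F" "\<forall>x\<in>B. int p dvd lin x u - v x"
    by auto
  have "linvec u = v"
  proof (rule extensionalityI[of _ B])
    show "linvec u \<in> extensional B" "v \<in> extensional B"
      using v by (auto simp: linvec_def PiE_def)
    fix x assume x: "x \<in> B"
    then have "lin x u mod int p = v x mod int p"
      using u(2) by (simp add: mod_eq_dvd_iff)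
    also have "\<dots> = v x"
      using PiE_mem[OF v x] by simp
    finally show "linvec u x = v x"
      using x by (simp add: linvec_def)
  qed
  with u(1) show ?thesis
    by (rule that)
qed

text \<open>If all linear coefficients of relators vanish modulo \<open>p\<close>, the kernel of
  \<open>\<pi>\<close> lies in \<open>lin_kernel\<close>, so vectors of linear coefficients modulo
  \<open>p\<close> make sense on \<open>G\<close>. Lifts of a topological generating set then span
  all \<open>p ^ card B\<close> vectors, with only \<open>p ^ card A\<close> choices of
  coefficients.\<close>

lemma card_basis_le:
  assumes R: "\<And>r x. r \<in> R \<Longrightarrow> x \<in> B \<Longrightarrow> int p dvd lin x r"
    and A: "A \<subseteq> carrier G" "finite A" "T closure_of (generate G A) = carrier G"
  shows "card B \<le> card A"
proof -
  have p: "p > 1"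
    using prime by (rule prime_gt_1_nat)
  have ker: "kernel F G \<pi> \<subseteq> lin_kernel"
    using R rels(1) by (intro kernel_minimal lin_kernel) (auto simp: lin_kernel_def)
  have "\<forall>a\<in>A. \<exists>u. u \<in> carrier F \<and> \<pi> u = a"
    using A(1) pi_surj by (metis imageE subsetD)
  then obtain f where f: "\<forall>a\<in>A. f a \<in> carrier F \<and> \<pi> (f a) = a"
    by (rule bchoice[THEN exE])
  define comb where "comb c = (\<lambda>x\<in>B. (\<Sum>a\<in>A. c a * lin x (f a)) mod int p)" for c :: "'a \<Rightarrow> int"
  \<comment> \<open>Elements whose linear coefficients are combinations of those of the lifts. Being
    open and hence closed, \<open>D\<close> has a closed image, which contains \<open>A\<close> and
    therefore all of \<open>G\<close>.\<close>
  define D where "D = {u \<in> carrier F. \<exists>c. \<forall>x\<in>B. int p dvd lin x u - (\<Sum>a\<in>A. c a * lin x (f a))}"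
  have D: "subgroup D F"
  proof (rule F.subgroupI)
    have "\<one>\<^bsub>F\<^esub> \<in> D"
      by (auto simp: D_def lin_one intro!: exI[of _ "\<lambda>_. 0"])
    then show "D \<noteq> {}"
      by blast
    fix u assume "u \<in> D"
    then obtain c where u: "u \<in> carrier F" and c: "\<forall>x\<in>B. int p dvd lin x u - (\<Sum>a\<in>A. c a * lin x (f a))"
      by (auto simp: D_def)
    have "int p dvd lin x (inv\<^bsub>F\<^esub> u) - (\<Sum>a\<in>A. - c a * lin x (f a))" if x: "x \<in> B" for x
    proof -
      have "int p dvd lin x (inv\<^bsub>F\<^esub> u) + lin x u - (lin x u - (\<Sum>a\<in>A. c a * lin x (f a)))"
        by (rule dvd_diff[OF lin_inv[OF u x] bspec[OF c x]])
      also have "lin x (inv\<^bsub>F\<^esub> u) + lin x u - (lin x u - (\<Sum>a\<in>A. c a * lin x (f a)))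
          = lin x (inv\<^bsub>F\<^esub> u) - (\<Sum>a\<in>A. - c a * lin x (f a))"
        by (simp add: sum_negf)
      finally show ?thesis .
    qed
    then show "inv\<^bsub>F\<^esub> u \<in> D"
      using u unfolding D_def by (intro CollectI conjI exI[of _ "\<lambda>a. - c a"] ballI F.inv_closed)
    fix v assume "v \<in> D"
    then obtain e where v: "v \<in> carrier F" and e: "\<forall>x\<in>B. int p dvd lin x v - (\<Sum>a\<in>A. e a * lin x (f a))"
      by (auto simp: D_def)
    have "int p dvd lin x (u \<otimes>\<^bsub>F\<^esub> v) - (\<Sum>a\<in>A. (c a + e a) * lin x (f a))" if x: "x \<in> B" for x
    proof -
      have "int p dvd (lin x (u \<otimes>\<^bsub>F\<^esub> v) - (lin x u + lin x v)) + (lin x u - (\<Sum>a\<in>A. c a * lin x (f a)))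
          + (lin x v - (\<Sum>a\<in>A. e a * lin x (f a)))"
        by (rule dvd_add[OF dvd_add[OF lin_mult[OF u v x] bspec[OF c x]] bspec[OF e x]])
      also have "(lin x (u \<otimes>\<^bsub>F\<^esub> v) - (lin x u + lin x v)) + (lin x u - (\<Sum>a\<in>A. c a * lin x (f a)))
          + (lin x v - (\<Sum>a\<in>A. e a * lin x (f a))) = lin x (u \<otimes>\<^bsub>F\<^esub> v) - (\<Sum>a\<in>A. (c a + e a) * lin x (f a))"
        by (simp add: distrib_right sum.distrib)
      finally show ?thesis .
    qed
    then show "u \<otimes>\<^bsub>F\<^esub> v \<in> D"
      using u v unfolding D_def by (intro CollectI conjI exI[of _ "\<lambda>a. c a + e a"] ballI F.m_closed)
  qed (auto simp: D_def)
  have kD: "lin_kernel \<subseteq> D"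
    by (auto simp: D_def lin_kernel_def intro!: exI[of _ "\<lambda>_. 0"])
  have "openin S D"
    by (rule F.openin_subgroup_superset[OF normal_imp_subgroup[OF lin_kernel(1)] lin_kernel(2) D kD])
  then have clD: "closedin T (\<pi> ` D)"
    by (intro closedin_image F.closedin_open_subgroup[OF D])
  have subD: "subgroup (\<pi> ` D) G"
    by (rule pi.subgroup_img_is_subgroup[OF D])
  have "A \<subseteq> \<pi> ` D"
  proof
    fix a assume a: "a \<in> A"
    have delta: "(\<Sum>b\<in>A. (if b = a then 1 else 0) * lin x (f b)) = lin x (f a)" for x
    proof -
      have "(\<Sum>b\<in>A. (if b = a then 1 else 0) * lin x (f b)) = (\<Sum>b\<in>A. if b = a then lin x (f a) else 0)"
        by (rule sum.cong) auto
      then show ?thesis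
        using a A(2) by simp
    qed
    have fa: "f a \<in> carrier F" "\<pi> (f a) = a"
      using f a by blast+
    have "\<exists>c. \<forall>x\<in>B. int p dvd lin x (f a) - (\<Sum>b\<in>A. c b * lin x (f b))"
      by (intro exI[of _ "\<lambda>b. if b = a then 1 else 0"] ballI) (simp only: delta diff_self dvd_0_right)
    then have "f a \<in> D"
      using fa(1) by (simp add: D_def)
    then show "a \<in> \<pi> ` D"
      using fa(2) by (metis imageI)
  qed
  then have "generate G A \<subseteq> \<pi> ` D"
    by (rule generate_subgroup_incl[OF _ subD])
  then have full: "carrier G \<subseteq> \<pi> ` D"
    using closure_of_minimal[OF _ clD] A(3) by metis
  have "B \<rightarrow>\<^sub>E {0..<int p} \<subseteq> comb ` (A \<rightarrow>\<^sub>E {0..<int p})"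
  proof
    fix v assume v: "v \<in> B \<rightarrow>\<^sub>E {0..<int p}"
    obtain u where u: "u \<in> carrier F" "linvec u = v"
      by (rule linvec_surj[OF v])
    have "\<pi> u \<in> \<pi> ` D"
      using full pi.hom_closed[OF u(1)] by blast
    then obtain d where d: "d \<in> D" "\<pi> u = \<pi> d"
      by blast
    have dc: "d \<in> carrier F"
      by (rule subgroup.mem_carrier[OF D d(1)])
    have "inv\<^bsub>F\<^esub> d \<otimes>\<^bsub>F\<^esub> u \<in> kernel F G \<pi>"
      using u dc d(2) by (simp add: kernel_def)
    then have "inv\<^bsub>F\<^esub> d \<otimes>\<^bsub>F\<^esub> u \<in> D"
      using ker kD by blast
    then have "d \<otimes>\<^bsub>F\<^esub> (inv\<^bsub>F\<^esub> d \<otimes>\<^bsub>F\<^esub> u) \<in> D"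
      by (rule subgroup.m_closed[OF D d(1)])
    then have "u \<in> D"
      using u dc by (simp add: F.m_assoc[symmetric])
    then obtain c where c: "\<forall>x\<in>B. int p dvd lin x u - (\<Sum>a\<in>A. c a * lin x (f a))"
      by (auto simp: D_def)
    let ?c = "\<lambda>a\<in>A. c a mod int p"
    have "comb ?c = linvec u"
    proof (rule extensionalityI[of _ B])
      show "comb ?c \<in> extensional B" "linvec u \<in> extensional B"
        by (simp_all add: comb_def linvec_def)
      fix x assume x: "x \<in> B"
      have "(\<Sum>a\<in>A. ?c a * lin x (f a)) = (\<Sum>a\<in>A. (c a mod int p) * lin x (f a))"
        by (rule sum.cong) auto
      then have "(\<Sum>a\<in>A. ?c a * lin x (f a)) mod int p = (\<Sum>a\<in>A. c a * lin x (f a)) mod int p"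
        by (simp only:) (subst (1 2) mod_sum_eq[symmetric], simp only: mod_mult_left_eq)
      also have "\<dots> = lin x u mod int p"
        using c x by (metis mod_eq_dvd_iff)
      finally show "comb ?c x = linvec u x"
        using x by (simp add: comb_def linvec_def)
    qed
    moreover have "?c \<in> A \<rightarrow>\<^sub>E {0..<int p}"
      using p by auto
    ultimately show "v \<in> comb ` (A \<rightarrow>\<^sub>E {0..<int p})"
      using u(2) by (metis imageI)
  qed
  moreover have "finite (A \<rightarrow>\<^sub>E {0..<int p})"
    using A(2) by (simp add: finite_PiE)
  ultimately have "card (B \<rightarrow>\<^sub>E {0..<int p}) \<le> card (A \<rightarrow>\<^sub>E {0..<int p})"
    by (metis surj_card_le)
  then have "p ^ card B \<le> p ^ card A"
    using A(2) basis(1) by (simp add: card_PiE)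
  then show ?thesis
    using p by simp
qed

text \<open>A linear coefficient nonzero modulo \<open>p\<close> would make a generator redundant,
  contradicting minimality of the basis.\<close>

lemma lin_rels:
  assumes min: "card B = generator_rank G T" and r: "r \<in> R" and x: "x \<in> B"
  shows "int p dvd lin x r"
proof (rule ccontr)
  assume "\<not> ?thesis"
  then have "T closure_of (generate G (\<pi> ` (B - {x}))) = carrier G"
    using rels_in_kernel[OF r] x by (intro redundant_generator)
  then have "generator_rank G T \<le> card (\<pi> ` (B - {x}))"
    using basis by (intro generator_rank_le) auto
  also have "\<dots> \<le> card (B - {x})"
    using basis(1) by (intro card_image_le) simp
  also have "\<dots> < card B"
    using basis(1) x by (rule card_Diff1_less)
  finally show False
    using min by simp
qed

lemma rels_low:
  assumes min: "card B = generator_rank G T" and r: "r \<in> R"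
  shows "h r - 1 \<in> low p B 2"
proof -
  have "int p dvd ncs_nth (h r - 1) w" if w: "set w \<subseteq> B" "length w < 2" for w
  proof (cases w)
    case Nil
    then show ?thesis
      using h_Nil rels_in_kernel(1)[OF r] by simp
  next
    case (Cons x v)
    then have "w = [x]" "x \<in> B"
      using w by auto
    then show ?thesis
      using lin_rels[OF min r] by (simp add: lin_def)
  qed
  then show ?thesis
    by (simp add: low_def)
qed

end

section \<open>Elimination of generators\<close>

lemma hom_restrict_carrier:
  assumes "f \<in> hom G H" "L \<subseteq> carrier G"
  shows "f \<in> hom (G\<lparr>carrier := L\<rparr>) H"
  using assms by (simp add: hom_def Pi_def subset_iff)

text \<open>A redundant generator \<open>x\<close> is eliminated by restricting to the closed subgroup \<open>L\<close> generated by the other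
  basis elements: \<open>L\<close> surjects onto \<open>G\<close>, and a retraction \<open>\<sigma>\<close> of \<open>F\<close> onto \<open>L\<close> compatible with \<open>\<pi>\<close> maps the
  relators to relators for \<open>L\<close>.\<close>
lemma (in presentation) eliminate_generator:
  assumes x: "x \<in> B" and gen: "T closure_of (generate G (\<pi> ` (B - {x}))) = carrier G"
  shows "\<exists>m. has_pro_p_presentation p G T (card B - 1) m"
proof -
  let ?C = "B - {x}"
  define L where "L = closed_hull F S ?C"
  have Cc: "?C \<subseteq> carrier F"
    using basis(2) by blast
  have L: "subgroup L F" "closedin S L" "?C \<subseteq> L"
    unfolding L_def by (rule F.closed_hull[OF Cc])+
  have Lc: "L \<subseteq> carrier F"
    using L(1) by (rule subgroup.subset)
  let ?L = "F\<lparr>carrier := L\<rparr>"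
  have freeL: "free_pro_p_group p ?L (subtopology S L) ?C"
    unfolding L_def by (rule free_subbasis[OF free]) blast
  interpret L: pro_p_group p ?L "subtopology S L"
    using freeL by (simp add: free_pro_p_group_def)
  have "?C \<subseteq> L" "\<pi> ` ?C \<subseteq> \<pi> ` L"
    using L(3) by auto
  then have "generate G (\<pi> ` ?C) \<subseteq> \<pi> ` L"
    by (intro generate_subgroup_incl pi.subgroup_img_is_subgroup L(1))
  then have surjL: "carrier G \<subseteq> \<pi> ` L"
    using closure_of_minimal[OF _ closedin_image[OF L(2)]] gen by metis
  have xc: "x \<in> carrier F"
    using x basis(2) by blast
  have "\<pi> x \<in> \<pi> ` L"
    using surjL pi.hom_closed[OF xc] by blast
  then obtain y where y: "y \<in> L" "\<pi> y = \<pi> x"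
    by (metis imageE)
  have "(\<lambda>b. if b = x then y else b) \<in> B \<rightarrow> carrier ?L"
    using y L(3) by auto
  then obtain \<sigma> where s: "\<sigma> \<in> hom F ?L" "continuous_map S (subtopology S L) \<sigma>"
    "\<forall>b\<in>B. \<sigma> b = (if b = x then y else b)"
    using free L.pro_p_group_axioms unfolding free_pro_p_group_def by blast
  have sL: "\<sigma> u \<in> L" if "u \<in> carrier F" for u
    using s(1) that by (auto simp: hom_def)
  have sF: "\<sigma> \<in> hom F F"
    using s(1) Lc by (auto simp: hom_def)
  have sFc: "continuous_map S S \<sigma>"
    using s(2) by (rule continuous_map_into_fulltopology)
  interpret s: group_hom F ?L \<sigma>
    by unfold_locales (rule s(1))
  have pi_s: "\<pi> (\<sigma> u) = \<pi> u" if "u \<in> carrier F" for u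
  proof -
    have "(\<pi> \<circ> \<sigma>) u = \<pi> u"
    proof (rule free_hom_eqI[OF free group_axioms Hausdorff _ _ pi_hom pi_cont _ that])
      show "\<pi> \<circ> \<sigma> \<in> hom F G"
        by (rule Group.hom_compose[OF sF pi_hom])
      show "continuous_map S T (\<pi> \<circ> \<sigma>)"
        by (rule continuous_map_compose[OF sFc pi_cont])
      show "(\<pi> \<circ> \<sigma>) b = \<pi> b" if "b \<in> B" for b
        using s(3) that y(2) by auto
    qed
    then show ?thesis by simp
  qed
  have s_id: "\<sigma> u = u" if "u \<in> L" for u
  proof (rule free_hom_eqI[OF freeL F.group_axioms F.Hausdorff, of \<sigma> "\<lambda>u. u"])
    show "\<sigma> \<in> hom ?L F"
      by (rule hom_restrict_carrier[OF sF Lc])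
    show "continuous_map (subtopology S L) S \<sigma>"
      using sFc by (rule continuous_map_from_subtopology)
    show "(\<lambda>u. u) \<in> hom ?L F"
      using Lc by (auto simp: hom_def)
    show "continuous_map (subtopology S L) S (\<lambda>u. u)"
      by (rule continuous_map_from_subtopology) simp
    show "\<sigma> b = b" if "b \<in> ?C" for b
      using s(3) that by auto
    show "u \<in> carrier ?L"
      using that by simp
  qed
  \<comment> \<open>\<open>\<sigma>\<close> fixes \<open>L\<close> and preserves
    \<open>\<pi>\<close>, so it maps the kernel on \<open>F\<close> onto the kernel on
    \<open>L\<close>.\<close>
  have kerL: "kernel ?L G \<pi> = \<sigma> ` kernel F G \<pi>"
  proof (intro equalityI subsetI)
    fix u assume "u \<in> kernel ?L G \<pi>"
    then have u: "u \<in> L" "\<pi> u = \<one>"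
      by (auto simp: kernel_def)
    then have "u \<in> kernel F G \<pi>"
      using Lc by (auto simp: kernel_def)
    then have "\<sigma> u \<in> \<sigma> ` kernel F G \<pi>"
      by (rule imageI)
    then show "u \<in> \<sigma> ` kernel F G \<pi>"
      by (simp only: s_id[OF u(1)])
  next
    fix u assume "u \<in> \<sigma> ` kernel F G \<pi>"
    then obtain v where "v \<in> carrier F" "\<pi> v = \<one>" "u = \<sigma> v"
      by (auto simp: kernel_def)
    then show "u \<in> kernel ?L G \<pi>"
      using sL pi_s by (simp add: kernel_def)
  qed
  have kerL2: "kernel ?L G \<pi> = closed_normal_closure ?L (subtopology S L) (\<sigma> ` R)"
    unfolding closed_normal_closure_def
  proof (rule hull_unique[symmetric])
    have RK: "R \<subseteq> kernel F G \<pi>"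
      using rels_in_kernel by (auto simp: kernel_def)
    then show "\<sigma> ` R \<subseteq> kernel ?L G \<pi>"
      unfolding kerL by (rule image_mono)
    have "\<pi> \<in> hom ?L G"
      by (rule hom_restrict_carrier[OF pi_hom Lc])
    then interpret piL: group_hom ?L G \<pi>
      by unfold_locales
    have "closedin S (kernel F G \<pi>)"
    proof -
      have "closedin S {u \<in> topspace S. \<pi> u \<in> {\<one>}}"
        by (rule closedin_continuous_map_preimage[OF pi_cont])
          (simp add: closedin_Hausdorff_sing_eq[OF Hausdorff] topspace_eq)
      then show ?thesis
        by (simp add: kernel_def F.topspace_eq)
    qed
    moreover have "kernel ?L G \<pi> = kernel F G \<pi> \<inter> L"
      using Lc by (auto simp: kernel_def)
    ultimately have "closedin (subtopology S L) (kernel ?L G \<pi>)"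
      by (auto simp: closedin_subtopology)
    then show "kernel ?L G \<pi> \<lhd> ?L \<and> closedin (subtopology S L) (kernel ?L G \<pi>)"
      using piL.normal_kernel by blast
    fix N assume RN: "\<sigma> ` R \<subseteq> N" and N: "N \<lhd> ?L \<and> closedin (subtopology S L) N"
    \<comment> \<open>The preimage of \<open>N\<close> under \<open>\<sigma>\<close> is a closed
      normal subgroup of \<open>F\<close> containing the relators, hence contains the kernel;
      applying \<open>\<sigma>\<close> gives minimality on \<open>L\<close>.\<close>
    have "kernel F G \<pi> \<subseteq> {u \<in> carrier F. \<sigma> u \<in> N}"
    proof (rule kernel_minimal)
      have N1: "N \<lhd> ?L"
        using N by blast
      interpret N: normal N ?L
        by (rule N1)
      have sub: "subgroup {u \<in> carrier F. \<sigma> u \<in> N} F"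
      proof (rule F.subgroupI)
        show "{u \<in> carrier F. \<sigma> u \<in> N} \<noteq> {}"
          using F.one_closed N.one_closed s.hom_one by force
        fix u assume u: "u \<in> {u \<in> carrier F. \<sigma> u \<in> N}"
        then show "inv\<^bsub>F\<^esub> u \<in> {u \<in> carrier F. \<sigma> u \<in> N}"
          using N.m_inv_closed s.hom_inv by auto
        fix v assume v: "v \<in> {u \<in> carrier F. \<sigma> u \<in> N}"
        show "u \<otimes>\<^bsub>F\<^esub> v \<in> {u \<in> carrier F. \<sigma> u \<in> N}"
          using u v N.m_closed s.hom_mult by auto
      qed auto
      show "{u \<in> carrier F. \<sigma> u \<in> N} \<lhd> F"
      proof (rule F.normal_invI[OF sub])
        fix a u assume a: "a \<in> carrier F" and u: "u \<in> {u \<in> carrier F. \<sigma> u \<in> N}"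
        then have uc: "u \<in> carrier F" "\<sigma> u \<in> N"
          by auto
        have "\<sigma> (a \<otimes>\<^bsub>F\<^esub> u \<otimes>\<^bsub>F\<^esub> inv\<^bsub>F\<^esub> a) = \<sigma> a \<otimes>\<^bsub>?L\<^esub> \<sigma> u \<otimes>\<^bsub>?L\<^esub> inv\<^bsub>?L\<^esub> \<sigma> a"
          using a uc(1) by (simp only: s.hom_mult s.hom_inv F.m_closed F.inv_closed)
        also have "\<dots> \<in> N"
          by (rule N.inv_op_closed2[OF s.hom_closed[OF a] uc(2)])
        finally show "a \<otimes>\<^bsub>F\<^esub> u \<otimes>\<^bsub>F\<^esub> inv\<^bsub>F\<^esub> a \<in> {u \<in> carrier F. \<sigma> u \<in> N}"
          using a uc(1) by simp
      qed
      have "closedin S {u \<in> topspace S. \<sigma> u \<in> N}"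
        using closedin_continuous_map_preimage[OF s(2)] N by blast
      then show "closedin S {u \<in> carrier F. \<sigma> u \<in> N}"
        by (simp add: F.topspace_eq)
      show "R \<subseteq> {u \<in> carrier F. \<sigma> u \<in> N}"
        using RN rels(1) by blast
    qed
    then show "kernel ?L G \<pi> \<subseteq> N"
      unfolding kerL by blast
  qed
  have "presentation p G T ?L (subtopology S L) ?C (\<sigma> ` R) \<pi>"
  proof unfold_locales
    show "free_pro_p_group p ?L (subtopology S L) ?C"
      by (rule freeL)
    show "\<sigma> ` R \<subseteq> carrier ?L"
      using sL rels(1) by auto
    show "finite (\<sigma> ` R)"
      using rels(2) by simp
    show "\<pi> \<in> hom ?L G"
      by (rule hom_restrict_carrier[OF pi_hom Lc])
    show "continuous_map (subtopology S L) T \<pi>"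
      using pi_cont by (rule continuous_map_from_subtopology)
    show "\<pi> ` carrier ?L = carrier G"
      using surjL Lc by auto
    show "kernel ?L G \<pi> = closed_normal_closure ?L (subtopology S L) (\<sigma> ` R)"
      by (rule kerL2)
  qed
  then have "has_pro_p_presentation p G T (card ?C) (card (\<sigma> ` R))"
    by (rule presentation.has_presentation)
  then show ?thesis
    using x basis(1) by auto
qed

text \<open>\<open>relation_rank\<close> is a \<open>LEAST\<close>, meaningful only once a
  presentation on \<open>generator_rank\<close> generators exists. In any presentation with a larger
  basis, \<open>card_basis_le\<close> forces a relator with a linear coefficient nonzero modulo
  \<open>p\<close>, and the corresponding generator is eliminated.\<close>

lemma minimal_presentation:
  assumes "finitely_presented_pro_p_group p G T"
  obtains F S B R \<pi> where "presentation p G T F S B R \<pi>" "card B = generator_rank G T"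
    "card R = relation_rank p G T"
proof -
  have gp: "pro_p_group p G T"
    using assms by (simp add: finitely_presented_pro_p_group_def)
  let ?P = "\<lambda>n. \<exists>m. has_pro_p_presentation p G T n m"
  have ge: "generator_rank G T \<le> n" if P: "?P n" for n
  proof -
    obtain m where "has_pro_p_presentation p G T n m"
      using P by blast
    then obtain F S B R \<pi> where "presentation p G T F S B R \<pi>" "card B = n"
      by (rule presentationE[OF _ gp])
    then interpret presentation p G T F S B R \<pi>
      by simp
    have "generator_rank G T \<le> card (\<pi> ` B)"
      using basis by (intro generator_rank_le basis_generates) auto
    also have "\<dots> \<le> n"
      using card_image_le[OF basis(1)] \<open>card B = n\<close> by blast
    finally show ?thesis .
  qed
  have step: "?P (n - 1)" if P: "?P n" and gt: "generator_rank G T < n" for n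
  proof -
    obtain m where "has_pro_p_presentation p G T n m"
      using P by blast
    then obtain F S B R \<pi> where pres: "presentation p G T F S B R \<pi>" and cB: "card B = n"
      by (rule presentationE[OF _ gp])
    interpret presentation p G T F S B R \<pi>
      by (rule pres)
    \<comment> \<open>Length two suffices, as only linear coefficients are inspected.\<close>
    obtain h where mag: "magnus p G T F S B R \<pi> 2 h"
      using obtain_magnus[of 2] by auto
    interpret magnus p G T F S B R \<pi> 2 h
      by (rule mag)
    obtain A where A: "A \<subseteq> carrier G" "finite A" "T closure_of (generate G A) = carrier G" "card A = generator_rank G T"
      using generator_rank_attained[OF _ _ basis_generates] basis
        by (metis finite_imageI pi.hom_closed image_subsetI subsetD)
    have "\<not> (\<forall>r\<in>R. \<forall>x\<in>B. int p dvd lin x r)"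
      using card_basis_le[OF _ A(1-3)] A(4) gt cB by fastforce
    then obtain r x where rx: "r \<in> R" "x \<in> B" "\<not> int p dvd lin x r"
      by blast
    have "T closure_of (generate G (\<pi> ` (B - {x}))) = carrier G"
      by (rule redundant_generator[OF rels_in_kernel[OF rx(1)] rx(2,3)])
    then show ?thesis
      using eliminate_generator[OF rx(2)] cB by simp
  qed
  obtain n where n: "?P n"
    using assms by (auto simp: finitely_presented_pro_p_group_def)
  have "generator_rank G T \<le> n"
    by (rule ge[OF n])
  then have "?P (generator_rank G T)"
    using n
  proof (induction "n - generator_rank G T" arbitrary: n)
    case 0
    then show ?case by simp
  next
    case (Suc k)
    have "k = n - 1 - generator_rank G T" "generator_rank G T \<le> n - 1" "generator_rank G T < n"
      using Suc.hyps(2) by linarith+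
    then show ?case
      using Suc.hyps(1)[of "n - 1"] step[OF Suc.prems(2)] by blast
  qed
  then have "has_pro_p_presentation p G T (generator_rank G T) (relation_rank p G T)"
    unfolding relation_rank_def by (rule LeastI_ex)
  then show ?thesis
    using that by (rule presentationE[OF _ gp])
qed

section \<open>Slow chains\<close>

text \<open>\<open>N_p\<close>-series, also called restricted filtrations, in the sense of Lazard;
  the indexing starts with \<open>D 1\<close> as the whole group.\<close>

definition open_Np_series :: "nat \<Rightarrow> ('a, 'm) monoid_scheme \<Rightarrow> 'a topology \<Rightarrow> (nat \<Rightarrow> 'a set) \<Rightarrow> bool" where
  "open_Np_series p G T D \<longleftrightarrow>
     (\<forall>n. subgroup (D n) G \<and> openin T (D n) \<and> D (Suc n) \<subseteq> D n) \<and> D 1 = carrier G \<and>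
     (\<forall>i j. \<forall>x\<in>D i. \<forall>y\<in>D j. x \<otimes>\<^bsub>G\<^esub> y \<otimes>\<^bsub>G\<^esub> inv\<^bsub>G\<^esub> x \<otimes>\<^bsub>G\<^esub> inv\<^bsub>G\<^esub> y \<in> D (i + j)) \<and>
     (\<forall>i. \<forall>x\<in>D i. x [^]\<^bsub>G\<^esub> p \<in> D (p * i))"

text \<open>A slow chain bounds the dimensions of all quotients of the group algebra by powers of the augmentation
  ideal, without reference to that ideal.\<close>
definition slow_chain :: "nat \<Rightarrow> ('a, 'm) monoid_scheme \<Rightarrow> 'a topology \<Rightarrow> nat \<Rightarrow> (nat \<Rightarrow> 'a set) \<Rightarrow> bool" where
  "slow_chain p G T K E \<longleftrightarrow>
     E 1 = carrier G \<and>
     (\<forall>j\<ge>1. E j \<subseteq> carrier G \<and>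
        (\<exists>C. finite C \<and> card C \<le> K \<and> C \<subseteq> E j \<and> (\<forall>g\<in>E j. \<exists>t\<in>C. \<exists>g'\<in>E (Suc j). g = t \<otimes>\<^bsub>G\<^esub> g'))) \<and>
     (\<forall>D. open_Np_series p G T D \<longrightarrow> (\<forall>j\<ge>1. E j \<subseteq> D j))"

section \<open>Filtrations of the group induced by ideals\<close>

lemma one_plus_power:
  fixes c :: "'a::ring_1"
  shows "(1 + c) ^ n = (\<Sum>k\<le>n. of_nat (n choose k) * c ^ k)"
proof (induction n)
  case (Suc n)
  have "(\<Sum>k\<le>n. of_nat (n choose k) * c ^ k) = (\<Sum>k\<le>Suc n. of_nat (n choose k) * c ^ k)"
    by (simp add: binomial_eq_0)
  also have "\<dots> = 1 + (\<Sum>k\<le>n. of_nat (n choose Suc k) * c ^ Suc k)"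
    by (subst sum.atMost_Suc_shift) simp
  finally have 1: "(\<Sum>k\<le>n. of_nat (n choose k) * c ^ k) = 1 + (\<Sum>k\<le>n. of_nat (n choose Suc k) * c ^ Suc k)" .
  have "(1 + c) ^ Suc n = (\<Sum>k\<le>n. of_nat (n choose k) * c ^ k) * (1 + c)"
    by (simp only: power_Suc2 Suc.IH)
  also have "\<dots> = (\<Sum>k\<le>n. of_nat (n choose k) * c ^ k) + (\<Sum>k\<le>n. of_nat (n choose k) * c ^ Suc k)"
    by (simp only: distrib_left mult_1_right sum_distrib_right mult.assoc power_Suc2)
  also have "\<dots> = 1 + (\<Sum>k\<le>n. of_nat (Suc n choose Suc k) * c ^ Suc k)"
    unfolding 1 by (simp add: sum.distrib distrib_right)
  also have "\<dots> = (\<Sum>k\<le>Suc n. of_nat (Suc n choose k) * c ^ k)"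
    by (subst sum.atMost_Suc_shift) simp
  finally show ?case .
qed simp

text \<open>In the binomial expansion the middle coefficients are multiples of \<open>p\<close>,
  which lies in \<open>J (p * i)\<close>, and the last term is \<open>c ^ p\<close>.\<close>

lemma (in ring_filtration) one_plus_power_prime:
  assumes p: "Factorial_Ring.prime p" and pJ: "of_nat p \<in> J (p * i)" and c: "c \<in> J i"
  shows "(1 + c) ^ p - 1 \<in> J (p * i)"
proof -
  have p1: "p > 1"
    using p by (rule prime_gt_1_nat)
  have "(\<Sum>k\<in>{..p} - {0}. of_nat (p choose k) * c ^ k) \<in> J (p * i)"
  proof (rule add_subgroup_sum[OF subgroup])
    fix k assume k: "k \<in> {..p} - {0}"
    show "of_nat (p choose k) * c ^ k \<in> J (p * i)"
    proof (cases "k = p")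
      case True
      have "c ^ p \<in> J (p * i)"
        using power[OF c, of p] by (simp add: mult.commute)
      then show ?thesis
        by (simp add: True)
    next
      case False
      then have "p dvd p choose k"
        using k p by (intro dvd_choose_prime) auto
      then obtain q where q: "p choose k = p * q"
        by (rule dvdE)
      have "of_nat p * (of_nat q * c ^ k) \<in> J (p * i)"
        by (rule mult_right[OF pJ])
      then show ?thesis
        by (simp add: q mult.assoc)
    qed
  qed
  moreover have "(1 + c) ^ p = 1 + (\<Sum>k\<in>{..p} - {0}. of_nat (p choose k) * c ^ k)"
    unfolding one_plus_power by (subst sum.remove[of _ 0]) auto
  ultimately show ?thesis
    by simp
qed

text \<open>\<open>h\<close> is multiplicative only modulo \<open>low p B N\<close>, so the
  filtration has to stay constant from \<open>N\<close> on; then \<open>J N\<close> lies in every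
  level, as \<open>magnus_filtration\<close> asks.\<close>

lemma ring_filtration_truncate:
  assumes "ring_filtration J"
  shows "ring_filtration (\<lambda>n. J (min n N))"
proof -
  interpret ring_filtration J
    by (rule assms)
  show ?thesis
  proof
    show "a * b \<in> J (min (i + j) N)" if "a \<in> J (min i N)" "b \<in> J (min j N)" for a b i j
      by (rule mult_mono[OF that]) simp
  qed (auto simp: subgroup filt_0 intro: subsetD[OF filt_antimono, rotated])
qed

locale magnus_filtration = magnus + ring_filtration J for J :: "nat \<Rightarrow> nat set ncs set" +
  assumes low_J: "low p B n \<subseteq> J n" and J_N: "J N \<subseteq> J n" and rels_J: "r \<in> R \<Longrightarrow> h r - 1 \<in> J N"
begin

lemma h_mult_J:
  assumes "u \<in> carrier F" "v \<in> carrier F"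
  shows "h (u \<otimes>\<^bsub>F\<^esub> v) - h u * h v \<in> J n"
  using h_mult[OF assms] low_J[of N] J_N[of n] by blast

lemma h_inv_J:
  assumes "u \<in> carrier F"
  shows "h (inv\<^bsub>F\<^esub> u) * h u - 1 \<in> J n" "h u * h (inv\<^bsub>F\<^esub> u) - 1 \<in> J n"
  using diff_commute[OF h_mult_J[of "inv\<^bsub>F\<^esub> u" u n]] diff_commute[OF h_mult_J[of u "inv\<^bsub>F\<^esub> u" n]] assms
  by (simp_all add: h_one)

definition U :: "nat \<Rightarrow> nat set set" where
  "U n = {u \<in> carrier F. h u - 1 \<in> J n}"

lemma U_mult: "u \<in> U n \<Longrightarrow> v \<in> U n \<Longrightarrow> u \<otimes>\<^bsub>F\<^esub> v \<in> U n"
proof -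
  assume u: "u \<in> U n" and v: "v \<in> U n"
  then have uv: "u \<in> carrier F" "v \<in> carrier F" "h u - 1 \<in> J n" "h v - 1 \<in> J n"
    by (auto simp: U_def)
  have "(h (u \<otimes>\<^bsub>F\<^esub> v) - h u * h v) + (h u - 1) * h v + (h v - 1) \<in> J n"
    by (intro add h_mult_J mult_right uv)
  then show "u \<otimes>\<^bsub>F\<^esub> v \<in> U n"
    using uv(1,2) by (simp add: U_def algebra_simps)
qed

lemma U_subgroup: "subgroup (U n) F"
proof (rule F.subgroupI)
  show "U n \<subseteq> carrier F"
    by (auto simp: U_def)
  have "\<one>\<^bsub>F\<^esub> \<in> U n"
    by (simp add: U_def h_one zero)
  then show "U n \<noteq> {}"
    by blast
  show "inv\<^bsub>F\<^esub> u \<in> U n" if u: "u \<in> U n" for u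
  proof -
    have uc: "u \<in> carrier F" "h u - 1 \<in> J n"
      using u by (auto simp: U_def)
    have "(h (inv\<^bsub>F\<^esub> u) * h u - 1) - h (inv\<^bsub>F\<^esub> u) * (h u - 1) \<in> J n"
      by (intro diff h_inv_J mult_left uc)
    then show ?thesis
      using uc(1) by (simp add: U_def algebra_simps)
  qed
qed (rule U_mult)

lemma U_open: "openin S (U n)"
  unfolding U_def by (rule lin_open)

text \<open>With \<open>a = h u\<close> and \<open>b = h v\<close>, the difference
  \<open>a * b - b * a\<close> equals \<open>(a - 1) * (b - 1) - (b - 1) * (a - 1)\<close> and so
  lies in \<open>J (i + j)\<close>; the value of \<open>h\<close> at the commutator minus 1 is this
  times the values at the inverses, up to the defects of \<open>h\<close>.\<close>

lemma U_comm:
  assumes u: "u \<in> U i" and v: "v \<in> U j"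
  shows "u \<otimes>\<^bsub>F\<^esub> v \<otimes>\<^bsub>F\<^esub> inv\<^bsub>F\<^esub> u \<otimes>\<^bsub>F\<^esub> inv\<^bsub>F\<^esub> v \<in> U (i + j)"
proof -
  have uv: "u \<in> carrier F" "v \<in> carrier F" "h u - 1 \<in> J i" "h v - 1 \<in> J j"
    using u v by (auto simp: U_def)
  let ?a = "h u" and ?b = "h v" and ?a' = "h (inv\<^bsub>F\<^esub> u)" and ?b' = "h (inv\<^bsub>F\<^esub> v)" and ?n = "i + j"
  have "(?a - 1) * (?b - 1) - (?b - 1) * (?a - 1) \<in> J ?n"
    using filt_mult[OF uv(3,4)] filt_mult[OF uv(4,3)] by (intro diff) (simp_all add: add.commute)
  then have "(?a * ?b - ?b * ?a) * (?a' * ?b') \<in> J ?n"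
    by (intro mult_right) (simp add: algebra_simps)
  moreover have "?b * (?a * ?a' - 1) * ?b' + (?b * ?b' - 1) \<in> J ?n"
    by (intro add mult_right mult_left h_inv_J uv)
  moreover have "h (u \<otimes>\<^bsub>F\<^esub> v \<otimes>\<^bsub>F\<^esub> inv\<^bsub>F\<^esub> u \<otimes>\<^bsub>F\<^esub> inv\<^bsub>F\<^esub> v) - ?a * ?b * ?a' * ?b' \<in> J ?n"
  proof -
    have "h (u \<otimes>\<^bsub>F\<^esub> v \<otimes>\<^bsub>F\<^esub> inv\<^bsub>F\<^esub> u) - ?a * ?b * ?a' \<in> J ?n"
      using diff_trans[OF h_mult_J mult_right[OF h_mult_J[OF uv(1,2), of ?n], unfolded left_diff_distrib]] uv(1,2)
      by simp
    from diff_trans[OF h_mult_J mult_right[OF this, unfolded left_diff_distrib]] show ?thesis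
      using uv(1,2) by simp
  qed
  ultimately have "(h (u \<otimes>\<^bsub>F\<^esub> v \<otimes>\<^bsub>F\<^esub> inv\<^bsub>F\<^esub> u \<otimes>\<^bsub>F\<^esub> inv\<^bsub>F\<^esub> v) - ?a * ?b * ?a' * ?b')
      + ((?a * ?b - ?b * ?a) * (?a' * ?b') + (?b * (?a * ?a' - 1) * ?b' + (?b * ?b' - 1))) \<in> J ?n"
    by (intro add[OF _ add])
  also have "(h (u \<otimes>\<^bsub>F\<^esub> v \<otimes>\<^bsub>F\<^esub> inv\<^bsub>F\<^esub> u \<otimes>\<^bsub>F\<^esub> inv\<^bsub>F\<^esub> v) - ?a * ?b * ?a' * ?b')
      + ((?a * ?b - ?b * ?a) * (?a' * ?b') + (?b * (?a * ?a' - 1) * ?b' + (?b * ?b' - 1)))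
      = h (u \<otimes>\<^bsub>F\<^esub> v \<otimes>\<^bsub>F\<^esub> inv\<^bsub>F\<^esub> u \<otimes>\<^bsub>F\<^esub> inv\<^bsub>F\<^esub> v) - 1"
    by (simp add: left_diff_distrib right_diff_distrib mult.assoc)
  finally show ?thesis
    using uv(1,2) by (simp add: U_def)
qed

lemma h_pow: "u \<in> carrier F \<Longrightarrow> h (u [^]\<^bsub>F\<^esub> (k::nat)) - h u ^ k \<in> J n"
proof (induction k)
  case 0
  then show ?case
    by (simp add: h_one zero)
next
  case (Suc k)
  have "h (u [^]\<^bsub>F\<^esub> k \<otimes>\<^bsub>F\<^esub> u) - h (u [^]\<^bsub>F\<^esub> k) * h u \<in> J n"
    using Suc.prems by (intro h_mult_J) auto
  from diff_trans[OF this mult_right[OF Suc.IH[OF Suc.prems], of "h u", unfolded left_diff_distrib]]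
  show ?case
    by (simp only: F.nat_pow_Suc power_Suc2)
qed

lemma U_pow:
  assumes u: "u \<in> U i"
  shows "u [^]\<^bsub>F\<^esub> p \<in> U (p * i)"
proof -
  have uc: "u \<in> carrier F" "h u - 1 \<in> J i"
    using u by (auto simp: U_def)
  have "of_nat p \<in> J (p * i)"
    using of_nat_in_low low_J by blast
  from one_plus_power_prime[OF prime this uc(2)] have "h u ^ p - 1 \<in> J (p * i)"
    by simp
  with h_pow[OF uc(1)] have "h (u [^]\<^bsub>F\<^esub> p) - 1 \<in> J (p * i)"
    by (rule diff_trans)
  then show ?thesis
    using uc(1) by (simp add: U_def)
qed

lemma kernel_U: "kernel F G \<pi> \<subseteq> U n"
proof -
  have sub: "subgroup (U N) F"
    by (rule U_subgroup)
  have "U N \<lhd> F"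
  proof (rule F.normal_invI[OF sub])
    fix u v assume u: "u \<in> carrier F" and v: "v \<in> U N"
    have vc: "v \<in> carrier F"
      using v by (simp add: U_def)
    \<comment> \<open>Normality of \<open>U N\<close> is the commutator rule with
      \<open>i = 0\<close>, since \<open>U 0\<close> is the whole group.\<close>
    have "u \<in> U 0"
      using u by (simp add: U_def filt_0)
    from U_comm[OF this v] have "u \<otimes>\<^bsub>F\<^esub> v \<otimes>\<^bsub>F\<^esub> inv\<^bsub>F\<^esub> u \<otimes>\<^bsub>F\<^esub> inv\<^bsub>F\<^esub> v \<in> U N"
      by simp
    from U_mult[OF this v] show "u \<otimes>\<^bsub>F\<^esub> v \<otimes>\<^bsub>F\<^esub> inv\<^bsub>F\<^esub> u \<in> U N"
      using u vc by (simp add: F.m_assoc)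
  qed
  moreover have "closedin S (U N)"
    by (rule F.closedin_open_subgroup[OF sub U_open])
  moreover have "R \<subseteq> U N"
    using rels(1) rels_J by (auto simp: U_def)
  ultimately have "kernel F G \<pi> \<subseteq> U N"
    by (rule kernel_minimal)
  also have "U N \<subseteq> U n"
    using J_N by (auto simp: U_def)
  finally show ?thesis .
qed

lemma image_U_series: "open_Np_series p G T (\<lambda>n. \<pi> ` U n)"
  unfolding open_Np_series_def
proof (intro conjI allI ballI)
  show "subgroup (\<pi> ` U n) G" for n
    by (rule pi.subgroup_img_is_subgroup[OF U_subgroup])
  show "openin T (\<pi> ` U n)" for n
    by (rule openin_image[OF U_subgroup U_open kernel_U])
  show "\<pi> ` U (Suc n) \<subseteq> \<pi> ` U n" for n
    using filt_antimono[of n "Suc n"] by (intro image_mono) (auto simp: U_def)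
  have "U 1 = carrier F"
    using h_aug low_J[of 1] by (auto simp: U_def)
  then show "\<pi> ` U 1 = carrier G"
    by (simp add: pi_surj)
  fix i j x y assume "x \<in> \<pi> ` U i"
  then obtain u where u: "u \<in> U i" "x = \<pi> u"
    by blast
  then have uc: "u \<in> carrier F"
    by (simp add: U_def)
  have "\<pi> (u [^]\<^bsub>F\<^esub> p) \<in> \<pi> ` U (p * i)"
    by (rule imageI[OF U_pow[OF u(1)]])
  then show "x [^] p \<in> \<pi> ` U (p * i)"
    using uc by (simp add: u(2) pi.hom_nat_pow)
  assume "y \<in> \<pi> ` U j"
  then obtain v where v: "v \<in> U j" "y = \<pi> v"
    by blast
  then have vc: "v \<in> carrier F"
    by (simp add: U_def)
  have "\<pi> (u \<otimes>\<^bsub>F\<^esub> v \<otimes>\<^bsub>F\<^esub> inv\<^bsub>F\<^esub> u \<otimes>\<^bsub>F\<^esub> inv\<^bsub>F\<^esub> v) \<in> \<pi> ` U (i + j)"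
    by (rule imageI[OF U_comm[OF u(1) v(1)]])
  then show "x \<otimes> y \<otimes> inv x \<otimes> inv y \<in> \<pi> ` U (i + j)"
    using uc vc by (simp add: u(2) v(2))
qed

lemma image_U_D:
  assumes u: "u \<in> carrier F" and mem: "\<pi> u \<in> \<pi> ` U n"
  shows "h u - 1 \<in> J n"
proof -
  obtain v where v: "v \<in> U n" "\<pi> u = \<pi> v"
    using mem by blast
  have vc: "v \<in> carrier F"
    using v(1) by (simp add: U_def)
  have "inv\<^bsub>F\<^esub> v \<otimes>\<^bsub>F\<^esub> u \<in> kernel F G \<pi>"
    using u vc v(2) by (simp add: kernel_def)
  then have "inv\<^bsub>F\<^esub> v \<otimes>\<^bsub>F\<^esub> u \<in> U n"
    using kernel_U by blast
  from U_mult[OF v(1) this] have "u \<in> U n"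
    using u vc by (simp add: F.m_assoc[symmetric])
  then show ?thesis
    by (simp add: U_def)
qed

text \<open>The chain is pulled back to \<open>F\<close>, where it descends at least as fast as
  \<open>U\<close>. Then \<open>chain_spanning_set\<close> with \<open>j = 1\<close>,
  \<open>k = N\<close> and \<open>a = 1\<close> replaces every \<open>h u\<close> by an element of a
  small span, and \<open>generators_span\<close> extends this to all series.\<close>

lemma index_bound:
  assumes chain: "slow_chain p G T K E" and s: "0 < s" "s < 1"
  shows "\<exists>c. add_index (J N) \<le> p ^ c \<and> real c \<le> exp (K / (1 - s)) / s ^ N"
proof -
  define E' where "E' j = {u \<in> carrier F. \<pi> u \<in> E j}" for j
  have E1: "E 1 = carrier G"
    using chain by (simp add: slow_chain_def)
  have E'1: "E' 1 = carrier F"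
    unfolding E'_def E1 by auto
  have hE: "h u - 1 \<in> J j" if "1 \<le> j" "u \<in> E' j" for j u
  proof (rule image_U_D)
    show "u \<in> carrier F"
      using that(2) by (simp add: E'_def)
    have "E j \<subseteq> \<pi> ` U j"
      using chain image_U_series that(1) unfolding slow_chain_def by blast
    then show "\<pi> u \<in> \<pi> ` U j"
      using that(2) by (auto simp: E'_def)
  qed
  have dec: "\<exists>C. finite C \<and> card C \<le> K \<and> C \<subseteq> E' j \<and>
      (\<forall>g\<in>E' j. \<exists>t\<in>C. \<exists>g'\<in>E' (Suc j). g = t \<otimes>\<^bsub>F\<^esub> g')" if j: "1 \<le> j" for j
  proof -
    have Ej: "E j \<subseteq> carrier G"
      using chain j by (simp add: slow_chain_def)
    obtain C where C: "finite C" "card C \<le> K" "C \<subseteq> E j"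
      and cov: "\<forall>g\<in>E j. \<exists>t\<in>C. \<exists>g'\<in>E (Suc j). g = t \<otimes> g'"
      using chain j unfolding slow_chain_def by metis
    have "\<forall>a\<in>C. \<exists>u. u \<in> carrier F \<and> \<pi> u = a"
      using C(3) Ej pi_surj by (metis imageE subsetD)
    then obtain l where l: "\<forall>a\<in>C. l a \<in> carrier F \<and> \<pi> (l a) = a"
      by (rule bchoice[THEN exE])
    have "finite (l ` C)" "card (l ` C) \<le> K" "l ` C \<subseteq> E' j"
      using C card_image_le[OF C(1), of l] l by (auto simp: E'_def)
    moreover have "\<exists>t\<in>l ` C. \<exists>g'\<in>E' (Suc j). g = t \<otimes>\<^bsub>F\<^esub> g'" if "g \<in> E' j" for g
    proof -
      have g: "g \<in> carrier F" "\<pi> g \<in> E j"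
        using that by (auto simp: E'_def)
      obtain t g' where t: "t \<in> C" and g': "g' \<in> E (Suc j)" and eq: "\<pi> g = t \<otimes> g'"
        using cov g(2) by blast
      have lt: "l t \<in> carrier F" "\<pi> (l t) = t"
        using l t by auto
      have "E (Suc j) \<subseteq> carrier G"
        using chain by (simp add: slow_chain_def)
      then have g'c: "g' \<in> carrier G"
        using g' by blast
      have tc: "t \<in> carrier G"
        using pi.hom_closed[OF lt(1)] lt(2) by simp
      have "\<pi> (inv\<^bsub>F\<^esub> (l t) \<otimes>\<^bsub>F\<^esub> g) = inv t \<otimes> (t \<otimes> g')"
        using lt g eq by simp
      also have "\<dots> = g'"
        using tc g'c by (simp add: m_assoc[symmetric])
      finally have "inv\<^bsub>F\<^esub> (l t) \<otimes>\<^bsub>F\<^esub> g \<in> E' (Suc j)"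
        using g' lt(1) g(1) by (simp add: E'_def)
      moreover have "g = l t \<otimes>\<^bsub>F\<^esub> (inv\<^bsub>F\<^esub> (l t) \<otimes>\<^bsub>F\<^esub> g)"
        using lt(1) g(1) by (simp add: F.m_assoc[symmetric])
      ultimately show ?thesis
        using t by blast
    qed
    ultimately show ?thesis
      by blast
  qed
  have "\<exists>Y. finite Y \<and> real (card Y) \<le> (\<Prod>i=1..<N. 1 + K * s ^ i) / s ^ N \<and>
    (\<forall>a\<in>J (N - N). \<forall>f\<in>E' 1. \<exists>y\<in>zmod.span Y. a * h f - a * y \<in> J N)"
  proof (rule chain_spanning_set[where m = "\<lambda>u v. u \<otimes>\<^bsub>F\<^esub> v"])
    show "h (f \<otimes>\<^bsub>F\<^esub> g) - h f * h g \<in> J N" if "f \<in> E' 1" "g \<in> E' 1" for f g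
      using that by (intro h_mult_J) (auto simp: E'_def)
    show "E' j \<subseteq> E' 1" if "1 \<le> j" for j
      unfolding E'1 by (auto simp: E'_def)
  qed (use hE dec s in auto)
  then obtain Y where Y: "finite Y" "real (card Y) \<le> (\<Prod>i=1..<N. 1 + K * s ^ i) / s ^ N"
    and span: "\<forall>a\<in>J (N - N). \<forall>f\<in>E' 1. \<exists>y\<in>zmod.span Y. a * h f - a * y \<in> J N"
    by blast
  have hY: "\<exists>y\<in>zmod.span Y. h u - y \<in> J N" if "u \<in> carrier F" for u
    using bspec[OF bspec[OF span, of 1], of u] that by (simp add: filt_0 E'1[simplified])
  have all: "\<exists>y\<in>zmod.span Y. a - y \<in> J N" for a
  proof (rule generators_span[OF basis(1) ring_filtration_axioms low_J F.one_closed, where m = "\<lambda>u v. u \<otimes>\<^bsub>F\<^esub> v"])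
    show "h \<one>\<^bsub>F\<^esub> - 1 \<in> J N"
      by (simp add: h_one zero)
    show "\<exists>f\<in>carrier F. h f - (1 + ncs_X x) \<in> J N" if "x \<in> B" for x
      using h_gen[OF that] low_J basis(2) that by blast
  qed (use hY h_mult_J in auto)
  have p0: "p > 0"
    using prime by (rule prime_gt_0_nat)
  have "add_index (J N) \<le> p ^ card Y"
  proof (rule add_index_le_power[OF subgroup p0 _ Y(1) all])
    show "of_nat p * a \<in> J N" for a
      using mult_right[of "of_nat p" N] of_nat_in_low low_J by blast
  qed
  moreover have "real (card Y) \<le> exp (K / (1 - s)) / s ^ N"
    using Y(2) prod_one_plus_le_exp[OF s, of K N] s by (smt (verit) divide_right_mono zero_le_power)
  ultimately show ?thesis
    by blast
qed

end

section \<open>Lower bound against upper bound\<close>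

lemma (in magnus) lower_bound:
  assumes min: "card B = generator_rank G T" and t: "0 < t" and quad: "1 - real (card B) * t + real (card R) * t\<^sup>2 \<le> 0"
  shows "t \<le> log p (add_index (rel_ideal p B ((\<lambda>r. h r - 1) ` R) N)) * t ^ N"
proof -
  have p: "p > 1"
    using prime by (rule prime_gt_1_nat)
  let ?R = "(\<lambda>r. h r - 1) ` R"
  interpret relators p B ?R
    using p basis(1) rels(2) rels_low[OF min] by unfold_locales auto
  have pos: "add_index (I n) \<ge> 1" for n
    using add_index_pos[OF rel_ideal_finite_index[OF p_pos finite_B, of ?R n]] by linarith
  let ?b = "\<lambda>n. log p (add_index (I n))"
  show ?thesis
  proof (rule gs_growth[where b = ?b])
    show "0 \<le> ?b n" for n
      using p pos[of n] by (simp add: zero_le_log_cancel_iff)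
    show "?b 0 = 0"
      by (simp add: rel.filt_0 add_index_UNIV)
    show "1 + real (card B) * ?b n \<le> ?b (Suc n) + real (card R) * ?b (n - 1)" for n
    proof -
      have "p * add_index (I n) ^ card B \<le> add_index (I (Suc n)) * add_index (I (n - 1)) ^ card ?R"
        by (rule golod_shafarevich)
      \<comment> \<open>Distinct relators may have the same image, so only
        \<open>card ?R \<le> card R\<close> is known.\<close>
      also have "\<dots> \<le> add_index (I (Suc n)) * add_index (I (n - 1)) ^ card R"
        using pos card_image_le[OF rels(2)] by (intro mult_left_mono power_increasing) auto
      finally have le: "real p * real (add_index (I n)) ^ card B
          \<le> real (add_index (I (Suc n))) * real (add_index (I (n - 1))) ^ card R"
        by (simp flip: of_nat_power of_nat_mult)
      have pos': "real (add_index (I n)) > 0" for n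
        using pos[of n] by simp
      have "1 + real (card B) * ?b n = log p (real p * real (add_index (I n)) ^ card B)"
        using p pos' by (simp add: log_mult log_nat_power)
      also have "\<dots> \<le> log p (real (add_index (I (Suc n))) * real (add_index (I (n - 1))) ^ card R)"
        using p pos' le by (subst log_le_cancel_iff) auto
      also have "\<dots> = ?b (Suc n) + real (card R) * ?b (n - 1)"
        using p pos' by (simp add: log_mult log_nat_power)
      finally show ?thesis .
    qed
    show "N > 0"
      using N2 by simp
  qed (use t quad in simp_all)
qed

theorem slow_chain_imp_relation_rank:
  assumes fp: "finitely_presented_pro_p_group p G T" and d: "generator_rank G T > 1"
    and ne: "\<not> (generator_rank G T = 2 \<and> relation_rank p G T = 1)" and chain: "slow_chain p G T K E"
  shows "real (relation_rank p G T) > (real (generator_rank G T))\<^sup>2 / 4"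
proof (rule ccontr)
  assume "\<not> ?thesis"
  then have "real (relation_rank p G T) \<le> (real (generator_rank G T))\<^sup>2 / 4"
    by simp
  then obtain t :: real where t: "0 < t" "t < 1"
    and quad: "1 - generator_rank G T * t + relation_rank p G T * t\<^sup>2 \<le> 0"
    by (rule gs_quadratic_root[OF d _ ne])
  \<comment> \<open>Any \<open>s\<close> strictly between \<open>t\<close> and 1 would do:
    \<open>s < 1\<close> gives a constant \<open>?C\<close> free of \<open>N\<close>, and
    \<open>t < s\<close> makes \<open>(t / s) ^ N\<close> tend to 0.\<close>
  define s where "s = (t + 1) / 2"
  have s: "0 < s" "s < 1" "t < s"
    using t by (auto simp: s_def)
  obtain F S B R \<pi> where pres: "presentation p G T F S B R \<pi>" and cB: "card B = generator_rank G T"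
    and cR: "card R = relation_rank p G T"
    by (rule minimal_presentation[OF fp])
  interpret presentation p G T F S B R \<pi>
    by (rule pres)
  have p: "p > 1"
    using prime by (rule prime_gt_1_nat)
  let ?C = "exp (K / (1 - s))"
  have le: "t \<le> ?C * (t / s) ^ N" if N: "N \<ge> 2" for N
  proof -
    obtain h where mag: "magnus p G T F S B R \<pi> N h"
      by (rule obtain_magnus[OF N])
    interpret magnus p G T F S B R \<pi> N h
      by (rule mag)
    let ?R = "(\<lambda>r. h r - 1) ` R"
    let ?J = "\<lambda>n. rel_ideal p B ?R (min n N)"
    interpret J: ring_filtration ?J
      by (rule ring_filtration_truncate) unfold_locales
    interpret J: magnus_filtration p G T F S B R \<pi> N h ?J
    proof unfold_locales
      show "low p B n \<subseteq> ?J n" for n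
        using low.filt_antimono[of "min n N" n p B] by (auto intro: rel_ideal.low)
      show "?J N \<subseteq> ?J n" for n
        by (rule rel.filt_antimono) simp
      show "h r - 1 \<in> ?J N" if "r \<in> R" for r
        using rel_ideal.gen[of "h r - 1" ?R 1 1 p B "min N N"] that by simp
    qed
    obtain c where c: "add_index (rel_ideal p B ?R N) \<le> p ^ c" "real c \<le> ?C / s ^ N"
      using J.index_bound[OF chain s(1,2)] by auto
    have pos: "add_index (rel_ideal p B ?R N) > 0"
      using add_index_pos[OF rel_ideal_finite_index[OF _ basis(1)]] p by simp
    have "log p (add_index (rel_ideal p B ?R N)) \<le> log p (p ^ c)"
      using p pos c(1) by (subst log_le_cancel_iff) (auto simp flip: of_nat_power)
    also have "\<dots> = c"
      using p by simp
    finally have "log p (add_index (rel_ideal p B ?R N)) \<le> ?C / s ^ N"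
      using c(2) by simp
    then have "log p (add_index (rel_ideal p B ?R N)) * t ^ N \<le> ?C / s ^ N * t ^ N"
      using t by (intro mult_right_mono) auto
    moreover have "t \<le> log p (add_index (rel_ideal p B ?R N)) * t ^ N"
      using quad by (intro lower_bound cB t(1)) (simp add: cB cR)
    ultimately show ?thesis
      by (simp add: power_divide)
  qed
  have "(\<lambda>N. ?C * (t / s) ^ N) \<longlonglongrightarrow> ?C * 0"
    using t s by (intro tendsto_mult tendsto_const LIMSEQ_power_zero) auto
  then have "t \<le> ?C * 0"
    by (rule LIMSEQ_le_const) (use le in blast)
  then show False
    using t by simp
qed

section \<open>Tools for building slow chains\<close>

lemma (in group) coset_cover:
  assumes E: "E \<subseteq> carrier G" and Z: "finite Z" "card Z \<le> K" "\<kappa> ` E \<subseteq> Z"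
    and eq: "\<And>x y. x \<in> E \<Longrightarrow> y \<in> E \<Longrightarrow> \<kappa> x = \<kappa> y \<Longrightarrow> inv x \<otimes> y \<in> E'"
  shows "\<exists>C. finite C \<and> card C \<le> K \<and> C \<subseteq> E \<and> (\<forall>g\<in>E. \<exists>t\<in>C. \<exists>g'\<in>E'. g = t \<otimes> g')"
proof -
  define r where "r z = (SOME x. x \<in> E \<and> \<kappa> x = z)" for z
  have r: "r (\<kappa> x) \<in> E \<and> \<kappa> (r (\<kappa> x)) = \<kappa> x" if "x \<in> E" for x
    unfolding r_def by (rule someI[of _ x]) (simp add: that)
  let ?C = "r ` \<kappa> ` E"
  have fin: "finite (\<kappa> ` E)"
    using Z(1,3) by (rule finite_subset[rotated])
  have "card ?C \<le> card (\<kappa> ` E)"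
    by (rule card_image_le[OF fin])
  also have "\<dots> \<le> K"
    using card_mono[OF Z(1,3)] Z(2) by linarith
  finally have "card ?C \<le> K" .
  moreover have "?C \<subseteq> E"
    using r by blast
  moreover have "\<exists>t\<in>?C. \<exists>g'\<in>E'. g = t \<otimes> g'" if g: "g \<in> E" for g
  proof -
    have rg: "r (\<kappa> g) \<in> E" "\<kappa> (r (\<kappa> g)) = \<kappa> g"
      using r[OF g] by auto
    have "inv (r (\<kappa> g)) \<otimes> g \<in> E'"
      by (rule eq[OF rg(1) g rg(2)])
    moreover have "g = r (\<kappa> g) \<otimes> (inv (r (\<kappa> g)) \<otimes> g)"
      using rg(1) g E by (simp add: m_assoc[symmetric] subset_iff)
    ultimately show ?thesis
      using g by blast
  qed
  ultimately show ?thesis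
    using fin by blast
qed

text \<open>Downward induction from a level \<open>I\<close> known to lie in \<open>S\<close>; when
  \<open>m\<close> exceeds \<open>I\<close>, monotonicity is enough. In the applications
  \<open>S\<close> is open, which provides \<open>I\<close>.\<close>

lemma (in group) descend_into_subgroup:
  assumes S: "subgroup S G" and dec: "\<And>i. \<Gamma> (Suc i) \<subseteq> \<Gamma> i" and top: "\<Gamma> I \<subseteq> S"
    and step: "\<And>i x. m \<le> i \<Longrightarrow> x \<in> \<Gamma> i \<Longrightarrow> \<exists>s\<in>S. \<exists>g\<in>\<Gamma> (Suc i). x = s \<otimes> g"
  shows "\<Gamma> (m::nat) \<subseteq> S"
proof (cases "m \<le> I")
  case True
  then show ?thesis
    using top
  proof (induction rule: inc_induct)
    case (step i)
    show ?case
    proof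
      fix x assume "x \<in> \<Gamma> i"
      then obtain s g where "s \<in> S" "g \<in> \<Gamma> (Suc i)" "x = s \<otimes> g"
        using assms(4)[OF step.hyps(1)] by blast
      then show "x \<in> S"
        using step.IH[OF step.prems] subgroup.m_closed[OF S] by blast
    qed
  qed
next
  case False
  then have "\<Gamma> m \<subseteq> \<Gamma> I"
    using lift_Suc_antimono_le[of \<Gamma>, OF dec] by simp
  then show ?thesis
    using top by simp
qed

section \<open>Compact groups of \<open>p\<close>-adic matrices\<close>

text \<open>\<open>a g k i j\<close> is the residue modulo \<open>p ^ k\<close> of the entry \<open>(i, j)\<close> of the matrix of \<open>g\<close>.\<close>
locale congruence_rep = topological_group G T for G (structure) and T +
  fixes p n :: nat and a :: "'a \<Rightarrow> nat \<Rightarrow> nat \<Rightarrow> nat \<Rightarrow> int"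
  assumes prime: "Factorial_Ring.prime p" and compact: "compact_space T"
    and a_range: "g \<in> carrier G \<Longrightarrow> i < n \<Longrightarrow> j < n \<Longrightarrow> a g k i j \<in> {0..<int p ^ k}"
    and a_coh: "g \<in> carrier G \<Longrightarrow> i < n \<Longrightarrow> j < n \<Longrightarrow> int p ^ k dvd a g (Suc k) i j - a g k i j"
    and a_mult: "g \<in> carrier G \<Longrightarrow> h \<in> carrier G \<Longrightarrow> i < n \<Longrightarrow> j < n \<Longrightarrow>
      int p ^ k dvd a (g \<otimes> h) k i j - (\<Sum>l<n. a g k i l * a h k l j)"
    and a_one: "i < n \<Longrightarrow> j < n \<Longrightarrow> int p ^ k dvd a \<one> k i j - (if i = j then 1 else 0)"
    and a_open: "i < n \<Longrightarrow> j < n \<Longrightarrow> openin T {g \<in> carrier G. a g k i j \<in> A}"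
    and a_inj: "g \<in> carrier G \<Longrightarrow>
      (\<And>k i j. i < n \<Longrightarrow> j < n \<Longrightarrow> int p ^ k dvd a g k i j - (if i = j then 1 else 0)) \<Longrightarrow> g = \<one>"
begin

definition e :: "'a \<Rightarrow> nat \<Rightarrow> nat \<Rightarrow> nat \<Rightarrow> int" where
  "e g k i j = a g k i j - (if i = j then 1 else 0)"

lemma e_coh:
  assumes "k \<le> l" "g \<in> carrier G" "i < n" "j < n"
  shows "int p ^ k dvd e g l i j - e g k i j"
  using assms(1)
proof (induction rule: dec_induct)
  case (step l)
  have "int p ^ k dvd e g (Suc l) i j - e g l i j"
    using dvd_trans[OF le_imp_power_dvd[OF step.hyps(1)] a_coh[OF assms(2-4)]] by (simp add: e_def)
  from dvd_add[OF this step.IH] show ?case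
    by simp
qed simp

lemma e_mult:
  assumes "g \<in> carrier G" "h \<in> carrier G" and ij: "i < n" "j < n"
  shows "int p ^ k dvd e (g \<otimes> h) k i j - (e g k i j + e h k i j + (\<Sum>l<n. e g k i l * e h k l j))"
proof -
  let ?d = "\<lambda>i j::nat. if i = j then 1 else 0 :: int"
  have 1: "(\<Sum>l<n. ?d i l * e h k l j) = e h k i j"
  proof -
    have "(\<Sum>l<n. ?d i l * e h k l j) = (\<Sum>l<n. if l = i then e h k i j else 0)"
      by (rule sum.cong) auto
    then show ?thesis
      using ij by simp
  qed
  have 2: "(\<Sum>l<n. e g k i l * ?d l j) = e g k i j"
  proof -
    have "(\<Sum>l<n. e g k i l * ?d l j) = (\<Sum>l<n. if l = j then e g k i j else 0)"
      by (rule sum.cong) auto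
    then show ?thesis
      using ij by simp
  qed
  have 3: "(\<Sum>l<n. ?d i l * ?d l j) = ?d i j"
  proof -
    have "(\<Sum>l<n. ?d i l * ?d l j) = (\<Sum>l<n. if l = i then ?d i j else 0)"
      by (rule sum.cong) auto
    then show ?thesis
      using ij by simp
  qed
  have "(\<Sum>l<n. a g k i l * a h k l j) = (\<Sum>l<n. (e g k i l + ?d i l) * (e h k l j + ?d l j))"
    by (simp add: e_def)
  also have "\<dots> = (\<Sum>l<n. e g k i l * e h k l j) + (\<Sum>l<n. e g k i l * ?d l j)
      + ((\<Sum>l<n. ?d i l * e h k l j) + (\<Sum>l<n. ?d i l * ?d l j))"
    unfolding sum.distrib[symmetric] by (rule sum.cong) (simp_all only: distrib_left distrib_right add_ac)
  finally have "(\<Sum>l<n. a g k i l * a h k l j) = (\<Sum>l<n. e g k i l * e h k l j) + e g k i j + (e h k i j + ?d i j)"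
    unfolding 1 2 3 .
  then have "a (g \<otimes> h) k i j - (\<Sum>l<n. a g k i l * a h k l j)
    = e (g \<otimes> h) k i j - (e g k i j + e h k i j + (\<Sum>l<n. e g k i l * e h k l j))"
    by (simp add: e_def)
  then show ?thesis
    using a_mult[OF assms, of k] by simp
qed

lemma e_one: "i < n \<Longrightarrow> j < n \<Longrightarrow> int p ^ k dvd e \<one> k i j"
  using a_one by (simp add: e_def)

definition \<Gamma> :: "nat \<Rightarrow> 'a set" where
  "\<Gamma> k = {g \<in> carrier G. \<forall>i<n. \<forall>j<n. int p ^ k dvd e g k i j}"

lemma Gamma_carrier: "g \<in> \<Gamma> k \<Longrightarrow> g \<in> carrier G"
  by (simp add: \<Gamma>_def)

lemma Gamma_dvd:
  assumes "g \<in> \<Gamma> k" "k \<le> l" "i < n" "j < n"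
  shows "int p ^ k dvd e g l i j"
proof -
  have "int p ^ k dvd (e g l i j - e g k i j) + e g k i j"
    using assms by (intro dvd_add e_coh) (auto simp: \<Gamma>_def)
  then show ?thesis
    by simp
qed

text \<open>By coherence the congruence may be tested at any precision
  \<open>l \<ge> k\<close>.\<close>

lemma GammaI:
  assumes "g \<in> carrier G" "k \<le> l" "\<And>i j. i < n \<Longrightarrow> j < n \<Longrightarrow> int p ^ k dvd e g l i j"
  shows "g \<in> \<Gamma> k"
proof -
  have "int p ^ k dvd e g l i j - (e g l i j - e g k i j)" if "i < n" "j < n" for i j
    by (rule dvd_diff[OF assms(3)[OF that] e_coh[OF assms(2,1) that]])
  then show ?thesis
    using assms(1) by (simp add: \<Gamma>_def)
qed

lemma Gamma_Suc: "\<Gamma> (Suc k) \<subseteq> \<Gamma> k"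
proof
  fix g assume g: "g \<in> \<Gamma> (Suc k)"
  show "g \<in> \<Gamma> k"
  proof (rule GammaI[of _ _ "Suc k"])
    show "g \<in> carrier G"
      by (rule Gamma_carrier[OF g])
    show "int p ^ k dvd e g (Suc k) i j" if "i < n" "j < n" for i j
      by (rule dvd_trans[OF le_imp_power_dvd Gamma_dvd[OF g _ that]]) simp_all
  qed simp
qed

lemma Gamma_antimono: "k \<le> l \<Longrightarrow> \<Gamma> l \<subseteq> \<Gamma> k"
  using lift_Suc_antimono_le[of \<Gamma>, OF Gamma_Suc] .

text \<open>For matrices \<open>1 + A\<close> and \<open>1 + B\<close> the deviation from additivity
  is the product of \<open>A\<close> and \<open>B\<close>, which is divisible by
  \<open>p ^ (2 * k)\<close>.\<close>

lemma e_additive: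
  assumes g: "g \<in> \<Gamma> k" and h: "h \<in> \<Gamma> k" and l: "k \<le> l" "l \<le> 2 * k" and ij: "i < n" "j < n"
  shows "int p ^ l dvd e (g \<otimes> h) l i j - (e g l i j + e h l i j)"
proof -
  have "int p ^ l dvd (\<Sum>m<n. e g l i m * e h l m j)"
  proof (rule dvd_sum)
    fix m assume "m \<in> {..<n}"
    then have "int p ^ k * int p ^ k dvd e g l i m * e h l m j"
      using g h l ij by (intro mult_dvd_mono Gamma_dvd) auto
    moreover have "int p ^ l dvd int p ^ k * int p ^ k"
      unfolding power_add[symmetric] using l by (intro le_imp_power_dvd) auto
    ultimately show "int p ^ l dvd e g l i m * e h l m j"
      by (rule dvd_trans[rotated])
  qed
  from dvd_add[OF e_mult[OF Gamma_carrier[OF g] Gamma_carrier[OF h] ij, of l] this]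
  show ?thesis
    by (simp add: algebra_simps)
qed

text \<open>Stated as an equivalence, this delivers closure under products and inverses
  together.\<close>

lemma Gamma_mult_iff:
  assumes g: "g \<in> \<Gamma> k" and h: "h \<in> carrier G"
  shows "g \<otimes> h \<in> \<Gamma> k \<longleftrightarrow> h \<in> \<Gamma> k"
proof -
  have "int p ^ k dvd e (g \<otimes> h) k i j - e h k i j" if ij: "i < n" "j < n" for i j
  proof -
    have "int p ^ k dvd (e (g \<otimes> h) k i j - (e g k i j + e h k i j + (\<Sum>l<n. e g k i l * e h k l j)))
        + (e g k i j + (\<Sum>l<n. e g k i l * e h k l j))"
      using ij Gamma_dvd[OF g order_refl] by (intro dvd_add e_mult Gamma_carrier[OF g] h dvd_sum dvd_mult2) auto
    then show ?thesis
      by (simp add: algebra_simps)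
  qed
  then have "int p ^ k dvd e (g \<otimes> h) k i j \<longleftrightarrow> int p ^ k dvd e h k i j" if "i < n" "j < n" for i j
    using that by (metis dvd_diff_left_iff dvd_diff_right_iff)
  then show ?thesis
    using Gamma_carrier[OF g] h by (auto simp: \<Gamma>_def)
qed

lemma Gamma_one: "\<one> \<in> \<Gamma> k"
  by (simp add: \<Gamma>_def e_one)

lemma Gamma_subgroup: "subgroup (\<Gamma> k) G"
proof (rule subgroupI)
  show "\<Gamma> k \<subseteq> carrier G"
    by (auto simp: \<Gamma>_def)
  show "\<Gamma> k \<noteq> {}"
    using Gamma_one by blast
  show "inv g \<in> \<Gamma> k" if g: "g \<in> \<Gamma> k" for g
    using Gamma_mult_iff[OF g, of "inv g"] Gamma_one Gamma_carrier[OF g] by simp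
  show "g \<otimes> h \<in> \<Gamma> k" if "g \<in> \<Gamma> k" "h \<in> \<Gamma> k" for g h
    using Gamma_mult_iff[OF that(1) Gamma_carrier[OF that(2)]] that(2) by simp
qed

lemma Gamma_closed: "closedin T (\<Gamma> k)"
proof -
  let ?A = "\<lambda>i j. {g \<in> carrier G. a g k i j \<in> {c. int p ^ k dvd c - (if i = j then 1 else 0)}}"
  let ?\<A> = "insert (carrier G) ((\<lambda>(i, j). ?A i j) ` ({..<n} \<times> {..<n}))"
  have "closedin T (?A i j)" if "i < n" "j < n" for i j
  proof -
    have eq: "carrier G - ?A i j = {g \<in> carrier G. a g k i j \<in> - {c. int p ^ k dvd c - (if i = j then 1 else 0)}}"
      by auto
    then show ?thesis
      unfolding closedin_def topspace_eq eq by (intro conjI a_open that) blast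
  qed
  moreover have "closedin T (carrier G)"
    using closedin_topspace[of T] by (simp add: topspace_eq)
  ultimately have "closedin T (\<Inter> ?\<A>)"
    by (intro closedin_Inter) auto
  moreover have "\<Inter> ?\<A> = \<Gamma> k"
    by (auto simp: \<Gamma>_def e_def)
  ultimately show ?thesis
    by simp
qed

lemma Gamma_eventually:
  assumes "openin T S" "\<one> \<in> S"
  obtains i where "\<Gamma> i \<subseteq> S"
proof (rule compact_decreasing_eventually[where D = \<Gamma>, OF compact Gamma_closed Gamma_Suc _ assms])
  show "\<Inter> (range \<Gamma>) \<subseteq> {\<one>}"
  proof
    fix g assume g: "g \<in> \<Inter> (range \<Gamma>)"
    then have "g \<in> \<Gamma> k" for k
      by blast
    then have "g = \<one>"
      using a_inj[of g] by (auto simp: \<Gamma>_def e_def)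
    then show "g \<in> {\<one>}"
      by simp
  qed
qed (rule that)

lemma e_power:
  assumes g: "g \<in> \<Gamma> k" and l: "k \<le> l" "l \<le> 2 * k" and ij: "i < n" "j < n"
  shows "int p ^ l dvd e (g [^] (m::nat)) l i j - int m * e g l i j"
proof (induction m)
  case 0
  then show ?case
    using e_one[OF ij] by simp
next
  case (Suc m)
  have "g [^] m \<in> \<Gamma> k"
    by (induction m) (auto simp: Gamma_one subgroup.m_closed[OF Gamma_subgroup] g)
  from dvd_add[OF e_additive[OF this g l ij] Suc] show ?case
    by (simp add: algebra_simps)
qed

text \<open>The leading digit of the matrix minus 1: for \<open>k \<ge> 1\<close> it embeds the
  layer between \<open>\<Gamma> k\<close> and \<open>\<Gamma> (Suc k)\<close> into the matrices over
  the field with \<open>p\<close> elements.\<close>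

definition vec :: "nat \<Rightarrow> 'a \<Rightarrow> nat \<times> nat \<Rightarrow> int" where
  "vec k g = (\<lambda>(i, j)\<in>{..<n} \<times> {..<n}. (e g (Suc k) i j div int p ^ k) mod int p)"

lemma vec_eq_iff:
  assumes g: "g \<in> \<Gamma> k" and h: "h \<in> \<Gamma> k'"
  shows "vec k g = vec k' h \<longleftrightarrow>
    (\<forall>i<n. \<forall>j<n. int p dvd e g (Suc k) i j div int p ^ k - e h (Suc k') i j div int p ^ k')"
  unfolding vec_def fun_eq_iff by (auto simp: restrict_def mod_eq_dvd_iff)

lemma vec_eq_imp:
  assumes k: "1 \<le> k" and g: "g \<in> \<Gamma> k" and h: "h \<in> \<Gamma> k" and eq: "vec k g = vec k h"
  shows "inv g \<otimes> h \<in> \<Gamma> (Suc k)"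
proof (rule GammaI[OF _ order_refl])
  have gi: "inv g \<in> \<Gamma> k"
    by (rule subgroup.m_inv_closed[OF Gamma_subgroup g])
  show "inv g \<otimes> h \<in> carrier G"
    using Gamma_carrier g h by simp
  fix i j assume ij: "i < n" "j < n"
  have l: "k \<le> Suc k" "Suc k \<le> 2 * k"
    using k by auto
  have "int p dvd e g (Suc k) i j div int p ^ k - e h (Suc k) i j div int p ^ k"
    using eq ij unfolding vec_eq_iff[OF g h] by blast
  then have "int p ^ k * int p dvd int p ^ k * (e g (Suc k) i j div int p ^ k - e h (Suc k) i j div int p ^ k)"
    by (rule mult_dvd_mono[OF dvd_refl])
  then have 1: "int p ^ Suc k dvd e g (Suc k) i j - e h (Suc k) i j"
    using Gamma_dvd[OF g l(1) ij] Gamma_dvd[OF h l(1) ij] by (simp add: right_diff_distrib mult.commute)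
  have 2: "int p ^ Suc k dvd e (inv g \<otimes> h) (Suc k) i j - (e (inv g) (Suc k) i j + e h (Suc k) i j)"
    by (rule e_additive[OF gi h l ij])
  have 3: "int p ^ Suc k dvd e (g \<otimes> inv g) (Suc k) i j - (e g (Suc k) i j + e (inv g) (Suc k) i j)"
    by (rule e_additive[OF g gi l ij])
  have 4: "int p ^ Suc k dvd e (g \<otimes> inv g) (Suc k) i j"
    using e_one[OF ij, of "Suc k"] Gamma_carrier[OF g] by (simp only: r_inv)
  have "int p ^ Suc k dvd (e (inv g \<otimes> h) (Suc k) i j - (e (inv g) (Suc k) i j + e h (Suc k) i j))
      - (e (g \<otimes> inv g) (Suc k) i j - (e g (Suc k) i j + e (inv g) (Suc k) i j))
      + e (g \<otimes> inv g) (Suc k) i j - (e g (Suc k) i j - e h (Suc k) i j)"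
    by (rule dvd_diff[OF dvd_add[OF dvd_diff[OF 2 3] 4] 1])
  then show "int p ^ Suc k dvd e (inv g \<otimes> h) (Suc k) i j"
    by (simp add: algebra_simps)
qed

text \<open>To precision \<open>p ^ (k + 2)\<close> the \<open>p\<close>-th power multiplies the
  deviation from 1 by \<open>p\<close>, which moves the leading digits one level down unchanged.
  \<open>k \<ge> 2\<close> makes \<open>k + 2 \<le> 2 * k\<close>, so additivity is available at
  this precision, also for \<open>p = 2\<close>.\<close>

lemma vec_power:
  assumes k: "2 \<le> k" and g: "g \<in> \<Gamma> k"
  shows "g [^] p \<in> \<Gamma> (Suc k)" "vec (Suc k) (g [^] p) = vec k g"
proof -
  have p0: "int p > 0"
    using prime prime_gt_0_nat by simp
  have l: "k \<le> Suc (Suc k)" "Suc (Suc k) \<le> 2 * k"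
    using k by auto
  have gp: "g [^] p \<in> carrier G"
    using Gamma_carrier[OF g] by simp
  have key: "\<exists>w t. e g (Suc (Suc k)) i j = int p ^ k * w \<and> e (g [^]
    p) (Suc (Suc k)) i j = int p ^ Suc k * (w + int p * t)"
    if ij: "i < n" "j < n" for i j
  proof -
    obtain w where w: "e g (Suc (Suc k)) i j = int p ^ k * w"
      using Gamma_dvd[OF g l(1) ij] by (rule dvdE)
    obtain t where t: "e (g [^] p) (Suc (Suc k)) i j - int p * e g (Suc (Suc k)) i j = int p ^ Suc (Suc k) * t"
      using e_power[OF g l ij, of p] by (rule dvdE)
    then have "e (g [^] p) (Suc (Suc k)) i j = int p ^ Suc k * (w + int p * t)"
      using w by (simp add: algebra_simps)
    with w show ?thesis
      by blast
  qed
  show gpG: "g [^] p \<in> \<Gamma> (Suc k)"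
  proof (rule GammaI[OF gp, of _ "Suc (Suc k)"])
    show "int p ^ Suc k dvd e (g [^] p) (Suc (Suc k)) i j" if "i < n" "j < n" for i j
      using key[OF that] by (metis dvd_triv_left)
  qed simp
  show "vec (Suc k) (g [^] p) = vec k g"
    unfolding vec_eq_iff[OF gpG g]
  proof (intro allI impI)
    fix i j assume ij: "i < n" "j < n"
    obtain w t where w: "e g (Suc (Suc k)) i j = int p ^ k * w"
      and t: "e (g [^] p) (Suc (Suc k)) i j = int p ^ Suc k * (w + int p * t)"
      using key[OF ij] by blast
    obtain w' where w': "e g (Suc k) i j = int p ^ k * w'"
      using Gamma_dvd[OF g _ ij, of "Suc k"] by (auto elim: dvdE)
    have "int p ^ Suc k dvd e g (Suc (Suc k)) i j - e g (Suc k) i j"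
      by (rule e_coh[OF _ Gamma_carrier[OF g] ij]) simp
    then have "int p ^ k * int p dvd int p ^ k * (w - w')"
      by (simp only: w w' right_diff_distrib power_Suc2)
    then have "int p dvd w - w'"
      using p0 unfolding dvd_mult_cancel_left by simp
    then have "int p dvd (w - w') + int p * t"
      by (rule dvd_add[OF _ dvd_triv_left])
    moreover have "e (g [^] p) (Suc (Suc k)) i j div int p ^ Suc k = w + int p * t"
      using p0 unfolding t by (intro nonzero_mult_div_cancel_left) auto
    moreover have "e g (Suc k) i j div int p ^ k = w'"
      using p0 unfolding w' by (intro nonzero_mult_div_cancel_left) auto
    moreover have "w + int p * t - w' = (w - w') + int p * t"
      by simp
    ultimately show "int p dvd e (g [^] p) (Suc (Suc k)) i j div int p ^ Suc k - e g (Suc k) i j div int p ^ k"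
      by (simp only:)
  qed
qed

definition vecs :: "(nat \<times> nat \<Rightarrow> int) set" where
  "vecs = ({..<n} \<times> {..<n}) \<rightarrow>\<^sub>E {0..<int p}"

lemma vec_in_vecs: "vec k g \<in> vecs"
  using prime prime_gt_0_nat by (auto simp: vec_def vecs_def)

lemma finite_vecs: "finite vecs"
  by (simp add: vecs_def finite_PiE)

text \<open>The \<open>p\<close>-th power map embeds each layer \<open>\<Gamma> k / \<Gamma> (k + 1)\<close> into the next one, so the layers stabilise.\<close>
lemma vec_stable:
  obtains m where "2 \<le> m" "\<And>k. m \<le> k \<Longrightarrow> vec (Suc k) ` \<Gamma> (Suc k) = vec k ` \<Gamma> k"
proof -
  let ?W = "\<lambda>k. vec k ` \<Gamma> k"
  have mono: "?W k \<subseteq> ?W (Suc k)" if "2 \<le> k" for k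
  proof
    fix v assume "v \<in> ?W k"
    then obtain g where g: "g \<in> \<Gamma> k" "v = vec k g"
      by blast
    then show "v \<in> ?W (Suc k)"
      using vec_power[OF that g(1)] by (metis imageI)
  qed
  have sub: "?W k \<subseteq> vecs" for k
    using vec_in_vecs by blast
  have fin: "finite (?W k)" for k
    using sub finite_vecs by (rule finite_subset)
  \<comment> \<open>The layers grow inside the finite set \<open>vecs\<close>, so from one of
    maximal size on they are constant.\<close>
  have "\<exists>m. 2 \<le> m \<and> (\<forall>k. 2 \<le> k \<longrightarrow> card (?W k) \<le> card (?W m))"
  proof (rule ex_has_greatest_nat[of "\<lambda>k. 2 \<le> k" 2 "\<lambda>k. card (?W k)" "Suc (card vecs)"])
    show "\<forall>k. 2 \<le> k \<longrightarrow> card (?W k) < Suc (card vecs)"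
      using card_mono[OF finite_vecs sub] by (simp add: less_Suc_eq_le)
  qed simp
  then obtain m where m: "2 \<le> m" "\<forall>k. 2 \<le> k \<longrightarrow> card (?W k) \<le> card (?W m)"
    by blast
  have le: "?W m \<subseteq> ?W k" if "m \<le> k" for k
    using that
  proof (induction rule: dec_induct)
    case (step k)
    then show ?case
      using mono[of k] m(1) by simp
  qed simp
  have eq: "?W m = ?W k" if "m \<le> k" for k
  proof (rule card_seteq[OF fin le[OF that]])
    show "card (?W k) \<le> card (?W m)"
      using m order_trans[OF m(1) \<open>m \<le> k\<close>] by blast
  qed
  have "?W (Suc k) = ?W k" if "m \<le> k" for k
    by (rule trans[OF eq[OF le_SucI[OF that], symmetric] eq[OF that]])
  with m(1) show ?thesis
    by (rule that)
qed

lemma same_residue: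
  assumes g: "g \<in> carrier G" and h: "h \<in> carrier G" and eq: "\<And>i j. i < n \<Longrightarrow> j < n \<Longrightarrow> a g k i j = a h k i j"
  shows "inv g \<otimes> h \<in> \<Gamma> k"
proof (rule GammaI[OF _ order_refl])
  show "inv g \<otimes> h \<in> carrier G"
    using g h by simp
  fix i j assume ij: "i < n" "j < n"
  have eq': "(\<Sum>l<n. a (inv g) k i l * a h k l j) = (\<Sum>l<n. a (inv g) k i l * a g k l j)"
    by (rule sum.cong) (use eq ij in auto)
  have "int p ^ k dvd (a (inv g \<otimes> h) k i j - (\<Sum>l<n. a (inv g) k i l * a g k l j))
      - (a (inv g \<otimes> g) k i j - (\<Sum>l<n. a (inv g) k i l * a g k l j)) + e \<one> k i j"
    by (rule dvd_add[OF dvd_diff[OF a_mult[OF inv_closed[OF g] h ij, of k, unfolded eq'] a_mult[OF inv_closed[OF g]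
      g ij]] e_one[OF ij]])
  then show "int p ^ k dvd e (inv g \<otimes> h) k i j"
    using g by (simp add: e_def)
qed

text \<open>Once the layers are stable, every element of \<open>\<Gamma> (Suc k)\<close> is a
  \<open>p\<close>-th power of an element of \<open>\<Gamma> k\<close> up to
  \<open>\<Gamma> (Suc (Suc k))\<close>. In a series \<open>D\<close>, the \<open>p\<close>-th power
  of an element of \<open>D j\<close> lies in \<open>D (p * j)\<close>, so the inclusion passes from
  \<open>j\<close> to \<open>Suc j\<close>.\<close>

theorem slow_chain_exists: "\<exists>K E. slow_chain p G T K E"
proof -
  obtain m where m: "2 \<le> m" and stab: "\<And>k. m \<le> k \<Longrightarrow> vec (Suc k) ` \<Gamma> (Suc k) = vec k ` \<Gamma> k"
    using vec_stable by metis
  have root: "\<exists>y\<in>\<Gamma> k. \<exists>g\<in>\<Gamma> (Suc (Suc k)). x = y [^] p \<otimes> g" if k: "m \<le> k" and x: "x \<in> \<Gamma> (Suc k)" for k x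
  proof -
    have "vec (Suc k) x \<in> vec k ` \<Gamma> k"
      using x stab[OF k] by blast
    then obtain y where y: "y \<in> \<Gamma> k" "vec (Suc k) x = vec k y"
      by blast
    have k2: "2 \<le> k"
      using k m by simp
    note yp = vec_power[OF k2 y(1)]
    have "inv (y [^] p) \<otimes> x \<in> \<Gamma> (Suc (Suc k))"
      by (rule vec_eq_imp[OF _ yp(1) x]) (simp_all add: yp(2) y(2))
    moreover have "x = y [^] p \<otimes> (inv (y [^] p) \<otimes> x)"
      using Gamma_carrier[OF x] Gamma_carrier[OF y(1)] by (simp add: m_assoc[symmetric])
    ultimately show ?thesis
      using y(1) by blast
  qed
  \<comment> \<open>The first step of the chain absorbs the finite quotient by
    \<open>\<Gamma> (m + 2)\<close>; later steps are single layers. The shift by \<open>m\<close>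
    keeps to stable layers.\<close>
  define E where "E j = (if j \<le> 1 then carrier G else \<Gamma> (m + j))" for j
  let ?Z = "({..<n} \<times> {..<n}) \<rightarrow>\<^sub>E {0..<int p ^ (m + 2)}"
  let ?K = "max (card ?Z) (card vecs)"
  have "slow_chain p G T ?K E"
    unfolding slow_chain_def
  proof (intro conjI allI impI)
    show "E 1 = carrier G"
      by (simp add: E_def)
    show Ec: "E j \<subseteq> carrier G" for j
      using subgroup.subset[OF Gamma_subgroup] by (simp add: E_def)
    show "\<exists>C. finite C \<and> card C \<le> ?K \<and> C \<subseteq> E j \<and> (\<forall>g\<in>E j. \<exists>t\<in>C. \<exists>g'\<in>E (Suc j). g = t \<otimes> g')"
      if j: "1 \<le> j" for j
    proof (cases "j = 1")
      case True
      let ?\<kappa> = "\<lambda>g. \<lambda>(i, j)\<in>{..<n} \<times> {..<n}. a g (m + 2) i j"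
      show ?thesis
      proof (rule coset_cover[OF Ec, where \<kappa> = ?\<kappa> and Z = ?Z])
        show "finite ?Z"
          by (simp add: finite_PiE)
        show "?\<kappa> ` E j \<subseteq> ?Z"
        proof (rule image_subsetI)
          fix g assume "g \<in> E j"
          then have gc: "g \<in> carrier G"
            using Ec by blast
          show "?\<kappa> g \<in> ?Z"
            unfolding restrict_PiE_iff using a_range[OF gc, of _ _ "m + 2"] by (simp add: case_prod_beta mem_Times_iff)
        qed
        fix x y assume x: "x \<in> E j" and y: "y \<in> E j" and eq: "?\<kappa> x = ?\<kappa> y"
        have "a x (m + 2) i l = a y (m + 2) i l" if "i < n" "l < n" for i l
          using fun_cong[OF eq, of "(i, l)"] that by simp
        then have "inv x \<otimes> y \<in> \<Gamma> (m + 2)"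
          using x y Ec by (intro same_residue) blast+
        then show "inv x \<otimes> y \<in> E (Suc j)"
          by (simp add: E_def True)
      qed simp
    next
      case False
      then have Ej: "E j = \<Gamma> (m + j)" "E (Suc j) = \<Gamma> (Suc (m + j))"
        using j by (auto simp: E_def)
      show ?thesis
        unfolding Ej
      proof (rule coset_cover[where \<kappa> = "vec (m + j)" and Z = vecs])
        show "\<Gamma> (m + j) \<subseteq> carrier G"
          by (rule subgroup.subset[OF Gamma_subgroup])
        show "finite vecs"
          by (rule finite_vecs)
        show "vec (m + j) ` \<Gamma> (m + j) \<subseteq> vecs"
          using vec_in_vecs by blast
        show "inv x \<otimes> y \<in> \<Gamma> (Suc (m + j))"
          if "x \<in> \<Gamma> (m + j)" "y \<in> \<Gamma> (m + j)" "vec (m + j) x = vec (m + j) y" for x y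
          using that j by (intro vec_eq_imp) auto
      qed simp
    qed
    fix D and j :: nat assume D: "open_Np_series p G T D" and j: "1 \<le> j"
    have D1: "D 1 = carrier G" and Dsub: "\<And>i. subgroup (D i) G" and Dop: "\<And>i. openin T (D i)"
      and Ddec: "\<And>i. D (Suc i) \<subseteq> D i" and Dpow: "\<And>i x. x \<in> D i \<Longrightarrow> x [^] p \<in> D (p * i)"
      using D unfolding open_Np_series_def by auto
    have "\<Gamma> (m + j) \<subseteq> D j"
      using j
    proof (induction rule: dec_induct)
      case base
      then show ?case
        unfolding D1 by (rule subgroup.subset[OF Gamma_subgroup])
    next
      case (step j)
      obtain I where I: "\<Gamma> I \<subseteq> D (Suc j)"
        by (rule Gamma_eventually[OF Dop subgroup.one_closed[OF Dsub]])
      have "\<Gamma> (Suc (m + j)) \<subseteq> D (Suc j)"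
      proof (rule descend_into_subgroup[OF Dsub Gamma_Suc I])
        fix i x assume i: "Suc (m + j) \<le> i" and x: "x \<in> \<Gamma> i"
        then obtain k where k: "i = Suc k" "m + j \<le> k"
          by (cases i) auto
        obtain y g where y: "y \<in> \<Gamma> k" and g: "g \<in> \<Gamma> (Suc i)" and eq: "x = y [^] p \<otimes> g"
          using root[of k x] x k by auto
        have "y \<in> D j"
          using y Gamma_antimono[OF k(2)] step.IH by blast
        then have "y [^] p \<in> D (p * j)"
          by (rule Dpow)
        moreover have "Suc j \<le> p * j"
          using step.hyps(1) mult_le_mono1[OF prime_ge_2_nat[OF prime], of j] by linarith
        ultimately have "y [^] p \<in> D (Suc j)"
          using lift_Suc_antimono_le[of D, OF Ddec, of "Suc j" "p * j"] by blast
        then show "\<exists>s\<in>D (Suc j). \<exists>g\<in>\<Gamma> (Suc i). x = s \<otimes> g"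
          using g eq by blast
      qed
      then show ?case
        by simp
    qed
    then show "E j \<subseteq> D j"
      using D1 j by (cases "j = 1") (auto simp: E_def)
  qed
  then show ?thesis
    by blast
qed

end

section \<open>The \<open>p\<close>-adic integers and matrices over them\<close>

lemma padic_carrierD:
  assumes "x \<in> carrier (padic_ints p)"
  shows "x k \<in> {0..<int p ^ k}" "x (Suc k) mod int p ^ k = x k" "x k mod int p ^ k = x k"
  using assms by (auto simp: padic_ints_def)

lemma padic_carrierI:
  assumes p: "p > 0" and coh: "\<And>k. f (Suc k) mod int p ^ k = f k mod int p ^ k"
  shows "(\<lambda>k. f k mod int p ^ k) \<in> carrier (padic_ints p)"
proof -
  have "f (Suc k) mod int p ^ Suc k mod int p ^ k = f k mod int p ^ k" for k
    using coh[of k] by (simp add: mod_mod_cancel)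
  then show ?thesis
    using p by (simp add: padic_ints_def)
qed

lemma padic_add_closed:
  assumes p: "p > 0" and x: "x \<in> carrier (padic_ints p)" and y: "y \<in> carrier (padic_ints p)"
  shows "x \<oplus>\<^bsub>padic_ints p\<^esub> y \<in> carrier (padic_ints p)" "x \<otimes>\<^bsub>padic_ints p\<^esub> y \<in> carrier (padic_ints p)"
proof -
  have "(x (Suc k) + y (Suc k)) mod int p ^ k = (x k + y k) mod int p ^ k"
    "(x (Suc k) * y (Suc k)) mod int p ^ k = (x k * y k) mod int p ^ k" for k
    by (metis mod_add_eq padic_carrierD(2)[OF x] padic_carrierD(2)[OF y],
        metis mod_mult_eq padic_carrierD(2)[OF x] padic_carrierD(2)[OF y])
  then show "x \<oplus>\<^bsub>padic_ints p\<^esub> y \<in> carrier (padic_ints p)" "x \<otimes>\<^bsub>padic_ints p\<^esub> y \<in> carrier (padic_ints p)"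
    using padic_carrierI[OF p, of "\<lambda>k. x k + y k"] padic_carrierI[OF p, of "\<lambda>k. x k * y k"]
    by (simp_all add: padic_ints_def)
qed

lemma padic_simps:
  "(x \<oplus>\<^bsub>padic_ints p\<^esub> y) k = (x k + y k) mod int p ^ k"
  "(x \<otimes>\<^bsub>padic_ints p\<^esub> y) k = (x k * y k) mod int p ^ k"
  "\<zero>\<^bsub>padic_ints p\<^esub> k = 0" "\<one>\<^bsub>padic_ints p\<^esub> k = 1 mod int p ^ k"
  by (simp_all add: padic_ints_def)

lemma padic_abelian_monoid:
  assumes p: "p > 0"
  shows "abelian_monoid (padic_ints p)"
proof (rule abelian_monoidI)
  fix x y z assume x: "x \<in> carrier (padic_ints p)" and y: "y \<in> carrier (padic_ints p)"
    and z: "z \<in> carrier (padic_ints p)"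
  show "x \<oplus>\<^bsub>padic_ints p\<^esub> y \<in> carrier (padic_ints p)"
    by (rule padic_add_closed[OF p x y])
  show "x \<oplus>\<^bsub>padic_ints p\<^esub> y \<oplus>\<^bsub>padic_ints p\<^esub> z = x \<oplus>\<^bsub>padic_ints p\<^esub> (y \<oplus>\<^bsub>padic_ints p\<^esub> z)"
    by (rule ext) (simp add: padic_simps mod_add_left_eq mod_add_right_eq add.assoc)
next
  fix x y assume "x \<in> carrier (padic_ints p)" "y \<in> carrier (padic_ints p)"
  show "x \<oplus>\<^bsub>padic_ints p\<^esub> y = y \<oplus>\<^bsub>padic_ints p\<^esub> x"
    by (rule ext) (simp add: padic_simps add.commute)
next
  show "\<zero>\<^bsub>padic_ints p\<^esub> \<in> carrier (padic_ints p)"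
    using p by (simp add: padic_ints_def)
  fix x assume x: "x \<in> carrier (padic_ints p)"
  show "\<zero>\<^bsub>padic_ints p\<^esub> \<oplus>\<^bsub>padic_ints p\<^esub> x = x"
    by (rule ext) (simp add: padic_simps padic_carrierD(3)[OF x])
qed

lemma padic_finsum:
  assumes p: "p > 0" and "finite A" and f: "f \<in> A \<rightarrow> carrier (padic_ints p)"
  shows "finsum (padic_ints p) f A k = (\<Sum>l\<in>A. f l k) mod int p ^ k"
proof -
  interpret abelian_monoid "padic_ints p"
    by (rule padic_abelian_monoid[OF p])
  show ?thesis
    using assms(2) f
  proof (induction A rule: finite_induct)
    case empty
    then show ?case
      by (simp add: padic_simps)
  next
    case (insert a A)
    then have "finsum (padic_ints p) f (insert a A) = f a \<oplus>\<^bsub>padic_ints p\<^esub> finsum (padic_ints p) f A"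
      by (intro finsum_insert) auto
    then show ?case
      using insert by (simp add: padic_simps mod_add_right_eq)
  qed
qed

lemma matrix_mult_entry:
  assumes p: "p > 0" and A: "A \<in> carrier (matrix_monoid n (padic_ints p))"
    and C: "C \<in> carrier (matrix_monoid n (padic_ints p))" and ij: "i < n" "j < n"
  shows "(A \<otimes>\<^bsub>matrix_monoid n (padic_ints p)\<^esub> C) (i, j) k = (\<Sum>l<n. A (i, l) k * C (l, j) k) mod int p ^ k"
proof -
  have mem: "A (i, l) \<in> carrier (padic_ints p)" "C (l, j) \<in> carrier (padic_ints p)" if "l < n" for l
    using A C ij that by (auto simp: matrix_monoid_def)
  have "(A \<otimes>\<^bsub>matrix_monoid n (padic_ints p)\<^esub> C) (i, j) k
    = finsum (padic_ints p) (\<lambda>l. A (i, l) \<otimes>\<^bsub>padic_ints p\<^esub> C (l, j)) {..<n} k"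
    using ij by (simp add: matrix_monoid_def)
  also have "\<dots> = (\<Sum>l<n. (A (i, l) \<otimes>\<^bsub>padic_ints p\<^esub> C (l, j)) k) mod int p ^ k"
    using mem by (intro padic_finsum[OF p] Pi_I padic_add_closed[OF p]) auto
  also have "\<dots> = (\<Sum>l<n. A (i, l) k * C (l, j) k) mod int p ^ k"
    by (simp add: padic_simps mod_sum_eq)
  finally show ?thesis .
qed

lemma mod_sum_mult_left: "(\<Sum>l\<in>A. (f l mod q) * g l) mod q = (\<Sum>l\<in>A. f l * g l) mod (q::int)"
  by (subst (1 2) mod_sum_eq[symmetric]) (simp only: mod_mult_left_eq)

lemma mod_sum_mult_right: "(\<Sum>l\<in>A. f l * (g l mod q)) mod q = (\<Sum>l\<in>A. f l * g l) mod (q::int)"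
  by (subst (1 2) mod_sum_eq[symmetric]) (simp only: mod_mult_right_eq)

text \<open>With a left inverse \<open>Y\<close>, \<open>E = (Y E) E = Y (E E) = Y E\<close> is the
  unit matrix; the computation is done on entries modulo \<open>p ^ k\<close>. It identifies the
  image of the unit of \<open>G\<close> from its idempotence.\<close>

lemma idempotent_unit_entry:
  assumes p: "p > 0" and E: "E \<in> carrier (general_linear_group n (padic_ints p))"
    and idem: "E \<otimes>\<^bsub>general_linear_group n (padic_ints p)\<^esub> E = E" and ij: "i < n" "j < n"
  shows "E (i, j) k = (if i = j then 1 else 0) mod int p ^ k"
proof -
  let ?M = "matrix_monoid n (padic_ints p)" and ?q = "int p ^ k"
  have Ec: "E \<in> carrier ?M"
    using E by (simp add: general_linear_group_def units_of_def Units_def)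
  obtain Y where Y: "Y \<in> carrier ?M" "Y \<otimes>\<^bsub>?M\<^esub> E = \<one>\<^bsub>?M\<^esub>"
    using E by (auto simp: general_linear_group_def units_of_def Units_def)
  have EE: "(\<Sum>l<n. E (m, l) k * E (l, j) k) mod ?q = E (m, j) k" if "m < n" for m
    using matrix_mult_entry[OF p Ec Ec that ij(2), of k] idem by (simp add: general_linear_group_def units_of_def)
  have YE: "(\<Sum>m<n. Y (i, m) k * E (m, l) k) mod ?q = (if i = l then 1 else 0) mod ?q" if "l < n" for l
  proof -
    have "\<one>\<^bsub>?M\<^esub> (i, l) k = (if i = l then 1 else 0) mod ?q"
      using ij that by (simp add: matrix_monoid_def padic_simps)
    then show ?thesis
      using matrix_mult_entry[OF p Y(1) Ec ij(1) that, of k] Y(2) by simp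
  qed
  have "E (i, j) \<in> carrier (padic_ints p)"
    using Ec ij by (auto simp: matrix_monoid_def)
  then have red: "E (i, j) k = E (i, j) k mod ?q"
    by (simp add: padic_carrierD(3))
  have delta: "E (i, j) k = (\<Sum>l<n. (if i = l then 1 else 0) * E (l, j) k)"
  proof -
    have "(\<Sum>l<n. (if i = l then 1 else 0) * E (l, j) k) = (\<Sum>l<n. if l = i then E (i, j) k else 0)"
      by (rule sum.cong) auto
    then show ?thesis
      using ij by simp
  qed
  have "E (i, j) k mod ?q = (\<Sum>l<n. ((if i = l then 1 else 0) mod ?q) * E (l, j) k) mod ?q"
    unfolding mod_sum_mult_left by (rule arg_cong[OF delta])
  also have "(\<Sum>l<n. ((if i = l then 1 else 0) mod ?q) * E (l, j) k)
      = (\<Sum>l<n. ((\<Sum>m<n. Y (i, m) k * E (m, l) k) mod ?q) * E (l, j) k)"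
    by (rule sum.cong) (use YE in auto)
  also have "\<dots> mod ?q = (\<Sum>l<n. (\<Sum>m<n. Y (i, m) k * E (m, l) k) * E (l, j) k) mod ?q"
    by (rule mod_sum_mult_left)
  also have "(\<Sum>l<n. (\<Sum>m<n. Y (i, m) k * E (m, l) k) * E (l, j) k)
      = (\<Sum>m<n. Y (i, m) k * (\<Sum>l<n. E (m, l) k * E (l, j) k))"
    unfolding sum_distrib_right sum_distrib_left mult.assoc by (rule sum.swap)
  also have "\<dots> mod ?q = (\<Sum>m<n. Y (i, m) k * ((\<Sum>l<n. E (m, l) k * E (l, j) k) mod ?q)) mod ?q"
    by (rule mod_sum_mult_right[symmetric])
  also have "(\<Sum>m<n. Y (i, m) k * ((\<Sum>l<n. E (m, l) k * E (l, j) k) mod ?q)) = (\<Sum>m<n. Y (i, m) k * E (m, j) k)"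
    by (rule sum.cong) (use EE in auto)
  also have "\<dots> mod ?q = (if i = j then 1 else 0) mod ?q"
    by (rule YE[OF ij(2)])
  finally show ?thesis
    using red by simp
qed

theorem p_adic_slow_chain:
  fixes G (structure)
  assumes G: "pro_p_group p G T" and H: "p_adic_analytic_group p H T_H" and iso: "isomorphic_to_open_subgroup G T H T_H"
  shows "\<exists>K E. slow_chain p G T K E"
proof -
  interpret pro_p_group p G T
    by (rule G)
  have p: "p > 0"
    using prime by (rule prime_gt_0_nat)
  obtain U \<phi> where U: "subgroup U H" and phi: "\<phi> \<in> iso G (H\<lparr>carrier := U\<rparr>)" "homeomorphic_map T (subtopology T_H U) \<phi>"
    using iso unfolding isomorphic_to_open_subgroup_def topological_iso_def by blast
  obtain n where "isomorphic_to_closed_subgroup H T_H (general_linear_group n (padic_ints p)) (GL_padic_topology n p)"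
    using H unfolding p_adic_analytic_group_def by blast
  then obtain L \<psi> where L: "subgroup L (general_linear_group n (padic_ints p))"
    and psi: "\<psi> \<in> iso H (general_linear_group n (padic_ints p)\<lparr>carrier := L\<rparr>)"
      "homeomorphic_map T_H (subtopology (GL_padic_topology n p) L) \<psi>"
    unfolding isomorphic_to_closed_subgroup_def topological_iso_def by blast
  let ?GL = "general_linear_group n (padic_ints p)" and ?M = "matrix_monoid n (padic_ints p)"
  define \<Phi> where "\<Phi> g = \<psi> (\<phi> g)" for g
  have UH: "U \<subseteq> carrier H"
    using U by (rule subgroup.subset)
  have phiU: "\<phi> g \<in> U" if "g \<in> carrier G" for g
    using phi(1) that by (auto simp: iso_def hom_def)
  have GL: "\<Phi> g \<in> carrier ?GL" if "g \<in> carrier G" for g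
    using psi(1) phiU[OF that] UH subgroup.subset[OF L] unfolding \<Phi>_def iso_def hom_def by auto
  have GLM: "carrier ?GL \<subseteq> carrier ?M"
    by (auto simp: general_linear_group_def units_of_def Units_def)
  have mult: "\<Phi> (g \<otimes> h) = \<Phi> g \<otimes>\<^bsub>?GL\<^esub> \<Phi> h" if "g \<in> carrier G" "h \<in> carrier G" for g h
  proof -
    have "\<phi> (g \<otimes> h) = \<phi> g \<otimes>\<^bsub>H\<^esub> \<phi> h"
      using phi(1) that by (simp add: iso_def hom_def)
    moreover have "\<psi> (\<phi> g \<otimes>\<^bsub>H\<^esub> \<phi> h) = \<psi> (\<phi> g) \<otimes>\<^bsub>?GL\<^esub> \<psi> (\<phi> h)"
      using psi(1) phiU[OF that(1)] phiU[OF that(2)] UH by (simp add: iso_def hom_def subset_iff)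
    ultimately show ?thesis
      by (simp add: \<Phi>_def)
  qed
  have inj: "g = h" if "g \<in> carrier G" "h \<in> carrier G" "\<Phi> g = \<Phi> h" for g h
  proof -
    have "inj_on \<psi> (carrier H)" "inj_on \<phi> (carrier G)"
      using psi(1) phi(1) by (auto simp: iso_def bij_betw_def)
    moreover have "\<phi> g \<in> carrier H" "\<phi> h \<in> carrier H"
      using phiU that UH by blast+
    ultimately show ?thesis
      using that unfolding \<Phi>_def by (metis inj_onD)
  qed
  have entry: "\<Phi> g (i, j) \<in> carrier (padic_ints p)" if "g \<in> carrier G" "i < n" "j < n" for g i j
  proof -
    have "\<Phi> g \<in> carrier ?M"
      using GL[OF that(1)] GLM by blast
    then show ?thesis
      using that by (auto simp: matrix_monoid_def)
  qed
  have one: "\<Phi> \<one> (i, j) k = (if i = j then 1 else 0) mod int p ^ k" if "i < n" "j < n" for i j k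
    by (rule idempotent_unit_entry[OF p GL[OF one_closed] _ that]) (simp flip: mult)
  have cont: "continuous_map T (product_topology (\<lambda>_. padic_ints_topology p) ({..<n} \<times> {..<n})) \<Phi>"
  proof -
    have "continuous_map T T_H \<phi>"
      using homeomorphic_imp_continuous_map[OF phi(2)] by (rule continuous_map_into_fulltopology)
    moreover have "continuous_map T_H (product_topology (\<lambda>_. padic_ints_topology p) ({..<n} \<times> {..<n})) \<psi>"
      by (rule continuous_map_into_fulltopology[OF continuous_map_into_fulltopology[OF
        homeomorphic_imp_continuous_map[OF psi(2)], unfolded GL_padic_topology_def]])
    ultimately show ?thesis
      unfolding \<Phi>_def[abs_def] using continuous_map_compose[of T T_H \<phi>] by (simp add: o_def)
  qed
  have entry_cont: "continuous_map T (discrete_topology UNIV) (\<lambda>g. \<Phi> g (i, j) k)" if "i < n" "j < n" for i j k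
  proof -
    have "continuous_map T (padic_ints_topology p) (\<lambda>g. \<Phi> g (i, j))"
      using continuous_map_compose[OF cont continuous_map_product_projection[of "(i, j)"]] that by (simp add: o_def)
    then have "continuous_map T (product_topology (\<lambda>_. discrete_topology UNIV) UNIV) (\<lambda>g. \<Phi> g (i, j))"
      unfolding padic_ints_topology_def by (rule continuous_map_into_fulltopology)
    from continuous_map_compose[OF this continuous_map_product_projection[of k]] show ?thesis
      by (simp add: o_def)
  qed
  interpret congruence_rep G T p n "\<lambda>g k i j. \<Phi> g (i, j) k"
  proof unfold_locales
    fix g h i j k assume g: "g \<in> carrier G" and i: "i < n" and j: "j < n"
    show "\<Phi> g (i, j) k \<in> {0..<int p ^ k}"
      by (rule padic_carrierD(1)[OF entry[OF g i j]])
    show "int p ^ k dvd \<Phi> g (i, j) (Suc k) - \<Phi> g (i, j) k"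
      using padic_carrierD(2,3)[OF entry[OF g i j], of k] by (simp flip: mod_eq_dvd_iff)
    assume h: "h \<in> carrier G"
    have "\<Phi> (g \<otimes> h) (i, j) k = (\<Sum>l<n. \<Phi> g (i, l) k * \<Phi> h (l, j) k) mod int p ^ k"
      using matrix_mult_entry[OF p _ _ i j, of "\<Phi> g" "\<Phi> h" k] GL[OF g] GL[OF h] GLM mult[OF g h]
      by (simp add: general_linear_group_def units_of_def Units_def)
    then show "int p ^ k dvd \<Phi> (g \<otimes> h) (i, j) k - (\<Sum>l<n. \<Phi> g (i, l) k * \<Phi> h (l, j) k)"
      by (simp flip: mod_eq_dvd_iff)
  next
    show "int p ^ k dvd \<Phi> \<one> (i, j) k - (if i = j then 1 else 0)" if "i < n" "j < n" for i j k
      unfolding one[OF that] by (metis mod_eq_dvd_iff mod_mod_trivial)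
    show "openin T {g \<in> carrier G. \<Phi> g (i, j) k \<in> A}" if "i < n" "j < n" for i j k A
      using openin_continuous_map_preimage[OF entry_cont[OF that], of A] by (simp add: topspace_eq)
    fix g assume g: "g \<in> carrier G"
      and d: "\<And>k i j. i < n \<Longrightarrow> j < n \<Longrightarrow> int p ^ k dvd \<Phi> g (i, j) k - (if i = j then 1 else 0)"
    have eq: "\<Phi> g (i, j) = \<Phi> \<one> (i, j)" if "i < n" "j < n" for i j
    proof
      fix k
      have "\<Phi> g (i, j) k = \<Phi> g (i, j) k mod int p ^ k"
        by (simp add: padic_carrierD(3)[OF entry[OF g that]])
      also have "\<dots> = (if i = j then 1 else 0) mod int p ^ k"
        using d[OF that, of k] by (simp only: mod_eq_dvd_iff)
      finally show "\<Phi> g (i, j) k = \<Phi> \<one> (i, j) k"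
        by (simp add: one[OF that])
    qed
    have "\<Phi> g = \<Phi> \<one>"
    proof (rule PiE_ext)
      show "\<Phi> g \<in> ({..<n} \<times> {..<n}) \<rightarrow>\<^sub>E carrier (padic_ints p)" "\<Phi> \<one> \<in> ({..<n} \<times> {..<n}) \<rightarrow>\<^sub>E carrier (padic_ints p)"
        using GL[OF g] GL[OF one_closed] GLM by (auto simp: matrix_monoid_def)
      show "\<Phi> g x = \<Phi> \<one> x" if "x \<in> {..<n} \<times> {..<n}" for x
        using eq that by auto
    qed
    then show "g = \<one>"
      by (rule inj[OF g one_closed])
  qed (use prime compact in auto)
  show ?thesis
    by (rule slow_chain_exists)
qed

section \<open>Local fields\<close>

context nonarch_valued_field
begin

lemma absval_zero [simp]: "absval \<zero> = 0"
  by (simp add: absval_eq_0_iff)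

lemma absval_pow: "x \<in> carrier F \<Longrightarrow> absval (x [^] (n::nat)) = absval x ^ n"
  by (induction n) (simp_all add: absval_one absval_mult)

lemma absval_inv:
  assumes "x \<in> carrier F" "x \<noteq> \<zero>"
  shows "inv x \<in> carrier F" "x \<otimes> inv x = \<one>" "inv x \<otimes> x = \<one>" "absval (inv x) = inverse (absval x)"
proof -
  have u: "x \<in> Units F"
    using assms by (simp add: field_Units)
  then show 1: "inv x \<in> carrier F" "x \<otimes> inv x = \<one>" "inv x \<otimes> x = \<one>"
    by simp_all
  have "absval x * absval (inv x) = 1"
    using absval_mult[OF assms(1) 1(1)] by (simp add: 1 absval_one)
  then show "absval (inv x) = inverse (absval x)"
    by (rule inverse_unique[symmetric])
qed

text \<open>Congruence modulo a closed ball: for \<open>r \<ge> 0\<close> an equivalence relation on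
  the carrier compatible with addition, by the ultrametric inequality. Carrier membership is
  included so that chains of congruences carry it along.\<close>

definition near :: "real \<Rightarrow> 'a \<Rightarrow> 'a \<Rightarrow> bool" where
  "near r x y \<longleftrightarrow> x \<in> carrier F \<and> y \<in> carrier F \<and> absval (x \<ominus> y) \<le> r"

lemma near_carrier: "near r x y \<Longrightarrow> x \<in> carrier F" "near r x y \<Longrightarrow> y \<in> carrier F"
  by (simp_all add: near_def)

lemma near_refl: "x \<in> carrier F \<Longrightarrow> 0 \<le> r \<Longrightarrow> near r x x"
  by (simp add: near_def a_minus_def r_neg)

lemma near_zero: "x \<in> carrier F \<Longrightarrow> near r x \<zero> \<longleftrightarrow> absval x \<le> r"
  by (simp add: near_def a_minus_def)

lemma near_add:
  assumes "near r x y" "near r u v"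
  shows "near r (x \<oplus> u) (y \<oplus> v)"
proof -
  have c: "x \<in> carrier F" "y \<in> carrier F" "u \<in> carrier F" "v \<in> carrier F"
    using assms by (auto simp: near_def)
  then have "(x \<oplus> u) \<ominus> (y \<oplus> v) = (x \<ominus> y) \<oplus> (u \<ominus> v)"
    by algebra
  then show ?thesis
    using absval_add[of "x \<ominus> y" "u \<ominus> v"] assms c by (auto simp: near_def)
qed

lemma near_uminus:
  assumes "near r x y"
  shows "near r (\<ominus> x) (\<ominus> y)"
proof -
  have c: "x \<in> carrier F" "y \<in> carrier F"
    using assms by (auto simp: near_def)
  then have "\<ominus> x \<ominus> (\<ominus> y) = \<ominus> (x \<ominus> y)"
    by algebra
  then show ?thesis
    using assms c by (auto simp: near_def absval_uminus)
qed

lemma near_minus: "near r x y \<Longrightarrow> near r u v \<Longrightarrow> near r (x \<ominus> u) (y \<ominus> v)"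
  unfolding a_minus_def by (intro near_add near_uminus)

lemma near_sym: "near r x y \<Longrightarrow> near r y x"
  using commute[of x y] by (auto simp: near_def absval_dist_def)

lemma near_trans:
  assumes "near r x y" "near r y z"
  shows "near r x z"
proof -
  have c: "x \<in> carrier F" "y \<in> carrier F" "z \<in> carrier F"
    using assms by (auto simp: near_def)
  then have "x \<ominus> z = (x \<ominus> y) \<oplus> (y \<ominus> z)"
    by algebra
  then show ?thesis
    using absval_add[of "x \<ominus> y" "y \<ominus> z"] assms c by (auto simp: near_def)
qed

lemma near_mono: "near r x y \<Longrightarrow> r \<le> s \<Longrightarrow> near s x y"
  by (simp add: near_def)

lemma near_absval: "near r x y \<Longrightarrow> absval y \<le> r \<Longrightarrow> absval x \<le> r"
  using near_trans[of r x y \<zero>] by (auto simp: near_zero near_carrier)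

lemma near_mult:
  assumes "c \<in> carrier F" "near r x y"
  shows "near (absval c * r) (c \<otimes> x) (c \<otimes> y)"
proof -
  have c: "x \<in> carrier F" "y \<in> carrier F" and le: "absval (x \<ominus> y) \<le> r"
    using assms by (auto simp: near_def)
  then have "c \<otimes> x \<ominus> c \<otimes> y = c \<otimes> (x \<ominus> y)"
    using assms(1) by algebra
  then show ?thesis
    using c assms(1) mult_left_mono[OF le absval_nonneg[OF assms(1)]] by (simp add: near_def absval_mult)
qed

lemma near_finsum:
  assumes "finite A" "0 \<le> r" "\<And>i. i \<in> A \<Longrightarrow> near r (f i) (g i)"
  shows "near r (finsum F f A) (finsum F g A)"
  using assms(1,3)
proof (induction rule: finite_induct)
  case empty
  then show ?case
    using assms(2) by (simp add: near_refl)
next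
  case (insert a A)
  then have "f \<in> insert a A \<rightarrow> carrier F" "g \<in> insert a A \<rightarrow> carrier F"
    by (auto simp: near_def)
  then show ?case
    using insert by (auto simp: Pi_def intro!: near_add)
qed

lemma near_scale_iff:
  assumes "c \<in> carrier F" "c \<noteq> \<zero>" "x \<in> carrier F" "y \<in> carrier F"
  shows "near (absval c * r) (c \<otimes> x) (c \<otimes> y) \<longleftrightarrow> near r x y"
proof
  have "absval c \<noteq> 0"
    using assms by (simp add: absval_eq_0_iff)
  moreover have "inv c \<otimes> (c \<otimes> z) = z" if "z \<in> carrier F" for z
    using that absval_inv[OF assms(1,2)] assms(1) by (simp add: m_assoc[symmetric])
  moreover assume "near (absval c * r) (c \<otimes> x) (c \<otimes> y)"
  ultimately show "near r x y"
    using near_mult[of "inv c" "absval c * r" "c \<otimes> x" "c \<otimes> y"] absval_inv[OF assms(1,2)] assms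
    by (simp add: field_simps)
qed (use assms near_mult in blast)

lemma small_element:
  assumes "0 < \<epsilon>"
  obtains c where "c \<in> carrier F" "c \<noteq> \<zero>" "absval c < \<epsilon>"
proof -
  obtain w where w: "w \<in> carrier F" "w \<noteq> \<zero>" "absval w \<noteq> 1"
    using absval_nontrivial by blast
  obtain v where v: "v \<in> carrier F" "v \<noteq> \<zero>" "absval v < 1"
  proof (cases "absval w < 1")
    case True
    then show ?thesis
      using that w by blast
  next
    case False
    then have "absval w > 1"
      using w by simp
    then have "absval (inv w) < 1"
      using absval_inv[OF w(1,2)] by (simp add: inverse_less_1_iff)
    moreover have "inv w \<noteq> \<zero>"
      using absval_inv[OF w(1,2)] w one_not_zero by auto
    ultimately show ?thesis
      using that absval_inv[OF w(1,2)] by blast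
  qed
  obtain n where "absval v ^ n < \<epsilon>"
    using real_arch_pow_inv[OF assms v(3)] by blast
  moreover have "v [^] n \<noteq> \<zero>"
    using v absval_pow[of v n] absval_eq_0_iff[of "v [^] n"] absval_eq_0_iff[of v] by simp
  ultimately show ?thesis
    using that[of "v [^] n"] v by (simp add: absval_pow)
qed

lemma in_mball_iff: "x \<in> mball a r \<longleftrightarrow> x \<in> carrier F \<and> a \<in> carrier F \<and> absval (a \<ominus> x) < r"
  by (auto simp: absval_dist_def)

declare in_mball [simp del]

text \<open>By the ultrametric inequality the ball of radius \<open>r\<close> around a point outside
  \<open>mball \<zero> r\<close> is disjoint from it.\<close>

lemma closedin_mball: "closedin mtopology (mball \<zero> r)"
  unfolding closedin_def topspace_mtopology
proof
  show "openin mtopology (carrier F - mball \<zero> r)"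
    unfolding openin_mtopology
  proof (intro conjI allI impI)
    fix x assume x: "x \<in> carrier F - mball \<zero> r"
    show "\<exists>s>0. mball x s \<subseteq> carrier F - mball \<zero> r"
    proof (cases "r \<le> 0")
      case True
      then have "mball \<zero> r = {}"
        using mball_eq_empty by blast
      then show ?thesis
        using mball_subset_mspace by (intro exI[of _ 1]) auto
    next
      case False
      have "mball x r \<inter> mball \<zero> r = {}"
      proof (rule equals0I)
        fix y assume "y \<in> mball x r \<inter> mball \<zero> r"
        then have y: "y \<in> carrier F" "absval (x \<ominus> y) < r" "absval (\<zero> \<ominus> y) < r" and xc: "x \<in> carrier F"
          by (auto simp: in_mball_iff)
        have "\<zero> \<ominus> x = (\<zero> \<ominus> y) \<oplus> \<ominus> (x \<ominus> y)"
          using y xc by algebra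
        then have "absval (\<zero> \<ominus> x) < r"
          using absval_add[of "\<zero> \<ominus> y" "\<ominus> (x \<ominus> y)"] y xc by (simp add: absval_uminus)
        then show False
          using x xc by (simp add: in_mball_iff)
      qed
      then show ?thesis
        using False mball_subset_mspace[of x r] by (intro exI[of _ r]) auto
    qed
  qed auto
qed (rule mball_subset_mspace)

end

section \<open>Uniformizer and residues\<close>

context nonarch_local_field
begin

text \<open>The radius is itself an absolute value, so division by \<open>c\<close> rescales this
  ball to the maximal ideal.\<close>

lemma compact_ball:
  obtains c where "c \<in> carrier F" "c \<noteq> \<zero>" "absval c < 1" "compactin mtopology (mball \<zero> (absval c))"
proof -
  have "\<zero> \<in> topspace mtopology"
    by simp
  then obtain U K where U: "openin mtopology U" "compactin mtopology K" "\<zero> \<in> U" "U \<subseteq> K"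
    using locally_compact unfolding locally_compact_space_def by blast
  obtain \<epsilon> where e: "\<epsilon> > 0" "mball \<zero> \<epsilon> \<subseteq> U"
    using U unfolding openin_mtopology by blast
  obtain c where c: "c \<in> carrier F" "c \<noteq> \<zero>" "absval c < min \<epsilon> 1"
    by (rule small_element[of "min \<epsilon> 1"]) (use e in auto)
  have "mball \<zero> (absval c) \<subseteq> K"
    using c e U(4) mball_subset_concentric[of "absval c" \<epsilon> \<zero>] by auto
  then have "compactin mtopology (mball \<zero> (absval c))"
    by (rule closed_compactin[OF U(2) _ closedin_mball])
  then show ?thesis
    using that c by simp
qed

text \<open>If absolute values had no maximum on the compact ball, the balls of radius
  \<open>absval y\<close> would cover it, but no finitely many of them could. A maximal element
  divided by \<open>c\<close> is a uniformizer. A second cover, by balls of radius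
  \<open>absval c * (absval \<pi>)\<^sup>2\<close>, yields the finitely many residues.\<close>

theorem uniformizer_exists:
  obtains \<pi> T where "\<pi> \<in> carrier F" "\<pi> \<noteq> \<zero>" "absval \<pi> < 1"
    "\<And>x. x \<in> carrier F \<Longrightarrow> absval x < 1 \<Longrightarrow> absval x \<le> absval \<pi>"
    "finite T" "T \<subseteq> carrier F"
    "\<And>x. x \<in> carrier F \<Longrightarrow> absval x < 1 \<Longrightarrow> \<exists>t\<in>T. near ((absval \<pi>)\<^sup>2) x t"
proof -
  obtain c where c: "c \<in> carrier F" "c \<noteq> \<zero>" "absval c < 1" "compactin mtopology (mball \<zero> (absval c))"
    by (rule compact_ball)
  have c0: "absval c > 0"
    using c absval_nonneg[of c] absval_eq_0_iff[of c] by linarith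
  let ?C = "mball \<zero> (absval c)"
  have C_iff: "x \<in> ?C \<longleftrightarrow> x \<in> carrier F \<and> absval x < absval c" for x
    by (auto simp: in_mball_iff a_minus_def absval_uminus)
  have "\<exists>y\<in>?C. \<forall>x\<in>?C. absval x \<le> absval y"
  proof (rule ccontr)
    assume "\<not> ?thesis"
    then have no: "\<forall>y\<in>?C. \<exists>x\<in>?C. absval y < absval x"
      by (meson not_le)
    have "\<exists>\<F>. finite \<F> \<and> \<F> \<subseteq> (\<lambda>y. mball \<zero> (absval y)) ` ?C \<and> ?C \<subseteq> \<Union>\<F>"
    proof (rule compactinD[OF c(4)])
      show "?C \<subseteq> \<Union> ((\<lambda>y. mball \<zero> (absval y)) ` ?C)"
        using no by (fastforce simp: in_mball_iff a_minus_def absval_uminus)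
    qed auto
    then obtain Y where Y: "finite Y" "Y \<subseteq> ?C" "?C \<subseteq> (\<Union>y\<in>Y. mball \<zero> (absval y))"
      using finite_subset_image by (metis (no_types, lifting))
    have "\<zero> \<in> ?C"
      using c0 by (simp add: C_iff)
    then have "Y \<noteq> {}"
      using Y by blast
    then have "Max (absval ` Y) \<in> absval ` Y"
      using Y by simp
    then obtain y where y: "y \<in> Y" "absval y = Max (absval ` Y)"
      by fastforce
    then obtain y' where "y' \<in> Y" "y \<in> mball \<zero> (absval y')"
      using Y by blast
    then have "y' \<in> Y" "absval y < absval y'"
      by (auto simp: in_mball_iff a_minus_def absval_uminus)
    then show False
      using y Y(1) by (metis Max_ge finite_imageI imageI not_le)
  qed
  then obtain y where y: "y \<in> carrier F" "absval y < absval c"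
    and ymax: "\<And>x. x \<in> carrier F \<Longrightarrow> absval x < absval c \<Longrightarrow> absval x \<le> absval y"
    unfolding C_iff Bex_def Ball_def by blast
  note ci = absval_inv[OF c(1,2)]
  define \<pi> where "\<pi> = inv c \<otimes> y"
  have absc: "absval (c \<otimes> x) < absval c \<longleftrightarrow> absval x < 1" if "x \<in> carrier F" for x
    using that c c0 by (simp add: absval_mult)
  have pc: "\<pi> \<in> carrier F" and p: "absval \<pi> = absval y / absval c"
    using ci y c by (auto simp: \<pi>_def absval_mult field_simps)
  have "absval c * absval c > 0" "absval (c \<otimes> c) < absval c"
    using absc[of c] c c0 by auto
  then have "absval y > 0"
    using ymax[of "c \<otimes> c"] c by (simp add: absval_mult)
  then have p0: "absval \<pi> > 0" "\<pi> \<noteq> \<zero>"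
    using p c0 by (auto simp: absval_eq_0_iff pc)
  have "\<exists>\<F>. finite \<F> \<and> \<F> \<subseteq> (\<lambda>y. mball y (absval c * (absval \<pi>)\<^sup>2)) ` ?C \<and> ?C \<subseteq> \<Union>\<F>"
  proof (rule compactinD[OF c(4)])
    show "?C \<subseteq> \<Union> ((\<lambda>y. mball y (absval c * (absval \<pi>)\<^sup>2)) ` ?C)"
    proof
      fix x assume x: "x \<in> ?C"
      then have "x \<in> mball x (absval c * (absval \<pi>)\<^sup>2)"
        using p0 c0 by (simp add: C_iff in_mball_iff)
      then show "x \<in> \<Union> ((\<lambda>y. mball y (absval c * (absval \<pi>)\<^sup>2)) ` ?C)"
        using x by blast
    qed
  qed auto
  then obtain Y where Y: "finite Y" "Y \<subseteq> ?C" "?C \<subseteq> (\<Union>y\<in>Y. mball y (absval c * (absval \<pi>)\<^sup>2))"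
    using finite_subset_image by (metis (no_types, lifting))
  show ?thesis
  proof (rule that[of \<pi> "(\<lambda>t. inv c \<otimes> t) ` Y"])
    show "absval \<pi> < 1"
      using y p c0 by simp
    show "absval x \<le> absval \<pi>" if "x \<in> carrier F" "absval x < 1" for x
      using ymax[of "c \<otimes> x"] absc that c c0 by (simp add: p absval_mult field_simps)
    show "(\<lambda>t. inv c \<otimes> t) ` Y \<subseteq> carrier F"
      using Y ci by (auto simp: in_mball_iff)
    show "\<exists>t\<in>(\<lambda>t. inv c \<otimes> t) ` Y. near ((absval \<pi>)\<^sup>2) x t" if x: "x \<in> carrier F" "absval x < 1" for x
    proof -
      have "c \<otimes> x \<in> ?C"
        using absc x c by (simp add: C_iff)
      then obtain t where t: "t \<in> Y" "c \<otimes> x \<in> mball t (absval c * (absval \<pi>)\<^sup>2)"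
        using Y by blast
      then have "near (absval c * (absval \<pi>)\<^sup>2) t (c \<otimes> x)"
        by (auto simp: in_mball_iff near_def)
      then have n: "near (absval c * (absval \<pi>)\<^sup>2) (c \<otimes> x) t" and tc: "t \<in> carrier F"
        using near_sym near_carrier by blast+
      moreover have "c \<otimes> (inv c \<otimes> t) = t"
        using ci c tc by (simp add: m_assoc[symmetric])
      ultimately have "near ((absval \<pi>)\<^sup>2) x (inv c \<otimes> t)"
        using near_scale_iff[OF c(1,2) x(1), of "inv c \<otimes> t"] ci tc by simp
      then show ?thesis
        using t by blast
    qed
  qed (use pc p0 Y in auto)
qed

end

locale uniformized_field = nonarch_local_field F absval for F (structure) and absval +
  fixes \<pi> T
  assumes pi_carrier: "\<pi> \<in> carrier F" and pi_nonzero: "\<pi> \<noteq> \<zero>" and pi_less_1: "absval \<pi> < 1"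
    and pi_max: "x \<in> carrier F \<Longrightarrow> absval x < 1 \<Longrightarrow> absval x \<le> absval \<pi>"
    and finite_T: "finite T" and T_carrier: "T \<subseteq> carrier F"
    and T_cover: "x \<in> carrier F \<Longrightarrow> absval x < 1 \<Longrightarrow> \<exists>t\<in>T. near ((absval \<pi>)\<^sup>2) x t"
begin

abbreviation q :: real where "q \<equiv> absval \<pi>"

lemma q_pos: "0 < q"
  using absval_nonneg[OF pi_carrier] absval_eq_0_iff[OF pi_carrier] pi_nonzero by linarith

lemma pi_pow: "\<pi> [^] (n::nat) \<in> carrier F" "absval (\<pi> [^] n) = q ^ n" "\<pi> [^] n \<noteq> \<zero>"
proof -
  show "\<pi> [^] n \<in> carrier F" "absval (\<pi> [^] n) = q ^ n"
    using pi_carrier by (simp_all add: absval_pow)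
  then show "\<pi> [^] n \<noteq> \<zero>"
    using q_pos by auto
qed

lemma pi_divide:
  assumes "x \<in> carrier F" "absval x \<le> q ^ n * r"
  obtains y where "y \<in> carrier F" "absval y \<le> r" "x = \<pi> [^] n \<otimes> y"
proof
  note i = absval_inv[OF pi_pow(1,3), of n]
  show "inv (\<pi> [^] n) \<otimes> x \<in> carrier F"
    using i assms by simp
  show "absval (inv (\<pi> [^] n) \<otimes> x) \<le> r"
    unfolding absval_mult[OF i(1) assms(1)] i(4) pi_pow(2) using assms(2) q_pos by (simp add: field_simps)
  show "x = \<pi> [^] n \<otimes> (inv (\<pi> [^] n) \<otimes> x)"
    using i assms pi_pow by (simp add: m_assoc[symmetric])
qed

text \<open>An expansion in powers of \<open>\<pi>\<close> with \<open>t\<close> digits from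
  \<open>T\<close>. One set \<open>Z\<close> serves all \<open>a\<close>, which later bounds coset
  numbers uniformly along the chain.\<close>

lemma residues:
  "\<exists>Z. finite Z \<and> Z \<subseteq> carrier F \<and>
    (\<forall>a x. x \<in> carrier F \<longrightarrow> absval x \<le> q ^ Suc a \<longrightarrow> (\<exists>z\<in>Z. near (q ^ (Suc a + t)) x (\<pi> [^] a \<otimes> z)))"
proof (induction t)
  case 0
  show ?case
    by (rule exI[of _ "{\<zero>}"]) (simp add: near_zero pi_pow)
next
  case (Suc t)
  then obtain Z where Z: "finite Z" "Z \<subseteq> carrier F"
    and near: "\<And>a x. x \<in> carrier F \<Longrightarrow> absval x \<le> q ^ Suc a \<Longrightarrow> \<exists>z\<in>Z. near (q ^ (Suc a + t)) x (\<pi> [^] a \<otimes> z)"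
    by auto
  let ?Z = "(\<lambda>(z, s). z \<oplus> \<pi> [^] t \<otimes> s) ` (Z \<times> T)"
  have "\<exists>z\<in>?Z. near (q ^ (Suc a + Suc t)) x (\<pi> [^] a \<otimes> z)" if x: "x \<in> carrier F" "absval x \<le> q ^ Suc a" for a x
  proof -
    obtain z where z: "z \<in> Z" "near (q ^ (Suc a + t)) x (\<pi> [^] a \<otimes> z)"
      using near[OF x] by blast
    have zc: "z \<in> carrier F" and azc: "\<pi> [^] a \<otimes> z \<in> carrier F"
      using z Z pi_pow by auto
    let ?y = "x \<ominus> \<pi> [^] a \<otimes> z"
    have "absval ?y \<le> q ^ (a + t) * q"
      using z(2) by (simp add: near_def mult.commute)
    then obtain y where y: "y \<in> carrier F" "absval y \<le> q" "?y = \<pi> [^] (a + t) \<otimes> y"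
      using pi_divide[of ?y "a + t" q] x(1) azc by auto
    then obtain s where s: "s \<in> T" "near (q\<^sup>2) y s"
      using T_cover[of y] pi_less_1 by auto
    have sc: "s \<in> carrier F"
      using s T_carrier by blast
    have "near (q ^ (a + t) * q\<^sup>2) ?y (\<pi> [^] (a + t) \<otimes> s)"
      unfolding y(3) using near_mult[OF pi_pow(1) s(2), of "a + t"] by (simp add: pi_pow)
    then have "near (q ^ (Suc a + Suc t)) ?y (\<pi> [^] (a + t) \<otimes> s)"
      by (simp add: power_add power2_eq_square mult_ac)
    from near_add[OF near_refl[OF azc] this] have "near (q ^ (Suc a + Suc t)) (\<pi> [^] a \<otimes> z \<oplus> ?y) (\<pi> [^] a \<otimes> z \<oplus> \<pi> [^]
      (a + t) \<otimes> s)"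
      using q_pos by simp
    moreover have "\<pi> [^] a \<otimes> z \<oplus> ?y = x"
      using azc x(1) by algebra
    moreover have "\<pi> [^] a \<otimes> z \<oplus> \<pi> [^] (a + t) \<otimes> s = \<pi> [^] a \<otimes> (z \<oplus> \<pi> [^] t \<otimes> s)"
      using zc sc pi_pow(1) pi_carrier by (simp add: r_distr nat_pow_mult[symmetric] m_assoc)
    ultimately show ?thesis
      using z(1) s(1) by (intro bexI[of _ "z \<oplus> \<pi> [^] t \<otimes> s"]) auto
  qed
  moreover have "finite ?Z" "?Z \<subseteq> carrier F"
    using Z finite_T T_carrier pi_pow by (auto intro!: a_closed m_closed)
  ultimately show ?case
    by blast
qed

end

section \<open>Standard groups\<close>

context nonarch_local_field
begin

lemma monomial_value_closed:
  assumes "\<And>i. i \<in># \<alpha> \<Longrightarrow> x i \<in> carrier F"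
  shows "monomial_value x \<alpha> \<in> carrier F"
  unfolding monomial_value_def using assms by (intro finprod_closed) auto

lemma monomial_value_empty [simp]: "monomial_value x {#} = \<one>"
  by (simp add: monomial_value_def)

lemma monomial_value_cong:
  assumes "\<And>i. i \<in># \<alpha> \<Longrightarrow> x i = y i" "\<And>i. i \<in># \<alpha> \<Longrightarrow> y i \<in> carrier F"
  shows "monomial_value x \<alpha> = monomial_value y \<alpha>"
  unfolding monomial_value_def using assms by (intro finprod_cong') auto

lemma monomial_value_add_mset:
  assumes c: "x i \<in> carrier F" "\<And>j. j \<in># \<alpha> \<Longrightarrow> x j \<in> carrier F"
  shows "monomial_value x (add_mset i \<alpha>) = x i \<otimes> monomial_value x \<alpha>"
proof -
  let ?S = "insert i (set_mset \<alpha>)"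
  have c': "x j \<in> carrier F" if "j \<in> ?S" for j
    using c that by auto
  have "monomial_value x (add_mset i \<alpha>) = (\<Otimes>j\<in>?S. (if i = j then x j else \<one>) \<otimes> x j [^] count \<alpha> j)"
    unfolding monomial_value_def set_mset_add_mset_insert
  proof (rule finprod_cong')
    show "x j [^] count (add_mset i \<alpha>) j = (if i = j then x j else \<one>) \<otimes> x j [^] count \<alpha> j" if "j \<in> ?S" for j
      using c'[OF that] by (auto simp: m_comm)
  qed (use c' in auto)
  also have "\<dots> = (\<Otimes>j\<in>?S. if i = j then x j else \<one>) \<otimes> (\<Otimes>j\<in>?S. x j [^] count \<alpha> j)"
    using c' by (intro finprod_multf) auto
  also have "(\<Otimes>j\<in>?S. if i = j then x j else \<one>) = x i"
    using c' by (intro finprod_singleton) auto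
  also have "(\<Otimes>j\<in>?S. x j [^] count \<alpha> j) = monomial_value x \<alpha>"
    unfolding monomial_value_def
    by (rule finprod_mono_neutral_cong_left[symmetric]) (use c' in \<open>auto simp: not_in_iff\<close>)
  finally show ?thesis .
qed

lemma monomial_value_le_1:
  assumes "\<And>i. i \<in># \<alpha> \<Longrightarrow> x i \<in> carrier F \<and> absval (x i) \<le> 1"
  shows "absval (monomial_value x \<alpha>) \<le> 1"
  using assms
proof (induction \<alpha>)
  case empty
  then show ?case
    by (simp add: absval_one)
next
  case (add i \<alpha>)
  then have "absval (monomial_value x \<alpha>) \<le> 1" "x i \<in> carrier F" "absval (x i) \<le> 1" "monomial_value x \<alpha> \<in> carrier F"
    by (auto intro!: monomial_value_closed)
  then show ?case
    using monomial_value_add_mset[of x i \<alpha>] add.prems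
    by (auto simp: absval_mult absval_nonneg mult_le_one)
qed

lemma monomial_value_le:
  assumes x: "\<And>i. i \<in># \<alpha> \<Longrightarrow> x i \<in> carrier F \<and> absval (x i) \<le> 1" and i: "i \<in># \<alpha>" "absval (x i) \<le> r"
  shows "absval (monomial_value x \<alpha>) \<le> r"
proof -
  obtain \<beta> where \<beta>: "\<alpha> = add_mset i \<beta>"
    using i(1) by (meson multi_member_split)
  have "absval (monomial_value x \<beta>) \<le> 1" "x i \<in> carrier F" "monomial_value x \<beta> \<in> carrier F"
    using x unfolding \<beta> by (auto intro!: monomial_value_le_1 monomial_value_closed)
  then have "absval (monomial_value x \<alpha>) \<le> r * 1"
    using monomial_value_add_mset[of x i \<beta>] x i(2) absval_nonneg[of "x i"] absval_nonneg[of "monomial_value x \<beta>"]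
    mult_mono[of "absval (x i)" r "absval (monomial_value x \<beta>)" 1]
    unfolding \<beta> by (auto simp: absval_mult)
  then show ?thesis
    by simp
qed

lemma monomial_value_zero:
  assumes "\<And>i. i \<in># \<alpha> \<Longrightarrow> x i \<in> carrier F \<and> absval (x i) \<le> 1" "i \<in># \<alpha>" "x i = \<zero>"
  shows "monomial_value x \<alpha> = \<zero>"
proof -
  have "absval (monomial_value x \<alpha>) \<le> 0"
    using assms by (intro monomial_value_le) auto
  moreover have "monomial_value x \<alpha> \<in> carrier F"
    using assms by (intro monomial_value_closed) auto
  ultimately show ?thesis
    using absval_nonneg absval_eq_0_iff by (metis antisym)
qed

lemma power_series_sums_eventually:
  assumes "power_series_sums I c x s" "0 < r"
  shows "eventually (\<lambda>A. near r (\<Oplus>\<alpha>\<in>A. c \<alpha> \<otimes> monomial_value x \<alpha>) s) (finite_subsets_at_top {\<alpha>. set_mset \<alpha> \<subseteq> I})"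
proof -
  have "s \<in> carrier F" and "eventually (\<lambda>A. (\<Oplus>\<alpha>\<in>A. c \<alpha> \<otimes> monomial_value x \<alpha>) \<in> carrier F \<and>
      absval_dist (\<Oplus>\<alpha>\<in>A. c \<alpha> \<otimes> monomial_value x \<alpha>) s < r) (finite_subsets_at_top {\<alpha>. set_mset \<alpha> \<subseteq> I})"
    using assms unfolding power_series_sums_def limitin_metric by auto
  then show ?thesis
    by (elim eventually_mono) (auto simp: near_def absval_dist_def)
qed

end

section \<open>Power series in two groups of variables\<close>

locale two_variable_series = nonarch_local_field F absval for F (structure) and absval +
  fixes d :: nat and c :: "(nat + nat) multiset \<Rightarrow> 'a"
  assumes c_carrier: "c \<alpha> \<in> carrier F" and c_le_1: "absval (c \<alpha>) \<le> 1" and c_empty: "c {#} = \<zero>"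
begin

definition series :: "(nat \<Rightarrow> 'a) \<Rightarrow> (nat \<Rightarrow> 'a) \<Rightarrow> 'a \<Rightarrow> bool" where
  "series u v s \<longleftrightarrow> power_series_sums ({..<d} <+> {..<d}) c (case_sum u v) s"

text \<open>The coordinates of the unit of a standard group.\<close>
abbreviation zv :: "nat \<Rightarrow> 'a" where "zv \<equiv> \<lambda>i\<in>{..<d}. \<zero>"

definition tm :: "(nat \<Rightarrow> 'a) \<Rightarrow> (nat \<Rightarrow> 'a) \<Rightarrow> (nat + nat) multiset \<Rightarrow> 'a" where
  "tm u v \<alpha> = c \<alpha> \<otimes> monomial_value (case_sum u v) \<alpha>"

definition bounded :: "real \<Rightarrow> (nat \<Rightarrow> 'a) \<Rightarrow> bool" where
  "bounded r u \<longleftrightarrow> (\<forall>k<d. u k \<in> carrier F \<and> absval (u k) \<le> r)"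

lemma bounded_o: "0 \<le> r \<Longrightarrow> bounded r zv"
  by (simp add: bounded_def)

lemma bounded_mono: "bounded r u \<Longrightarrow> r \<le> s \<Longrightarrow> bounded s u"
  by (auto simp: bounded_def intro: order_trans)

lemma bounded_case_sum:
  assumes "bounded 1 u" "bounded 1 v" "set_mset \<alpha> \<subseteq> {..<d} <+> {..<d}" "i \<in># \<alpha>"
  shows "case_sum u v i \<in> carrier F \<and> absval (case_sum u v i) \<le> 1"
  using assms by (cases i) (auto simp: bounded_def)

lemma tm_closed:
  assumes "bounded 1 u" "bounded 1 v" "set_mset \<alpha> \<subseteq> {..<d} <+> {..<d}"
  shows "tm u v \<alpha> \<in> carrier F"
  unfolding tm_def using bounded_case_sum[OF assms] c_carrier by (intro m_closed monomial_value_closed) auto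

lemma tm_absval:
  assumes "monomial_value (case_sum u v) \<alpha> \<in> carrier F" "absval (monomial_value (case_sum u v) \<alpha>) \<le> r"
  shows "absval (tm u v \<alpha>) \<le> r"
  using assms mult_mono[OF c_le_1 assms(2)] absval_nonneg c_carrier by (simp add: tm_def absval_mult)

lemma tm_left:
  assumes "bounded 1 u" "bounded 1 v" "set_mset \<alpha> \<subseteq> {..<d} <+> {..<d}" "\<And>b. Inr b \<notin># \<alpha>"
  shows "tm u w \<alpha> = tm u v \<alpha>"
  unfolding tm_def using bounded_case_sum[OF assms(1-3)] assms(4)
  by (intro arg_cong2[where f = "(\<otimes>)"] refl monomial_value_cong) (auto split: sum.splits)

lemma tm_right:
  assumes "bounded 1 u" "bounded 1 v" "set_mset \<alpha> \<subseteq> {..<d} <+> {..<d}" "\<And>b. Inl b \<notin># \<alpha>"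
  shows "tm w v \<alpha> = tm u v \<alpha>"
  unfolding tm_def using bounded_case_sum[OF assms(1-3)] assms(4)
  by (intro arg_cong2[where f = "(\<otimes>)"] refl monomial_value_cong) (auto split: sum.splits)

lemma tm_zero_left:
  assumes "bounded 1 v" "set_mset \<alpha> \<subseteq> {..<d} <+> {..<d}" "Inl a \<in># \<alpha>"
  shows "tm zv v \<alpha> = \<zero>"
proof -
  have "monomial_value (case_sum zv v) \<alpha> = \<zero>"
    using bounded_case_sum[OF bounded_o assms(1,2)] assms(2,3) by (intro monomial_value_zero[of _ _ "Inl a"]) auto
  then show ?thesis
    by (simp add: tm_def c_carrier)
qed

lemma tm_zero_right:
  assumes "bounded 1 u" "set_mset \<alpha> \<subseteq> {..<d} <+> {..<d}" "Inr a \<in># \<alpha>"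
  shows "tm u zv \<alpha> = \<zero>"
proof -
  have "monomial_value (case_sum u zv) \<alpha> = \<zero>"
    using bounded_case_sum[OF assms(1) bounded_o assms(2)] assms(2,3)
      by (intro monomial_value_zero[of _ _ "Inr a"]) auto
  then show ?thesis
    by (simp add: tm_def c_carrier)
qed

text \<open>Monomials in one of the two groups of variables only are reproduced by setting the other
  group to 0; just the mixed ones contribute to the error terms below.\<close>

lemma monomial_type_cases:
  obtains "\<alpha> = {#}" | a where "Inl a \<in># \<alpha>" "\<And>b. Inr b \<notin># \<alpha>" | b where "Inr b \<in># \<alpha>" "\<And>a. Inl a \<notin># \<alpha>"
    | a b \<beta> where "\<alpha> = add_mset (Inl a) (add_mset (Inr b) \<beta>)"
proof (cases "\<exists>a. Inl a \<in># \<alpha>")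
  case True
  then obtain a where a: "Inl a \<in># \<alpha>"
    by blast
  show thesis
  proof (cases "\<exists>b. Inr b \<in># \<alpha>")
    case True
    then obtain b where b: "Inr b \<in># \<alpha>"
      by blast
    obtain \<gamma> where g: "\<alpha> = add_mset (Inl a) \<gamma>"
      using a by (meson multi_member_split)
    then have "Inr b \<in># \<gamma>"
      using b by simp
    then obtain \<beta> where "\<gamma> = add_mset (Inr b) \<beta>"
      by (meson multi_member_split)
    then show thesis
      using that(4) g by blast
  qed (use that(2) a in blast)
next
  case no: False
  show thesis
  proof (cases "\<exists>b. Inr b \<in># \<alpha>")
    case False
    then have "x \<notin># \<alpha>" for x
      using no by (cases x) auto
    then show thesis
      using that(1) by (metis multiset_nonemptyE)
  qed (use that(3) no in blast)
qed

lemma tm_mixed: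
  assumes "bounded 1 u" "bounded 1 v" "set_mset (add_mset (Inl a) (add_mset (Inr b) \<beta>)) \<subseteq> {..<d} <+> {..<d}"
  shows "monomial_value (case_sum u v) (add_mset (Inl a) (add_mset (Inr b) \<beta>)) = u a \<otimes> (v b \<otimes> monomial_value (case_sum u
    v) \<beta>)"
    "u a \<in> carrier F" "v b \<in> carrier F" "monomial_value (case_sum u v) \<beta> \<in> carrier F"
proof -
  let ?x = "case_sum u v"
  have c: "?x i \<in> carrier F" if "i \<in># add_mset (Inl a) (add_mset (Inr b) \<beta>)" for i
    using bounded_case_sum[OF assms that] by blast
  show "u a \<in> carrier F" "v b \<in> carrier F"
    using c[of "Inl a"] c[of "Inr b"] by simp_all
  show "monomial_value ?x \<beta> \<in> carrier F"
    using c by (intro monomial_value_closed) simp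
  have "monomial_value ?x (add_mset (Inl a) (add_mset (Inr b) \<beta>)) = ?x (Inl a) \<otimes> monomial_value ?x (add_mset (Inr b) \<beta>)"
    using c c[of "Inl a"] by (intro monomial_value_add_mset) auto
  also have "monomial_value ?x (add_mset (Inr b) \<beta>) = ?x (Inr b) \<otimes> monomial_value ?x \<beta>"
    using c c[of "Inr b"] by (intro monomial_value_add_mset) auto
  finally show "monomial_value ?x (add_mset (Inl a) (add_mset (Inr b) \<beta>)) = u a \<otimes> (v b \<otimes> monomial_value ?x \<beta>)"
    by simp
qed

lemma eventually_finite_subsets:
  "eventually (\<lambda>A. finite A \<and> A \<subseteq> S) (finite_subsets_at_top S)"
  by (intro eventually_finite_subsets_at_top_weakI) blast

lemma finsum_near:
  assumes "finite A" "A \<subseteq> {\<alpha>. set_mset \<alpha> \<subseteq> {..<d} <+> {..<d}}" "0 \<le> r"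
    "\<And>\<alpha>. set_mset \<alpha> \<subseteq> {..<d} <+> {..<d} \<Longrightarrow> near r (f \<alpha>) (g \<alpha>)"
  shows "near r (finsum F f A) (finsum F g A)"
  using assms by (intro near_finsum) auto

text \<open>What \<open>F(X, Y)\<close> has beyond \<open>F(X, 0)\<close> and \<open>F(0, Y)\<close>
  are mixed monomials, each divisible by a variable from either side and thus of size at most
  \<open>r * s\<close>. The ultrametric inequality passes this to finite partial sums and so to the
  limits.\<close>

theorem sums_additive:
  assumes u: "bounded r u" and v: "bounded s v" and rs: "0 < r" "r \<le> 1" "0 < s" "s \<le> 1"
    and uv: "series u v z" and u0: "series u zv x" and v0: "series zv v y"
  shows "near (r * s) z (x \<oplus> y)"
proof -
  note b = bounded_mono[OF u rs(2)] bounded_mono[OF v rs(4)] bounded_o[of 1]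
  have R: "0 < r * s"
    using rs by simp
  have tm: "near (r * s) (tm u v \<alpha>) (tm u zv \<alpha> \<oplus> tm zv v \<alpha>)" if \<alpha>: "set_mset \<alpha> \<subseteq> {..<d} <+> {..<d}" for \<alpha>
  proof (cases \<alpha> rule: monomial_type_cases)
    case 1
    then show ?thesis
      using R by (simp add: tm_def c_empty near_refl)
  next
    case (2 a)
    then show ?thesis
      using R tm_left[OF b(1,3) \<alpha>, of v] tm_zero_left[OF b(2) \<alpha>] tm_closed[OF b(1,3) \<alpha>] by (simp add: near_refl)
  next
    case (3 a)
    then show ?thesis
      using R tm_right[OF b(3,2) \<alpha>, of u] tm_zero_right[OF b(1) \<alpha>] tm_closed[OF b(3,2) \<alpha>] by (simp add: near_refl)
  next
    case (4 a c \<beta>)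
    note m = tm_mixed[OF b(1,2) \<alpha>[unfolded 4]]
    have ac: "a < d" "c < d"
      using \<alpha> 4 by auto
    have "absval (monomial_value (case_sum u v) \<beta>) \<le> 1"
      using bounded_case_sum[OF b(1,2) \<alpha>] 4 by (intro monomial_value_le_1) auto
    then have "absval (u a) * (absval (v c) * absval (monomial_value (case_sum u v) \<beta>)) \<le> r * (s * 1)"
      using u v ac m rs by (intro mult_mono) (auto simp: bounded_def absval_nonneg)
    then have "absval (tm u v \<alpha>) \<le> r * s"
      using m unfolding 4 by (intro tm_absval) (auto simp: absval_mult)
    then show ?thesis
      using tm_zero_left[OF b(2) \<alpha>, of a] tm_zero_right[OF b(1) \<alpha>, of c] tm_closed[OF b(1,2) \<alpha>] 4
      by (simp add: near_zero)
  qed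
  let ?S = "\<lambda>u v A. \<Oplus>\<alpha>\<in>A. tm u v \<alpha>" and ?FF = "finite_subsets_at_top {\<alpha>. set_mset \<alpha> \<subseteq> {..<d} <+> {..<d}}"
  have ev: "eventually (\<lambda>A. near (r * s) (?S u v A) z) ?FF" "eventually (\<lambda>A. near (r * s) (?S u zv A) x) ?FF"
    "eventually (\<lambda>A. near (r * s) (?S zv v A) y) ?FF"
    using power_series_sums_eventually[OF uv[unfolded series_def] R]
      power_series_sums_eventually[OF u0[unfolded series_def] R]
      power_series_sums_eventually[OF v0[unfolded series_def] R]
    unfolding tm_def .
  \<comment> \<open>The claim does not mention \<open>A\<close>: one finite set for which all three
    partial sums are close enough yields it.\<close>
  have "eventually (\<lambda>A. near (r * s) z (x \<oplus> y)) ?FF"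
    using ev eventually_finite_subsets
  proof eventually_elim
    case (elim A)
    have "near (r * s) (?S u v A) (\<Oplus>\<alpha>\<in>A. tm u zv \<alpha> \<oplus> tm zv v \<alpha>)"
      using elim R tm by (intro finsum_near) auto
    also have "(\<Oplus>\<alpha>\<in>A. tm u zv \<alpha> \<oplus> tm zv v \<alpha>) = ?S u zv A \<oplus> ?S zv v A"
      using elim(4) subsetD[of A] tm_closed[OF b(1,3)] tm_closed[OF b(3,2)] by (intro finsum_addf) auto
    finally show ?case
      using near_trans[OF near_sym[OF elim(1)] near_trans[OF _ near_add[OF elim(2,3)]]] by blast
  qed
  then show ?thesis
    by simp
qed

text \<open>Scaling the arguments by \<open>a\<close> and \<open>b\<close> scales the bilinear mixed
  terms exactly by \<open>a \<otimes> b\<close>; the other mixed monomials have degree at least 3.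
  In effect \<open>z - x - y\<close> is compared with its scaled counterpart, with subtracted terms
  moved across so that only sums occur.\<close>

theorem sums_scale:
  assumes u: "bounded r u" and v: "bounded r v" and r: "0 < r" "r \<le> 1"
    and a: "a \<in> carrier F" "a \<noteq> \<zero>" "absval a \<le> 1" and b: "b \<in> carrier F" "b \<noteq> \<zero>" "absval b \<le> 1"
    and u': "\<And>k. k < d \<Longrightarrow> u' k = a \<otimes> u k" and v': "\<And>k. k < d \<Longrightarrow> v' k = b \<otimes> v k"
    and uv: "series u v z" "series u zv x" "series zv v y" and uv': "series u' v' z'" "series u' zv x'"
      "series zv v' y'"
  shows "near (absval a * absval b * r ^ 3) (a \<otimes> b \<otimes> z \<oplus> (x' \<oplus> y')) (z' \<oplus> (a \<otimes> b \<otimes> x \<oplus> a \<otimes> b \<otimes> y))"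
proof -
  let ?w = "a \<otimes> b" and ?R = "absval a * absval b * r ^ 3"
  have ab0: "0 < absval a" "0 < absval b"
    using a b absval_nonneg absval_eq_0_iff by (metis less_eq_real_def)+
  have wc: "?w \<in> carrier F" and w: "absval ?w = absval a * absval b" "absval ?w \<le> 1"
    using a b by (simp_all add: absval_mult absval_nonneg mult_le_one)
  have R: "0 < ?R"
    using ab0 r by simp
  have sc: "absval (a \<otimes> u k) \<le> absval a * r \<and> a \<otimes> u k \<in> carrier F"
    "absval (b \<otimes> v k) \<le> absval b * r \<and> b \<otimes> v k \<in> carrier F" if "k < d" for k
    using u v a b that by (auto simp: bounded_def absval_mult intro!: mult_left_mono absval_nonneg)
  have us: "bounded (absval a * r) u'" and vs: "bounded (absval b * r) v'"
    using sc u' v' by (auto simp: bounded_def)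
  have ar: "absval a * r \<le> r" "absval b * r \<le> r"
    using a b r by (auto simp: mult_le_cancel_right1)
  note bd = bounded_mono[OF u r(2)] bounded_mono[OF v r(2)] bounded_o[of 1]
    bounded_mono[OF us order_trans[OF ar(1) r(2)]] bounded_mono[OF vs order_trans[OF ar(2) r(2)]]
  have tm: "near ?R (?w \<otimes> tm u v \<alpha> \<oplus> (tm u' zv \<alpha> \<oplus> tm zv v' \<alpha>)) (tm u' v' \<alpha> \<oplus> (?w \<otimes> tm u zv \<alpha> \<oplus> ?w \<otimes> tm zv v \<alpha>))"
    if \<alpha>: "set_mset \<alpha> \<subseteq> {..<d} <+> {..<d}" for \<alpha>
  proof (cases \<alpha> rule: monomial_type_cases)
    case 1
    then show ?thesis
      using R wc by (simp add: tm_def c_empty near_refl)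
  next
    case (2 k)
    then show ?thesis
      using R wc tm_left[OF bd(1,3) \<alpha>, of v] tm_left[OF bd(4,3) \<alpha>, of v'] tm_zero_left[OF bd(2) \<alpha>]
        tm_zero_left[OF bd(5) \<alpha>]
        tm_closed[OF bd(1,3) \<alpha>] tm_closed[OF bd(4,3) \<alpha>] by (simp add: near_refl a_comm)
  next
    case (3 k)
    then show ?thesis
      using R wc tm_right[OF bd(3,2) \<alpha>, of u] tm_right[OF bd(3,5) \<alpha>, of u'] tm_zero_right[OF bd(1) \<alpha>]
        tm_zero_right[OF bd(4) \<alpha>]
        tm_closed[OF bd(3,2) \<alpha>] tm_closed[OF bd(3,5) \<alpha>] by (simp add: near_refl a_comm)
  next
    case (4 k l \<beta>)
    note m = tm_mixed[OF bd(1,2) \<alpha>[unfolded 4]] and m' = tm_mixed[OF bd(4,5) \<alpha>[unfolded 4]]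
    have kl: "k < d" "l < d"
      using \<alpha> 4 by auto
    have "near ?R (?w \<otimes> tm u v \<alpha>) (tm u' v' \<alpha>)"
    proof (cases "\<beta> = {#}")
      case True
      have "?w \<otimes> tm u v \<alpha> = tm u' v' \<alpha>"
        using m m' a b c_carrier[of \<alpha>] u'[OF kl(1)] v'[OF kl(2)]
        unfolding tm_def 4 True by (simp add: m_ac)
      then show ?thesis
        using R near_refl[OF tm_closed[OF bd(4,5) \<alpha>]] by simp
    next
      case False
      then obtain i where i: "i \<in># \<beta>"
        by blast
      have iu: "absval (case_sum u v i) \<le> r" "absval (case_sum u' v' i) \<le> r"
        using i \<alpha> 4 u v bounded_mono[OF us ar(1)] bounded_mono[OF vs ar(2)]
          by (auto simp: bounded_def split: sum.splits)
      have "absval (monomial_value (case_sum u v) \<beta>) \<le> r" "absval (monomial_value (case_sum u' v') \<beta>) \<le> r"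
        using bounded_case_sum[OF bd(1,2) \<alpha>] bounded_case_sum[OF bd(4,5) \<alpha>] 4 i iu
        by (auto intro!: monomial_value_le[of _ _ i])
      then have "absval (u k) * (absval (v l) * absval (monomial_value (case_sum u v) \<beta>)) \<le> r * (r * r)"
        "absval (u' k) * (absval (v' l) * absval (monomial_value (case_sum u' v') \<beta>)) \<le> (absval a * r) * ((absval b * r)
          * r)"
        using u v us vs kl m m' r ab0 by (auto intro!: mult_mono simp: bounded_def absval_nonneg)
      then have t: "absval (tm u v \<alpha>) \<le> r * (r * r)" "absval (tm u' v' \<alpha>) \<le> (absval a * r) * ((absval b * r) * r)"
        using m m' unfolding 4 by (auto intro!: tm_absval simp: absval_mult)
      have "absval (?w \<otimes> tm u v \<alpha>) \<le> ?R"
        using mult_left_mono[OF t(1), of "absval ?w"] wc tm_closed[OF bd(1,2) \<alpha>]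
        by (simp add: absval_mult[OF wc] absval_nonneg[OF a(1)] absval_nonneg[OF b(1)] w(1) power3_eq_cube mult_ac)
      moreover have "absval (tm u' v' \<alpha>) \<le> ?R"
        using t(2) by (simp add: power3_eq_cube mult_ac)
      ultimately show ?thesis
        using near_trans[OF _ near_sym] near_zero wc tm_closed[OF bd(1,2) \<alpha>] tm_closed[OF bd(4,5) \<alpha>] by (meson m_closed)
    qed
    then show ?thesis
      using tm_zero_left[OF bd(2) \<alpha>, of k] tm_zero_right[OF bd(1) \<alpha>, of l]
        tm_zero_left[OF bd(5) \<alpha>, of k] tm_zero_right[OF bd(4) \<alpha>, of l] tm_closed[OF bd(1,2) \<alpha>] tm_closed[OF bd(4,5) \<alpha>]
          4 wc
      by simp
  qed
  let ?S = "\<lambda>u v A. \<Oplus>\<alpha>\<in>A. tm u v \<alpha>" and ?FF = "finite_subsets_at_top {\<alpha>. set_mset \<alpha> \<subseteq> {..<d} <+> {..<d}}"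
  have ev: "eventually (\<lambda>A. near ?R (?S u v A) z) ?FF" if "series u v z" for u v z
    using power_series_sums_eventually[OF that[unfolded series_def] R] unfolding tm_def .
  have "eventually (\<lambda>A. near ?R (?w \<otimes> z \<oplus> (x' \<oplus> y')) (z' \<oplus> (?w \<otimes> x \<oplus> ?w \<otimes> y))) ?FF"
    using uv[THEN ev] uv'[THEN ev] eventually_finite_subsets
  proof eventually_elim
    case (elim A)
    have wn: "near ?R (?w \<otimes> f) (?w \<otimes> g)" if "near ?R f g" for f g
      using near_mono[OF near_mult[OF wc that]] w(2) R absval_nonneg[OF wc] by (simp add: mult_left_le_one_le)
    have fin: "finite A" "\<And>\<alpha>. \<alpha> \<in> A \<Longrightarrow> set_mset \<alpha> \<subseteq> {..<d} <+> {..<d}"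
      using elim(7) by auto
    have cl: "tm f g \<in> A \<rightarrow> carrier F" if "bounded 1 f" "bounded 1 g" for f g
      using tm_closed[OF that] fin(2) by auto
    have wcl: "(\<lambda>\<alpha>. ?w \<otimes> tm f g \<alpha>) \<in> A \<rightarrow> carrier F" if "bounded 1 f" "bounded 1 g" for f g
      using cl[OF that] wc by auto
    have ws: "(\<Oplus>\<alpha>\<in>A. ?w \<otimes> tm f g \<alpha>) = ?w \<otimes> ?S f g A" if "bounded 1 f" "bounded 1 g" for f g
      using finsum_rdistr[OF fin(1) wc cl[OF that]] by simp
    have acl: "(\<lambda>\<alpha>. f \<alpha> \<oplus> g \<alpha>) \<in> A \<rightarrow> carrier F" if "f \<in> A \<rightarrow> carrier F" "g \<in> A \<rightarrow> carrier F" for f g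
      using that by auto
    have "near ?R (\<Oplus>\<alpha>\<in>A. ?w \<otimes> tm u v \<alpha> \<oplus> (tm u' zv \<alpha> \<oplus> tm zv v' \<alpha>)) (\<Oplus>\<alpha>\<in>A. tm u' v' \<alpha> \<oplus> (?w \<otimes> tm u zv \<alpha> \<oplus> ?w \<otimes> tm zv v
      \<alpha>))"
      using elim(7) R tm by (intro finsum_near) auto
    also have "(\<Oplus>\<alpha>\<in>A. ?w \<otimes> tm u v \<alpha> \<oplus> (tm u' zv \<alpha> \<oplus> tm zv v' \<alpha>)) = ?w \<otimes> ?S u v A \<oplus> (?S u' zv A \<oplus> ?S zv v' A)"
      using finsum_addf[OF wcl[OF bd(1,2)] acl[OF cl[OF bd(4,3)] cl[OF bd(3,5)]]] finsum_addf[OF cl[OF bd(4,3)]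
        cl[OF bd(3,5)]]
        ws[OF bd(1,2)] by simp
    also have "(\<Oplus>\<alpha>\<in>A. tm u' v' \<alpha> \<oplus> (?w \<otimes> tm u zv \<alpha> \<oplus> ?w \<otimes> tm zv v \<alpha>)) = ?S u' v' A \<oplus> (?w \<otimes> ?S u zv A \<oplus> ?w \<otimes> ?S zv v A)"
      using finsum_addf[OF cl[OF bd(4,5)] acl[OF wcl[OF bd(1,3)] wcl[OF bd(3,2)]]] finsum_addf[OF wcl[OF bd(1,3)]
        wcl[OF bd(3,2)]]
        ws[OF bd(1,3)] ws[OF bd(3,2)] by simp
    finally have 1: "near ?R (?w \<otimes> ?S u v A \<oplus> (?S u' zv A \<oplus> ?S zv v' A)) (?S u' v' A \<oplus> (?w \<otimes> ?S u zv A \<oplus> ?w \<otimes> ?S zv v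
      A))" .
    have 2: "near ?R (?w \<otimes> ?S u v A \<oplus> (?S u' zv A \<oplus> ?S zv v' A)) (?w \<otimes> z \<oplus> (x' \<oplus> y'))"
      by (intro near_add wn elim)
    have 3: "near ?R (?S u' v' A \<oplus> (?w \<otimes> ?S u zv A \<oplus> ?w \<otimes> ?S zv v A)) (z' \<oplus> (?w \<otimes> x \<oplus> ?w \<otimes> y))"
      by (intro near_add wn elim)
    show ?case
      by (rule near_trans[OF near_sym[OF 2] near_trans[OF 1 3]])
  qed
  then show ?thesis
    by simp
qed

end

section \<open>Congruence levels of a standard group\<close>

locale standard_chart = uniformized_field F absval \<pi> T for F (structure) and absval and \<pi> T +
  fixes d :: nat and H :: "('g, 'm) monoid_scheme" and T\<^sub>H :: "'g topology" and \<psi> :: "'g \<Rightarrow> nat \<Rightarrow> 'a"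
  assumes standard: "standard_group d H T\<^sub>H \<psi>"
begin

sublocale H: topological_group H T\<^sub>H
  using standard by (simp add: standard_group_def analytic_group_in_chart_def)

lemma chart_homeomorphic:
  "homeomorphic_map T\<^sub>H (product_topology (\<lambda>_. subtopology mtopology maximal_ideal_set) {..<d}) \<psi>"
  using standard by (simp add: standard_group_def analytic_group_in_chart_def)

lemma chart_image: "\<psi> ` carrier H = {..<d} \<rightarrow>\<^sub>E maximal_ideal_set"
proof -
  have "carrier F \<inter> maximal_ideal_set = maximal_ideal_set"
    by (auto simp: maximal_ideal_set_def)
  then show ?thesis
    using homeomorphic_imp_surjective_map[OF chart_homeomorphic] H.topspace_eq by simp
qed

lemma chart_inj: "x \<in> carrier H \<Longrightarrow> y \<in> carrier H \<Longrightarrow> \<psi> x = \<psi> y \<Longrightarrow> x = y"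
  using homeomorphic_imp_injective_map[OF chart_homeomorphic] H.topspace_eq by (simp add: inj_on_def)

lemma chart_one: "\<psi> \<one>\<^bsub>H\<^esub> = (\<lambda>i\<in>{..<d}. \<zero>)"
  using standard by (simp add: standard_group_def)

lemma chart_one_apply [simp]: "k < d \<Longrightarrow> \<psi> \<one>\<^bsub>H\<^esub> k = \<zero>"
  by (simp add: chart_one)

lemma chart_bound:
  assumes "x \<in> carrier H" "k < d"
  shows "\<psi> x k \<in> carrier F" "absval (\<psi> x k) \<le> q"
proof -
  have "\<psi> x k \<in> maximal_ideal_set"
    using chart_image assms by blast
  then show "\<psi> x k \<in> carrier F" "absval (\<psi> x k) \<le> q"
    by (auto simp: maximal_ideal_set_def intro: pi_max)
qed

lemma q_pow_mono: "m \<le> n \<Longrightarrow> q ^ n \<le> q ^ m"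
  using q_pos pi_less_1 by (intro power_decreasing) auto

lemma chart_series:
  assumes "k < d"
  obtains c where "two_variable_series F absval c"
    "\<forall>x\<in>carrier H. \<forall>y\<in>carrier H. two_variable_series.series F absval d c (\<psi> x) (\<psi> y) (\<psi> (x \<otimes>\<^bsub>H\<^esub> y) k)"
proof -
  obtain c where c: "\<forall>\<alpha>. c \<alpha> \<in> carrier valuation_ring" "c {#} = \<zero>"
    and s: "\<forall>x\<in>carrier H. \<forall>y\<in>carrier H.
      power_series_sums ({..<d} <+> {..<d}) c (case_sum (\<psi> x) (\<psi> y)) (\<psi> (x \<otimes>\<^bsub>H\<^esub> y) k)"
    using standard assms unfolding standard_group_def by blast
  interpret S: two_variable_series F absval d c
    by unfold_locales (use c in \<open>auto simp: valuation_ring_def\<close>)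
  show ?thesis
    using that[OF S.two_variable_series_axioms] s by (simp add: S.series_def)
qed

definition lev :: "nat \<Rightarrow> 'g set" where
  "lev i = {x \<in> carrier H. \<forall>k<d. absval (\<psi> x k) \<le> q ^ i}"

lemma lev_carrier: "x \<in> lev i \<Longrightarrow> x \<in> carrier H"
  by (simp add: lev_def)

lemma lev_antimono: "i \<le> j \<Longrightarrow> lev j \<subseteq> lev i"
  using q_pow_mono by (auto simp: lev_def intro: order_trans)

lemma lev_1: "lev (Suc 0) = carrier H"
  using chart_bound by (auto simp: lev_def)

lemma one_lev: "\<one>\<^bsub>H\<^esub> \<in> lev i"
  using q_pos by (simp add: lev_def)

lemma chart_additive:
  assumes x: "x \<in> lev i" and y: "y \<in> lev j" and k: "k < d"
  shows "near (q ^ (i + j)) (\<psi> (x \<otimes>\<^bsub>H\<^esub> y) k) (\<psi> x k \<oplus> \<psi> y k)"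
proof -
  obtain c where c: "two_variable_series F absval c"
    "\<forall>x\<in>carrier H. \<forall>y\<in>carrier H. two_variable_series.series F absval d c (\<psi> x) (\<psi> y) (\<psi> (x \<otimes>\<^bsub>H\<^esub> y) k)"
    by (rule chart_series[OF k])
  interpret S: two_variable_series F absval d c
    by (rule c(1))
  have xy: "x \<in> carrier H" "y \<in> carrier H"
    using x y lev_carrier by blast+
  have "near (q ^ i * q ^ j) (\<psi> (x \<otimes>\<^bsub>H\<^esub> y) k) (\<psi> x k \<oplus> \<psi> y k)"
  proof (rule S.sums_additive[where u = "\<psi> x" and v = "\<psi> y"])
    show "S.bounded (q ^ i) (\<psi> x)" "S.bounded (q ^ j) (\<psi> y)"
      using x y chart_bound by (auto simp: S.bounded_def lev_def)
    show "S.series (\<psi> x) (\<psi> y) (\<psi> (x \<otimes>\<^bsub>H\<^esub> y) k)"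
      using c(2) xy by blast
    \<comment> \<open>\<open>F(x, 0) = x\<close> and \<open>F(0, y) = y\<close> come from
      multiplication by the unit, whose coordinates are \<open>S.zv\<close>.\<close>
    show "S.series (\<psi> x) S.zv (\<psi> x k)" "S.series S.zv (\<psi> y) (\<psi> y k)"
      using c(2)[rule_format, OF xy(1) H.one_closed] c(2)[rule_format, OF H.one_closed xy(2)] xy
        by (simp_all add: chart_one)
  qed (use q_pos pi_less_1 in \<open>auto simp: power_le_one\<close>)
  then show ?thesis
    by (simp add: power_add)
qed

lemma chart_scale:
  assumes xy: "x \<in> carrier H" "y \<in> carrier H" "x' \<in> carrier H" "y' \<in> carrier H" and k: "k < d"
    and x': "\<And>k. k < d \<Longrightarrow> \<psi> x' k = \<pi> [^] r \<otimes> \<psi> x k" and y': "\<And>k. k < d \<Longrightarrow> \<psi> y' k = \<pi> [^] s \<otimes> \<psi> y k"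
  shows "near (q ^ (r + s + 3)) (\<pi> [^] (r + s) \<otimes> \<psi> (x \<otimes>\<^bsub>H\<^esub> y) k \<oplus> (\<psi> x' k \<oplus> \<psi> y' k))
    (\<psi> (x' \<otimes>\<^bsub>H\<^esub> y') k \<oplus> (\<pi> [^] (r + s) \<otimes> \<psi> x k \<oplus> \<pi> [^] (r + s) \<otimes> \<psi> y k))"
proof -
  obtain c where c: "two_variable_series F absval c"
    "\<forall>x\<in>carrier H. \<forall>y\<in>carrier H. two_variable_series.series F absval d c (\<psi> x) (\<psi> y) (\<psi> (x \<otimes>\<^bsub>H\<^esub> y) k)"
    by (rule chart_series[OF k])
  interpret S: two_variable_series F absval d c
    by (rule c(1))
  have u0: "S.series (\<psi> x) S.zv (\<psi> x k)" "S.series S.zv (\<psi> x) (\<psi> x k)" if "x \<in> carrier H" for x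
    using c(2)[rule_format, OF that H.one_closed] c(2)[rule_format, OF H.one_closed that] that
      by (simp_all add: chart_one)
  have "near (absval (\<pi> [^] r) * absval (\<pi> [^] s) * q ^ 3) (\<pi> [^] r \<otimes> \<pi> [^] s \<otimes> \<psi> (x \<otimes>\<^bsub>H\<^esub> y) k \<oplus> (\<psi> x' k \<oplus> \<psi> y' k))
    (\<psi> (x' \<otimes>\<^bsub>H\<^esub> y') k \<oplus> (\<pi> [^] r \<otimes> \<pi> [^] s \<otimes> \<psi> x k \<oplus> \<pi> [^] r \<otimes> \<pi> [^] s \<otimes> \<psi> y k))"
  proof (rule S.sums_scale[where u = "\<psi> x" and v = "\<psi> y" and u' = "\<psi> x'" and v' = "\<psi> y'"])
    show "S.bounded q (\<psi> x)" "S.bounded q (\<psi> y)"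
      using xy chart_bound by (auto simp: S.bounded_def)
  qed (use q_pos pi_less_1 pi_pow x' y' xy u0 c(2) in \<open>auto simp: power_le_one\<close>)
  then show ?thesis
    by (simp add: pi_pow power_add nat_pow_mult pi_carrier)
qed

text \<open>Bootstrapping: if \<open>z\<close> is known to lie in \<open>lev m\<close>, then \<open>\<psi> w\<close> agrees with \<open>\<psi> z + \<psi> v\<close> up to \<open>q ^ Suc m\<close>,
  which puts \<open>z\<close> into \<open>lev (Suc m)\<close> as long as \<open>m < l\<close>.\<close>
lemma lev_quotient:
  assumes z: "z \<in> carrier H" and v: "v \<in> carrier H" and w: "w = z \<otimes>\<^bsub>H\<^esub> v \<or> w = v \<otimes>\<^bsub>H\<^esub> z"
    and wv: "\<And>k. k < d \<Longrightarrow> near (q ^ l) (\<psi> w k) (\<psi> v k)"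
  shows "z \<in> lev l" "k < d \<Longrightarrow> near (q ^ Suc l) (\<psi> z k) (\<psi> w k \<ominus> \<psi> v k)"
proof -
  have wc: "w \<in> carrier H"
    using w z v by auto
  have step: "near (q ^ Suc m) (\<psi> z k) (\<psi> w k \<ominus> \<psi> v k)" if m: "z \<in> lev m" and k: "k < d" for m k
  proof -
    have v1: "v \<in> lev 1"
      using v lev_1 by simp
    note c = chart_bound(1)[OF z k] chart_bound(1)[OF v k] chart_bound(1)[OF wc k]
    have "near (q ^ Suc m) (\<psi> w k) (\<psi> z k \<oplus> \<psi> v k)"
      using w chart_additive[OF m v1 k] chart_additive[OF v1 m k] c by (auto simp: a_comm)
    from near_minus[OF this near_refl[OF c(2)]] have "near (q ^ Suc m) (\<psi> w k \<ominus> \<psi> v k) (\<psi> z k \<oplus> \<psi> v k \<ominus> \<psi> v k)"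
      using q_pos by simp
    moreover have "\<psi> z k \<oplus> \<psi> v k \<ominus> \<psi> v k = \<psi> z k"
      using c by algebra
    ultimately show ?thesis
      using near_sym by simp
  qed
  have "z \<in> lev m" if "m \<le> l" for m
    using that
  proof (induction m)
    case 0
    then show ?case
      using lev_1 lev_antimono[of 0 1] z by auto
  next
    case (Suc m)
    have "absval (\<psi> z k) \<le> q ^ Suc m" if k: "k < d" for k
    proof (rule near_absval[OF step[OF _ k]])
      show "z \<in> lev m"
        using Suc by simp
      have "absval (\<psi> w k \<ominus> \<psi> v k) \<le> q ^ l"
        using wv[OF k] by (simp add: near_def)
      then show "absval (\<psi> w k \<ominus> \<psi> v k) \<le> q ^ Suc m"
        using q_pow_mono[OF Suc.prems] by linarith
    qed
    then show ?case
      using z by (simp add: lev_def)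
  qed
  then show l: "z \<in> lev l"
    by simp
  show "k < d \<Longrightarrow> near (q ^ Suc l) (\<psi> z k) (\<psi> w k \<ominus> \<psi> v k)"
    by (rule step[OF l])
qed

lemma lev_diff:
  assumes "x \<in> carrier H" "y \<in> carrier H" "\<And>k. k < d \<Longrightarrow> near (q ^ l) (\<psi> x k) (\<psi> y k)"
  shows "inv\<^bsub>H\<^esub> x \<otimes>\<^bsub>H\<^esub> y \<in> lev l"
proof (rule lev_quotient(1)[where v = x and w = y])
  have "y = x \<otimes>\<^bsub>H\<^esub> (inv\<^bsub>H\<^esub> x \<otimes>\<^bsub>H\<^esub> y)"
    using assms by (simp add: H.m_assoc[symmetric])
  then show "y = inv\<^bsub>H\<^esub> x \<otimes>\<^bsub>H\<^esub> y \<otimes>\<^bsub>H\<^esub> x \<or> y = x \<otimes>\<^bsub>H\<^esub> (inv\<^bsub>H\<^esub> x \<otimes>\<^bsub>H\<^esub> y)" ..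
qed (use assms near_sym in auto)

lemma lev_additive:
  assumes "x \<in> lev (Suc i)" "y \<in> lev (Suc i)" "k < d"
  shows "near (q ^ Suc (Suc i)) (\<psi> (x \<otimes>\<^bsub>H\<^esub> y) k) (\<psi> x k \<oplus> \<psi> y k)"
  by (rule near_mono[OF chart_additive[OF assms] q_pow_mono]) simp

lemma lev_inv:
  assumes "x \<in> lev (Suc i)"
  shows "inv\<^bsub>H\<^esub> x \<in> lev (Suc i)" "k < d \<Longrightarrow> near (q ^ Suc (Suc i)) (\<psi> (inv\<^bsub>H\<^esub> x) k) (\<ominus> \<psi> x k)"
proof -
  have x: "x \<in> carrier H"
    using assms lev_carrier by blast
  have w: "\<one>\<^bsub>H\<^esub> = inv\<^bsub>H\<^esub> x \<otimes>\<^bsub>H\<^esub> x \<or> \<one>\<^bsub>H\<^esub> = x \<otimes>\<^bsub>H\<^esub> inv\<^bsub>H\<^esub> x"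
    using x by simp
  have "near (q ^ Suc i) (\<psi> \<one>\<^bsub>H\<^esub> k) (\<psi> x k)" if "k < d" for k
    using assms that chart_bound(1)[OF x that] near_sym near_zero by (simp add: lev_def)
  note l = lev_quotient[OF H.inv_closed[OF x] x w this]
  show "inv\<^bsub>H\<^esub> x \<in> lev (Suc i)"
    by (rule l(1))
  show "near (q ^ Suc (Suc i)) (\<psi> (inv\<^bsub>H\<^esub> x) k) (\<ominus> \<psi> x k)" if k: "k < d"
    using l(2)[OF _ k] k chart_bound(1)[OF x k] by (simp add: a_minus_def)
qed

lemma lev_subgroup: "subgroup (lev (Suc i)) H"
proof (rule H.subgroupI)
  show "x \<otimes>\<^bsub>H\<^esub> y \<in> lev (Suc i)" if xy: "x \<in> lev (Suc i)" "y \<in> lev (Suc i)" for x y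
  proof -
    have "absval (\<psi> (x \<otimes>\<^bsub>H\<^esub> y) k) \<le> q ^ Suc i" if k: "k < d" for k
    proof (rule near_absval[OF near_mono[OF lev_additive[OF xy k] q_pow_mono]])
      show "absval (\<psi> x k \<oplus> \<psi> y k) \<le> q ^ Suc i"
        using xy k chart_bound(1)[OF lev_carrier[OF xy(1)] k] chart_bound(1)[OF lev_carrier[OF xy(2)] k]
        by (intro order_trans[OF absval_add]) (auto simp: lev_def)
    qed simp
    then show ?thesis
      using lev_carrier[OF xy(1)] lev_carrier[OF xy(2)] by (simp add: lev_def)
  qed
  show "lev (Suc i) \<noteq> {}"
    using one_lev by blast
  show "lev (Suc i) \<subseteq> carrier H"
    by (auto simp: lev_def)
qed (rule lev_inv(1))

abbreviation comm :: "'g \<Rightarrow> 'g \<Rightarrow> 'g" where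
  "comm x y \<equiv> x \<otimes>\<^bsub>H\<^esub> y \<otimes>\<^bsub>H\<^esub> inv\<^bsub>H\<^esub> x \<otimes>\<^bsub>H\<^esub> inv\<^bsub>H\<^esub> y"

text \<open>\<open>comm x y\<close> is the quotient of \<open>x y\<close> by \<open>y x\<close>,
  whose coordinates agree up to \<open>q ^ (i + j)\<close> as both are close to the sum; then
  \<open>lev_quotient\<close> applies.\<close>

lemma chart_commutator:
  assumes x: "x \<in> lev i" and y: "y \<in> lev j"
  shows "comm x y \<in> lev (i + j)"
    "k < d \<Longrightarrow> near (q ^ Suc (i + j)) (\<psi> (comm x y) k) (\<psi> (x \<otimes>\<^bsub>H\<^esub> y) k \<ominus> \<psi> (y \<otimes>\<^bsub>H\<^esub> x) k)"
proof -
  have c: "x \<in> carrier H" "y \<in> carrier H"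
    using x y lev_carrier by blast+
  have z: "comm x y \<in> carrier H" and v: "y \<otimes>\<^bsub>H\<^esub> x \<in> carrier H"
    using c by simp_all
  have "comm x y \<otimes>\<^bsub>H\<^esub> (y \<otimes>\<^bsub>H\<^esub> x) = x \<otimes>\<^bsub>H\<^esub> y"
  proof -
    have "inv\<^bsub>H\<^esub> y \<otimes>\<^bsub>H\<^esub> (y \<otimes>\<^bsub>H\<^esub> x) = x"
      using c by (simp add: H.m_assoc[symmetric])
    then show ?thesis
      using c by (simp add: H.m_assoc)
  qed
  then have w: "x \<otimes>\<^bsub>H\<^esub> y = comm x y \<otimes>\<^bsub>H\<^esub> (y \<otimes>\<^bsub>H\<^esub> x) \<or> x \<otimes>\<^bsub>H\<^esub> y = y \<otimes>\<^bsub>H\<^esub> x \<otimes>\<^bsub>H\<^esub> comm x y"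
    by simp
  have "near (q ^ (i + j)) (\<psi> (x \<otimes>\<^bsub>H\<^esub> y) k) (\<psi> (y \<otimes>\<^bsub>H\<^esub> x) k)" if k: "k < d" for k
  proof (rule near_trans[OF chart_additive[OF x y k] near_sym])
    show "near (q ^ (i + j)) (\<psi> (y \<otimes>\<^bsub>H\<^esub> x) k) (\<psi> x k \<oplus> \<psi> y k)"
      using chart_additive[OF y x k] chart_bound(1)[OF c(1) k] chart_bound(1)[OF c(2) k]
        by (simp add: a_comm add.commute)
  qed
  note l = lev_quotient[OF z v w this]
  show "comm x y \<in> lev (i + j)"
    by (rule l(1))
  show "near (q ^ Suc (i + j)) (\<psi> (comm x y) k) (\<psi> (x \<otimes>\<^bsub>H\<^esub> y) k \<ominus> \<psi> (y \<otimes>\<^bsub>H\<^esub> x) k)" if "k < d"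
    by (rule l(2)[OF _ that])
qed

lemma absval_scaled:
  assumes "x \<in> carrier H" "k < d"
  shows "\<pi> [^] r \<otimes> \<psi> x k \<in> carrier F" "absval (\<pi> [^] (r::nat) \<otimes> \<psi> x k) \<le> q ^ Suc r"
  using chart_bound[OF assms] mult_left_mono[of "absval (\<psi> x k)" q "q ^ r"] q_pos pi_pow[of r]
  by (simp_all add: absval_mult mult.commute)

text \<open>Apply \<open>chart_scale\<close> to \<open>(x, y)\<close> and to \<open>(y, x)\<close>
  and subtract: the linear terms cancel, and the differences that remain are the commutators to
  leading order.\<close>

lemma chart_commutator_scale:
  assumes xy: "x \<in> carrier H" "y \<in> carrier H" and x'l: "x' \<in> lev (Suc r)" and y'l: "y' \<in> lev (Suc s)" and k: "k < d"
    and x': "\<And>k. k < d \<Longrightarrow> \<psi> x' k = \<pi> [^] r \<otimes> \<psi> x k" and y': "\<And>k. k < d \<Longrightarrow> \<psi> y' k = \<pi> [^] s \<otimes> \<psi> y k"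
  shows "near (q ^ (r + s + 3)) (\<psi> (comm x' y') k) (\<pi> [^] (r + s) \<otimes> \<psi> (comm x y) k)"
proof -
  have xy': "x' \<in> carrier H" "y' \<in> carrier H"
    using x'l y'l lev_carrier by blast+
  let ?w = "\<pi> [^] (r + s)" and ?R = "q ^ (r + s + 3)"
  have R: "0 \<le> ?R"
    using q_pos by simp
  have l1: "x \<in> lev 1" "y \<in> lev 1"
    using xy lev_1 by simp_all
  have c: "\<psi> (x \<otimes>\<^bsub>H\<^esub> y) k \<in> carrier F" "\<psi> (y \<otimes>\<^bsub>H\<^esub> x) k \<in> carrier F" "\<psi> (x' \<otimes>\<^bsub>H\<^esub> y') k \<in> carrier F"
    "\<psi> (y' \<otimes>\<^bsub>H\<^esub> x') k \<in> carrier F"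
    "\<psi> x k \<in> carrier F" "\<psi> y k \<in> carrier F" "\<psi> x' k \<in> carrier F" "\<psi> y' k \<in> carrier F" "?w \<in> carrier F"
    using chart_bound(1)[OF _ k] xy xy' pi_pow by simp_all
  have A: "near ?R (?w \<otimes> \<psi> (x \<otimes>\<^bsub>H\<^esub> y) k \<oplus> (\<psi> x' k \<oplus> \<psi> y' k)) (\<psi> (x' \<otimes>\<^bsub>H\<^esub> y') k \<oplus> (?w \<otimes> \<psi> x k \<oplus> ?w \<otimes> \<psi> y k))"
    by (rule chart_scale[OF xy xy' k x' y'])
  have B: "near ?R (?w \<otimes> \<psi> (y \<otimes>\<^bsub>H\<^esub> x) k \<oplus> (\<psi> y' k \<oplus> \<psi> x' k)) (\<psi> (y' \<otimes>\<^bsub>H\<^esub> x') k \<oplus> (?w \<otimes> \<psi> y k \<oplus> ?w \<otimes> \<psi> x k))"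
    unfolding add.commute[of r s] by (rule chart_scale[OF xy(2,1) xy'(2,1) k y' x'])
  let ?C = "\<psi> (x \<otimes>\<^bsub>H\<^esub> y) k \<ominus> \<psi> (y \<otimes>\<^bsub>H\<^esub> x) k" and ?C' = "\<psi> (x' \<otimes>\<^bsub>H\<^esub> y') k \<ominus> \<psi> (y' \<otimes>\<^bsub>H\<^esub> x') k"
  have 1: "(?w \<otimes> \<psi> (x \<otimes>\<^bsub>H\<^esub> y) k \<oplus> (\<psi> x' k \<oplus> \<psi> y' k)) \<ominus> (?w \<otimes> \<psi> (y \<otimes>\<^bsub>H\<^esub> x) k \<oplus> (\<psi> y' k \<oplus> \<psi> x' k)) = ?w \<otimes> ?C"
    using c by algebra
  have 2: "(\<psi> (x' \<otimes>\<^bsub>H\<^esub> y') k \<oplus> (?w \<otimes> \<psi> x k \<oplus> ?w \<otimes> \<psi> y k)) \<ominus> (\<psi> (y' \<otimes>\<^bsub>H\<^esub> x') k \<oplus> (?w \<otimes> \<psi> y k \<oplus> ?w \<otimes> \<psi> x k)) = ?C'"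
    using c by algebra
  have "near ?R (?w \<otimes> ?C) ?C'"
    using near_minus[OF A B] unfolding 1 2 .
  moreover have "near ?R (\<psi> (comm x' y') k) ?C'"
    using chart_commutator(2)[OF x'l y'l k] by (simp add: numeral_3_eq_3)
  moreover have "near ?R (?w \<otimes> \<psi> (comm x y) k) (?w \<otimes> ?C)"
    using near_mult[OF pi_pow(1)[of "r + s"] chart_commutator(2)[OF l1 k]]
    by (simp add: pi_pow power_add[symmetric] numeral_3_eq_3 mult_ac)
  ultimately show "near ?R (\<psi> (comm x' y') k) (?w \<otimes> \<psi> (comm x y) k)"
    using near_sym near_trans by blast
qed

lemma chart_surj:
  assumes "\<And>k. k < d \<Longrightarrow> f k \<in> carrier F \<and> absval (f k) < 1"
  obtains x where "x \<in> carrier H" "\<And>k. k < d \<Longrightarrow> \<psi> x k = f k"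
proof -
  have "(\<lambda>k\<in>{..<d}. f k) \<in> \<psi> ` carrier H"
    unfolding chart_image using assms by (auto simp: maximal_ideal_set_def)
  then obtain x where x: "x \<in> carrier H" "\<psi> x = (\<lambda>k\<in>{..<d}. f k)"
    by auto
  show ?thesis
    by (rule that[OF x(1)]) (simp add: x(2))
qed

lemma chart_scaled:
  assumes "x \<in> carrier H"
  obtains x' where "x' \<in> lev (Suc r)" "\<forall>k<d. \<psi> x' k = \<pi> [^] r \<otimes> \<psi> x k"
proof -
  have lt: "absval (\<pi> [^] r \<otimes> \<psi> x k) < 1" if "k < d" for k
    using absval_scaled(2)[OF assms that, of r] q_pow_mono[of 1 "Suc r"] pi_less_1 by simp
  obtain x' where x': "x' \<in> carrier H" "\<And>k. k < d \<Longrightarrow> \<psi> x' k = \<pi> [^] r \<otimes> \<psi> x k"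
    by (rule chart_surj[of "\<lambda>k. \<pi> [^] r \<otimes> \<psi> x k"]) (use absval_scaled(1)[OF assms] lt in auto)
  have "x' \<in> lev (Suc r)"
    unfolding lev_def using x' absval_scaled(2)[OF assms] by simp
  then show ?thesis
    by (rule that) (use x'(2) in blast)
qed

text \<open>Commutators are bilinear in the coordinates to leading order, so a product of commutators with coordinates
  \<open>\<psi> v\<close> has a counterpart deeper in the group whose coordinates are \<open>\<psi> v\<close> scaled by \<open>\<pi> [^] (r + s)\<close>. This
  transports the equation \<open>[H, H] = lev 2\<close> of a perfect group to \<open>lev (i + j) = [lev i, lev j] lev (i + j + 1)\<close>.\<close>
lemma derived_scaled:
  assumes S: "\<And>x y. x \<in> lev (Suc r) \<Longrightarrow> y \<in> lev (Suc s) \<Longrightarrow> comm x y \<in> S"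
    and v: "v \<in> derived H (carrier H)"
  shows "v \<in> lev 2 \<and> (\<exists>z\<in>generate H S.
    z \<in> lev (r + s + 2) \<and> (\<forall>k<d. near (q ^ (r + s + 3)) (\<psi> z k) (\<pi> [^] (r + s) \<otimes> \<psi> v k)))"
    (is "_ \<and> (\<exists>z\<in>_. _ \<and> ?P z v)")
  using v unfolding derived_def
proof (induction rule: generate.induct)
  let ?w = "\<pi> [^] (r + s)"
  have R: "q ^ (r + s + 3) = q ^ Suc (r + s + 2)" "q ^ (r + s + 3) = absval ?w * q ^ 3"
    by (simp_all add: pi_pow power_add[symmetric] numeral_3_eq_3)
  have l2: "lev 2 = lev (Suc 1)" "lev (r + s + 2) = lev (Suc (r + s + 1))"
    by (simp_all add: numeral_2_eq_2)
  \<comment> \<open>A commutator has a counterpart in \<open>S\<close> itself, not just in the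
    subgroup generated by it, as the case of inverted generators requires.\<close>
  have comm: "h \<in> lev 2 \<and> (\<exists>z\<in>S. z \<in> lev (r + s + 2) \<and> ?P z h)" if hd: "h \<in> derived_set H (carrier H)" for h
  proof -
    obtain x y where xy: "x \<in> carrier H" "y \<in> carrier H" "h = comm x y"
      using hd by (elim UN_E singletonE)
    have "x \<in> lev 1" "y \<in> lev 1"
      using xy lev_1 by simp_all
    then have h: "h \<in> lev 2"
      using chart_commutator(1)[of x 1 y 1] xy by (simp add: numeral_2_eq_2)
    obtain x' where x': "x' \<in> lev (Suc r)" "\<forall>k<d. \<psi> x' k = \<pi> [^] r \<otimes> \<psi> x k"
      by (rule chart_scaled[OF xy(1), of r])
    obtain y' where y': "y' \<in> lev (Suc s)" "\<forall>k<d. \<psi> y' k = \<pi> [^] s \<otimes> \<psi> y k"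
      by (rule chart_scaled[OF xy(2), of s])
    have C: "comm x' y' \<in> S"
      by (rule assms(1)[OF x'(1) y'(1)])
    have L: "comm x' y' \<in> lev (r + s + 2)"
      using chart_commutator(1)[OF x'(1) y'(1)] by simp
    have "?P (comm x' y') h"
      unfolding xy(3)
    proof (intro allI impI)
      show "near (q ^ (r + s + 3)) (\<psi> (comm x' y') k) (?w \<otimes> \<psi> (comm x y) k)" if "k < d" for k
        by (rule chart_commutator_scale[OF xy(1,2) x'(1) y'(1) that]) (use x'(2) y'(2) in simp_all)
    qed
    with C L show ?thesis
      by (intro conjI h bexI[of _ "comm x' y'"])
  qed
  {
    case one
    show ?case
    proof (intro conjI bexI[of _ "\<one>\<^bsub>H\<^esub>"] one_lev allI impI)
      show "near (q ^ (r + s + 3)) (\<psi> \<one>\<^bsub>H\<^esub> k) (?w \<otimes> \<psi> \<one>\<^bsub>H\<^esub> k)" if "k < d" for k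
        using that pi_pow q_pos by (simp add: near_refl)
    qed (rule generate.one)
  next
    case (incl h)
    then show ?case
      using comm[OF incl] generate.incl[of _ S H] by blast
  next
    case (inv h)
    obtain z where h: "h \<in> lev 2" and z: "z \<in> S" "z \<in> lev (r + s + 2)" "?P z h"
      using comm[OF inv] by blast
    show ?case
    proof (intro conjI bexI[of _ "inv\<^bsub>H\<^esub> z"] allI impI)
      show "inv\<^bsub>H\<^esub> h \<in> lev 2" "inv\<^bsub>H\<^esub> z \<in> lev (r + s + 2)"
        using lev_inv(1) h z(2) unfolding l2 by blast+
      show "inv\<^bsub>H\<^esub> z \<in> generate H S"
        by (rule generate.inv[OF z(1)])
      fix k assume k: "k < d"
      have hc: "\<psi> h k \<in> carrier F"
        using chart_bound(1)[OF lev_carrier[OF h] k] .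
      have "near (q ^ (r + s + 3)) (\<psi> (inv\<^bsub>H\<^esub> z) k) (\<ominus> \<psi> z k)"
        using lev_inv(2)[OF z(2)[unfolded l2] k] by (simp add: numeral_3_eq_3)
      moreover have "near (q ^ (r + s + 3)) (\<ominus> \<psi> z k) (\<ominus> (?w \<otimes> \<psi> h k))"
        using z(3) k by (blast intro: near_uminus)
      moreover have "near (q ^ (r + s + 3)) (?w \<otimes> \<psi> (inv\<^bsub>H\<^esub> h) k) (?w \<otimes> (\<ominus> \<psi> h k))"
        unfolding R(2) using lev_inv(2)[OF h[unfolded l2] k] by (intro near_mult pi_pow) (simp add: numeral_3_eq_3)
      moreover have "?w \<otimes> (\<ominus> \<psi> h k) = \<ominus> (?w \<otimes> \<psi> h k)"
        using hc pi_pow(1) by (simp add: r_minus)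
      ultimately show "near (q ^ (r + s + 3)) (\<psi> (inv\<^bsub>H\<^esub> z) k) (?w \<otimes> \<psi> (inv\<^bsub>H\<^esub> h) k)"
        using near_trans near_sym by metis
    qed
  next
    case (eng h1 h2)
    obtain z1 where h1: "h1 \<in> lev 2" and z1: "z1 \<in> generate H S" "z1 \<in> lev (r + s + 2)" "?P z1 h1"
      using eng.IH(1) by blast
    obtain z2 where h2: "h2 \<in> lev 2" and z2: "z2 \<in> generate H S" "z2 \<in> lev (r + s + 2)" "?P z2 h2"
      using eng.IH(2) by blast
    show ?case
    proof (intro conjI bexI[of _ "z1 \<otimes>\<^bsub>H\<^esub> z2"] allI impI)
      show "h1 \<otimes>\<^bsub>H\<^esub> h2 \<in> lev 2"
        using h1 h2 unfolding l2 by (rule subgroup.m_closed[OF lev_subgroup])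
      show "z1 \<otimes>\<^bsub>H\<^esub> z2 \<in> lev (r + s + 2)"
        using z1(2) z2(2) unfolding l2 by (rule subgroup.m_closed[OF lev_subgroup])
      show "z1 \<otimes>\<^bsub>H\<^esub> z2 \<in> generate H S"
        by (rule generate.eng[OF z1(1) z2(1)])
      fix k assume k: "k < d"
      have hc: "\<psi> h1 k \<in> carrier F" "\<psi> h2 k \<in> carrier F"
        using chart_bound(1)[OF lev_carrier k] h1 h2 by blast+
      have "near (q ^ (r + s + 3)) (\<psi> (z1 \<otimes>\<^bsub>H\<^esub> z2) k) (\<psi> z1 k \<oplus> \<psi> z2 k)"
        using lev_additive[OF z1(2)[unfolded l2] z2(2)[unfolded l2] k] by (simp add: numeral_3_eq_3)
      moreover have "near (q ^ (r + s + 3)) (\<psi> z1 k \<oplus> \<psi> z2 k) (?w \<otimes> \<psi> h1 k \<oplus> ?w \<otimes> \<psi> h2 k)"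
        using z1(3) z2(3) k by (blast intro: near_add)
      moreover have "near (q ^ (r + s + 3)) (?w \<otimes> \<psi> (h1 \<otimes>\<^bsub>H\<^esub> h2) k) (?w \<otimes> (\<psi> h1 k \<oplus> \<psi> h2 k))"
        unfolding R(2) using lev_additive[OF h1[unfolded l2] h2[unfolded l2] k]
          by (intro near_mult pi_pow) (simp add: numeral_3_eq_3)
      moreover have "?w \<otimes> (\<psi> h1 k \<oplus> \<psi> h2 k) = ?w \<otimes> \<psi> h1 k \<oplus> ?w \<otimes> \<psi> h2 k"
        using hc pi_pow(1) by (simp add: r_distr)
      ultimately show "near (q ^ (r + s + 3)) (\<psi> (z1 \<otimes>\<^bsub>H\<^esub> z2) k) (?w \<otimes> \<psi> (h1 \<otimes>\<^bsub>H\<^esub> h2) k)"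
        using near_trans near_sym by metis
    qed
  }
qed

section \<open>Filling the levels by commutators\<close>

lemma small_in_ideal_prod:
  assumes "x \<in> carrier F" "absval x \<le> q\<^sup>2"
  shows "x \<in> ideal_prod valuation_ring maximal_ideal_set maximal_ideal_set"
proof -
  obtain y where y: "y \<in> carrier F" "absval y \<le> q" "x = \<pi> [^] (1::nat) \<otimes> y"
    using pi_divide[of x 1 q] assms by (auto simp: power2_eq_square)
  have "\<pi> \<otimes>\<^bsub>valuation_ring\<^esub> y \<in> ideal_prod valuation_ring maximal_ideal_set maximal_ideal_set"
    by (rule ideal_prod.prod) (use y pi_carrier pi_less_1 in \<open>auto simp: maximal_ideal_set_def\<close>)
  then show ?thesis
    using y(3) pi_carrier by (simp add: valuation_ring_def)
qed

text \<open>Dividing the coordinates of \<open>x\<close> by \<open>\<pi> [^] (r + s)\<close> gives a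
  vector over the square of the maximal ideal, by perfectness the chart of some \<open>v\<close> in
  the derived subgroup. The scaled counterpart \<open>z\<close> of \<open>v\<close> then agrees with
  \<open>x\<close> up to the next level.\<close>

lemma lev_decompose:
  assumes perfect: "\<psi> ` derived H (carrier H) = {..<d} \<rightarrow>\<^sub>E ideal_prod valuation_ring maximal_ideal_set
    maximal_ideal_set"
    and x: "x \<in> lev (r + s + 2)"
    and S: "\<And>x y. x \<in> lev (Suc r) \<Longrightarrow> y \<in> lev (Suc s) \<Longrightarrow> comm x y \<in> S"
  shows "\<exists>z\<in>generate H S. \<exists>g\<in>lev (r + s + 3). x = z \<otimes>\<^bsub>H\<^esub> g"
proof -
  have xc: "x \<in> carrier H"
    by (rule lev_carrier[OF x])
  have "\<exists>y. y \<in> carrier F \<and> absval y \<le> q\<^sup>2 \<and> \<psi> x k = \<pi> [^] (r + s) \<otimes> y" if k: "k < d" for k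
  proof -
    have "absval (\<psi> x k) \<le> q ^ (r + s) * q\<^sup>2"
      using x k by (simp add: lev_def power_add power2_eq_square mult_ac)
    then show ?thesis
      using pi_divide[OF chart_bound(1)[OF xc k], of "r + s" "q\<^sup>2"] by metis
  qed
  then obtain f where f: "\<And>k. k < d \<Longrightarrow> f k \<in> carrier F \<and> absval (f k) \<le> q\<^sup>2 \<and> \<psi> x k = \<pi> [^] (r + s) \<otimes> f k"
    by metis
  have "(\<lambda>k\<in>{..<d}. f k) \<in> \<psi> ` derived H (carrier H)"
    unfolding perfect using f small_in_ideal_prod by auto
  then obtain v where v: "v \<in> derived H (carrier H)" "\<psi> v = (\<lambda>k\<in>{..<d}. f k)"
    by (metis imageE)
  obtain z where z: "z \<in> generate H S" "z \<in> lev (r + s + 2)"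
    "\<And>k. k < d \<Longrightarrow> near (q ^ (r + s + 3)) (\<psi> z k) (\<pi> [^] (r + s) \<otimes> \<psi> v k)"
    using derived_scaled[where S = S, OF S v(1)] by blast
  have zc: "z \<in> carrier H"
    by (rule lev_carrier[OF z(2)])
  have "inv\<^bsub>H\<^esub> z \<otimes>\<^bsub>H\<^esub> x \<in> lev (r + s + 3)"
    by (rule lev_diff[OF zc xc]) (use z(3) f v(2) in simp)
  moreover have "x = z \<otimes>\<^bsub>H\<^esub> (inv\<^bsub>H\<^esub> z \<otimes>\<^bsub>H\<^esub> x)"
    using xc zc by (simp add: H.m_assoc[symmetric])
  ultimately show ?thesis
    using z(1) by blast
qed

text \<open>A box around 0 contains a ball, since only \<open>d\<close> coordinates occur and
  \<open>q ^ l\<close> tends to 0.\<close>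

lemma lev_eventually:
  assumes V: "openin T\<^sub>H V" "\<one>\<^bsub>H\<^esub> \<in> V"
  obtains l where "lev (Suc l) \<subseteq> V"
proof -
  have Vc: "V \<subseteq> carrier H"
    using openin_subset[OF V(1)] H.topspace_eq by simp
  have "openin (product_topology (\<lambda>_. subtopology mtopology maximal_ideal_set) {..<d}) (\<psi> ` V)"
    using homeomorphic_imp_open_map[OF chart_homeomorphic] V(1) by (simp add: open_map_def)
  then have "\<forall>f\<in>\<psi> ` V. \<exists>U. finite {i \<in> {..<d}. U i \<noteq> topspace (subtopology mtopology maximal_ideal_set)} \<and>
      (\<forall>i\<in>{..<d}. openin (subtopology mtopology maximal_ideal_set) (U i)) \<and> f \<in> PiE {..<d} U \<and> PiE {..<d} U \<subseteq> \<psi> ` V"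
    unfolding openin_product_topology_alt .
  from bspec[OF this imageI[OF V(2)]]
  obtain U where U: "\<forall>i\<in>{..<d}. openin (subtopology mtopology maximal_ideal_set) (U i)"
    "\<psi> \<one>\<^bsub>H\<^esub> \<in> PiE {..<d} U" "PiE {..<d} U \<subseteq> \<psi> ` V"
    by (elim exE conjE)
  have "\<exists>e>0. mball \<zero> e \<inter> maximal_ideal_set \<subseteq> U i" if i: "i < d" for i
  proof -
    obtain W where W: "openin mtopology W" "U i = W \<inter> maximal_ideal_set"
      using U(1) i by (auto simp: openin_subtopology)
    have "\<psi> \<one>\<^bsub>H\<^esub> i \<in> U i"
      using U(2) i by blast
    then have "\<zero> \<in> W"
      using i W(2) by simp
    moreover have "\<forall>x. x \<in> W \<longrightarrow> (\<exists>e>0. mball x e \<subseteq> W)"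
      using W(1) by (simp add: openin_mtopology)
    ultimately obtain e where "e > 0" "mball \<zero> e \<subseteq> W"
      by blast
    then show ?thesis
      unfolding W(2) by (intro exI[of _ e]) auto
  qed
  then obtain e where e: "\<And>i. i < d \<Longrightarrow> e i > 0 \<and> mball \<zero> (e i) \<inter> maximal_ideal_set \<subseteq> U i"
    by metis
  have "eventually (\<lambda>l. q ^ l < e i) sequentially" if "i < d" for i
    using order_tendstoD(2)[OF LIMSEQ_realpow_zero[of q], of "e i"] e[OF that] q_pos pi_less_1 by simp
  then have "eventually (\<lambda>l. \<forall>i\<in>{..<d}. q ^ l < e i) sequentially"
    by (intro eventually_ball_finite) auto
  then obtain l where l: "\<forall>i\<in>{..<d}. q ^ Suc l < e i"
    unfolding eventually_sequentially by (meson le_SucI order_refl)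
  have "lev (Suc l) \<subseteq> V"
  proof
    fix x assume x: "x \<in> lev (Suc l)"
    have xc: "x \<in> carrier H"
      by (rule lev_carrier[OF x])
    have xm: "\<psi> x \<in> {..<d} \<rightarrow>\<^sub>E maximal_ideal_set"
      using chart_image xc by blast
    have "\<psi> x i \<in> U i" if i: "i < d" for i
    proof -
      have "absval (\<psi> x i) \<le> q ^ Suc l"
        using x i unfolding lev_def by blast
      also have "\<dots> < e i"
        using l i by blast
      finally have "absval (\<psi> x i) < e i" .
      then have "\<psi> x i \<in> mball \<zero> (e i)"
        using chart_bound(1)[OF xc i] by (simp add: in_mball_iff a_minus_def absval_uminus)
      moreover have "\<psi> x i \<in> maximal_ideal_set"
        using PiE_mem[OF xm] i by simp
      ultimately show ?thesis
        using subsetD[OF conjunct2[OF e[OF i]]] by simp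
    qed
    then have "\<psi> x \<in> PiE {..<d} U"
      using xm by (auto simp: PiE_iff)
    then obtain y where y: "y \<in> V" "\<psi> x = \<psi> y"
      using U(3) by blast
    then show "x \<in> V"
      using chart_inj[OF xc] Vc by blast
  qed
  then show ?thesis
    by (rule that)
qed

end

context standard_chart
begin

text \<open>The bound depends on the width \<open>t\<close> but not on the level \<open>a\<close>,
  since \<open>residues\<close> uses one set \<open>Z\<close> for all \<open>a\<close>; a slow chain
  needs exactly this uniformity.\<close>

lemma lev_cover:
  assumes hom: "group_hom G H \<phi>"
  shows "\<exists>K. \<forall>a E. E \<subseteq> {g \<in> carrier G. \<phi> g \<in> lev (Suc a)} \<longrightarrow>
    (\<exists>C. finite C \<and> card C \<le> K \<and> C \<subseteq> E \<and>
      (\<forall>g\<in>E. \<exists>u\<in>C. \<exists>g'\<in>{g \<in> carrier G. \<phi> g \<in> lev (Suc a + t)}. g = u \<otimes>\<^bsub>G\<^esub> g'))"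
proof -
  interpret \<phi>: group_hom G H \<phi>
    by (rule hom)
  obtain Z where Z: "finite Z" and Zc: "\<forall>a x. x \<in> carrier F \<longrightarrow> absval x \<le> q ^ Suc a \<longrightarrow>
      (\<exists>z\<in>Z. near (q ^ (Suc a + t)) x (\<pi> [^] a \<otimes> z))"
    using residues by blast
  show ?thesis
  proof (intro exI[of _ "card ({..<d} \<rightarrow>\<^sub>E Z)"] allI impI)
    fix a E assume E: "E \<subseteq> {g \<in> carrier G. \<phi> g \<in> lev (Suc a)}"
    let ?P = "\<lambda>g k z. z \<in> Z \<and> near (q ^ (Suc a + t)) (\<psi> (\<phi> g) k) (\<pi> [^] a \<otimes> z)"
    define \<kappa> where "\<kappa> g = (\<lambda>k\<in>{..<d}. SOME z. ?P g k z)" for g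
    have \<kappa>: "?P g k (\<kappa> g k)" if g: "g \<in> E" and k: "k < d" for g k
    proof -
      have gc: "\<phi> g \<in> carrier H" and gl: "absval (\<psi> (\<phi> g) k) \<le> q ^ Suc a"
        using E g k by (auto simp: lev_def)
      have "\<exists>z. ?P g k z"
        using Zc chart_bound(1)[OF gc k] gl by blast
      then have "?P g k (SOME z. ?P g k z)"
        by (rule someI_ex)
      then show ?thesis
        using k by (simp add: \<kappa>_def)
    qed
    show "\<exists>C. finite C \<and> card C \<le> card ({..<d} \<rightarrow>\<^sub>E Z) \<and> C \<subseteq> E \<and>
      (\<forall>g\<in>E. \<exists>u\<in>C. \<exists>g'\<in>{g \<in> carrier G. \<phi> g \<in> lev (Suc a + t)}. g = u \<otimes>\<^bsub>G\<^esub> g')"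
    proof (rule \<phi>.G.coset_cover[where \<kappa> = \<kappa> and Z = "{..<d} \<rightarrow>\<^sub>E Z"])
      show "E \<subseteq> carrier G"
        using E by blast
      show "finite ({..<d} \<rightarrow>\<^sub>E Z)"
        using Z by (simp add: finite_PiE)
      show "\<kappa> ` E \<subseteq> {..<d} \<rightarrow>\<^sub>E Z"
      proof (intro image_subsetI PiE_I)
        show "\<kappa> g k \<in> Z" if "g \<in> E" "k \<in> {..<d}" for g k
          using \<kappa>[of g k] that by simp
        show "\<kappa> g k = undefined" if "k \<notin> {..<d}" for g k
          using that by (simp add: \<kappa>_def)
      qed
      fix x y assume x: "x \<in> E" and y: "y \<in> E" and eq: "\<kappa> x = \<kappa> y"
      have c: "x \<in> carrier G" "y \<in> carrier G"
        using E x y by blast+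
      have "near (q ^ (Suc a + t)) (\<psi> (\<phi> x) k) (\<psi> (\<phi> y) k)" if k: "k < d" for k
        using \<kappa>[OF x k] \<kappa>[OF y k] eq near_trans[OF _ near_sym] by metis
      then have "inv\<^bsub>H\<^esub> (\<phi> x) \<otimes>\<^bsub>H\<^esub> \<phi> y \<in> lev (Suc a + t)"
        using c by (intro lev_diff) auto
      then show "inv\<^bsub>G\<^esub> x \<otimes>\<^bsub>G\<^esub> y \<in> {g \<in> carrier G. \<phi> g \<in> lev (Suc a + t)}"
        using c by simp
    qed simp
  qed
qed

text \<open>Let \<open>lev ?k\<close> lie in the open subgroup. Commutators with elements of
  \<open>D 1\<close> over \<open>lev ?k\<close> pass from \<open>D j\<close> to
  \<open>D (Suc j)\<close> and deepen the level by \<open>?k\<close>; by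
  \<open>lev_decompose\<close> they fill the deeper levels one after the other, until openness of
  \<open>D (Suc j)\<close> absorbs the remainder.\<close>

theorem perfect_slow_chain:
  assumes perfect: "\<psi> ` derived H (carrier H) = {..<d} \<rightarrow>\<^sub>E ideal_prod valuation_ring maximal_ideal_set
    maximal_ideal_set"
    and G: "group G" and iso: "isomorphic_to_open_subgroup G T\<^sub>G H T\<^sub>H"
  shows "\<exists>K E. slow_chain p G T\<^sub>G K E"
proof -
  obtain U \<phi> where U: "subgroup U H" "openin T\<^sub>H U" and phi: "\<phi> \<in> iso G (H\<lparr>carrier := U\<rparr>)"
    "homeomorphic_map T\<^sub>G (subtopology T\<^sub>H U) \<phi>"
    using iso unfolding isomorphic_to_open_subgroup_def topological_iso_def by blast
  have inj: "x = y" if "x \<in> carrier G" "y \<in> carrier G" "\<phi> x = \<phi> y" for x y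
    using phi(1) that by (auto simp: iso_def bij_betw_def inj_on_def)
  have surj: "\<exists>x\<in>carrier G. \<phi> x = u" if "u \<in> U" for u
  proof -
    have "\<phi> ` carrier G = U"
      using phi(1) by (simp add: iso_def bij_betw_def)
    then show ?thesis
      using that by blast
  qed
  have "\<phi> \<in> hom G H"
    using phi(1) subgroup.subset[OF U(1)] by (auto simp: iso_def hom_def)
  then interpret \<phi>: group_hom G H \<phi>
    by (intro group_hom.intro G H.is_group group_hom_axioms.intro)
  obtain l where l: "lev (Suc l) \<subseteq> U"
    by (rule lev_eventually[OF U(2) subgroup.one_closed[OF U(1)]])
  let ?k = "Suc l"
  define \<Gamma> where "\<Gamma> i = {g \<in> carrier G. \<phi> g \<in> lev i}" for i
  have Gamma_anti: "\<Gamma> j \<subseteq> \<Gamma> i" if "i \<le> j" for i j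
    using lev_antimono[OF that] by (auto simp: \<Gamma>_def)
  have lift: "\<exists>g\<in>\<Gamma> i. \<phi> g = x" if i: "?k \<le> i" and x: "x \<in> lev i" for i x
  proof -
    have "x \<in> U"
      using x l lev_antimono[OF i] by blast
    then show ?thesis
      using surj x by (auto simp: \<Gamma>_def)
  qed
  \<comment> \<open>As \<open>lev 1\<close> is everything, the first step covers
    \<open>2 * ?k - 1\<close> levels and each later one \<open>?k\<close> levels; hence the two
    bounds \<open>K1\<close> and \<open>K2\<close>.\<close>
  define E where "E j = (if j \<le> 1 then carrier G else \<Gamma> (j * ?k))" for j
  note cover = lev_cover[OF \<phi>.group_hom_axioms, folded \<Gamma>_def]
  obtain K1 where K1: "\<forall>a E. E \<subseteq> \<Gamma> (Suc a) \<longrightarrow> (\<exists>C. finite C \<and> card C \<le> K1 \<and> C \<subseteq> E \<and>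
      (\<forall>g\<in>E. \<exists>u\<in>C. \<exists>g'\<in>\<Gamma> (Suc a + (2 * ?k - 1)). g = u \<otimes>\<^bsub>G\<^esub> g'))"
    using cover[of "2 * ?k - 1"] by (elim exE)
  obtain K2 where K2: "\<forall>a E. E \<subseteq> \<Gamma> (Suc a) \<longrightarrow> (\<exists>C. finite C \<and> card C \<le> K2 \<and> C \<subseteq> E \<and>
      (\<forall>g\<in>E. \<exists>u\<in>C. \<exists>g'\<in>\<Gamma> (Suc a + ?k). g = u \<otimes>\<^bsub>G\<^esub> g'))"
    using cover[of ?k] by (elim exE)
  have "slow_chain p G T\<^sub>G (max K1 K2) E"
    unfolding slow_chain_def
  proof (intro conjI allI impI)
    show "E 1 = carrier G"
      by (simp add: E_def)
    show "E j \<subseteq> carrier G" for j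
      by (auto simp: E_def \<Gamma>_def)
    show "\<exists>C. finite C \<and> card C \<le> max K1 K2 \<and> C \<subseteq> E j \<and> (\<forall>g\<in>E j. \<exists>t\<in>C. \<exists>g'\<in>E (Suc j). g = t \<otimes>\<^bsub>G\<^esub> g')"
      if j: "1 \<le> j" for j
    proof (cases "j = 1")
      case True
      have "E j \<subseteq> \<Gamma> (Suc 0)"
        by (auto simp: True E_def \<Gamma>_def lev_1)
      from mp[OF spec[OF spec[OF K1, of 0], of "E j"] this]
      obtain C where C: "finite C" "card C \<le> K1" "C \<subseteq> E j"
        "\<forall>g\<in>E j. \<exists>u\<in>C. \<exists>g'\<in>\<Gamma> (Suc 0 + (2 * ?k - 1)). g = u \<otimes>\<^bsub>G\<^esub> g'"
        by (elim exE conjE)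
      have "E (Suc j) = \<Gamma> (Suc 0 + (2 * ?k - 1))"
        by (simp add: True E_def mult_2)
      then show ?thesis
        using C by (intro exI[of _ C]) (simp add: max.coboundedI1)
    next
      case False
      have E: "E j = \<Gamma> (Suc (j * ?k - 1))" "E (Suc j) = \<Gamma> (Suc (j * ?k - 1) + ?k)"
        using False j by (simp_all add: E_def ac_simps)
      from mp[OF spec[OF spec[OF K2, of "j * ?k - 1"], of "E j"] equalityD1[OF E(1)]]
      obtain C where C: "finite C" "card C \<le> K2" "C \<subseteq> E j"
        "\<forall>g\<in>E j. \<exists>u\<in>C. \<exists>g'\<in>\<Gamma> (Suc (j * ?k - 1) + ?k). g = u \<otimes>\<^bsub>G\<^esub> g'"
        by (elim exE conjE)
      then show ?thesis
        unfolding E(2) by (intro exI[of _ C]) (simp add: max.coboundedI2)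
    qed
    fix D and j :: nat assume D: "open_Np_series p G T\<^sub>G D" and j: "1 \<le> j"
    have D1: "D 1 = carrier G" and Dsub: "\<And>i. subgroup (D i) G" and Dop: "\<And>i. openin T\<^sub>G (D i)"
      and Dcomm: "\<And>i j x y. x \<in> D i \<Longrightarrow> y \<in> D j \<Longrightarrow>
        x \<otimes>\<^bsub>G\<^esub> y \<otimes>\<^bsub>G\<^esub> inv\<^bsub>G\<^esub> x \<otimes>\<^bsub>G\<^esub> inv\<^bsub>G\<^esub> y \<in> D (i + j)"
      using D unfolding open_Np_series_def by auto
    have Dc: "x \<in> carrier G" if "x \<in> D i" for x i
      using subgroup.subset[OF Dsub] that by blast
    have "\<Gamma> (j * ?k) \<subseteq> D j"
      using j
    proof (induction rule: dec_induct)
      case base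
      then show ?case
        unfolding D1 by (auto simp: \<Gamma>_def)
    next
      case (step j)
      have sub: "subgroup (\<phi> ` D (Suc j)) H"
        by (rule \<phi>.subgroup_img_is_subgroup[OF Dsub])
      have "openin (subtopology T\<^sub>H U) (\<phi> ` D (Suc j))"
        using homeomorphic_imp_open_map[OF phi(2)] Dop by (simp add: open_map_def)
      then have "openin T\<^sub>H (\<phi> ` D (Suc j))"
        by (rule openin_trans_full[OF _ U(2)])
      then obtain I where I: "lev (Suc I) \<subseteq> \<phi> ` D (Suc j)"
        by (rule lev_eventually[OF _ subgroup.one_closed[OF sub]])
      show ?case
      proof (rule \<phi>.G.descend_into_subgroup[OF Dsub])
        show "\<Gamma> (Suc i) \<subseteq> \<Gamma> i" for i
          by (rule Gamma_anti) simp
        show "\<Gamma> (Suc I) \<subseteq> D (Suc j)"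
        proof
          fix g assume g: "g \<in> \<Gamma> (Suc I)"
          then obtain h where "h \<in> D (Suc j)" "\<phi> g = \<phi> h"
            using I by (auto simp: \<Gamma>_def)
          then show "g \<in> D (Suc j)"
            using inj[of g h] g Dc by (auto simp: \<Gamma>_def)
        qed
        fix i x assume i: "Suc j * ?k \<le> i" and x: "x \<in> \<Gamma> i"
        \<comment> \<open>With \<open>?k = Suc l\<close> this makes \<open>i\<close> the sum of
          \<open>Suc r\<close> and \<open>Suc l\<close>, and \<open>Suc r \<ge> j * ?k\<close> gives
          access to the induction hypothesis for the left entries.\<close>
        define r where "r = i - ?k - 1"
        have jk: "?k \<le> j * ?k"
          using mult_le_mono1[OF step.hyps(1), of ?k] by (simp only: mult_1)
        have ij: "j * ?k + ?k \<le> i"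
          using i by (simp only: mult_Suc add.commute)
        have r: "i = r + l + 2" "j * ?k \<le> Suc r"
          using ij jk unfolding r_def by linarith+
        have S: "comm u v \<in> \<phi> ` D (Suc j)" if u: "u \<in> lev (Suc r)" and v: "v \<in> lev (Suc l)" for u v
        proof -
          obtain g where g: "g \<in> \<Gamma> (Suc r)" "\<phi> g = u"
            using lift[OF order_trans[OF jk r(2)] u] by blast
          obtain h where h: "h \<in> \<Gamma> ?k" "\<phi> h = v"
            using lift[OF order_refl v] by blast
          have gD: "g \<in> D j" and hD: "h \<in> D 1"
            using g(1) Gamma_anti[OF r(2)] step.IH h(1) unfolding D1 by (auto simp: \<Gamma>_def)
          have "comm u v = \<phi> (g \<otimes>\<^bsub>G\<^esub> h \<otimes>\<^bsub>G\<^esub> inv\<^bsub>G\<^esub> g \<otimes>\<^bsub>G\<^esub> inv\<^bsub>G\<^esub> h)"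
            using Dc[OF gD] Dc[OF hD] g(2) h(2) by simp
          then show ?thesis
            using Dcomm[OF gD hD] by simp
        qed
        have "\<phi> x \<in> lev (r + l + 2)"
          using x r(1) by (simp add: \<Gamma>_def)
        from lev_decompose[OF perfect this S]
        obtain z g where z: "z \<in> generate H (\<phi> ` D (Suc j))" and g: "g \<in> lev (r + l + 3)" and eq: "\<phi> x = z \<otimes>\<^bsub>H\<^esub> g"
          by blast
        obtain s where s: "s \<in> D (Suc j)" "z = \<phi> s"
          using z H.generate_subgroup_incl[OF order_refl sub] by blast
        obtain g' where g': "g' \<in> \<Gamma> (Suc i)" "\<phi> g' = g"
          using lift[of "Suc i" g] g r(1) by (auto simp: numeral_3_eq_3)
        have "\<phi> x = \<phi> (s \<otimes>\<^bsub>G\<^esub> g')"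
          using eq s g' Dc[OF s(1)] by (simp add: \<Gamma>_def)
        then have "x = s \<otimes>\<^bsub>G\<^esub> g'"
          using x g'(1) Dc[OF s(1)] by (intro inj) (auto simp: \<Gamma>_def)
        then show "\<exists>s\<in>D (Suc j). \<exists>g\<in>\<Gamma> (Suc i). x = s \<otimes>\<^bsub>G\<^esub> g"
          using s(1) g'(1) by blast
      qed
    qed
    then show "E j \<subseteq> D j"
      using D1 j by (cases "j = 1") (auto simp: E_def)
  qed
  then show ?thesis
    by blast
qed

end

theorem theorem3p6:
  fixes G :: "('g, 'm) monoid_scheme" and T :: "'g topology" and p :: nat
  assumes "finitely_presented_pro_p_group p G T"
    and "generator_rank G T > 1"
    and "\<not> (generator_rank G T = 2 \<and> relation_rank p G T = 1)"
    and "(\<exists>(H :: 'h monoid) T_H. p_adic_analytic_group p H T_H \<and>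
             isomorphic_to_open_subgroup G T H T_H) \<or>
         (\<exists>(F :: 'f ring) absval (H :: 'h monoid) T_H.
             nonarch_local_field F absval \<and> has_characteristic F p \<and>
             nonarch_local_field.perfect_group F absval H T_H \<and>
             isomorphic_to_open_subgroup G T H T_H)"
  shows "real (relation_rank p G T) > (real (generator_rank G T))\<^sup>2 / 4"
proof -
  have G: "pro_p_group p G T"
    using assms(1) by (simp add: finitely_presented_pro_p_group_def)
  have "\<exists>K E. slow_chain p G T K E"
    using assms(4)
  proof (elim disjE exE conjE)
    fix H :: "'h monoid" and T_H
    assume "p_adic_analytic_group p H T_H" "isomorphic_to_open_subgroup G T H T_H"
    then show ?thesis
      by (rule p_adic_slow_chain[OF G])
  next
    fix F :: "'f ring" and absval and H :: "'h monoid" and T_H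
    assume F: "nonarch_local_field F absval" and perfect: "nonarch_local_field.perfect_group F absval H T_H"
      and iso: "isomorphic_to_open_subgroup G T H T_H"
    interpret nonarch_local_field F absval
      by (rule F)
    obtain \<pi> R where pi: "\<pi> \<in> carrier F" "\<pi> \<noteq> \<zero>\<^bsub>F\<^esub>" "absval \<pi> < 1"
      "\<forall>x\<in>carrier F. absval x < 1 \<longrightarrow> absval x \<le> absval \<pi>"
      "finite R" "R \<subseteq> carrier F"
      "\<forall>x\<in>carrier F. absval x < 1 \<longrightarrow> (\<exists>t\<in>R. near ((absval \<pi>)\<^sup>2) x t)"
      by (rule uniformizer_exists) blast
    obtain d \<psi> where d: "standard_group d H T_H \<psi>"
      and dp: "\<psi> ` derived H (carrier H) = {..<d} \<rightarrow>\<^sub>E ideal_prod valuation_ring maximal_ideal_set maximal_ideal_set"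
      using perfect unfolding perfect_group_def by blast
    interpret standard_chart F absval \<pi> R d H T_H \<psi>
      by unfold_locales (use pi d in auto)
    have "group G"
      using G by (simp add: pro_p_group_def topological_group_def)
    then show ?thesis
      by (rule perfect_slow_chain[OF dp _ iso])
  qed
  then show ?thesis
    using slow_chain_imp_relation_rank[OF assms(1-3)] by blast
qed

end
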